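(* Let $R=R_0[x_1,\dots,x_d]$ be a Noetherian $\mathbb{N}$-graded ring, let $L$ and $M$ be finitely generated $\mathbb{Z}$-graded $R$-modules, and let $I$ be a homogeneous ideal of $R$. Fix $k\in\mathbb{N}$. Either set $H:=\operatorname{Ext}_R^k(L,M)$ and $H_n:=\operatorname{Ext}_R^k(L,M/I^nM)$ for all $n\ge 0$, or set $H:=\operatorname{Tor}_k^R(L,M)$ and $H_n:=\operatorname{Tor}_k^R(L,M/I^nM)$ for all $n\ge 0$. Assume that $(0:_H I)=0$. Then either $H_n=0$ for all $n\gg 0$, or $v(H_n)$ is eventually a linear function of $n$ (that is, there are constants $a,b\in\mathbb{Z}$ with $v(H_n)=an+b$ for all $n\gg 0$) whose leading coefficient $a$ is the degree of a minimal (homogeneous) generator of $I$.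
   Context: Rings are commutative and $\mathbb{N}=\{0,1,2,\dots\}$. $R=R_0[x_1,\dots,x_d]$ means that $R$ is generated over its degree-zero component $R_0$ by homogeneous elements $x_1,\dots,x_d$. Ext and Tor of finitely generated graded $R$-modules carry their natural $\mathbb{Z}$-graded structures (computed from a graded free resolution of $L$ by finitely generated graded free modules). For an $R$-module $H$ and an ideal $I$, $(0:_H I):=\{x\in H: Ix=0\}$. v-numbers: for a finitely generated $\mathbb{Z}$-graded $R$-module $E$ with graded components $E_n$ and $\mathfrak{p}\in\operatorname{Ass}_R(E)$, the local v-number is $v_{\mathfrak{p}}(E):=\inf\{n:\text{there exists }x\in E_n\text{ with }\mathfrak{p}=(0:_R x)\}$, where $(0:_R x)$ is the annihilator of $x$ in $R$. The v-number is $v(E):=\inf\{v_{\mathfrak{p}}(E):\mathfrak{p}\in\operatorname{Ass}_R(E)\}$, with $v(0)=\infty$. A minimal generator of $I$ is an element of a minimal system of homogeneous generators of $I$. *)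

theory Defs
  imports
    "HOL-Algebra.Module"
    "HOL-Algebra.Ideal_Product"
    "HOL-Algebra.Ring_Divisibility"
    "HOL-Algebra.Generated_Rings"
    "HOL-Algebra.Generated_Groups"
    "HOL-Library.Extended_Real"
begin

section \<open>Graded rings and graded modules\<close>

record 'a gring = "'a ring" +
  rcomp :: "nat \<Rightarrow> 'a set"

record ('a, 'b) gmodule = "('a, 'b) module" +
  hcomp :: "int \<Rightarrow> 'b set"

definition internal_direct_sum :: "('a, 'c) ring_scheme \<Rightarrow> ('i \<Rightarrow> 'a set) \<Rightarrow> bool" where
  "internal_direct_sum G A \<longleftrightarrow>
     (\<forall>i. additive_subgroup (A i) G) \<and>
     (\<forall>x\<in>carrier G. \<exists>!f. (\<forall>i. f i \<in> A i) \<and> finite {i. f i \<noteq> \<zero>\<^bsub>G\<^esub>} \<and>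
        x = (\<Oplus>\<^bsub>G\<^esub>i\<in>{i. f i \<noteq> \<zero>\<^bsub>G\<^esub>}. f i))"

locale graded_ring = cring R for R :: "'a gring" (structure) +
  assumes rcomp_direct_sum: "internal_direct_sum R (rcomp R)"
    and one_rcomp: "\<one> \<in> rcomp R 0"
    and mult_rcomp: "\<lbrakk>a \<in> rcomp R i; b \<in> rcomp R j\<rbrakk> \<Longrightarrow> a \<otimes> b \<in> rcomp R (i + j)"

locale graded_module = graded_ring R + module R M
    for R :: "'a gring" (structure) and M :: "('a, 'b) gmodule" (structure) +
  assumes hcomp_direct_sum: "internal_direct_sum M (hcomp M)"
    and smult_hcomp:
      "\<lbrakk>a \<in> rcomp R i; x \<in> hcomp M j\<rbrakk> \<Longrightarrow> a \<odot>\<^bsub>M\<^esub> x \<in> hcomp M (int i + j)"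

definition homogeneous_elements :: "'a gring \<Rightarrow> 'a set" where
  "homogeneous_elements R = (\<Union>n. rcomp R n)"

definition homogeneous_ideal :: "'a set \<Rightarrow> 'a gring \<Rightarrow> bool" where
  "homogeneous_ideal I R \<longleftrightarrow> (\<exists>S \<subseteq> homogeneous_elements R. I = Idl\<^bsub>R\<^esub> S)"

text \<open>Minimal means irredundant: no proper subset generates the same ideal.\<close>

definition minimal_homogeneous_generators :: "'a gring \<Rightarrow> 'a set \<Rightarrow> 'a set \<Rightarrow> bool" where
  "minimal_homogeneous_generators R I S \<longleftrightarrow>
     S \<subseteq> homogeneous_elements R \<and> Idl\<^bsub>R\<^esub> S = I \<and> (\<forall>T. T \<subset> S \<longrightarrow> Idl\<^bsub>R\<^esub> T \<noteq> I)"

definition minimal_generator_degree :: "'a gring \<Rightarrow> 'a set \<Rightarrow> nat \<Rightarrow> bool" where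
  "minimal_generator_degree R I m \<longleftrightarrow>
     (\<exists>S y. minimal_homogeneous_generators R I S \<and> y \<in> S \<and> y \<in> rcomp R m)"


section \<open>Submodules, quotients and linear maps\<close>

definition submodule_span ::
  "('a, 'c) ring_scheme \<Rightarrow> ('a, 'b, 'd) module_scheme \<Rightarrow> 'b set \<Rightarrow> 'b set" where
  "submodule_span R M S = \<Inter>{N. submodule N R M \<and> S \<subseteq> N}"

definition fin_gen_module :: "('a, 'c) ring_scheme \<Rightarrow> ('a, 'b, 'd) module_scheme \<Rightarrow> bool" where
  "fin_gen_module R M \<longleftrightarrow> (\<exists>S \<subseteq> carrier M. finite S \<and> submodule_span R M S = carrier M)"

definition ideal_times ::
  "('a, 'c) ring_scheme \<Rightarrow> 'a set \<Rightarrow> ('a, 'b, 'd) module_scheme \<Rightarrow> 'b set" where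
  "ideal_times R J M = submodule_span R M {a \<odot>\<^bsub>M\<^esub> x | a x. a \<in> J \<and> x \<in> carrier M}"

text \<open>The ring operations \<^const>\<open>monoid.mult\<close> and \<^const>\<open>one\<close> of a module record have no meaning for
  modules; they are left unspecified in all constructions below.\<close>

definition quot_module ::
  "('a, 'b, 'd) module_scheme \<Rightarrow> 'b set \<Rightarrow> ('a, 'b set) module" where
  "quot_module M N =
     \<lparr>carrier = a_rcosets\<^bsub>M\<^esub> N, monoid.mult = undefined, one = undefined,
      zero = N, add = set_add M,
      smult = (\<lambda>a X. \<Union>x\<in>X. N +>\<^bsub>M\<^esub> (a \<odot>\<^bsub>M\<^esub> x))\<rparr>"

definition with_grading :: "('a, 'b) module \<Rightarrow> (int \<Rightarrow> 'b set) \<Rightarrow> ('a, 'b) gmodule" where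
  "with_grading M A =
     \<lparr>carrier = carrier M, monoid.mult = monoid.mult M, one = one M, zero = zero M, add = add M,
      smult = smult M, hcomp = A\<rparr>"

definition quot_gmodule :: "('a, 'b) gmodule \<Rightarrow> 'b set \<Rightarrow> ('a, 'b set) gmodule" where
  "quot_gmodule M N =
     with_grading (quot_module M N) (\<lambda>n. {N +>\<^bsub>M\<^esub> x | x. x \<in> hcomp M n})"

definition mod_ideal_power :: "'a gring \<Rightarrow> 'a set \<Rightarrow> ('a, 'b) gmodule \<Rightarrow> nat \<Rightarrow> ('a, 'b set) gmodule" where
  "mod_ideal_power R I M n = quot_gmodule M (ideal_times R (I [^]\<^bsub>ideals_set R\<^esub> n) M)"

text \<open>The subquotient \<open>Z / B\<close> of \<open>M\<close>, for graded submodules \<open>B \<subseteq> Z\<close> of \<open>M\<close>.\<close>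

definition subquot_gmodule ::
  "('a, 'b) gmodule \<Rightarrow> 'b set \<Rightarrow> 'b set \<Rightarrow> ('a, 'b set) gmodule" where
  "subquot_gmodule M Z B =
     quot_gmodule (M\<lparr>carrier := Z, hcomp := (\<lambda>n. hcomp M n \<inter> Z)\<rparr>) B"

definition linear_maps ::
  "('a, 'c) ring_scheme \<Rightarrow> ('a, 'b, 'd) module_scheme \<Rightarrow> ('a, 'e, 'f) module_scheme
     \<Rightarrow> ('b \<Rightarrow> 'e) set" where
  "linear_maps R M N =
     {f \<in> carrier M \<rightarrow> carrier N.
        (\<forall>x\<in>carrier M. \<forall>y\<in>carrier M. f (x \<oplus>\<^bsub>M\<^esub> y) = f x \<oplus>\<^bsub>N\<^esub> f y) \<and>
        (\<forall>a\<in>carrier R. \<forall>x\<in>carrier M. f (a \<odot>\<^bsub>M\<^esub> x) = a \<odot>\<^bsub>N\<^esub> f x)}"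

definition graded_linear_maps ::
  "'a gring \<Rightarrow> ('a, 'b) gmodule \<Rightarrow> ('a, 'e) gmodule \<Rightarrow> ('b \<Rightarrow> 'e) set" where
  "graded_linear_maps R M N =
     {f \<in> linear_maps R M N. \<forall>n. f ` hcomp M n \<subseteq> hcomp N n}"


section \<open>Graded free resolutions\<close>

definition graded_free :: "'a gring \<Rightarrow> ('a, 'b) gmodule \<Rightarrow> bool" where
  "graded_free R F \<longleftrightarrow> graded_module R F \<and>
     (\<exists>B. finite B \<and> B \<subseteq> (\<Union>n. hcomp F n) \<and>
        (\<forall>x\<in>carrier F. \<exists>!c. c \<in> B \<rightarrow>\<^sub>E carrier R \<and> x = (\<Oplus>\<^bsub>F\<^esub>b\<in>B. c b \<odot>\<^bsub>F\<^esub> b)))"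

text \<open>\<open>\<cdots> \<rightarrow> F\<^sub>2 \<rightarrow> F\<^sub>1 \<rightarrow> F\<^sub>0 \<rightarrow> L \<rightarrow> 0\<close>, where \<open>d i\<close> maps \<open>F (Suc i)\<close> to \<open>F i\<close>. All \<open>F i\<close>
  live on one type \<open>'f\<close>; since they are finitely generated free, \<open>nat \<Rightarrow> 'a\<close> is large enough
  for every such resolution up to isomorphism.\<close>

definition graded_free_resolution ::
  "'a gring \<Rightarrow> ('a, 'l) gmodule \<Rightarrow> (nat \<Rightarrow> ('a, 'f) gmodule) \<Rightarrow> (nat \<Rightarrow> 'f \<Rightarrow> 'f)
     \<Rightarrow> ('f \<Rightarrow> 'l) \<Rightarrow> bool" where
  "graded_free_resolution R L F d \<epsilon> \<longleftrightarrow>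
     (\<forall>i. graded_free R (F i)) \<and>
     (\<forall>i. d i \<in> graded_linear_maps R (F (Suc i)) (F i)) \<and>
     \<epsilon> \<in> graded_linear_maps R (F 0) L \<and>
     \<epsilon> ` carrier (F 0) = carrier L \<and>
     d 0 ` carrier (F 1) = a_kernel (F 0) L \<epsilon> \<and>
     (\<forall>i. d (Suc i) ` carrier (F (Suc (Suc i))) = a_kernel (F (Suc i)) (F i) (d i))"


section \<open>Ext\<close>

text \<open>Linear maps are represented extensionally, so that equal maps are equal as functions.\<close>

definition Hom_gmodule ::
  "'a gring \<Rightarrow> ('a, 'f) gmodule \<Rightarrow> ('a, 'b) gmodule \<Rightarrow> ('a, 'f \<Rightarrow> 'b) gmodule" where
  "Hom_gmodule R F N =
     \<lparr>carrier = linear_maps R F N \<inter> extensional (carrier F), monoid.mult = undefined, one = undefined,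
      zero = (\<lambda>x\<in>carrier F. \<zero>\<^bsub>N\<^esub>),
      add = (\<lambda>f g. \<lambda>x\<in>carrier F. f x \<oplus>\<^bsub>N\<^esub> g x),
      smult = (\<lambda>a f. \<lambda>x\<in>carrier F. a \<odot>\<^bsub>N\<^esub> f x),
      hcomp = (\<lambda>n. {f \<in> linear_maps R F N \<inter> extensional (carrier F).
                      \<forall>m. f ` hcomp F m \<subseteq> hcomp N (m + n)})\<rparr>"

text \<open>\<open>Ext\<^sup>k(L,N)\<close>, computed from a resolution \<open>(F, d)\<close> of \<open>L\<close>: the cohomology at position \<open>k\<close> of the complex
  \<open>0 \<rightarrow> Hom(F\<^sub>0,N) \<rightarrow> Hom(F\<^sub>1,N) \<rightarrow> Hom(F\<^sub>2,N) \<rightarrow> \<cdots>\<close>.\<close>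

definition Hom_diff ::
  "(nat \<Rightarrow> ('a, 'f) gmodule) \<Rightarrow> (nat \<Rightarrow> 'f \<Rightarrow> 'f) \<Rightarrow> nat \<Rightarrow> ('f \<Rightarrow> 'b) \<Rightarrow> ('f \<Rightarrow> 'b)" where
  "Hom_diff F d i f = (\<lambda>x\<in>carrier (F (Suc i)). f (d i x))"

definition Ext ::
  "'a gring \<Rightarrow> (nat \<Rightarrow> ('a, 'f) gmodule) \<Rightarrow> (nat \<Rightarrow> 'f \<Rightarrow> 'f) \<Rightarrow> nat \<Rightarrow> ('a, 'b) gmodule
     \<Rightarrow> ('a, ('f \<Rightarrow> 'b) set) gmodule" where
  "Ext R F d k N =
     subquot_gmodule (Hom_gmodule R (F k) N)
       (a_kernel (Hom_gmodule R (F k) N) (Hom_gmodule R (F (Suc k)) N) (Hom_diff F d k))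
       (case k of
          0 \<Rightarrow> {\<zero>\<^bsub>Hom_gmodule R (F k) N\<^esub>}
        | Suc j \<Rightarrow> Hom_diff F d j ` carrier (Hom_gmodule R (F j) N))"


section \<open>Tor\<close>

definition free_module :: "('a, 'c) ring_scheme \<Rightarrow> 'x set \<Rightarrow> ('a, 'x \<Rightarrow> 'a) module" where
  "free_module R X =
     \<lparr>carrier = {c. (\<forall>p. c p \<in> carrier R) \<and> finite {p. c p \<noteq> \<zero>\<^bsub>R\<^esub>} \<and> {p. c p \<noteq> \<zero>\<^bsub>R\<^esub>} \<subseteq> X},
      monoid.mult = undefined, one = undefined,
      zero = (\<lambda>p. \<zero>\<^bsub>R\<^esub>), add = (\<lambda>c c' p. c p \<oplus>\<^bsub>R\<^esub> c' p),
      smult = (\<lambda>a c p. a \<otimes>\<^bsub>R\<^esub> c p)\<rparr>"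

definition free_gen :: "('a, 'c) ring_scheme \<Rightarrow> 'x \<Rightarrow> 'x \<Rightarrow> 'a" where
  "free_gen R p = (\<lambda>q. if q = p then \<one>\<^bsub>R\<^esub> else \<zero>\<^bsub>R\<^esub>)"

definition tensor_relations ::
  "'a gring \<Rightarrow> ('a, 'f) gmodule \<Rightarrow> ('a, 'b) gmodule \<Rightarrow> ('f \<times> 'b \<Rightarrow> 'a) set" where
  "tensor_relations R F N =
     (let P = free_module R (carrier F \<times> carrier N); e = (\<lambda>x y. free_gen R (x, y)) in
        {e (x \<oplus>\<^bsub>F\<^esub> x') y \<ominus>\<^bsub>P\<^esub> (e x y \<oplus>\<^bsub>P\<^esub> e x' y) | x x' y.
           x \<in> carrier F \<and> x' \<in> carrier F \<and> y \<in> carrier N} \<union>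
        {e x (y \<oplus>\<^bsub>N\<^esub> y') \<ominus>\<^bsub>P\<^esub> (e x y \<oplus>\<^bsub>P\<^esub> e x y') | x y y'.
           x \<in> carrier F \<and> y \<in> carrier N \<and> y' \<in> carrier N} \<union>
        {e (a \<odot>\<^bsub>F\<^esub> x) y \<ominus>\<^bsub>P\<^esub> (a \<odot>\<^bsub>P\<^esub> e x y) | a x y.
           a \<in> carrier R \<and> x \<in> carrier F \<and> y \<in> carrier N} \<union>
        {e x (a \<odot>\<^bsub>N\<^esub> y) \<ominus>\<^bsub>P\<^esub> (a \<odot>\<^bsub>P\<^esub> e x y) | a x y.
           a \<in> carrier R \<and> x \<in> carrier F \<and> y \<in> carrier N})"

definition tensor_submodule ::
  "'a gring \<Rightarrow> ('a, 'f) gmodule \<Rightarrow> ('a, 'b) gmodule \<Rightarrow> ('f \<times> 'b \<Rightarrow> 'a) set" where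
  "tensor_submodule R F N =
     submodule_span R (free_module R (carrier F \<times> carrier N)) (tensor_relations R F N)"

definition pure_tensor ::
  "'a gring \<Rightarrow> ('a, 'f) gmodule \<Rightarrow> ('a, 'b) gmodule \<Rightarrow> 'f \<Rightarrow> 'b \<Rightarrow> ('f \<times> 'b \<Rightarrow> 'a) set" where
  "pure_tensor R F N x y =
     tensor_submodule R F N +>\<^bsub>free_module R (carrier F \<times> carrier N)\<^esub> free_gen R (x, y)"

definition tensor_module ::
  "'a gring \<Rightarrow> ('a, 'f) gmodule \<Rightarrow> ('a, 'b) gmodule \<Rightarrow> ('a, ('f \<times> 'b \<Rightarrow> 'a) set) module" where
  "tensor_module R F N =
     quot_module (free_module R (carrier F \<times> carrier N)) (tensor_submodule R F N)"

text \<open>The degree \<open>n\<close> component is the additive subgroup generated by the \<open>x \<otimes> y\<close> with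
  \<open>x\<close>, \<open>y\<close> homogeneous of degrees summing to \<open>n\<close>.\<close>

definition tensor_gmodule ::
  "'a gring \<Rightarrow> ('a, 'f) gmodule \<Rightarrow> ('a, 'b) gmodule \<Rightarrow> ('a, ('f \<times> 'b \<Rightarrow> 'a) set) gmodule" where
  "tensor_gmodule R F N =
     with_grading (tensor_module R F N)
       (\<lambda>n. generate (add_monoid (tensor_module R F N))
          {pure_tensor R F N x y | x y i j. x \<in> hcomp F i \<and> y \<in> hcomp N j \<and> i + j = n})"

text \<open>The map \<open>f \<otimes> id\<close>, evaluated on a coset \<open>X\<close> by extending \<open>x \<otimes> y \<mapsto> f x \<otimes> y\<close> linearly
  on any representative of \<open>X\<close>.\<close>

definition tensor_map ::
  "'a gring \<Rightarrow> ('a, 'f) gmodule \<Rightarrow> ('a, 'b) gmodule \<Rightarrow> ('f \<Rightarrow> 'f)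
     \<Rightarrow> ('f \<times> 'b \<Rightarrow> 'a) set \<Rightarrow> ('f \<times> 'b \<Rightarrow> 'a) set" where
  "tensor_map R F' N f X =
     the_elem ((\<lambda>c. \<Oplus>\<^bsub>tensor_module R F' N\<^esub>p\<in>{p. c p \<noteq> \<zero>\<^bsub>R\<^esub>}.
        c p \<odot>\<^bsub>tensor_module R F' N\<^esub> pure_tensor R F' N (f (fst p)) (snd p)) ` X)"

text \<open>\<open>Tor\<^sub>k(L,N)\<close>, computed from a resolution \<open>(F, d)\<close> of \<open>L\<close>: the homology at position \<open>k\<close> of the complex
  \<open>\<cdots> \<rightarrow> F\<^sub>2 \<otimes> N \<rightarrow> F\<^sub>1 \<otimes> N \<rightarrow> F\<^sub>0 \<otimes> N \<rightarrow> 0\<close>.\<close>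

definition Tor ::
  "'a gring \<Rightarrow> (nat \<Rightarrow> ('a, 'f) gmodule) \<Rightarrow> (nat \<Rightarrow> 'f \<Rightarrow> 'f) \<Rightarrow> nat \<Rightarrow> ('a, 'b) gmodule
     \<Rightarrow> ('a, ('f \<times> 'b \<Rightarrow> 'a) set set) gmodule" where
  "Tor R F d k N =
     subquot_gmodule (tensor_gmodule R (F k) N)
       (case k of
          0 \<Rightarrow> carrier (tensor_gmodule R (F k) N)
        | Suc j \<Rightarrow> a_kernel (tensor_gmodule R (F k) N) (tensor_gmodule R (F j) N)
                     (tensor_map R (F j) N (d j)))
       (tensor_map R (F k) N (d k) ` carrier (tensor_gmodule R (F (Suc k)) N))"


section \<open>Associated primes and v-numbers\<close>

definition annihilator ::
  "('a, 'c) ring_scheme \<Rightarrow> ('a, 'b, 'd) module_scheme \<Rightarrow> 'b \<Rightarrow> 'a set" where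
  "annihilator R E x = {a \<in> carrier R. a \<odot>\<^bsub>E\<^esub> x = \<zero>\<^bsub>E\<^esub>}"

definition ideal_annihilated :: "('a, 'b, 'd) module_scheme \<Rightarrow> 'a set \<Rightarrow> 'b set" where
  "ideal_annihilated H I = {x \<in> carrier H. \<forall>a\<in>I. a \<odot>\<^bsub>H\<^esub> x = \<zero>\<^bsub>H\<^esub>}"

definition Ass :: "('a, 'c) ring_scheme \<Rightarrow> ('a, 'b, 'd) module_scheme \<Rightarrow> 'a set set" where
  "Ass R E = {\<pp>. primeideal \<pp> R \<and> (\<exists>x\<in>carrier E. \<pp> = annihilator R E x)}"

definition local_v_number :: "'a gring \<Rightarrow> ('a, 'b) gmodule \<Rightarrow> 'a set \<Rightarrow> ereal" where
  "local_v_number R E \<pp> =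
     Inf {ereal (of_int n) | n. \<exists>x\<in>hcomp E n. \<pp> = annihilator R E x}"

definition v_number :: "'a gring \<Rightarrow> ('a, 'b) gmodule \<Rightarrow> ereal" where
  "v_number R E = Inf {local_v_number R E \<pp> | \<pp>. \<pp> \<in> Ass R E}"

end

theory Submission
  imports Defs
begin

text \<open>With finite homogeneous bases \<open>B i\<close> of the free modules \<open>F i\<close>, both \<open>Hom(F i, N)\<close> and
  \<open>F i \<otimes> N\<close> become powers of \<open>N\<close>, and the differentials become matrices over \<open>R\<close> that do not depend on \<open>N\<close>.
  So \<open>H\<close> and all \<open>H\<^sub>n\<close> are the homology of one matrix complex with coefficients in \<open>M\<close> and in \<open>M/I\<^sup>nM\<close>.

  As \<open>I\<^sup>n\<close> kills \<open>H\<^sub>n\<close>, every associated prime of \<open>H\<^sub>n\<close> contains \<open>I\<close>, and only the classes killed by \<open>I\<close>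
  contribute to \<open>v(H\<^sub>n)\<close>. By the Artin-Rees lemma and \<open>(0 :\<^bsub>H\<^esub> I) = 0\<close> they are represented by tuples with
  entries in \<open>I\<^bsup>n-e\<^esup>M\<close> for a fixed \<open>e\<close>, so together they form a finitely generated bigraded module over the
  Rees algebra of \<open>I\<close>. Along a prime filtration of such a module, the least degree of an element of level \<open>n\<close>
  with a given annihilator is eventually linear in \<open>n\<close>, with slope the degree of one of the chosen generators of \<open>I\<close>.\<close>

section \<open>Noetherian modules\<close>

text \<open>The obstacle: the sum of all H_n need not be finitely generated over the Rees algebra,
  because every cycle over M is a cycle modulo each I^n M and these do not shrink with n. The
  v-number sees less. If w is a cycle over M and I w lies in the boundaries plus the tuples over I^n
  M, then Artin-Rees, applied to the family of all y w with y a generator of I, and the hypothesis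
  on H put w into the boundaries plus the tuples over a slightly lower power. The shift e adds two
  Artin-Rees constants, one for approximating cycles modulo I^n M by true cycles and one for this
  colon.

  No Rees algebra is constructed. A graded module over it is a sequence of submodules of one fixed
  module, a list \<open>ys\<close> acting from each level to the next, and passing to a quotient
  means working relative to a second sequence \<open>K\<close>. Generation then matters in high
  levels only; the chain condition covers the others.

  A cyclic factor with prime annihilator P has as slope the least degree of a generator of I outside
  P, since monomials in such generators survive. Irredundance of \<open>ys\<close> makes this the
  degree of a minimal generator.\<close>

lemma exists_maximal_chain:
  fixes P :: "'x::order \<Rightarrow> bool"
  assumes "P x0"
    and "\<And>f::nat \<Rightarrow> 'x. (\<And>i. P (f i)) \<Longrightarrow> (\<And>i. f i \<le> f (Suc i)) \<Longrightarrow> \<exists>i. f (Suc i) = f i"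
  shows "\<exists>x. P x \<and> x0 \<le> x \<and> (\<forall>y. P y \<longrightarrow> x \<le> y \<longrightarrow> y = x)"
proof (rule ccontr)
  assume "\<not> ?thesis"
  then have step: "\<exists>y. (P y \<and> x0 \<le> y) \<and> x < y" if "P x \<and> x0 \<le> x" for x
    using that by (metis order.strict_iff_order order_trans)
  \<comment> \<open>Dependent choice yields a strictly increasing sequence, against the second
    assumption.\<close>
  have "\<exists>f. \<forall>n::nat. (P (f n) \<and> x0 \<le> f n) \<and> f n < f (Suc n)"
    by (rule dependent_nat_choice) (use assms(1) step in auto)
  then show False
    using assms(2) by (metis order.strict_iff_order)
qed

text \<open>Stated as the ascending chain condition because it is always used to stabilise an
  increasing sequence of submodules or ideals.\<close>

definition noetherian_module :: "('a, 'c) ring_scheme \<Rightarrow> ('a, 'b, 'd) module_scheme \<Rightarrow> bool" where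
  "noetherian_module R M \<longleftrightarrow>
     (\<forall>N :: nat \<Rightarrow> 'b set. (\<forall>i. submodule (N i) R M) \<longrightarrow> (\<forall>i. N i \<subseteq> N (Suc i)) \<longrightarrow>
        (\<exists>k. \<forall>i\<ge>k. N i = N k))"

text \<open>For a submodule \<open>V\<close> this is I V with I generated by \<open>ys\<close>.
  Recursion over a list lets the basis theorem split off one generator at a time.\<close>

primrec lin_comb :: "('a, 'b, 'd) module_scheme \<Rightarrow> 'a list \<Rightarrow> 'b set \<Rightarrow> 'b set" where
  "lin_comb M [] V = {\<zero>\<^bsub>M\<^esub>}"
| "lin_comb M (y # ys) V = {y \<odot>\<^bsub>M\<^esub> v \<oplus>\<^bsub>M\<^esub> w | v w. v \<in> V \<and> w \<in> lin_comb M ys V}"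

text \<open>A graded module over the polynomial ring with one variable for each entry of
  \<open>ys\<close>, in disguise: \<open>N n\<close> is its part of level n, and the variable of
  \<open>y\<close> acts as multiplication by \<open>y\<close> from level n to level n + 1. All
  levels sit in the same \<open>M\<close>.\<close>

definition stable_family ::
  "('a, 'c) ring_scheme \<Rightarrow> ('a, 'b, 'd) module_scheme \<Rightarrow> 'a list \<Rightarrow> (nat \<Rightarrow> 'b set) \<Rightarrow> bool" where
  "stable_family R M ys N \<longleftrightarrow>
     (\<forall>n. submodule (N n) R M) \<and> (\<forall>n. \<forall>y\<in>set ys. \<forall>v\<in>N n. y \<odot>\<^bsub>M\<^esub> v \<in> N (Suc n))"

text \<open>Together with the chain condition on the finitely many remaining levels, this replaces
  finite generation of N / K over the polynomial ring, and it makes sense without choosing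
  generators.\<close>

definition eventually_generated ::
  "('a, 'b, 'd) module_scheme \<Rightarrow> 'a list \<Rightarrow> (nat \<Rightarrow> 'b set) \<Rightarrow> (nat \<Rightarrow> 'b set) \<Rightarrow> bool" where
  "eventually_generated M ys K N \<longleftrightarrow>
     (\<exists>n0. \<forall>n\<ge>n0. N (Suc n) \<subseteq> lin_comb M ys (N n) <+>\<^bsub>M\<^esub> K (Suc n))"

section \<open>Sums, scalar multiples and stable families of submodules\<close>

context module
begin

lemma submodule_mem: "submodule N R M \<Longrightarrow> x \<in> N \<Longrightarrow> x \<in> carrier M"
  using submoduleE(1) by blast

lemma submodule_zero: "submodule N R M \<Longrightarrow> \<zero>\<^bsub>M\<^esub> \<in> N"
  using subgroup.one_closed submodule.axioms(1) by fastforce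

lemmas submodule_add = submoduleE(5)
lemmas submodule_smult = submoduleE(4)
lemmas submodule_neg = submoduleE(3)

lemma submodule_diff: "submodule N R M \<Longrightarrow> x \<in> N \<Longrightarrow> y \<in> N \<Longrightarrow> x \<ominus>\<^bsub>M\<^esub> y \<in> N"
  by (simp add: a_minus_def submodule_add submodule_neg)

lemma submodule_add_cancel:
  assumes "submodule N R M" "x \<in> N" "x \<oplus>\<^bsub>M\<^esub> y \<in> N" "y \<in> carrier M"
  shows "y \<in> N"
proof -
  have "(\<ominus>\<^bsub>M\<^esub> x) \<oplus>\<^bsub>M\<^esub> (x \<oplus>\<^bsub>M\<^esub> y) \<in> N"
    by (rule submodule_add[OF assms(1) submodule_neg[OF assms(1,2)] assms(3)])
  then show ?thesis
    using assms by (metis M.r_neg1 submodule_mem)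
qed

lemma submodule_Int: "submodule N R M \<Longrightarrow> submodule K R M \<Longrightarrow> submodule (N \<inter> K) R M"
  by (rule submoduleI) (auto simp: submodule_mem submodule_zero submodule_add submodule_smult submodule_neg)

lemma submodule_finsum:
  assumes "submodule N R M" "\<And>i. i \<in> J \<Longrightarrow> f i \<in> N"
  shows "finsum M f J \<in> N"
  using assms(2)
proof (induction J rule: infinite_finite_induct)
  case (insert i J)
  then have "f \<in> J \<rightarrow> carrier M" "f i \<in> carrier M"
    using submodule_mem[OF assms(1)] by auto
  with insert show ?case
    by (simp add: submodule_add[OF assms(1)])
qed (auto simp: submodule_zero[OF assms(1)])

lemma in_set_add: "x \<in> V <+>\<^bsub>M\<^esub> W \<longleftrightarrow> (\<exists>v\<in>V. \<exists>w\<in>W. x = v \<oplus>\<^bsub>M\<^esub> w)"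
  by (auto simp: set_add_def')

lemma in_set_addI: "v \<in> V \<Longrightarrow> w \<in> W \<Longrightarrow> v \<oplus>\<^bsub>M\<^esub> w \<in> V <+>\<^bsub>M\<^esub> W"
  by (auto simp: set_add_def')

lemma submodule_set_add:
  assumes N: "submodule N R M" and K: "submodule K R M"
  shows "submodule (N <+>\<^bsub>M\<^esub> K) R M"
proof (rule submoduleI)
  note c = submodule_mem[OF N] submodule_mem[OF K]
  show "N <+>\<^bsub>M\<^esub> K \<subseteq> carrier M"
    by (auto simp: in_set_add c)
  show "\<zero>\<^bsub>M\<^esub> \<in> N <+>\<^bsub>M\<^esub> K"
    unfolding in_set_add
    by (rule bexI[OF _ submodule_zero[OF N]], rule bexI[OF _ submodule_zero[OF K]]) simp
  show "\<ominus>\<^bsub>M\<^esub> x \<in> N <+>\<^bsub>M\<^esub> K" if "x \<in> N <+>\<^bsub>M\<^esub> K" for x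
  proof -
    from that obtain v w where "v \<in> N" "w \<in> K" "x = v \<oplus>\<^bsub>M\<^esub> w" by (auto simp: in_set_add)
    then show ?thesis
      using in_set_addI[OF submodule_neg[OF N] submodule_neg[OF K], of v w] c by (simp add: M.minus_add)
  qed
  show "x \<oplus>\<^bsub>M\<^esub> x' \<in> N <+>\<^bsub>M\<^esub> K" if "x \<in> N <+>\<^bsub>M\<^esub> K" "x' \<in> N <+>\<^bsub>M\<^esub> K" for x x'
  proof -
    from that obtain v w v' w' where *: "v \<in> N" "w \<in> K" "x = v \<oplus>\<^bsub>M\<^esub> w" "v' \<in> N" "w' \<in> K" "x' = v' \<oplus>\<^bsub>M\<^esub> w'"
      by (auto simp: in_set_add)
    then have "x \<oplus>\<^bsub>M\<^esub> x' = (v \<oplus>\<^bsub>M\<^esub> v') \<oplus>\<^bsub>M\<^esub> (w \<oplus>\<^bsub>M\<^esub> w')"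
      using c by (simp add: M.a_ac)
    then show ?thesis
      using * in_set_addI submodule_add[OF N] submodule_add[OF K] by auto
  qed
  show "a \<odot>\<^bsub>M\<^esub> x \<in> N <+>\<^bsub>M\<^esub> K" if "a \<in> carrier R" "x \<in> N <+>\<^bsub>M\<^esub> K" for a x
  proof -
    from that obtain v w where *: "v \<in> N" "w \<in> K" "x = v \<oplus>\<^bsub>M\<^esub> w" by (auto simp: in_set_add)
    then have "a \<odot>\<^bsub>M\<^esub> x = a \<odot>\<^bsub>M\<^esub> v \<oplus>\<^bsub>M\<^esub> a \<odot>\<^bsub>M\<^esub> w"
      using c that by (simp add: smult_r_distr)
    then show ?thesis
      using * that in_set_addI submodule_smult[OF N] submodule_smult[OF K] by auto
  qed
qed

lemma set_add_left: "submodule N R M \<Longrightarrow> submodule K R M \<Longrightarrow> x \<in> N \<Longrightarrow> x \<in> N <+>\<^bsub>M\<^esub> K"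
  using in_set_addI[of x N "\<zero>\<^bsub>M\<^esub>" K] submodule_zero[of K] submodule_mem[of N x] by simp

lemma set_add_right: "submodule N R M \<Longrightarrow> submodule K R M \<Longrightarrow> x \<in> K \<Longrightarrow> x \<in> N <+>\<^bsub>M\<^esub> K"
  using in_set_addI[of "\<zero>\<^bsub>M\<^esub>" N x K] submodule_zero[of N] submodule_mem[of K x] by simp

lemma set_add_least:
  "submodule T R M \<Longrightarrow> V \<subseteq> T \<Longrightarrow> W \<subseteq> T \<Longrightarrow> V <+>\<^bsub>M\<^esub> W \<subseteq> T"
  by (auto simp: in_set_add) (meson submodule_add subsetD)

lemma zero_submodule: "submodule {\<zero>\<^bsub>M\<^esub>} R M"
  by (rule submoduleI) auto

lemma smult_swap:
  "\<lbrakk>a \<in> carrier R; b \<in> carrier R; x \<in> carrier M\<rbrakk> \<Longrightarrow> a \<odot>\<^bsub>M\<^esub> (b \<odot>\<^bsub>M\<^esub> x) = b \<odot>\<^bsub>M\<^esub> (a \<odot>\<^bsub>M\<^esub> x)"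
  by (metis R.m_comm smult_assoc1)

lemma submodule_smult_image:
  assumes N: "submodule N R M" and y: "y \<in> carrier R"
  shows "submodule {y \<odot>\<^bsub>M\<^esub> v | v. v \<in> N} R M"
proof (rule submoduleI)
  note c = submodule_mem[OF N]
  show "{y \<odot>\<^bsub>M\<^esub> v | v. v \<in> N} \<subseteq> carrier M" using c y by auto
  show "\<zero>\<^bsub>M\<^esub> \<in> {y \<odot>\<^bsub>M\<^esub> v | v. v \<in> N}" using submodule_zero[OF N] y by force
  show "\<ominus>\<^bsub>M\<^esub> x \<in> {y \<odot>\<^bsub>M\<^esub> v | v. v \<in> N}" if "x \<in> {y \<odot>\<^bsub>M\<^esub> v | v. v \<in> N}" for x
    using that smult_r_minus[OF y] submodule_neg[OF N] c by force
  show "x \<oplus>\<^bsub>M\<^esub> x' \<in> {y \<odot>\<^bsub>M\<^esub> v | v. v \<in> N}"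
    if "x \<in> {y \<odot>\<^bsub>M\<^esub> v | v. v \<in> N}" "x' \<in> {y \<odot>\<^bsub>M\<^esub> v | v. v \<in> N}" for x x'
    using that smult_r_distr[OF y, symmetric] submodule_add[OF N] c by force
  show "a \<odot>\<^bsub>M\<^esub> x \<in> {y \<odot>\<^bsub>M\<^esub> v | v. v \<in> N}"
    if "a \<in> carrier R" "x \<in> {y \<odot>\<^bsub>M\<^esub> v | v. v \<in> N}" for a x
    using that smult_swap[of a y] y submodule_smult[OF N] c by force
qed

lemma lin_comb_Cons: "lin_comb M (y # ys) V = {y \<odot>\<^bsub>M\<^esub> v | v. v \<in> V} <+>\<^bsub>M\<^esub> lin_comb M ys V"
  by (force simp: set_add_def')

lemma submodule_lin_comb:
  "submodule V R M \<Longrightarrow> set ys \<subseteq> carrier R \<Longrightarrow> submodule (lin_comb M ys V) R M"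
proof (induction ys)
  case (Cons y ys)
  then show ?case
    unfolding lin_comb_Cons by (intro submodule_set_add submodule_smult_image) auto
qed (simp add: zero_submodule)

lemma lin_comb_least:
  assumes "submodule T R M" "\<And>y v. y \<in> set ys \<Longrightarrow> v \<in> V \<Longrightarrow> y \<odot>\<^bsub>M\<^esub> v \<in> T"
  shows "lin_comb M ys V \<subseteq> T"
  using assms(2)
proof (induction ys)
  case (Cons y ys)
  then show ?case
    unfolding lin_comb_Cons by (intro set_add_least[OF assms(1)]) auto
qed (simp add: submodule_zero[OF assms(1)])

lemma lin_comb_smult:
  assumes "submodule V R M" "set ys \<subseteq> carrier R" "y \<in> set ys" "v \<in> V"
  shows "y \<odot>\<^bsub>M\<^esub> v \<in> lin_comb M ys V"
  using assms(2,3)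
proof (induction ys)
  case (Cons z zs)
  have sub: "submodule {z \<odot>\<^bsub>M\<^esub> v | v. v \<in> V} R M" "submodule (lin_comb M zs V) R M"
    using Cons.prems by (auto intro: submodule_smult_image submodule_lin_comb assms(1))
  show ?case
    using Cons assms(4) unfolding lin_comb_Cons
    by (cases "y = z") (auto intro: set_add_left[OF sub] set_add_right[OF sub])
qed simp

lemma lin_comb_mono: "V \<subseteq> W \<Longrightarrow> lin_comb M ys V \<subseteq> lin_comb M ys W"
  by (induction ys) auto

lemma stable_familyD:
  assumes "stable_family R M ys N"
  shows "submodule (N n) R M" "\<And>y v. y \<in> set ys \<Longrightarrow> v \<in> N n \<Longrightarrow> y \<odot>\<^bsub>M\<^esub> v \<in> N (Suc n)"
  using assms by (auto simp: stable_family_def)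

lemma stable_family_subset:
  "stable_family R M ys N \<Longrightarrow> set zs \<subseteq> set ys \<Longrightarrow> stable_family R M zs N"
  by (auto simp: stable_family_def)

lemma stable_family_set_add:
  assumes ys: "set ys \<subseteq> carrier R" and N: "stable_family R M ys N" and K: "stable_family R M ys K"
  shows "stable_family R M ys (\<lambda>n. N n <+>\<^bsub>M\<^esub> K n)"
  unfolding stable_family_def
proof (intro conjI allI ballI)
  show "submodule (N n <+>\<^bsub>M\<^esub> K n) R M" for n
    by (intro submodule_set_add stable_familyD(1)[OF N] stable_familyD(1)[OF K])
  show "y \<odot>\<^bsub>M\<^esub> x \<in> N (Suc n) <+>\<^bsub>M\<^esub> K (Suc n)" if "y \<in> set ys" and "x \<in> N n <+>\<^bsub>M\<^esub> K n" for n y x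
  proof -
    obtain v w where *: "v \<in> N n" "w \<in> K n" "x = v \<oplus>\<^bsub>M\<^esub> w"
      using \<open>x \<in> N n <+>\<^bsub>M\<^esub> K n\<close> by (auto simp: in_set_add)
    have "y \<odot>\<^bsub>M\<^esub> x = y \<odot>\<^bsub>M\<^esub> v \<oplus>\<^bsub>M\<^esub> y \<odot>\<^bsub>M\<^esub> w"
      using * ys \<open>y \<in> set ys\<close> submodule_mem stable_familyD(1)[OF N] stable_familyD(1)[OF K]
      by (metis smult_r_distr subsetD)
    then show ?thesis
      using in_set_addI stable_familyD(2)[OF N \<open>y \<in> set ys\<close> *(1)] stable_familyD(2)[OF K \<open>y \<in> set ys\<close> *(2)]
      by auto
  qed
qed

lemma submodule_chain_union:
  fixes N :: "nat \<Rightarrow> _"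
  assumes "\<And>i. submodule (N i) R M" "\<And>i. N i \<subseteq> N (Suc i)"
  shows "submodule (\<Union>i. N i) R M"
proof (rule submoduleI)
  have mono: "i \<le> j \<Longrightarrow> N i \<subseteq> N j" for i j
    using assms(2) by (rule lift_Suc_mono_le)
  show "x \<oplus>\<^bsub>M\<^esub> y \<in> (\<Union>i. N i)" if x: "x \<in> (\<Union>i. N i)" and y: "y \<in> (\<Union>i. N i)" for x y
  proof -
    obtain i j where ij: "x \<in> N i" "y \<in> N j" using x y by blast
    then have "x \<in> N (max i j)" "y \<in> N (max i j)"
      using mono[of i "max i j"] mono[of j "max i j"] by auto
    then show ?thesis using submodule_add[OF assms(1)] by blast
  qed
  show "\<zero>\<^bsub>M\<^esub> \<in> (\<Union>i. N i)" using submodule_zero[OF assms(1)] by blast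
  show "(\<Union>i. N i) \<subseteq> carrier M" using submodule_mem[OF assms(1)] by blast
  show "\<ominus>\<^bsub>M\<^esub> x \<in> (\<Union>i. N i)" if "x \<in> (\<Union>i. N i)" for x
    using that submodule_neg[OF assms(1)] by blast
  show "a \<odot>\<^bsub>M\<^esub> x \<in> (\<Union>i. N i)" if "a \<in> carrier R" "x \<in> (\<Union>i. N i)" for a x
    using that submodule_smult[OF assms(1)] by blast
qed

text \<open>The union of the chain is determined by its levels up to \<open>n0\<close>, because each
  later level is generated from the one before it modulo \<open>K\<close>, which all members
  contain. Each of these finitely many levels stabilises by the chain condition in \<open>M\<close>,
  and the maximum of their indices serves every level. The premise \<open>gen\<close> is asked for
  the union only, so that it can be supplied by an induction hypothesis as well as by the finished
  basis theorem.\<close>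

lemma noetherian_family_chain:
  assumes noeth: "noetherian_module R M" and ys: "set ys \<subseteq> carrier R"
    and G: "\<And>i. stable_family R M ys (G i)" and mono: "\<And>i n. G i n \<subseteq> G (Suc i) n"
    and K: "\<And>i n. K n \<subseteq> G i n"
    and gen: "stable_family R M ys (\<lambda>n. \<Union>i. G i n) \<Longrightarrow> eventually_generated M ys K (\<lambda>n. \<Union>i. G i n)"
  shows "\<exists>i0. \<forall>i\<ge>i0. \<forall>n. G i n = G i0 n"
proof -
  have le: "i \<le> j \<Longrightarrow> G i n \<subseteq> G j n" for i j n
    using mono by (rule lift_Suc_mono_le[of "\<lambda>i. G i n"])
  have "stable_family R M ys (\<lambda>n. \<Union>i. G i n)"
    unfolding stable_family_def
    using submodule_chain_union[of "\<lambda>i. G i _", OF stable_familyD(1)[OF G] mono] stable_familyD(2)[OF G]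
    by blast
  from gen[OF this] obtain n0 where
    n0: "\<And>n. n \<ge> n0 \<Longrightarrow> (\<Union>i. G i (Suc n)) \<subseteq> lin_comb M ys (\<Union>i. G i n) <+>\<^bsub>M\<^esub> K (Suc n)"
    by (auto simp: eventually_generated_def)
  have "\<exists>k. \<forall>i\<ge>k. G i n = G k n" for n
    using noeth[unfolded noetherian_module_def, rule_format, of "\<lambda>i. G i n"] stable_familyD(1)[OF G] mono
    by blast
  then obtain k where k: "\<And>n i. i \<ge> k n \<Longrightarrow> G i n = G (k n) n" by metis
  define i0 where "i0 = Max (k ` {..n0})"
  have i0: "k n \<le> i0" if "n \<le> n0" for n
    using that by (auto simp: i0_def)
  have main: "(\<Union>i. G i n) \<subseteq> G i0 n" for n
  proof (induction n)
    case 0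
    have "G i 0 \<subseteq> G i0 0" for i
      using k[of 0 "max i i0"] k[of 0 i0] i0[of 0] le[of i "max i i0" 0] by auto
    then show ?case by blast
  next
    case (Suc n)
    show ?case
    proof (cases "Suc n \<le> n0")
      case True
      have "G i (Suc n) \<subseteq> G i0 (Suc n)" for i
        using k[of "Suc n" "max i i0"] k[of "Suc n" i0] i0[OF True] le[of i "max i i0" "Suc n"] by auto
      then show ?thesis by blast
    next
      case False
      have "lin_comb M ys (\<Union>i. G i n) \<subseteq> G i0 (Suc n)"
        using Suc.IH stable_familyD[OF G] by (intro lin_comb_least) blast+
      then have "lin_comb M ys (\<Union>i. G i n) <+>\<^bsub>M\<^esub> K (Suc n) \<subseteq> G i0 (Suc n)"
        using K stable_familyD(1)[OF G] by (intro set_add_least)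
      moreover have "n0 \<le> n"
        using False by simp
      ultimately show ?thesis
        using n0[of n] by blast
    qed
  qed
  show ?thesis
    using main le by blast
qed

end

section \<open>A relative basis theorem by elimination of one variable\<close>

context module
begin

text \<open>Let e lie in \<open>P i m\<close>. Up to a summand whose multiple by y^i is already in
  the target \<open>T\<close>, it can be written as y e' with e' in level m - 1, and then y^i e
  becomes y^(i+1) e'. So m drops by one, i rises by one, and the total level m + i stays fixed until
  m is exhausted. For i up to \<open>i0\<close> the factor y comes from the generation of
  \<open>P i\<close> modulo \<open>K'\<close>, which requires m to be large; beyond
  \<open>i0\<close> it comes from the stationarity of \<open>P i\<close> modulo
  \<open>K'\<close>.\<close>

lemma eventually_generated_step:
  assumes ys: "set (y # ys) \<subseteq> carrier R"
    and E: "stable_family R M (y # ys) E" and K: "stable_family R M (y # ys) K"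
    and N: "stable_family R M (y # ys) N" and KN: "\<And>n. K n \<subseteq> N n" and NE: "\<And>n. N n \<subseteq> E n"
    and P: "\<And>i n. P i n = {e \<in> E n. (y [^]\<^bsub>R\<^esub> i) \<odot>\<^bsub>M\<^esub> e \<in> N (n + i)}"
    and K': "\<And>n. K' n = (case n of 0 \<Rightarrow> K 0 | Suc m \<Rightarrow> {y \<odot>\<^bsub>M\<^esub> v | v. v \<in> E m} <+>\<^bsub>M\<^esub> K (Suc m))"
    and i0: "\<And>i n. i \<ge> i0 \<Longrightarrow> P i n <+>\<^bsub>M\<^esub> K' n = P i0 n <+>\<^bsub>M\<^esub> K' n"
    and n1: "\<And>i n. i \<le> i0 \<Longrightarrow> n \<ge> n1 \<Longrightarrow> P i (Suc n) \<subseteq> lin_comb M ys (P i n) <+>\<^bsub>M\<^esub> K' (Suc n)"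
    and Psub: "\<And>i n. submodule (P i n) R M" and K'sub: "\<And>n. submodule (K' n) R M"
    and Pst: "\<And>i. stable_family R M ys (P i)"
    and KP: "\<And>i n. K n \<subseteq> P i n"
  shows "eventually_generated M (y # ys) K N"
proof -
  define T where "T p = lin_comb M (y # ys) (N p) <+>\<^bsub>M\<^esub> K (Suc p)" for p
  note Nsub = stable_familyD(1)[OF N] and Ksub = stable_familyD(1)[OF K] and Esub = stable_familyD(1)[OF E]
  have y: "y \<in> carrier R" and ysc: "set ys \<subseteq> carrier R" using ys by auto
  have yi: "y [^]\<^bsub>R\<^esub> (i::nat) \<in> carrier R" for i using y by simp
  have Lsub: "submodule (lin_comb M (y # ys) (N p)) R M" for p
    by (rule submodule_lin_comb[OF Nsub ys])
  have Tsub: "submodule (T p) R M" for p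
    unfolding T_def by (intro submodule_set_add Lsub Ksub)
  have LT: "z \<in> lin_comb M (y # ys) (N p) \<Longrightarrow> z \<in> T p" for z p
    unfolding T_def by (rule set_add_left[OF Lsub Ksub])
  have KT: "z \<in> K (Suc p) \<Longrightarrow> z \<in> T p" for z p
    unfolding T_def by (rule set_add_right[OF Lsub Ksub])
  have TN: "T p \<subseteq> N (Suc p)" for p
    unfolding T_def using stable_familyD[OF N] KN by (intro set_add_least Nsub lin_comb_least) auto
  have pow_Suc: "(y [^]\<^bsub>R\<^esub> Suc i) \<odot>\<^bsub>M\<^esub> v = (y [^]\<^bsub>R\<^esub> i) \<odot>\<^bsub>M\<^esub> (y \<odot>\<^bsub>M\<^esub> v)" if "v \<in> carrier M" for i v
    using that y yi by (simp add: smult_assoc1)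
  have pow_Suc': "(y [^]\<^bsub>R\<^esub> Suc i) \<odot>\<^bsub>M\<^esub> v = y \<odot>\<^bsub>M\<^esub> ((y [^]\<^bsub>R\<^esub> i) \<odot>\<^bsub>M\<^esub> v)" if "v \<in> carrier M" for i v
    using that y yi pow_Suc smult_swap by simp
  \<comment> \<open>The element y^(i+1) e' is back in \<open>N\<close> because the other two terms
    of the sum are, so e' satisfies the colon condition for exponent i + 1.\<close>
  have step: "e' \<in> P (Suc i) m \<and> ((y [^]\<^bsub>R\<^esub> Suc i) \<odot>\<^bsub>M\<^esub> e' \<in> T (m + i) \<longrightarrow> (y [^]\<^bsub>R\<^esub> i) \<odot>\<^bsub>M\<^esub> e \<in> T (m + i))"
    if e: "e \<in> P i (Suc m)" "e = w \<oplus>\<^bsub>M\<^esub> y \<odot>\<^bsub>M\<^esub> e'" "w \<in> carrier M" "(y [^]\<^bsub>R\<^esub> i) \<odot>\<^bsub>M\<^esub> w \<in> T (m + i)" "e' \<in> E m"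
    for e e' w i m
  proof -
    have e'c: "e' \<in> carrier M" using submodule_mem[OF Esub e(5)] .
    have eq: "(y [^]\<^bsub>R\<^esub> i) \<odot>\<^bsub>M\<^esub> e = (y [^]\<^bsub>R\<^esub> i) \<odot>\<^bsub>M\<^esub> w \<oplus>\<^bsub>M\<^esub> (y [^]\<^bsub>R\<^esub> Suc i) \<odot>\<^bsub>M\<^esub> e'"
      using e(2,3) e'c y yi by (simp only: pow_Suc[OF e'c] smult_r_distr smult_closed)
    have "(y [^]\<^bsub>R\<^esub> i) \<odot>\<^bsub>M\<^esub> w \<in> N (Suc (m + i))" using e(4) TN by blast
    moreover have "(y [^]\<^bsub>R\<^esub> i) \<odot>\<^bsub>M\<^esub> e \<in> N (Suc (m + i))" using e(1) by (simp add: P)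
    ultimately have "(y [^]\<^bsub>R\<^esub> Suc i) \<odot>\<^bsub>M\<^esub> e' \<in> N (Suc (m + i))"
      using submodule_add_cancel[OF Nsub] eq e'c yi by (metis smult_closed)
    then have "e' \<in> P (Suc i) m" using e(5) by (simp add: P)
    then show ?thesis using eq submodule_add[OF Tsub e(4)] by auto
  qed
  have powK: "k \<in> K n \<Longrightarrow> (y [^]\<^bsub>R\<^esub> i) \<odot>\<^bsub>M\<^esub> k \<in> K (n + i)" for k n i
  proof (induction i)
    case 0 then show ?case using submodule_mem[OF Ksub] by simp
  next
    case (Suc i)
    then show ?case
      using stable_familyD(2)[OF K, of y] submodule_mem[OF Ksub] by (simp only: pow_Suc') auto
  qed
  \<comment> \<open>One factor y is split off: an element of the colon for exponent i - 1,
    multiplied by y^i, is y times an element of \<open>N\<close>.\<close>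
  have powL: "(y [^]\<^bsub>R\<^esub> i) \<odot>\<^bsub>M\<^esub> p \<in> T (n + j)" if "p \<in> P j n" "i = Suc j" for p n i j
  proof -
    have "(y [^]\<^bsub>R\<^esub> j) \<odot>\<^bsub>M\<^esub> p \<in> N (n + j)" using that by (simp add: P)
    then have "y \<odot>\<^bsub>M\<^esub> ((y [^]\<^bsub>R\<^esub> j) \<odot>\<^bsub>M\<^esub> p) \<in> lin_comb M (y # ys) (N (n + j))"
      by (intro lin_comb_smult[OF Nsub ys]) auto
    then show ?thesis
      using LT that pow_Suc' submodule_mem[OF Psub] by auto
  qed
  \<comment> \<open>The bound on m is tuned to the descent: while i is at most \<open>i0\<close>, it
    guarantees m - 1 \<ge> n1 and is inherited by the pair (i + 1, m - 1), and once i exceeds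
    \<open>i0\<close> the first alternative holds forever. At m = 0 only the first alternative is
    possible.\<close>
  have main: "(y [^]\<^bsub>R\<^esub> i) \<odot>\<^bsub>M\<^esub> e \<in> T p"
    if "e \<in> P i m" "i > i0 \<or> m \<ge> Suc n1 + (i0 - i)" "m + i = Suc p" for i e m p
    using that
  proof (induction m arbitrary: i e)
    case 0
    then obtain j where j: "i = Suc j" "j = p" "j \<ge> i0" by auto
    have "e \<in> P i 0 <+>\<^bsub>M\<^esub> K' 0" using 0 by (intro set_add_left[OF Psub K'sub])
    then have "e \<in> P j 0 <+>\<^bsub>M\<^esub> K 0" using i0[of i 0] i0[of j 0] j by (simp add: K')
    then obtain v k where vk: "v \<in> P j 0" "k \<in> K 0" "e = v \<oplus>\<^bsub>M\<^esub> k" by (auto simp: in_set_add)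
    have "(y [^]\<^bsub>R\<^esub> i) \<odot>\<^bsub>M\<^esub> v \<in> T p" using powL[OF vk(1) j(1)] j by simp
    moreover have "(y [^]\<^bsub>R\<^esub> i) \<odot>\<^bsub>M\<^esub> k \<in> T p" using powK[OF vk(2), of i] j KT by simp
    ultimately show ?case
      using submodule_add[OF Tsub] vk smult_r_distr[OF yi] submodule_mem[OF Psub] submodule_mem[OF Ksub] by auto
  next
    case (Suc m)
    have p: "p = m + i" using Suc.prems by simp
    obtain w e' where we: "e = w \<oplus>\<^bsub>M\<^esub> y \<odot>\<^bsub>M\<^esub> e'" "w \<in> carrier M" "(y [^]\<^bsub>R\<^esub> i) \<odot>\<^bsub>M\<^esub> w \<in> T (m + i)" "e' \<in> E m"
    proof (cases "i > i0")
      case True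
      then obtain j where j: "i = Suc j" "j \<ge> i0" by (cases i) auto
      have "e \<in> P i (Suc m) <+>\<^bsub>M\<^esub> K' (Suc m)" using Suc.prems by (intro set_add_left[OF Psub K'sub])
      then have "e \<in> P j (Suc m) <+>\<^bsub>M\<^esub> K' (Suc m)" using i0[of i "Suc m"] i0[of j "Suc m"] j by simp
      then obtain v k e' where vk: "v \<in> P j (Suc m)" "k \<in> K (Suc m)" "e' \<in> E m" "e = v \<oplus>\<^bsub>M\<^esub> (y \<odot>\<^bsub>M\<^esub> e' \<oplus>\<^bsub>M\<^esub> k)"
        by (auto simp: in_set_add K')
      have c: "v \<in> carrier M" "k \<in> carrier M" "e' \<in> carrier M"
        using vk submodule_mem[OF Psub] submodule_mem[OF Ksub] submodule_mem[OF Esub] by blast+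
      show thesis
      proof (rule that[of "v \<oplus>\<^bsub>M\<^esub> k" e'])
        show "e = v \<oplus>\<^bsub>M\<^esub> k \<oplus>\<^bsub>M\<^esub> y \<odot>\<^bsub>M\<^esub> e'" using vk c y by (simp add: M.a_ac)
        show "v \<oplus>\<^bsub>M\<^esub> k \<in> carrier M" using c by simp
        have "(y [^]\<^bsub>R\<^esub> i) \<odot>\<^bsub>M\<^esub> v \<in> T (m + i)" using powL[OF vk(1) j(1)] j by simp
        moreover have "(y [^]\<^bsub>R\<^esub> i) \<odot>\<^bsub>M\<^esub> k \<in> T (m + i)" using powK[OF vk(2), of i] KT by simp
        ultimately show "(y [^]\<^bsub>R\<^esub> i) \<odot>\<^bsub>M\<^esub> (v \<oplus>\<^bsub>M\<^esub> k) \<in> T (m + i)"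
          using submodule_add[OF Tsub] smult_r_distr[OF yi] c by auto
        show "e' \<in> E m" by fact
      qed
    next
      case False
      then have "i \<le> i0" "m \<ge> n1" using Suc.prems by auto
      then have "e \<in> lin_comb M ys (P i m) <+>\<^bsub>M\<^esub> K' (Suc m)" using n1 Suc.prems by blast
      then obtain u k e' where uk: "u \<in> lin_comb M ys (P i m)" "k \<in> K (Suc m)" "e' \<in> E m" "e = u \<oplus>\<^bsub>M\<^esub> (y \<odot>\<^bsub>M\<^esub> e' \<oplus>\<^bsub>M\<^esub> k)"
        by (auto simp: in_set_add K')
      have c: "u \<in> carrier M" "k \<in> carrier M" "e' \<in> carrier M"
        using uk submodule_mem[OF submodule_lin_comb[OF Psub ysc]] submodule_mem[OF Ksub] submodule_mem[OF Esub] by blast+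
      have sub: "submodule {v \<in> carrier M. (y [^]\<^bsub>R\<^esub> i) \<odot>\<^bsub>M\<^esub> v \<in> T (m + i)} R M"
        using yi submodule_zero[OF Tsub] submodule_add[OF Tsub] submodule_neg[OF Tsub] submodule_smult[OF Tsub]
        by (intro submoduleI) (auto simp: smult_r_distr smult_r_minus smult_swap[OF yi])
      have "lin_comb M ys (P i m) \<subseteq> {v \<in> carrier M. (y [^]\<^bsub>R\<^esub> i) \<odot>\<^bsub>M\<^esub> v \<in> T (m + i)}"
      proof (rule lin_comb_least[OF sub])
        fix z v assume z: "z \<in> set ys" and v: "v \<in> P i m"
        have zc: "z \<in> carrier R" and vc: "v \<in> carrier M" using z ysc submodule_mem[OF Psub v] by auto
        have "z \<odot>\<^bsub>M\<^esub> ((y [^]\<^bsub>R\<^esub> i) \<odot>\<^bsub>M\<^esub> v) \<in> lin_comb M (y # ys) (N (m + i))"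
          using v z by (intro lin_comb_smult[OF Nsub ys]) (auto simp: P)
        then show "z \<odot>\<^bsub>M\<^esub> v \<in> {v \<in> carrier M. (y [^]\<^bsub>R\<^esub> i) \<odot>\<^bsub>M\<^esub> v \<in> T (m + i)}"
          using LT zc vc smult_swap[OF yi zc vc] by simp
      qed
      then have u: "(y [^]\<^bsub>R\<^esub> i) \<odot>\<^bsub>M\<^esub> u \<in> T (m + i)" using uk by blast
      show thesis
      proof (rule that[of "u \<oplus>\<^bsub>M\<^esub> k" e'])
        show "e = u \<oplus>\<^bsub>M\<^esub> k \<oplus>\<^bsub>M\<^esub> y \<odot>\<^bsub>M\<^esub> e'" using uk c y by (simp add: M.a_ac)
        show "u \<oplus>\<^bsub>M\<^esub> k \<in> carrier M" using c by simp
        have "(y [^]\<^bsub>R\<^esub> i) \<odot>\<^bsub>M\<^esub> k \<in> T (m + i)" using powK[OF uk(2), of i] KT by simp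
        with u show "(y [^]\<^bsub>R\<^esub> i) \<odot>\<^bsub>M\<^esub> (u \<oplus>\<^bsub>M\<^esub> k) \<in> T (m + i)"
          using submodule_add[OF Tsub] smult_r_distr[OF yi] c by auto
        show "e' \<in> E m" by fact
      qed
    qed
    have st: "e' \<in> P (Suc i) m" "(y [^]\<^bsub>R\<^esub> Suc i) \<odot>\<^bsub>M\<^esub> e' \<in> T (m + i) \<Longrightarrow> (y [^]\<^bsub>R\<^esub> i) \<odot>\<^bsub>M\<^esub> e \<in> T (m + i)"
      using step[OF Suc.prems(1) we] by auto
    have "(y [^]\<^bsub>R\<^esub> Suc i) \<odot>\<^bsub>M\<^esub> e' \<in> T p"
      using Suc.prems by (intro Suc.IH[OF st(1)]) auto
    then show ?case using st(2) p by simp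
  qed
  \<comment> \<open>The descent starts at i = 0, where the colon family is \<open>N\<close> itself;
    the threshold n1 + i0 is the bound of the descent for this i.\<close>
  have "N (Suc n) \<subseteq> T n" if "n \<ge> n1 + i0" for n
  proof
    fix e assume e: "e \<in> N (Suc n)"
    then have "e \<in> P 0 (Suc n)" using NE submodule_mem[OF Nsub] by (auto simp: P)
    from main[OF this, of n] that show "e \<in> T n" using submodule_mem[OF Nsub e] by simp
  qed
  then show ?thesis unfolding eventually_generated_def T_def by blast
qed

text \<open>A relative form of Hilbert's basis theorem for the Rees algebra; the Artin-Rees lemma is the
  case \<open>N n = N' \<inter> I\<^sup>n M\<close>. The induction removes the variable \<open>y\<close> by passing to the bottom family
  \<open>K n + y E (n - 1)\<close> and to the colon families \<open>P i n = (N (n + i) : y\<^sup>i)\<close>, which increase with \<open>i\<close>.\<close>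

theorem eventually_generated_subfamily:
  assumes noeth: "noetherian_module R M" and ys: "set ys \<subseteq> carrier R"
    and E: "stable_family R M ys E" and K: "stable_family R M ys K" and N: "stable_family R M ys N"
    and KN: "\<And>n. K n \<subseteq> N n" and NE: "\<And>n. N n \<subseteq> E n"
    and gen: "eventually_generated M ys K E"
  shows "eventually_generated M ys K N"
  using assms(2-)
proof (induction ys arbitrary: K N)
  case Nil
  then show ?case
    unfolding eventually_generated_def lin_comb.simps(1) by (meson subset_trans)
next
  case (Cons y ys)
  note ys = Cons.prems(1) and E = Cons.prems(2) and K = Cons.prems(3) and N = Cons.prems(4)
    and KN = Cons.prems(5) and NE = Cons.prems(6) and gen = Cons.prems(7)
  note Nsub = stable_familyD(1)[OF N] and Ksub = stable_familyD(1)[OF K] and Esub = stable_familyD(1)[OF E]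
  have y: "y \<in> carrier R" and ysc: "set ys \<subseteq> carrier R" using ys by auto
  have yi: "y [^]\<^bsub>R\<^esub> (i::nat) \<in> carrier R" for i using y by simp
  define K' where "K' n = (case n of 0 \<Rightarrow> K 0 | Suc m \<Rightarrow> {y \<odot>\<^bsub>M\<^esub> v | v. v \<in> E m} <+>\<^bsub>M\<^esub> K (Suc m))" for n
  define P where "P i n = {e \<in> E n. (y [^]\<^bsub>R\<^esub> i) \<odot>\<^bsub>M\<^esub> e \<in> N (n + i)}" for i n
  have yE: "submodule {y \<odot>\<^bsub>M\<^esub> v | v. v \<in> E m} R M" for m
    by (rule submodule_smult_image[OF Esub y])
  have K'sub: "submodule (K' n) R M" for n
    by (cases n) (auto simp: K'_def intro: submodule_set_add yE Ksub)
  have KK': "K n \<subseteq> K' n" for n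
    by (cases n) (auto simp: K'_def intro: set_add_right[OF yE Ksub])
  have yEK': "{y \<odot>\<^bsub>M\<^esub> v | v. v \<in> E m} \<subseteq> K' (Suc m)" for m
    by (auto simp: K'_def intro: set_add_left[OF yE Ksub])
  have K'E: "K' n \<subseteq> E n" for n
  proof -
    have KE: "K n \<subseteq> E n" using KN NE by blast
    show ?thesis
    proof (cases n)
      case (Suc m)
      have "{y \<odot>\<^bsub>M\<^esub> v | v. v \<in> E m} \<subseteq> E n"
        using stable_familyD(2)[OF E, of y] Suc by auto
      from set_add_least[OF Esub this KE] Suc show ?thesis by (simp add: K'_def)
    qed (use KE in \<open>simp add: K'_def\<close>)
  qed
  have K'st: "stable_family R M ys K'"
    unfolding stable_family_def
  proof (intro conjI allI ballI K'sub)
    fix n z x assume z: "z \<in> set ys" and x: "x \<in> K' n"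
    have zc: "z \<in> carrier R" using z ysc by auto
    show "z \<odot>\<^bsub>M\<^esub> x \<in> K' (Suc n)"
    proof (cases n)
      case 0
      then have "z \<odot>\<^bsub>M\<^esub> x \<in> K (Suc n)" using x z stable_familyD(2)[OF K] by (auto simp: K'_def)
      then show ?thesis using KK' by blast
    next
      case (Suc m)
      then obtain v k where vk: "v \<in> E m" "k \<in> K n" "x = y \<odot>\<^bsub>M\<^esub> v \<oplus>\<^bsub>M\<^esub> k"
        using x by (auto simp: K'_def in_set_add)
      then have c: "v \<in> carrier M" "k \<in> carrier M" using submodule_mem[OF Esub] submodule_mem[OF Ksub] by auto
      have eq: "z \<odot>\<^bsub>M\<^esub> x = y \<odot>\<^bsub>M\<^esub> (z \<odot>\<^bsub>M\<^esub> v) \<oplus>\<^bsub>M\<^esub> z \<odot>\<^bsub>M\<^esub> k"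
        using vk c y zc by (simp add: smult_r_distr smult_swap[OF zc y])
      have "z \<odot>\<^bsub>M\<^esub> v \<in> E n" "z \<odot>\<^bsub>M\<^esub> k \<in> K (Suc n)"
        using stable_familyD(2)[OF E] stable_familyD(2)[OF K] z vk Suc by auto
      then show ?thesis
        unfolding eq using yEK'[of n] KK'[of "Suc n"] by (intro submodule_add[OF K'sub]) auto
    qed
  qed
  have Psub: "submodule (P i n) R M" for i n
    unfolding P_def
    using yi[of i] submodule_zero[OF Nsub] submodule_add[OF Nsub] submodule_neg[OF Nsub] submodule_smult[OF Nsub]
      submodule_zero[OF Esub] submodule_add[OF Esub] submodule_neg[OF Esub] submodule_smult[OF Esub] submodule_mem[OF Esub]
    by (intro submoduleI) (auto simp: smult_r_distr smult_r_minus smult_swap[OF yi])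
  have Pst: "stable_family R M ys (P i)" for i
    unfolding stable_family_def
  proof (intro conjI allI ballI Psub)
    fix n z x assume z: "z \<in> set ys" and x: "x \<in> P i n"
    have zc: "z \<in> carrier R" and xc: "x \<in> carrier M" using z ysc submodule_mem[OF Psub x] by auto
    have "z \<odot>\<^bsub>M\<^esub> ((y [^]\<^bsub>R\<^esub> i) \<odot>\<^bsub>M\<^esub> x) \<in> N (Suc n + i)"
      using stable_familyD(2)[OF N, of z] x z by (auto simp: P_def)
    then show "z \<odot>\<^bsub>M\<^esub> x \<in> P i (Suc n)"
      using stable_familyD(2)[OF E, of z] x z smult_swap[OF yi zc xc] by (auto simp: P_def)
  qed
  have Pmono: "P i n \<subseteq> P (Suc i) n" for i n
  proof
    fix x assume x: "x \<in> P i n"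
    then have "y \<odot>\<^bsub>M\<^esub> ((y [^]\<^bsub>R\<^esub> i) \<odot>\<^bsub>M\<^esub> x) \<in> N (n + Suc i)"
      using stable_familyD(2)[OF N, of y] by (auto simp: P_def)
    moreover have "(y [^]\<^bsub>R\<^esub> Suc i) \<odot>\<^bsub>M\<^esub> x = y \<odot>\<^bsub>M\<^esub> ((y [^]\<^bsub>R\<^esub> i) \<odot>\<^bsub>M\<^esub> x)"
      using submodule_mem[OF Psub x] y yi by (simp add: R.m_comm smult_assoc1)
    ultimately show "x \<in> P (Suc i) n" using x by (auto simp: P_def)
  qed
  have P0: "N n \<subseteq> P 0 n" for n
    using NE submodule_mem[OF Nsub] by (auto simp: P_def)
  have KP: "K n \<subseteq> P i n" for i n
    using lift_Suc_mono_le[of "\<lambda>i. P i n" 0 i] Pmono P0 KN by blast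
  have PE: "P i n \<subseteq> E n" for i n by (auto simp: P_def)
  \<comment> \<open>The contributions of y are absorbed by \<open>K'\<close>, so the shorter list
    generates \<open>E\<close> modulo it. This is what makes the induction hypothesis
    applicable.\<close>
  have genE: "eventually_generated M ys K' E"
  proof -
    have "lin_comb M (y # ys) (E n) <+>\<^bsub>M\<^esub> K (Suc n) \<subseteq> lin_comb M ys (E n) <+>\<^bsub>M\<^esub> K' (Suc n)" for n
    proof -
      have L: "submodule (lin_comb M ys (E n)) R M" by (rule submodule_lin_comb[OF Esub ysc])
      have T: "submodule (lin_comb M ys (E n) <+>\<^bsub>M\<^esub> K' (Suc n)) R M" by (intro submodule_set_add L K'sub)
      have "K' (Suc n) \<subseteq> lin_comb M ys (E n) <+>\<^bsub>M\<^esub> K' (Suc n)"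
        "lin_comb M ys (E n) \<subseteq> lin_comb M ys (E n) <+>\<^bsub>M\<^esub> K' (Suc n)"
        using set_add_right[OF L K'sub] set_add_left[OF L K'sub] by auto
      then show ?thesis
        unfolding lin_comb_Cons using yEK' KK' by (intro set_add_least[OF T]) blast+
    qed
    then show ?thesis
      using gen unfolding eventually_generated_def by (meson subset_trans)
  qed
  \<comment> \<open>\<open>P i\<close> need not contain \<open>K'\<close>, while the induction
    hypothesis speaks of families above the bottom family. Adding \<open>K'\<close> repairs this,
    and the result still increases with i.\<close>
  define G where "G i n = P i n <+>\<^bsub>M\<^esub> K' n" for i n
  have E': "stable_family R M ys E" using stable_family_subset[OF E] by auto
  have Gst: "stable_family R M ys (G i)" for i
    unfolding G_def by (rule stable_family_set_add[OF ysc Pst K'st])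
  have PG: "P i n \<subseteq> G i n" and K'G: "K' n \<subseteq> G i n" for i n
    unfolding G_def using set_add_left[OF Psub K'sub] set_add_right[OF Psub K'sub] by auto
  have GE: "G i n \<subseteq> E n" for i n
    unfolding G_def by (intro set_add_least[OF Esub] PE K'E)
  have Gmono: "G i n \<subseteq> G (Suc i) n" for i n
  proof -
    have "P i n \<subseteq> G (Suc i) n" using Pmono PG by (rule subset_trans)
    from set_add_least[OF stable_familyD(1)[OF Gst] this K'G] show ?thesis by (simp add: G_def)
  qed
  \<comment> \<open>The induction hypothesis for \<open>ys\<close> enters twice: here for the union
    of all \<open>G i\<close>, to stop the chain, and below for each single \<open>G i\<close>, to
    generate it.\<close>
  have "\<exists>i0. \<forall>i\<ge>i0. \<forall>n. G i n = G i0 n"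
  proof (rule noetherian_family_chain[where G = G and K = K', OF noeth ysc Gst Gmono K'G])
    assume "stable_family R M ys (\<lambda>n. \<Union>i. G i n)"
    from Cons.IH[OF ysc E' K'st this _ _ genE] K'G GE
    show "eventually_generated M ys K' (\<lambda>n. \<Union>i. G i n)" by blast
  qed
  then obtain i0 where i0: "\<And>i n. i \<ge> i0 \<Longrightarrow> G i n = G i0 n" by blast
  have "eventually_generated M ys K' (G i)" for i
    by (rule Cons.IH[OF ysc E' K'st Gst K'G GE genE])
  then obtain m where m: "\<And>i n. n \<ge> m i \<Longrightarrow> G i (Suc n) \<subseteq> lin_comb M ys (G i n) <+>\<^bsub>M\<^esub> K' (Suc n)"
    unfolding eventually_generated_def by metis
  \<comment> \<open>A single threshold works for the finitely many colon families up to
    \<open>i0\<close>. Generation passes from \<open>G i\<close> back to \<open>P i\<close> because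
    \<open>ys\<close> carries \<open>K'\<close> into itself.\<close>
  have n1: "P i (Suc n) \<subseteq> lin_comb M ys (P i n) <+>\<^bsub>M\<^esub> K' (Suc n)"
    if "i \<le> i0" "n \<ge> Max (m ` {..i0})" for i n
  proof -
    have L: "submodule (lin_comb M ys (P i n)) R M" by (rule submodule_lin_comb[OF Psub ysc])
    have T: "submodule (lin_comb M ys (P i n) <+>\<^bsub>M\<^esub> K' (Suc n)) R M" by (intro submodule_set_add L K'sub)
    have K'T: "K' (Suc n) \<subseteq> lin_comb M ys (P i n) <+>\<^bsub>M\<^esub> K' (Suc n)"
      using set_add_right[OF L K'sub] by auto
    have "lin_comb M ys (G i n) \<subseteq> lin_comb M ys (P i n) <+>\<^bsub>M\<^esub> K' (Suc n)"
    proof (rule lin_comb_least[OF T])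
      fix z v assume z: "z \<in> set ys" and "v \<in> G i n"
      then obtain p k where pk: "p \<in> P i n" "k \<in> K' n" "v = p \<oplus>\<^bsub>M\<^esub> k" by (auto simp: G_def in_set_add)
      have zc: "z \<in> carrier R" using z ysc by auto
      have "z \<odot>\<^bsub>M\<^esub> v = z \<odot>\<^bsub>M\<^esub> p \<oplus>\<^bsub>M\<^esub> z \<odot>\<^bsub>M\<^esub> k"
        using pk zc submodule_mem[OF Psub] submodule_mem[OF K'sub] by (simp add: smult_r_distr)
      then show "z \<odot>\<^bsub>M\<^esub> v \<in> lin_comb M ys (P i n) <+>\<^bsub>M\<^esub> K' (Suc n)"
        using in_set_addI[OF lin_comb_smult[OF Psub ysc z pk(1)] stable_familyD(2)[OF K'st z pk(2)]] by simp
    qed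
    then have "lin_comb M ys (G i n) <+>\<^bsub>M\<^esub> K' (Suc n) \<subseteq> lin_comb M ys (P i n) <+>\<^bsub>M\<^esub> K' (Suc n)"
      using K'T by (rule set_add_least[OF T])
    moreover have "m i \<le> n" using that Max_ge[of "m ` {..i0}" "m i"] by force
    ultimately show ?thesis using m[of i n] PG by blast
  qed
  show ?case
    by (rule eventually_generated_step[where P = P and K' = K' and ?i0.0 = i0, OF ys E K N KN NE P_def K'_def i0[unfolded G_def] n1 Psub K'sub Pst KP])
qed

end

section \<open>The chain condition for finitely generated modules\<close>

definition regular_module :: "('a, 'c) ring_scheme \<Rightarrow> ('a, 'a) module" where
  "regular_module R = \<lparr>carrier = carrier R, monoid.mult = monoid.mult R, one = one R, zero = zero R, add = add R,
     smult = monoid.mult R\<rparr>"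

lemma regular_module_simps [simp]:
  "carrier (regular_module R) = carrier R" "add (regular_module R) = add R"
  "zero (regular_module R) = zero R" "smult (regular_module R) = monoid.mult R"
  by (simp_all add: regular_module_def)

lemma a_inv_regular_module [simp]: "a_inv (regular_module R) = a_inv R"
  by (rule ext) (simp add: a_inv_def m_inv_def)

lemma (in cring) regular_module: "module R (regular_module R)"
proof (rule moduleI)
  show "abelian_group (regular_module R)"
    by (rule abelian_groupI) (auto simp: a_ac intro: bexI[of _ "\<ominus> _"] l_neg)
qed (auto simp: l_distr r_distr m_assoc is_cring)

lemma (in cring) submodule_regular_iff: "submodule J R (regular_module R) \<longleftrightarrow> ideal J R"
proof
  assume J: "submodule J R (regular_module R)"
  note JE = module.submoduleE[OF regular_module J] module.submodule_zero[OF regular_module J]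
  show "ideal J R"
  proof (rule idealI[OF ring_axioms])
    show "subgroup J (add_monoid R)"
      by (rule add.subgroupI) (use JE in \<open>auto simp flip: a_inv_def\<close>)
    show "x \<otimes> a \<in> J" "a \<otimes> x \<in> J" if "a \<in> J" "x \<in> carrier R" for a x
      using JE that m_comm[of a x] by auto
  qed
next
  assume "ideal J R"
  then interpret ideal J R .
  show "submodule J R (regular_module R)"
    by (rule module.submoduleI[OF regular_module]) (auto simp: I_l_closed)
qed

text \<open>The union of a nonempty chain of ideals belongs to the chain; from the member that
  equals the union on, the sequence is constant.\<close>

lemma noetherian_regular:
  assumes "cring R" "noetherian_ring R"
  shows "noetherian_module R (regular_module R)"
proof -
  interpret cring R by fact
  interpret noetherian_ring R by fact
  show ?thesis
    unfolding noetherian_module_def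
  proof (intro allI impI)
    fix N :: "nat \<Rightarrow> 'a set"
    assume N: "\<forall>i. submodule (N i) R (regular_module R)" and mono: "\<forall>i. N i \<subseteq> N (Suc i)"
    have le: "i \<le> j \<Longrightarrow> N i \<subseteq> N j" for i j
      by (rule lift_Suc_mono_le[of N]) (use mono in auto)
    have "\<Union> (range N) \<in> range N"
    proof (rule ideal_chain_is_trivial)
      show "subset.chain {I. ideal I R} (range N)"
        unfolding subset_chain_def
      proof (intro conjI ballI)
        show "range N \<subseteq> {I. ideal I R}" using N submodule_regular_iff by auto
        fix X Y assume "X \<in> range N" "Y \<in> range N"
        then obtain i j where "X = N i" "Y = N j" by auto
        then show "X \<subseteq> Y \<or> Y \<subseteq> X" using le[of i j] le[of j i] nat_le_linear[of i j] by blast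
      qed
    qed simp
    then obtain k where "\<Union> (range N) = N k" by auto
    then have "\<forall>i\<ge>k. N i = N k" using le by blast
    then show "\<exists>k. \<forall>i\<ge>k. N i = N k" by blast
  qed
qed

context module
begin

lemma submodule_Inter:
  assumes "\<And>N. N \<in> \<N> \<Longrightarrow> submodule N R M" "\<N> \<noteq> {}"
  shows "submodule (\<Inter>\<N>) R M"
proof (rule submoduleI)
  show "\<Inter>\<N> \<subseteq> carrier M" using assms submodule_mem by blast
qed (use assms submodule_zero submodule_neg submodule_add submodule_smult in auto)

lemma submodule_submodule_span: "S \<subseteq> carrier M \<Longrightarrow> submodule (submodule_span R M S) R M"
  unfolding submodule_span_def using carrier_is_submodule by (intro submodule_Inter) auto

lemma submodule_span_superset: "S \<subseteq> submodule_span R M S"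
  by (auto simp: submodule_span_def)

lemma submodule_span_least: "submodule N R M \<Longrightarrow> S \<subseteq> N \<Longrightarrow> submodule_span R M S \<subseteq> N"
  by (auto simp: submodule_span_def)

lemma submodule_principal:
  assumes "x \<in> carrier M"
  shows "submodule {a \<odot>\<^bsub>M\<^esub> x | a. a \<in> carrier R} R M"
proof (rule submoduleI)
  show "\<zero>\<^bsub>M\<^esub> \<in> {a \<odot>\<^bsub>M\<^esub> x | a. a \<in> carrier R}"
    using assms by (metis (mono_tags, lifting) R.zero_closed mem_Collect_eq smult_l_null)
  show "\<ominus>\<^bsub>M\<^esub> y \<in> {a \<odot>\<^bsub>M\<^esub> x | a. a \<in> carrier R}" if "y \<in> {a \<odot>\<^bsub>M\<^esub> x | a. a \<in> carrier R}" for y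
    using that assms by clarify (metis R.a_inv_closed smult_l_minus)
  show "y \<oplus>\<^bsub>M\<^esub> z \<in> {a \<odot>\<^bsub>M\<^esub> x | a. a \<in> carrier R}"
    if "y \<in> {a \<odot>\<^bsub>M\<^esub> x | a. a \<in> carrier R}" "z \<in> {a \<odot>\<^bsub>M\<^esub> x | a. a \<in> carrier R}" for y z
    using that assms by clarify (metis R.a_closed smult_l_distr)
  show "b \<odot>\<^bsub>M\<^esub> y \<in> {a \<odot>\<^bsub>M\<^esub> x | a. a \<in> carrier R}"
    if "b \<in> carrier R" "y \<in> {a \<odot>\<^bsub>M\<^esub> x | a. a \<in> carrier R}" for b y
    using that assms by clarify (metis R.m_closed smult_assoc1)
qed (use assms in auto)

lemma submodule_span_insert:
  assumes "x \<in> carrier M" "S \<subseteq> carrier M"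
  shows "submodule_span R M (insert x S) \<subseteq> {a \<odot>\<^bsub>M\<^esub> x | a. a \<in> carrier R} <+>\<^bsub>M\<^esub> submodule_span R M S"
proof (rule submodule_span_least)
  note sub = submodule_principal[OF assms(1)] submodule_submodule_span[OF assms(2)]
  show "submodule ({a \<odot>\<^bsub>M\<^esub> x | a. a \<in> carrier R} <+>\<^bsub>M\<^esub> submodule_span R M S) R M"
    by (rule submodule_set_add[OF sub])
  have "x \<in> {a \<odot>\<^bsub>M\<^esub> x | a. a \<in> carrier R}"
    using assms(1) by (metis (mono_tags, lifting) R.one_closed mem_Collect_eq smult_one)
  then show "insert x S \<subseteq> {a \<odot>\<^bsub>M\<^esub> x | a. a \<in> carrier R} <+>\<^bsub>M\<^esub> submodule_span R M S"
    using set_add_left[OF sub] set_add_right[OF sub] submodule_span_superset by blast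
qed

text \<open>Induction on the generators. For a further generator \<open>x\<close>, a submodule is
  controlled by two data: the ideal of the coefficients of \<open>x\<close> that occur in it, and
  its intersection with the span of the others. Both stabilise along the chain, the first by the
  chain condition in the ring and the second by induction.\<close>

lemma noetherian_span_chain:
  assumes "noetherian_module R (regular_module R)" "finite S" "S \<subseteq> carrier M"
    and "\<And>i::nat. submodule (N i) R M" "\<And>i. N i \<subseteq> N (Suc i)" "\<And>i. N i \<subseteq> submodule_span R M S"
  shows "\<exists>k. \<forall>i\<ge>k. N i = N k"
  using assms(2-)
proof (induction S arbitrary: N rule: finite_induct)
  case empty
  have "N i \<subseteq> {\<zero>\<^bsub>M\<^esub>}" for i
    using empty.prems(4)[of i] submodule_span_least[OF zero_submodule, of "{}"] by blast
  then have "N i = {\<zero>\<^bsub>M\<^esub>}" for i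
    using submodule_zero[OF empty.prems(2), of i] by blast
  then show ?case by simp
next
  case (insert x S)
  note Nsub = insert.prems(2) and Nmono = insert.prems(3)
  have x: "x \<in> carrier M" and S: "S \<subseteq> carrier M" using insert.prems by auto
  note Ssub = submodule_submodule_span[OF S]
  define J where "J i = {a \<in> carrier R. \<exists>n\<in>submodule_span R M S. a \<odot>\<^bsub>M\<^esub> x \<oplus>\<^bsub>M\<^esub> n \<in> N i}" for i
  have Jsub: "submodule (J i) R (regular_module R)" for i
  proof (rule module.submoduleI[OF R.regular_module])
    show "J i \<subseteq> carrier (regular_module R)" by (auto simp: J_def)
    show "\<zero>\<^bsub>regular_module R\<^esub> \<in> J i"
      using x submodule_zero[OF Ssub] submodule_zero[OF Nsub] by (auto simp: J_def intro!: bexI[of _ "\<zero>\<^bsub>M\<^esub>"])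
    show add: "a \<oplus>\<^bsub>regular_module R\<^esub> b \<in> J i" if ab: "a \<in> J i" "b \<in> J i" for a b
    proof -
      obtain n m where nm: "n \<in> submodule_span R M S" "a \<odot>\<^bsub>M\<^esub> x \<oplus>\<^bsub>M\<^esub> n \<in> N i"
        "m \<in> submodule_span R M S" "b \<odot>\<^bsub>M\<^esub> x \<oplus>\<^bsub>M\<^esub> m \<in> N i" "a \<in> carrier R" "b \<in> carrier R"
        using ab unfolding J_def by blast
      have "(a \<oplus>\<^bsub>R\<^esub> b) \<odot>\<^bsub>M\<^esub> x \<oplus>\<^bsub>M\<^esub> (n \<oplus>\<^bsub>M\<^esub> m) = (a \<odot>\<^bsub>M\<^esub> x \<oplus>\<^bsub>M\<^esub> n) \<oplus>\<^bsub>M\<^esub> (b \<odot>\<^bsub>M\<^esub> x \<oplus>\<^bsub>M\<^esub> m)"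
        using nm x submodule_mem[OF Ssub] by (simp add: smult_l_distr M.a_ac)
      then show ?thesis
        using nm submodule_add[OF Ssub nm(1,3)] submodule_add[OF Nsub nm(2,4)]
        by (auto simp: J_def intro!: bexI[of _ "n \<oplus>\<^bsub>M\<^esub> m"])
    qed
    show smult: "c \<odot>\<^bsub>regular_module R\<^esub> a \<in> J i" if ca: "c \<in> carrier R" "a \<in> J i" for c a
    proof -
      obtain n where n: "n \<in> submodule_span R M S" "a \<odot>\<^bsub>M\<^esub> x \<oplus>\<^bsub>M\<^esub> n \<in> N i" "a \<in> carrier R"
        using ca by (auto simp: J_def)
      have "(c \<otimes>\<^bsub>R\<^esub> a) \<odot>\<^bsub>M\<^esub> x \<oplus>\<^bsub>M\<^esub> c \<odot>\<^bsub>M\<^esub> n = c \<odot>\<^bsub>M\<^esub> (a \<odot>\<^bsub>M\<^esub> x \<oplus>\<^bsub>M\<^esub> n)"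
        using n x that submodule_mem[OF Ssub] by (simp add: smult_r_distr smult_assoc1)
      then show ?thesis
        using n ca submodule_smult[OF Ssub ca(1) n(1)] submodule_smult[OF Nsub ca(1) n(2)]
        by (auto simp: J_def intro!: bexI[of _ "c \<odot>\<^bsub>M\<^esub> n"])
    qed
    show "\<ominus>\<^bsub>regular_module R\<^esub> a \<in> J i" if "a \<in> J i" for a
    proof -
      have a: "a \<in> carrier R" using that by (auto simp: J_def)
      have "\<ominus>\<^bsub>regular_module R\<^esub> a = \<ominus>\<^bsub>R\<^esub> a" by simp
      also have "\<dots> = (\<ominus>\<^bsub>R\<^esub> \<one>\<^bsub>R\<^esub>) \<otimes>\<^bsub>R\<^esub> a" using a by (simp add: R.l_minus)
      finally show ?thesis using smult[of "\<ominus>\<^bsub>R\<^esub> \<one>\<^bsub>R\<^esub>" a] that by simp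
    qed
  qed
  have Jmono: "J i \<subseteq> J (Suc i)" for i using Nmono[of i] by (auto simp: J_def)
  obtain k1 where k1: "\<And>i. i \<ge> k1 \<Longrightarrow> J i = J k1"
    using assms(1)[unfolded noetherian_module_def, rule_format, of J] Jsub Jmono by blast
  have "\<exists>k. \<forall>i\<ge>k. N i \<inter> submodule_span R M S = N k \<inter> submodule_span R M S"
    using Nmono by (intro insert.IH[OF S]) (auto intro: submodule_Int Nsub Ssub)
  then obtain k2 where k2: "\<And>i. i \<ge> k2 \<Longrightarrow> N i \<inter> submodule_span R M S = N k2 \<inter> submodule_span R M S" by blast
  have le: "i \<le> j \<Longrightarrow> N i \<subseteq> N j" for i j by (rule lift_Suc_mono_le[of N]) (use Nmono in auto)
  define k where "k = max k1 k2"
  have "N i \<subseteq> N k" if "i \<ge> k" for i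
  proof
    \<comment> \<open>With \<open>a\<close> as coefficient of \<open>x\<close> there is already an
      element of \<open>N k\<close>; the difference lies in the span of the old generators, where
      \<open>N i\<close> and \<open>N k\<close> agree.\<close>
    fix y assume y: "y \<in> N i"
    then have "y \<in> {a \<odot>\<^bsub>M\<^esub> x | a. a \<in> carrier R} <+>\<^bsub>M\<^esub> submodule_span R M S"
      using insert.prems(4)[of i] submodule_span_insert[OF x S] by blast
    then obtain a n where an: "a \<in> carrier R" "n \<in> submodule_span R M S" "y = a \<odot>\<^bsub>M\<^esub> x \<oplus>\<^bsub>M\<^esub> n"
      by (auto simp: in_set_add)
    then have "a \<in> J i" using y by (auto simp: J_def)
    then have "a \<in> J k" using k1[of i] k1[of k] that by (auto simp: k_def)
    then obtain m where m: "m \<in> submodule_span R M S" "a \<odot>\<^bsub>M\<^esub> x \<oplus>\<^bsub>M\<^esub> m \<in> N k" by (auto simp: J_def)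
    have c: "n \<in> carrier M" "m \<in> carrier M" using an m submodule_mem[OF Ssub] by auto
    have eq: "y = (a \<odot>\<^bsub>M\<^esub> x \<oplus>\<^bsub>M\<^esub> m) \<oplus>\<^bsub>M\<^esub> (n \<ominus>\<^bsub>M\<^esub> m)"
    proof -
      have "(a \<odot>\<^bsub>M\<^esub> x \<oplus>\<^bsub>M\<^esub> m) \<oplus>\<^bsub>M\<^esub> (n \<ominus>\<^bsub>M\<^esub> m) = a \<odot>\<^bsub>M\<^esub> x \<oplus>\<^bsub>M\<^esub> n \<oplus>\<^bsub>M\<^esub> (m \<oplus>\<^bsub>M\<^esub> \<ominus>\<^bsub>M\<^esub> m)"
        using c an x by (simp add: a_minus_def M.a_ac)
      then show ?thesis using c an x by (simp add: M.r_neg)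
    qed
    have "n \<ominus>\<^bsub>M\<^esub> m \<in> N i"
      using submodule_add_cancel[OF Nsub, of "a \<odot>\<^bsub>M\<^esub> x \<oplus>\<^bsub>M\<^esub> m" i "n \<ominus>\<^bsub>M\<^esub> m"] y m le[OF that] c eq
      by auto
    then have "n \<ominus>\<^bsub>M\<^esub> m \<in> N k"
      using k2[of i] k2[of k] that submodule_diff[OF Ssub an(2) m(1)] by (auto simp: k_def)
    then show "y \<in> N k" using eq m submodule_add[OF Nsub] by auto
  qed
  then show ?case using le by blast
qed

lemma noetherian_fin_gen_module:
  assumes "noetherian_ring R" "fin_gen_module R M"
  shows "noetherian_module R M"
proof -
  obtain S where S: "S \<subseteq> carrier M" "finite S" "submodule_span R M S = carrier M"
    using assms(2) by (auto simp: fin_gen_module_def)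
  show ?thesis
    unfolding noetherian_module_def
    using noetherian_span_chain[OF noetherian_regular[OF R.is_cring assms(1)] S(2,1)] S(3) submodule_mem
    by (metis subsetI)
qed

end

section \<open>Gradings given by projections\<close>

lemma finsum_regular_module [simp]: "finsum (regular_module R) = finsum R"
  by (intro ext) (simp add: finsum_def finprod_def)

text \<open>\<open>rp i\<close> is the projection onto the part of degree \<open>i\<close>. Ring degrees range over the integers, with zero
  parts in negative degrees, so that degrees can be subtracted.\<close>

locale ring_parts = cring R for R (structure) +
  fixes rp :: "int \<Rightarrow> 'a \<Rightarrow> 'a"
  assumes rp_closed [simp]: "a \<in> carrier R \<Longrightarrow> rp i a \<in> carrier R"
    and rp_add: "\<lbrakk>a \<in> carrier R; b \<in> carrier R\<rbrakk> \<Longrightarrow> rp i (a \<oplus> b) = rp i a \<oplus> rp i b"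
    and rp_mult: "\<lbrakk>a \<in> carrier R; b \<in> carrier R; rp i a = a\<rbrakk> \<Longrightarrow> rp (i + j) (a \<otimes> b) = a \<otimes> rp j b"
    and rp_rp: "a \<in> carrier R \<Longrightarrow> rp i (rp j a) = (if i = j then rp j a else \<zero>)"
    and rp_finite: "a \<in> carrier R \<Longrightarrow> finite {i. rp i a \<noteq> \<zero>}"
    and rp_sum: "a \<in> carrier R \<Longrightarrow> (\<Oplus>i\<in>{i. rp i a \<noteq> \<zero>}. rp i a) = a"
    and rp_neg: "\<lbrakk>a \<in> carrier R; i < 0\<rbrakk> \<Longrightarrow> rp i a = \<zero>"
    and rp_one: "rp 0 \<one> = \<one>"

locale module_parts = module R M + ring_parts R rp
  for R (structure) and M (structure) and rp +
  fixes mp :: "int \<Rightarrow> 'c \<Rightarrow> 'c"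
  assumes mp_closed [simp]: "x \<in> carrier M \<Longrightarrow> mp j x \<in> carrier M"
    and mp_add: "\<lbrakk>x \<in> carrier M; y \<in> carrier M\<rbrakk> \<Longrightarrow> mp j (x \<oplus>\<^bsub>M\<^esub> y) = mp j x \<oplus>\<^bsub>M\<^esub> mp j y"
    and mp_smult: "\<lbrakk>a \<in> carrier R; rp i a = a; x \<in> carrier M\<rbrakk> \<Longrightarrow> mp (i + j) (a \<odot>\<^bsub>M\<^esub> x) = a \<odot>\<^bsub>M\<^esub> mp j x"
    and mp_mp: "x \<in> carrier M \<Longrightarrow> mp i (mp j x) = (if i = j then mp j x else \<zero>\<^bsub>M\<^esub>)"
    and mp_finite: "x \<in> carrier M \<Longrightarrow> finite {j. mp j x \<noteq> \<zero>\<^bsub>M\<^esub>}"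
    and mp_sum: "x \<in> carrier M \<Longrightarrow> (\<Oplus>\<^bsub>M\<^esub>j\<in>{j. mp j x \<noteq> \<zero>\<^bsub>M\<^esub>}. mp j x) = x"

lemma (in ring_parts) regular_parts: "module_parts R (regular_module R) rp rp"
  by (intro module_parts.intro module_parts_axioms.intro regular_module ring_parts_axioms)
    (simp_all add: rp_add rp_mult rp_rp rp_finite rp_sum)

text \<open>The annihilator of the class of \<open>x\<close> modulo \<open>K\<close>, available
  without forming the quotient.\<close>

definition colon :: "('a, 'c) ring_scheme \<Rightarrow> ('a, 'b, 'd) module_scheme \<Rightarrow> 'b set \<Rightarrow> 'b \<Rightarrow> 'a set" where
  "colon R M K x = {a \<in> carrier R. a \<odot>\<^bsub>M\<^esub> x \<in> K}"

text \<open>For a submodule or an ideal this is homogeneity.\<close>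

definition parts_closed :: "(int \<Rightarrow> 'b \<Rightarrow> 'b) \<Rightarrow> 'b set \<Rightarrow> bool" where
  "parts_closed mp N \<longleftrightarrow> (\<forall>x\<in>N. \<forall>j. mp j x \<in> N)"

context module_parts
begin

lemma mp_zero [simp]: "mp j \<zero>\<^bsub>M\<^esub> = \<zero>\<^bsub>M\<^esub>"
proof -
  have "mp j \<zero>\<^bsub>M\<^esub> \<oplus>\<^bsub>M\<^esub> mp j \<zero>\<^bsub>M\<^esub> = mp j \<zero>\<^bsub>M\<^esub>"
    using mp_add[of "\<zero>\<^bsub>M\<^esub>" "\<zero>\<^bsub>M\<^esub>" j] by simp
  then show ?thesis using mp_closed[of "\<zero>\<^bsub>M\<^esub>" j] by (metis M.add.l_cancel_one' M.zero_closed)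
qed

lemma parts_induct:
  assumes x: "x \<in> carrier M" and parts: "\<And>j. P (mp j x)" and zero: "P \<zero>\<^bsub>M\<^esub>"
    and add: "\<And>u v. \<lbrakk>u \<in> carrier M; v \<in> carrier M; P u; P v\<rbrakk> \<Longrightarrow> P (u \<oplus>\<^bsub>M\<^esub> v)"
  shows "P x"
proof -
  have "P (\<Oplus>\<^bsub>M\<^esub>j\<in>J. mp j x)" if "finite J" for J
    using that
  proof induction
    case (insert j J)
    have "(\<Oplus>\<^bsub>M\<^esub>j\<in>J. mp j x) \<in> carrier M" using x by (intro M.finsum_closed) auto
    then show ?case using insert x parts by (simp add: M.finsum_insert add)
  qed (simp add: zero)
  then show ?thesis using mp_finite[OF x] mp_sum[OF x] by metis
qed

lemma submodule_parts_mem: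
  assumes "submodule N R M" "x \<in> carrier M" "\<And>j. mp j x \<in> N"
  shows "x \<in> N"
  using assms by (intro parts_induct[of x "\<lambda>x. x \<in> N"]) (auto simp: submodule_zero submodule_add)

text \<open>\<open>mp_smult\<close> treats a homogeneous scalar and an arbitrary element. Here the
  roles are exchanged, by splitting the scalar into its parts.\<close>

lemma mp_smult_homogeneous:
  assumes "a \<in> carrier R" "z \<in> carrier M" "mp j z = z"
  shows "mp k (a \<odot>\<^bsub>M\<^esub> z) = rp (k - j) a \<odot>\<^bsub>M\<^esub> z"
proof -
  interpret RR: module_parts R "regular_module R" rp rp by (rule regular_parts)
  have "\<forall>k. mp k (a \<odot>\<^bsub>M\<^esub> z) = rp (k - j) a \<odot>\<^bsub>M\<^esub> z"
  proof (rule RR.parts_induct[of a "\<lambda>a. \<forall>k. mp k (a \<odot>\<^bsub>M\<^esub> z) = rp (k - j) a \<odot>\<^bsub>M\<^esub> z"])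
    show "\<forall>k. mp k (rp i a \<odot>\<^bsub>M\<^esub> z) = rp (k - j) (rp i a) \<odot>\<^bsub>M\<^esub> z" for i
    proof
      fix k
      have "mp (i + (k - i)) (rp i a \<odot>\<^bsub>M\<^esub> z) = rp i a \<odot>\<^bsub>M\<^esub> mp (k - i) z"
        using assms by (intro mp_smult) (auto simp: rp_rp)
      then show "mp k (rp i a \<odot>\<^bsub>M\<^esub> z) = rp (k - j) (rp i a) \<odot>\<^bsub>M\<^esub> z"
        using assms mp_mp[of z "k - i" j] by (auto simp: rp_rp)
    qed
    show "\<forall>k. mp k (\<zero>\<^bsub>regular_module R\<^esub> \<odot>\<^bsub>M\<^esub> z) = rp (k - j) \<zero>\<^bsub>regular_module R\<^esub> \<odot>\<^bsub>M\<^esub> z"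
      using assms RR.mp_zero by simp
    show "\<forall>k. mp k ((u \<oplus>\<^bsub>regular_module R\<^esub> v) \<odot>\<^bsub>M\<^esub> z) = rp (k - j) (u \<oplus>\<^bsub>regular_module R\<^esub> v) \<odot>\<^bsub>M\<^esub> z"
      if "u \<in> carrier (regular_module R)" "v \<in> carrier (regular_module R)"
        "\<forall>k. mp k (u \<odot>\<^bsub>M\<^esub> z) = rp (k - j) u \<odot>\<^bsub>M\<^esub> z" "\<forall>k. mp k (v \<odot>\<^bsub>M\<^esub> z) = rp (k - j) v \<odot>\<^bsub>M\<^esub> z" for u v
      using that assms by (simp add: smult_l_distr mp_add rp_add)
  qed (use assms in auto)
  then show ?thesis by blast
qed

lemma colon_submodule:
  assumes "submodule K R M" "x \<in> carrier M"
  shows "submodule (colon R M K x) R (regular_module R)"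
  by (rule module.submoduleI[OF R.regular_module])
    (use assms in \<open>auto simp: colon_def smult_l_distr smult_l_minus smult_assoc1
      submodule_zero submodule_add submodule_neg submodule_smult\<close>)

lemma colon_parts_closed:
  assumes K: "submodule K R M" "parts_closed mp K" and x: "x \<in> carrier M" "mp j x = x"
  shows "parts_closed rp (colon R M K x)"
  unfolding parts_closed_def
proof (intro ballI allI)
  fix a i assume a: "a \<in> colon R M K x"
  then have "mp (i + j) (a \<odot>\<^bsub>M\<^esub> x) \<in> K" using K by (auto simp: colon_def parts_closed_def)
  then show "rp i a \<in> colon R M K x"
    using a mp_smult_homogeneous[OF _ x, of a "i + j"] by (auto simp: colon_def)
qed

end

section \<open>Prime ideals tested on homogeneous elements\<close>

lemma (in ring_parts) rp_top_mult:
  assumes a: "a \<in> carrier R" "\<And>k. k > i \<Longrightarrow> rp k a = \<zero>" and b: "b \<in> carrier R" "\<And>k. k > j \<Longrightarrow> rp k b = \<zero>"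
  shows "rp (i + j) (a \<otimes> b) = rp i a \<otimes> rp j b"
proof -
  interpret RR: module_parts R "regular_module R" rp rp by (rule regular_parts)
  show ?thesis
  proof (rule RR.parts_induct[of a "\<lambda>u. rp (i + j) (u \<otimes> b) = rp i u \<otimes> rp j b"])
    fix k
    \<comment> \<open>Only \<open>a\<close> is split: its part of degree k meets the part of
      \<open>b\<close> of degree i + j - k, and for k < i this lies above the top degree of
      \<open>b\<close>.\<close>
    have eq: "rp (k + (i + j - k)) (rp k a \<otimes> b) = rp k a \<otimes> rp (i + j - k) b"
      using a b by (intro rp_mult) (auto simp: rp_rp)
    consider "k < i" | "k = i" | "k > i" by linarith
    then show "rp (i + j) (rp k a \<otimes> b) = rp i (rp k a) \<otimes> rp j b"
    proof cases
      case 1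
      then have "rp (i + j - k) b = \<zero>" by (intro b(2)) simp
      then show ?thesis using eq 1 a b by (simp add: rp_rp)
    next
      case 2
      then show ?thesis using eq a b by (simp add: rp_rp)
    next
      case 3
      then show ?thesis using a b RR.mp_zero by simp
    qed
  qed (use a b RR.mp_zero in \<open>auto simp: l_distr rp_add\<close>)
qed

text \<open>Top parts multiply without interference, so if a b lies in \<open>p\<close> then the top
  part of a or of b does. Subtracting that part keeps the product in \<open>p\<close> and lowers the
  total number of nonzero parts, which is the induction measure.\<close>

lemma (in ring_parts) primeideal_homogeneous:
  assumes p: "ideal p R" and parts: "parts_closed rp p" and one: "\<one> \<notin> p"
    and prime: "\<And>i j a b. \<lbrakk>a \<in> carrier R; b \<in> carrier R; rp i a = a; rp j b = b; a \<otimes> b \<in> p\<rbrakk> \<Longrightarrow> a \<in> p \<or> b \<in> p"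
  shows "primeideal p R"
proof -
  interpret ideal p R by fact
  interpret RR: module_parts R "regular_module R" rp rp by (rule regular_parts)
  define s where "s a = card {i. rp i a \<noteq> \<zero>}" for a
  have top: "\<exists>i. rp i a \<noteq> \<zero> \<and> (\<forall>k>i. rp k a = \<zero>)" if "a \<in> carrier R" "a \<noteq> \<zero>" for a
  proof -
    have ne: "{i. rp i a \<noteq> \<zero>} \<noteq> {}"
    proof
      assume "{i. rp i a \<noteq> \<zero>} = {}"
      then show False using rp_sum[OF that(1)] that(2) by (metis finsum_empty)
    qed
    show ?thesis
      using Max_in[OF rp_finite[OF that(1)] ne] Max_ge[OF rp_finite[OF that(1)]]
      by (intro exI[of _ "Max {i. rp i a \<noteq> \<zero>}"]) force
  qed
  have drop: "s (a \<ominus> rp i a) < s a" if "a \<in> carrier R" "rp i a \<noteq> \<zero>" for a i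
  proof -
    have "rp k (a \<ominus> rp i a) = (if k = i then \<zero> else rp k a)" for k
    proof -
      have "rp k (\<ominus> rp i a) = \<ominus> rp k (rp i a)"
      proof -
        have "rp k (\<ominus> rp i a) \<oplus> rp k (rp i a) = \<zero>"
          using that rp_add[of "\<ominus> rp i a" "rp i a" k] RR.mp_zero by (simp add: l_neg)
        then show ?thesis using that by (simp add: minus_equality)
      qed
      then show ?thesis
        using that by (simp add: a_minus_def rp_add rp_rp r_neg)
    qed
    then have "{k. rp k (a \<ominus> rp i a) \<noteq> \<zero>} \<subset> {k. rp k a \<noteq> \<zero>}" using that by auto
    then show ?thesis unfolding s_def by (intro psubset_card_mono rp_finite that)
  qed
  have main: "a \<in> p \<or> b \<in> p" if "a \<in> carrier R" "b \<in> carrier R" "a \<otimes> b \<in> p" for a b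
    using that
  proof (induction "s a + s b" arbitrary: a b rule: less_induct)
    case less
    note ab = less.prems
    show ?case
    proof (cases "a = \<zero> \<or> b = \<zero>")
      case False
      then obtain i j where i: "rp i a \<noteq> \<zero>" "\<And>k. k > i \<Longrightarrow> rp k a = \<zero>"
        and j: "rp j b \<noteq> \<zero>" "\<And>k. k > j \<Longrightarrow> rp k b = \<zero>"
        using top ab by metis
      have "rp (i + j) (a \<otimes> b) \<in> p" using parts ab by (auto simp: parts_closed_def)
      then have "rp i a \<otimes> rp j b \<in> p" using rp_top_mult ab i j by simp
      then consider "rp i a \<in> p" | "rp j b \<in> p"
        using prime[of "rp i a" "rp j b" i j] ab by (auto simp: rp_rp)
      then show ?thesis
      proof cases
        case 1
        have "(a \<ominus> rp i a) \<otimes> b = a \<otimes> b \<ominus> rp i a \<otimes> b"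
          using ab by (simp add: a_minus_def l_distr l_minus)
        moreover have "rp i a \<otimes> b \<in> p" using 1 ab by (simp add: I_r_closed)
        ultimately have "(a \<ominus> rp i a) \<otimes> b \<in> p" using ab by (simp add: a_minus_def)
        then have "a \<ominus> rp i a \<in> p \<or> b \<in> p"
          using ab drop[OF ab(1) i(1)] by (intro less.hyps) auto
        moreover have "a = (a \<ominus> rp i a) \<oplus> rp i a"
          using ab by (simp add: a_minus_def a_assoc l_neg)
        ultimately show ?thesis using 1 a_closed by metis
      next
        case 2
        have "a \<otimes> (b \<ominus> rp j b) = a \<otimes> b \<ominus> a \<otimes> rp j b"
          using ab by (simp add: a_minus_def r_distr r_minus)
        moreover have "a \<otimes> rp j b \<in> p" using 2 ab by (simp add: I_l_closed)
        ultimately have "a \<otimes> (b \<ominus> rp j b) \<in> p" using ab by (simp add: a_minus_def)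
        then have "a \<in> p \<or> b \<ominus> rp j b \<in> p"
          using ab drop[OF ab(2) j(1)] by (intro less.hyps) auto
        moreover have "b = (b \<ominus> rp j b) \<oplus> rp j b"
          using ab by (simp add: a_minus_def a_assoc l_neg)
        ultimately show ?thesis using 2 a_closed by metis
      qed
    qed auto
  qed
  show ?thesis
    using main one by (intro primeidealI p is_cring) auto
qed

context module_parts
begin

text \<open>An annihilator that is maximal among those of nonzero homogeneous classes of Z / B is
  prime, since replacing z by b z for a homogeneous b outside it cannot enlarge it. This supplies
  the dichotomy of the theorem: where no homogeneous class has a prime annihilator, the homology
  vanishes.\<close>

lemma exists_prime_colon:
  assumes noeth: "noetherian_ring R"
    and B: "submodule B R M" "parts_closed mp B" and Z: "submodule Z R M" "parts_closed mp Z"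
    and z0: "z0 \<in> Z" "z0 \<notin> B"
  shows "\<exists>j z. z \<in> Z \<and> mp j z = z \<and> primeideal (colon R M B z) R"
proof -
  define P where "P J \<longleftrightarrow> (\<exists>j z. z \<in> Z \<and> mp j z = z \<and> z \<notin> B \<and> J = colon R M B z)" for J
  obtain j0 where "mp j0 z0 \<notin> B"
    using submodule_parts_mem[OF B(1)] z0 submodule_mem[OF Z(1)] by blast
  then have P0: "P (colon R M B (mp j0 z0))"
    using z0 Z submodule_mem[OF Z(1)] unfolding P_def
    by (intro exI[of _ j0] exI[of _ "mp j0 z0"]) (auto simp: parts_closed_def mp_mp)
  have Psub: "submodule J R (regular_module R)" if "P J" for J
    using that colon_submodule[OF B(1)] submodule_mem[OF Z(1)] by (auto simp: P_def)
  have "\<exists>i. f (Suc i) = f i" if "\<And>i. P (f i)" "\<And>i. f i \<subseteq> f (Suc i)" for f :: "nat \<Rightarrow> _"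
    using noetherian_regular[OF R.is_cring noeth, unfolded noetherian_module_def, rule_format, of f] that Psub
    by (metis le_SucI order_refl)
  from exists_maximal_chain[of P, OF P0 this] obtain J where
    J: "P J" "\<And>J'. P J' \<Longrightarrow> J \<subseteq> J' \<Longrightarrow> J' = J" by blast
  then obtain j z where z: "z \<in> Z" "mp j z = z" "z \<notin> B" "J = colon R M B z" by (auto simp: P_def)
  have zc: "z \<in> carrier M" using z submodule_mem[OF Z(1)] by blast
  have "primeideal J R"
  proof (rule primeideal_homogeneous)
    show "ideal J R" using Psub[OF J(1)] R.submodule_regular_iff by blast
    show "parts_closed rp J" unfolding z(4) by (rule colon_parts_closed[OF B zc z(2)])
    show "\<one> \<notin> J" using z zc by (auto simp: colon_def)
    fix i k a b assume ab: "a \<in> carrier R" "b \<in> carrier R" "rp i a = a" "rp k b = b" "a \<otimes> b \<in> J"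
    show "a \<in> J \<or> b \<in> J"
    proof (rule disjCI)
      assume "b \<notin> J"
      then have "b \<odot>\<^bsub>M\<^esub> z \<notin> B" using ab z by (auto simp: colon_def)
      moreover have "mp (k + j) (b \<odot>\<^bsub>M\<^esub> z) = b \<odot>\<^bsub>M\<^esub> z" using mp_smult[OF ab(2,4) zc, of j] z by simp
      ultimately have "P (colon R M B (b \<odot>\<^bsub>M\<^esub> z))"
        unfolding P_def using z ab submodule_smult[OF Z(1)] by blast
      moreover have "J \<subseteq> colon R M B (b \<odot>\<^bsub>M\<^esub> z)"
        using z ab zc submodule_smult[OF B(1)] by (auto simp: colon_def smult_swap[of _ b])
      ultimately have "colon R M B (b \<odot>\<^bsub>M\<^esub> z) = J" by (rule J(2))
      moreover have "a \<in> colon R M B (b \<odot>\<^bsub>M\<^esub> z)"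
        using ab z zc by (simp add: colon_def smult_assoc1)
      ultimately show "a \<in> J" by simp
    qed
  qed
  then show ?thesis using z by blast
qed

end

section \<open>Graded families of submodules over the Rees algebra\<close>

text \<open>The n-th power of the ideal generated by \<open>ys\<close>, that is, the part of level n
  of its Rees algebra.\<close>

primrec rees_power :: "('a, 'c) ring_scheme \<Rightarrow> 'a list \<Rightarrow> nat \<Rightarrow> 'a set" where
  "rees_power R ys 0 = carrier R"
| "rees_power R ys (Suc n) = lin_comb (regular_module R) ys (rees_power R ys n)"

text \<open>The chain condition is required of the ring as well as of \<open>M\<close>, because
  annihilators in the Rees algebra are themselves stable families, inside the ring regarded as a
  module over itself.\<close>

locale rees_setting = module_parts R M rp mp
  for R (structure) and M (structure) and rp mp +
  fixes ys :: "'a list" and dg :: "'a \<Rightarrow> int"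
  assumes ys: "set ys \<subseteq> carrier R"
    and dg: "y \<in> set ys \<Longrightarrow> rp (dg y) y = y"
    and noeth: "noetherian_module R M" and noeth_R: "noetherian_ring R"
begin

abbreviation A where "A \<equiv> rees_power R ys"

definition graded_family :: "(nat \<Rightarrow> 'c set) \<Rightarrow> bool" where
  "graded_family N \<longleftrightarrow> stable_family R M ys N \<and> (\<forall>n. parts_closed mp (N n))"

lemma graded_familyD:
  assumes "graded_family N"
  shows "stable_family R M ys N" "submodule (N n) R M" "x \<in> N n \<Longrightarrow> mp j x \<in> N n" "parts_closed mp (N n)"
    "x \<in> N n \<Longrightarrow> x \<in> carrier M"
proof -
  show st: "stable_family R M ys N" and "parts_closed mp (N n)" "x \<in> N n \<Longrightarrow> mp j x \<in> N n"
    using assms by (auto simp: graded_family_def parts_closed_def)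
  show "submodule (N n) R M" using stable_familyD(1)[OF st] .
  then show "x \<in> N n \<Longrightarrow> x \<in> carrier M" by (rule submodule_mem)
qed

lemma dg_mult:
  assumes "y \<in> set ys" "v \<in> carrier M"
  shows "mp j (y \<odot>\<^bsub>M\<^esub> v) = y \<odot>\<^bsub>M\<^esub> mp (j - dg y) v"
  using mp_smult[OF _ dg[OF assms(1)] assms(2), of "j - dg y"] assms ys by auto

lemma lin_comb_parts_closed:
  assumes V: "submodule V R M" "parts_closed mp V"
  shows "parts_closed mp (lin_comb M ys V)"
proof -
  have "parts_closed mp (lin_comb M zs V)" if "set zs \<subseteq> set ys" for zs
    using that
  proof (induction zs)
    case (Cons z zs)
    have zs: "set zs \<subseteq> carrier R" "z \<in> carrier R" using Cons ys by auto
    show ?case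
      unfolding parts_closed_def
    proof (intro ballI allI)
      fix x j assume "x \<in> lin_comb M (z # zs) V"
      then obtain v w where vw: "v \<in> V" "w \<in> lin_comb M zs V" "x = z \<odot>\<^bsub>M\<^esub> v \<oplus>\<^bsub>M\<^esub> w" by auto
      have c: "v \<in> carrier M" "w \<in> carrier M"
        using vw submodule_mem[OF V(1)] submodule_mem[OF submodule_lin_comb[OF V(1) zs(1)]] by auto
      have "mp j x = z \<odot>\<^bsub>M\<^esub> mp (j - dg z) v \<oplus>\<^bsub>M\<^esub> mp j w"
        using vw c zs Cons.prems dg_mult[of z v j] by (simp add: mp_add)
      moreover have "mp (j - dg z) v \<in> V" "mp j w \<in> lin_comb M zs V"
        using vw Cons V(2) by (auto simp: parts_closed_def)
      ultimately show "mp j x \<in> lin_comb M (z # zs) V" by auto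
    qed
  qed (simp add: parts_closed_def)
  then show ?thesis by blast
qed

end

section \<open>Cyclic extensions of families and prime filtrations\<close>

context rees_setting
begin

lemma regular_rees: "rees_setting R (regular_module R) rp rp ys dg"
  by (intro rees_setting.intro rees_setting_axioms.intro regular_parts ys dg noeth_R noetherian_regular R.is_cring)

interpretation RR: rees_setting R "regular_module R" rp rp ys dg
  by (rule regular_rees)

lemma A_submodule: "submodule (A n) R (regular_module R)"
proof (induction n)
  case (Suc n)
  then show ?case using RR.submodule_lin_comb[OF Suc ys] by simp
qed (use RR.carrier_is_submodule in simp)

lemma A_carrier: "a \<in> A n \<Longrightarrow> a \<in> carrier R"
  using RR.submodule_mem[OF A_submodule] by simp

lemma A_Suc_mult: "y \<in> set ys \<Longrightarrow> a \<in> A n \<Longrightarrow> y \<otimes> a \<in> A (Suc n)"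
  using RR.lin_comb_smult[OF A_submodule ys] by simp

lemma A_stable: "stable_family R (regular_module R) ys A"
  unfolding stable_family_def using A_submodule A_Suc_mult by simp

lemma A_parts: "parts_closed rp (A n)"
proof (induction n)
  case (Suc n)
  then show ?case using RR.lin_comb_parts_closed[OF A_submodule Suc] by simp
qed (simp add: parts_closed_def)

lemma A_generated: "eventually_generated (regular_module R) ys (\<lambda>n. {\<zero>}) A"
  unfolding eventually_generated_def
  using RR.set_add_left[OF RR.submodule_lin_comb[OF A_submodule ys] RR.zero_submodule] by auto

lemma A_smult:
  assumes N: "stable_family R M ys N" and a: "a \<in> A n" and v: "v \<in> N m"
  shows "a \<odot>\<^bsub>M\<^esub> v \<in> N (m + n)"
  using a
proof (induction n arbitrary: a)
  case 0
  then show ?case using v submodule_smult[OF stable_familyD(1)[OF N]] by simp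
next
  case (Suc n)
  have vc: "v \<in> carrier M" using v submodule_mem[OF stable_familyD(1)[OF N]] by blast
  have "lin_comb (regular_module R) ys (A n) \<subseteq> colon R M (N (m + Suc n)) v"
  proof (rule RR.lin_comb_least[OF colon_submodule[OF stable_familyD(1)[OF N] vc]])
    fix y b assume y: "y \<in> set ys" and b: "b \<in> A n"
    have "y \<odot>\<^bsub>M\<^esub> (b \<odot>\<^bsub>M\<^esub> v) \<in> N (Suc (m + n))"
      using stable_familyD(2)[OF N y Suc.IH[OF b]] .
    then show "y \<odot>\<^bsub>regular_module R\<^esub> b \<in> colon R M (N (m + Suc n)) v"
      using y ys vc A_carrier[OF b] by (auto simp: colon_def smult_assoc1)
  qed
  then show ?case using Suc.prems by (auto simp: colon_def)
qed

text \<open>Adds to \<open>N\<close> the Rees submodule generated by \<open>z\<close> placed in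
  level m. The case n < m is separate because truncated subtraction would otherwise add all
  multiples of \<open>z\<close> there.\<close>

definition extend :: "(nat \<Rightarrow> 'c set) \<Rightarrow> nat \<Rightarrow> 'c \<Rightarrow> nat \<Rightarrow> 'c set" where
  "extend N m z n = (if n < m then N n else {x \<oplus>\<^bsub>M\<^esub> a \<odot>\<^bsub>M\<^esub> z | x a. x \<in> N n \<and> a \<in> A (n - m)})"

lemma extend_superset:
  assumes N: "graded_family N" and z: "z \<in> carrier M"
  shows "N \<le> extend N m z"
proof (rule le_funI, rule subsetI)
  fix n x assume x: "x \<in> N n"
  have "x = x \<oplus>\<^bsub>M\<^esub> \<zero> \<odot>\<^bsub>M\<^esub> z" using graded_familyD(5)[OF N x] z by simp
  moreover have "\<zero> \<in> A (n - m)" using RR.submodule_zero[OF A_submodule] by simp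
  ultimately show "x \<in> extend N m z n" using x unfolding extend_def by auto
qed

lemma extend_least:
  assumes "stable_family R M ys U" "N \<le> U" "z \<in> U m"
  shows "extend N m z \<le> U"
proof (rule le_funI, rule subsetI)
  fix n x assume x: "x \<in> extend N m z n"
  show "x \<in> U n"
  proof (cases "n < m")
    case False
    then obtain v a where va: "v \<in> N n" "a \<in> A (n - m)" "x = v \<oplus>\<^bsub>M\<^esub> a \<odot>\<^bsub>M\<^esub> z"
      using x by (auto simp: extend_def)
    then have "a \<odot>\<^bsub>M\<^esub> z \<in> U n" using A_smult[OF assms(1) va(2) assms(3)] False by simp
    moreover have "v \<in> U n" using va assms(2) by (auto simp: le_fun_def)
    ultimately show ?thesis using va submodule_add[OF stable_familyD(1)[OF assms(1)]] by auto
  qed (use x assms(2) in \<open>auto simp: extend_def le_fun_def\<close>)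
qed

lemma graded_family_extend:
  assumes N: "graded_family N" and z: "z \<in> carrier M" "mp j z = z"
  shows "graded_family (extend N m z)"
proof -
  note Nsub = graded_familyD(2)[OF N] and Nc = graded_familyD(5)[OF N]
  have sub: "submodule (extend N m z n) R M" for n
  proof (cases "n < m")
    case False
    then have eq: "extend N m z n = {x \<oplus>\<^bsub>M\<^esub> a \<odot>\<^bsub>M\<^esub> z | x a. x \<in> N n \<and> a \<in> A (n - m)}" by (simp add: extend_def)
    show ?thesis
      unfolding eq
    proof (rule submoduleI)
      show "{x \<oplus>\<^bsub>M\<^esub> a \<odot>\<^bsub>M\<^esub> z | x a. x \<in> N n \<and> a \<in> A (n - m)} \<subseteq> carrier M"
        using Nc A_carrier z by auto
      show "\<zero>\<^bsub>M\<^esub> \<in> {x \<oplus>\<^bsub>M\<^esub> a \<odot>\<^bsub>M\<^esub> z | x a. x \<in> N n \<and> a \<in> A (n - m)}"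
        using submodule_zero[OF Nsub] RR.submodule_zero[OF A_submodule] z
        by (intro CollectI exI[of _ "\<zero>\<^bsub>M\<^esub>"] exI[of _ \<zero>]) auto
      show "\<ominus>\<^bsub>M\<^esub> u \<in> {x \<oplus>\<^bsub>M\<^esub> a \<odot>\<^bsub>M\<^esub> z | x a. x \<in> N n \<and> a \<in> A (n - m)}"
        if "u \<in> {x \<oplus>\<^bsub>M\<^esub> a \<odot>\<^bsub>M\<^esub> z | x a. x \<in> N n \<and> a \<in> A (n - m)}" for u
      proof -
        from that obtain x a where *: "x \<in> N n" "a \<in> A (n - m)" "u = x \<oplus>\<^bsub>M\<^esub> a \<odot>\<^bsub>M\<^esub> z" by auto
        show ?thesis
          using * Nc A_carrier z submodule_neg[OF Nsub *(1)] RR.submodule_neg[OF A_submodule *(2)]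
          by (intro CollectI exI[of _ "\<ominus>\<^bsub>M\<^esub> x"] exI[of _ "\<ominus> a"]) (auto simp: M.minus_add smult_l_minus)
      qed
      show "u \<oplus>\<^bsub>M\<^esub> u' \<in> {x \<oplus>\<^bsub>M\<^esub> a \<odot>\<^bsub>M\<^esub> z | x a. x \<in> N n \<and> a \<in> A (n - m)}"
        if u: "u \<in> {x \<oplus>\<^bsub>M\<^esub> a \<odot>\<^bsub>M\<^esub> z | x a. x \<in> N n \<and> a \<in> A (n - m)}"
          and u': "u' \<in> {x \<oplus>\<^bsub>M\<^esub> a \<odot>\<^bsub>M\<^esub> z | x a. x \<in> N n \<and> a \<in> A (n - m)}" for u u'
      proof -
        from u u' obtain x a x' a' where *: "x \<in> N n" "a \<in> A (n - m)" "u = x \<oplus>\<^bsub>M\<^esub> a \<odot>\<^bsub>M\<^esub> z"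
          "x' \<in> N n" "a' \<in> A (n - m)" "u' = x' \<oplus>\<^bsub>M\<^esub> a' \<odot>\<^bsub>M\<^esub> z" by blast
        show ?thesis
          using * Nc A_carrier z submodule_add[OF Nsub *(1,4)] RR.submodule_add[OF A_submodule *(2,5)]
          by (intro CollectI exI[of _ "x \<oplus>\<^bsub>M\<^esub> x'"] exI[of _ "a \<oplus> a'"]) (auto simp: M.a_ac smult_l_distr)
      qed
      show "b \<odot>\<^bsub>M\<^esub> u \<in> {x \<oplus>\<^bsub>M\<^esub> a \<odot>\<^bsub>M\<^esub> z | x a. x \<in> N n \<and> a \<in> A (n - m)}"
        if b: "b \<in> carrier R" and u: "u \<in> {x \<oplus>\<^bsub>M\<^esub> a \<odot>\<^bsub>M\<^esub> z | x a. x \<in> N n \<and> a \<in> A (n - m)}" for b u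
      proof -
        from u obtain x a where *: "x \<in> N n" "a \<in> A (n - m)" "u = x \<oplus>\<^bsub>M\<^esub> a \<odot>\<^bsub>M\<^esub> z" by auto
        show ?thesis
          using * b Nc A_carrier z submodule_smult[OF Nsub b *(1)] RR.submodule_smult[OF A_submodule b *(2)]
          by (intro CollectI exI[of _ "b \<odot>\<^bsub>M\<^esub> x"] exI[of _ "b \<otimes> a"]) (auto simp: smult_r_distr smult_assoc1)
      qed
    qed
  qed (simp add: extend_def Nsub)
  have Nex: "N n \<subseteq> extend N m z n" for n using extend_superset[OF N z(1)] by (auto simp: le_fun_def)
  have "y \<odot>\<^bsub>M\<^esub> x \<in> extend N m z (Suc n)" if y: "y \<in> set ys" and x: "x \<in> extend N m z n" for n y x
  proof (cases "n < m")
    case True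
    then have "y \<odot>\<^bsub>M\<^esub> x \<in> N (Suc n)"
      using x y stable_familyD(2)[OF graded_familyD(1)[OF N]] by (simp add: extend_def)
    then show ?thesis using Nex by blast
  next
    case False
    then obtain v a where va: "v \<in> N n" "a \<in> A (n - m)" "x = v \<oplus>\<^bsub>M\<^esub> a \<odot>\<^bsub>M\<^esub> z"
      using x by (auto simp: extend_def)
    have yc: "y \<in> carrier R" using y ys by auto
    have "y \<odot>\<^bsub>M\<^esub> x = y \<odot>\<^bsub>M\<^esub> v \<oplus>\<^bsub>M\<^esub> (y \<otimes> a) \<odot>\<^bsub>M\<^esub> z"
      using va yc Nc A_carrier z by (simp add: smult_r_distr smult_assoc1)
    moreover have "y \<otimes> a \<in> A (Suc n - m)"
      using A_Suc_mult[OF y va(2)] False by (simp add: Suc_diff_le)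
    moreover have "y \<odot>\<^bsub>M\<^esub> v \<in> N (Suc n)" using stable_familyD(2)[OF graded_familyD(1)[OF N] y va(1)] .
    ultimately show ?thesis using False unfolding extend_def by auto
  qed
  moreover have "parts_closed mp (extend N m z n)" for n
  proof (cases "n < m")
    case False
    show ?thesis
      unfolding parts_closed_def
    proof (intro ballI allI)
      fix x k assume "x \<in> extend N m z n"
      then obtain v a where va: "v \<in> N n" "a \<in> A (n - m)" "x = v \<oplus>\<^bsub>M\<^esub> a \<odot>\<^bsub>M\<^esub> z"
        using False by (auto simp: extend_def)
      then have "mp k x = mp k v \<oplus>\<^bsub>M\<^esub> rp (k - j) a \<odot>\<^bsub>M\<^esub> z"
        using Nc A_carrier z by (simp add: mp_add mp_smult_homogeneous)
      moreover have "rp (k - j) a \<in> A (n - m)" using va A_parts by (auto simp: parts_closed_def)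
      moreover have "mp k v \<in> N n" using va graded_familyD(3)[OF N] by blast
      ultimately show "mp k x \<in> extend N m z n" using False unfolding extend_def by auto
    qed
  qed (use graded_familyD(4)[OF N] in \<open>simp add: extend_def parts_closed_def\<close>)
  ultimately show ?thesis
    using sub by (simp add: graded_family_def stable_family_def)
qed

text \<open>The premises on \<open>z\<close> in the step say that \<open>(N : z)\<close> is a prime ideal of the Rees algebra, so the rule
  is induction along a prime filtration of the bigraded module \<open>U / K\<close>.\<close>

lemma prime_filtration_induct:
  assumes K: "graded_family K" and U: "graded_family U" and KU: "K \<le> U"
    and gen: "eventually_generated M ys K U" and base: "\<Phi> K"
    and step: "\<And>N m j z. \<lbrakk>graded_family N; K \<le> N; N \<le> U; \<Phi> N; z \<in> U m; mp j z = z; z \<notin> N m;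
      \<And>n l i a b. \<lbrakk>a \<in> A n; rp i a = a; b \<in> A l; (b \<otimes> a) \<odot>\<^bsub>M\<^esub> z \<in> N (m + n + l); a \<odot>\<^bsub>M\<^esub> z \<notin> N (m + n)\<rbrakk>
        \<Longrightarrow> b \<odot>\<^bsub>M\<^esub> z \<in> N (m + l)\<rbrakk> \<Longrightarrow> \<Phi> (extend N m z)"
  shows "\<Phi> U"
proof -
  define P where "P N \<longleftrightarrow> graded_family N \<and> K \<le> N \<and> N \<le> U \<and> \<Phi> N" for N
  \<comment> \<open>Families between \<open>K\<close> and \<open>U\<close> satisfy the chain
    condition: the union of a chain is again stable, and it is generated relative to
    \<open>K\<close> by the basis theorem.\<close>
  have chain: "\<exists>i. f (Suc i) = f i" if f: "\<And>i. P (f i)" "\<And>i. f i \<le> f (Suc i)" for f :: "nat \<Rightarrow> _"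
  proof -
    have "\<exists>i0. \<forall>i\<ge>i0. \<forall>n. f i n = f i0 n"
    proof (rule noetherian_family_chain[where G = f and K = K, OF noeth ys])
      show "stable_family R M ys (f i)" for i using f(1) by (auto simp: P_def intro: graded_familyD)
      show "f i n \<subseteq> f (Suc i) n" "K n \<subseteq> f i n" for i n using f by (auto simp: le_fun_def P_def)
      assume "stable_family R M ys (\<lambda>n. \<Union>i. f i n)"
      then show "eventually_generated M ys K (\<lambda>n. \<Union>i. f i n)"
        by (rule eventually_generated_subfamily[where E = U, OF noeth ys graded_familyD(1)[OF U] graded_familyD(1)[OF K]])
          (use f(1) gen in \<open>auto simp: P_def le_fun_def, blast\<close>)
    qed
    then show ?thesis by (metis ext le_SucI order_refl)
  qed
  have "P K" using K KU base by (auto simp: P_def)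
  from exists_maximal_chain[of P, OF this chain] obtain N where
    N: "P N" "\<And>N'. P N' \<Longrightarrow> N \<le> N' \<Longrightarrow> N' = N" by blast
  have gN: "graded_family N" and KN: "K \<le> N" and NU: "N \<le> U" and PhiN: "\<Phi> N" using N(1) by (auto simp: P_def)
  have "N = U"
  proof (rule ccontr)
    assume "N \<noteq> U"
    then obtain m0 x0 where x0: "x0 \<in> U m0" "x0 \<notin> N m0"
      using NU by (metis le_funD order_antisym le_funI subsetI)
    obtain j0 where "mp j0 x0 \<notin> N m0"
      using submodule_parts_mem[OF graded_familyD(2)[OF gN]] x0 graded_familyD(5)[OF U] by blast
    \<comment> \<open>The annihilators, in the Rees algebra, of nonzero bihomogeneous classes of U /
      N, as families of submodules of the ring. A maximal one exists by the basis theorem for the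
      ring, with \<open>A\<close> as ambient family and zero at the bottom.\<close>
    define Q where "Q J \<longleftrightarrow> (\<exists>m j z. z \<in> U m \<and> mp j z = z \<and> z \<notin> N m \<and> J = (\<lambda>l. {a \<in> A l. a \<odot>\<^bsub>M\<^esub> z \<in> N (m + l)}))" for J
    have Q0: "Q (\<lambda>l. {a \<in> A l. a \<odot>\<^bsub>M\<^esub> (mp j0 x0) \<in> N (m0 + l)})"
      unfolding Q_def using x0 \<open>mp j0 x0 \<notin> N m0\<close> graded_familyD(3,5)[OF U]
      by (intro exI[of _ m0] exI[of _ j0] exI[of _ "mp j0 x0"]) (auto simp: mp_mp)
    have Qstable: "stable_family R (regular_module R) ys J" and Qzero: "\<zero> \<in> J l" and QA: "J l \<subseteq> A l" if "Q J" for J l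
    proof -
      obtain m j z where z: "z \<in> U m" "J = (\<lambda>l. {a \<in> A l. a \<odot>\<^bsub>M\<^esub> z \<in> N (m + l)})"
        using \<open>Q J\<close> by (auto simp: Q_def)
      have zc: "z \<in> carrier M" using z graded_familyD(5)[OF U] by blast
      have J: "J l = A l \<inter> colon R M (N (m + l)) z" for l
        using z A_carrier by (auto simp: colon_def)
      have sub: "submodule (J l) R (regular_module R)" for l
        unfolding J by (intro RR.submodule_Int A_submodule colon_submodule graded_familyD(2)[OF gN] zc)
      have "y \<otimes> a \<in> J (Suc l)" if "y \<in> set ys" "a \<in> J l" for y a l
      proof -
        have "y \<odot>\<^bsub>M\<^esub> (a \<odot>\<^bsub>M\<^esub> z) \<in> N (Suc (m + l))"
          using that stable_familyD(2)[OF graded_familyD(1)[OF gN]] z by auto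
        then show ?thesis
          using that z zc A_Suc_mult A_carrier ys by (auto simp: smult_assoc1)
      qed
      then show "stable_family R (regular_module R) ys J" using sub by (simp add: stable_family_def)
      show "\<zero> \<in> J l" using RR.submodule_zero[OF sub] by simp
      show "J l \<subseteq> A l" using z by auto
    qed
    have chainQ: "\<exists>i. f (Suc i) = f i" if f: "\<And>i. Q (f i)" "\<And>i. f i \<le> f (Suc i)" for f :: "nat \<Rightarrow> _"
    proof -
      have Z: "stable_family R (regular_module R) ys (\<lambda>n. {\<zero>})"
        using RR.zero_submodule ys by (auto simp: stable_family_def)
      have fA: "f i n \<subseteq> A n" for i n by (rule QA[OF f(1)])
      have "\<exists>i0. \<forall>i\<ge>i0. \<forall>n. f i n = f i0 n"
      proof (rule RR.noetherian_family_chain[where G = f and K = "\<lambda>n. {\<zero>}", OF RR.noeth ys Qstable[OF f(1)]])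
        show "f i n \<subseteq> f (Suc i) n" "{\<zero>} \<subseteq> f i n" for i n using f Qzero by (auto simp: le_fun_def)
        assume "stable_family R (regular_module R) ys (\<lambda>n. \<Union>i. f i n)"
        then show "eventually_generated (regular_module R) ys (\<lambda>n. {\<zero>}) (\<lambda>n. \<Union>i. f i n)"
          by (rule RR.eventually_generated_subfamily[where E = A, OF RR.noeth ys A_stable Z])
            (use f(1) Qzero subsetD[OF fA] A_generated in auto)
      qed
      then show ?thesis by (metis ext le_SucI order_refl)
    qed
    from exists_maximal_chain[of Q, OF Q0 chainQ] obtain J where
      J: "Q J" "\<And>J'. Q J' \<Longrightarrow> J \<le> J' \<Longrightarrow> J' = J" by blast
    then obtain m j z where z: "z \<in> U m" "mp j z = z" "z \<notin> N m" "J = (\<lambda>l. {a \<in> A l. a \<odot>\<^bsub>M\<^esub> z \<in> N (m + l)})"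
      by (auto simp: Q_def)
    have zc: "z \<in> carrier M" using z graded_familyD(5)[OF U] by blast
    \<comment> \<open>The annihilator of a z contains that of z and belongs to the same collection
      when a z is nonzero and homogeneous, so it equals it by maximality. Homogeneity of
      \<open>a\<close> is what makes a z homogeneous; \<open>b\<close> may be arbitrary.\<close>
    have prime: "b \<odot>\<^bsub>M\<^esub> z \<in> N (m + l)"
      if ab: "a \<in> A n" "rp i a = a" "b \<in> A l" "(b \<otimes> a) \<odot>\<^bsub>M\<^esub> z \<in> N (m + n + l)" "a \<odot>\<^bsub>M\<^esub> z \<notin> N (m + n)" for n l i a b
    proof -
      have ac: "a \<in> carrier R" using A_carrier ab by blast
      define J' where "J' = (\<lambda>l. {b \<in> A l. b \<odot>\<^bsub>M\<^esub> (a \<odot>\<^bsub>M\<^esub> z) \<in> N (m + n + l)})"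
      have "mp (i + j) (a \<odot>\<^bsub>M\<^esub> z) = a \<odot>\<^bsub>M\<^esub> z" using mp_smult[OF ac ab(2) zc, of j] z by simp
      then have "Q J'"
        unfolding Q_def J'_def using A_smult[OF graded_familyD(1)[OF U] ab(1) z(1)] ab(5) by blast
      moreover have "J \<le> J'"
      proof (rule le_funI, rule subsetI)
        fix l c assume c: "c \<in> J l"
        then have "a \<odot>\<^bsub>M\<^esub> (c \<odot>\<^bsub>M\<^esub> z) \<in> N (m + l + n)"
          using A_smult[OF graded_familyD(1)[OF gN] ab(1)] z by auto
        then show "c \<in> J' l"
          using c z A_carrier[of c] smult_swap[OF ac _ zc, of c] by (auto simp: J'_def ac_simps)
      qed
      ultimately have "J' = J" by (rule J(2))
      moreover have "b \<in> J' l"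
        using ab ac zc A_carrier[OF ab(3)] by (auto simp: J'_def smult_assoc1)
      ultimately show ?thesis using z by auto
    qed
    have "P (extend N m z)"
      unfolding P_def
    proof (intro conjI)
      show "graded_family (extend N m z)" by (rule graded_family_extend[OF gN zc z(2)])
      show "K \<le> extend N m z" using KN extend_superset[OF gN zc] by (rule order_trans)
      show "extend N m z \<le> U" by (rule extend_least[OF graded_familyD(1)[OF U] NU z(1)])
      show "\<Phi> (extend N m z)"
        by (rule step[OF gN KN NU PhiN z(1,2,3) prime])
    qed
    then have "extend N m z = N" using extend_superset[OF gN zc] by (rule N(2))
    \<comment> \<open>By maximality of \<open>N\<close> the extension adds nothing, yet it contains
      \<open>z\<close> in level m.\<close>
    moreover have "\<zero>\<^bsub>M\<^esub> \<oplus>\<^bsub>M\<^esub> \<one> \<odot>\<^bsub>M\<^esub> z \<in> extend N m z m"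
      using submodule_zero[OF graded_familyD(2)[OF gN]] unfolding extend_def by force
    ultimately show False using z zc by simp
  qed
  then show ?thesis using PhiN by simp
qed

end

section \<open>Linear growth of initial degrees\<close>

text \<open>A statement about the minimum of \<open>S n\<close> that carries the whole set: along a
  filtration the sets of degrees unite, and vanishing factors call for no convention about the
  minimum of the empty set. \<open>D\<close> collects the admissible slopes.\<close>

definition eventually_linear :: "int set \<Rightarrow> (nat \<Rightarrow> int set) \<Rightarrow> bool" where
  "eventually_linear D S \<longleftrightarrow>
     (\<exists>n0. \<forall>n\<ge>n0. S n = {}) \<or>
     (\<exists>a\<in>D. \<exists>b n0. \<forall>n\<ge>n0. a * int n + b \<in> S n \<and> (\<forall>j\<in>S n. a * int n + b \<le> j))"

lemma eventually_linear_cong: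
  assumes "\<And>n. n \<ge> n1 \<Longrightarrow> S n = T n" "eventually_linear D S"
  shows "eventually_linear D T"
proof -
  have T: "T n = S n" if "n \<ge> max n0 n1" for n n0 using assms(1) that by auto
  show ?thesis
    using assms(2) unfolding eventually_linear_def
  proof (elim disjE exE bexE)
    fix n0 assume "\<forall>n\<ge>n0. S n = {}"
    then show "(\<exists>n0. \<forall>n\<ge>n0. T n = {}) \<or>
      (\<exists>a\<in>D. \<exists>b n0. \<forall>n\<ge>n0. a * int n + b \<in> T n \<and> (\<forall>j\<in>T n. a * int n + b \<le> j))"
      using T[of n0] by (intro disjI1 exI[of _ "max n0 n1"]) auto
  next
    fix a b n0 assume "a \<in> D" "\<forall>n\<ge>n0. a * int n + b \<in> S n \<and> (\<forall>j\<in>S n. a * int n + b \<le> j)"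
    then show "(\<exists>n0. \<forall>n\<ge>n0. T n = {}) \<or>
      (\<exists>a\<in>D. \<exists>b n0. \<forall>n\<ge>n0. a * int n + b \<in> T n \<and> (\<forall>j\<in>T n. a * int n + b \<le> j))"
      using T[of n0] by (intro disjI2 bexI[of _ a] exI[of _ b] exI[of _ "max n0 n1"]) auto
  qed
qed

lemma eventually_le_linear:
  fixes a b a' b' :: int
  shows "(\<exists>n0. \<forall>n\<ge>n0. a * int n + b \<le> a' * int n + b') \<or> (\<exists>n0. \<forall>n\<ge>n0. a' * int n + b' \<le> a * int n + b)"
proof -
  have less: "\<exists>n0. \<forall>n\<ge>n0. a * int n + b \<le> a' * int n + b'" if "a < a'" for a b a' b' :: int
  proof (intro exI allI impI)
    fix n assume "n \<ge> nat (b - b')"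
    moreover have "1 * int n \<le> (a' - a) * int n" using that by (intro mult_right_mono) auto
    ultimately show "a * int n + b \<le> a' * int n + b'" by (simp add: left_diff_distrib)
  qed
  consider "a < a'" | "a' < a" | "a = a'" "b \<le> b'" | "a = a'" "b' \<le> b" by linarith
  then show ?thesis by cases (auto dest: less)
qed

text \<open>Of two linear functions one is eventually the smaller, so the minimum of both is again
  linear and keeps one of the two slopes.\<close>

lemma eventually_linear_Un:
  assumes S: "eventually_linear D S" and T: "eventually_linear D T"
  shows "eventually_linear D (\<lambda>n. S n \<union> T n)"
proof -
  consider "\<exists>n0. \<forall>n\<ge>n0. S n = {}" | "\<exists>n0. \<forall>n\<ge>n0. T n = {}"
    | "\<exists>a\<in>D. \<exists>b n0. \<forall>n\<ge>n0. a * int n + b \<in> S n \<and> (\<forall>j\<in>S n. a * int n + b \<le> j)"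
      "\<exists>a\<in>D. \<exists>b n0. \<forall>n\<ge>n0. a * int n + b \<in> T n \<and> (\<forall>j\<in>T n. a * int n + b \<le> j)"
    using S T unfolding eventually_linear_def by blast
  then show ?thesis
  proof cases
    case 1
    then obtain n0 where "\<And>n. n \<ge> n0 \<Longrightarrow> S n = {}" by blast
    then show ?thesis by (intro eventually_linear_cong[of n0 T, OF _ T]) auto
  next
    case 2
    then obtain n0 where "\<And>n. n \<ge> n0 \<Longrightarrow> T n = {}" by blast
    then show ?thesis by (intro eventually_linear_cong[of n0 S, OF _ S]) auto
  next
    case 3
    then obtain a b n1 a' b' n2
      where 3: "a \<in> D" "\<And>n. n \<ge> n1 \<Longrightarrow> a * int n + b \<in> S n \<and> (\<forall>j\<in>S n. a * int n + b \<le> j)"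
        "a' \<in> D" "\<And>n. n \<ge> n2 \<Longrightarrow> a' * int n + b' \<in> T n \<and> (\<forall>j\<in>T n. a' * int n + b' \<le> j)"
      by blast
    from eventually_le_linear[of a b a' b'] show ?thesis
    proof (elim disjE exE)
      fix n3 assume n3: "\<forall>n\<ge>n3. a * int n + b \<le> a' * int n + b'"
      have "a * int n + b \<in> S n \<union> T n \<and> (\<forall>j\<in>S n \<union> T n. a * int n + b \<le> j)" if "n \<ge> max n1 (max n2 n3)" for n
        using 3(2)[of n] 3(4)[of n] n3[rule_format, of n] that by fastforce
      then show ?thesis unfolding eventually_linear_def using 3(1) by blast
    next
      fix n3 assume n3: "\<forall>n\<ge>n3. a' * int n + b' \<le> a * int n + b"
      have "a' * int n + b' \<in> S n \<union> T n \<and> (\<forall>j\<in>S n \<union> T n. a' * int n + b' \<le> j)" if "n \<ge> max n1 (max n2 n3)" for n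
        using 3(2)[of n] 3(4)[of n] n3[rule_format, of n] that by fastforce
      then show ?thesis unfolding eventually_linear_def using 3(3) by blast
    qed
  qed
qed

lemma eventually_linear_UN:
  "finite J \<Longrightarrow> (\<And>p. p \<in> J \<Longrightarrow> eventually_linear D (S p)) \<Longrightarrow> eventually_linear D (\<lambda>n. \<Union>p\<in>J. S p n)"
proof (induction J rule: finite_induct)
  case (insert p J)
  then have "eventually_linear D (\<lambda>n. S p n \<union> (\<Union>p\<in>J. S p n))" by (intro eventually_linear_Un) auto
  then show ?case by simp
qed (simp add: eventually_linear_def)

section \<open>Initial degrees along a prime filtration\<close>

context rees_setting
begin

interpretation RR: rees_setting R "regular_module R" rp rp ys dg
  by (rule regular_rees)

text \<open>The degrees in which the graded module U n / K n does not vanish.\<close>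

definition degs :: "(nat \<Rightarrow> 'c set) \<Rightarrow> (nat \<Rightarrow> 'c set) \<Rightarrow> nat \<Rightarrow> int set" where
  "degs U K n = {j. \<exists>x\<in>U n. mp j x = x \<and> x \<notin> K n}"

lemma extend_homogeneous:
  assumes N: "graded_family N" and z: "z \<in> carrier M" "mp j z = z"
    and x: "x \<in> extend N m z n" "mp k x = x" and mn: "m \<le> n"
  obtains v a where "v \<in> N n" "a \<in> A (n - m)" "rp (k - j) a = a" "x = v \<oplus>\<^bsub>M\<^esub> a \<odot>\<^bsub>M\<^esub> z"
proof -
  obtain v a where va: "v \<in> N n" "a \<in> A (n - m)" "x = v \<oplus>\<^bsub>M\<^esub> a \<odot>\<^bsub>M\<^esub> z"
    using x(1) mn by (auto simp: extend_def)
  have "mp k x = mp k v \<oplus>\<^bsub>M\<^esub> rp (k - j) a \<odot>\<^bsub>M\<^esub> z"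
    using va graded_familyD(5)[OF N] A_carrier z by (simp add: mp_add mp_smult_homogeneous)
  then show thesis
    using that[of "mp k v" "rp (k - j) a"] va A_carrier x(2) graded_familyD(3)[OF N] A_parts
    by (auto simp: parts_closed_def rp_rp)
qed

text \<open>The factor of \<open>extend N m z\<close> by \<open>N\<close> is a shifted copy of the
  Rees algebra modulo a prime P. A product of generators survives in it exactly when no factor lies
  in P, so the least degree in level m + l is l times the least degree of a generator outside P,
  shifted by the degree of z. If all generators lie in P, nothing survives above level m.\<close>

lemma degs_extend_linear:
  assumes N: "graded_family N" and z: "z \<in> carrier M" "mp j z = z" "z \<notin> N m"
    and prime: "\<And>n l i a b. \<lbrakk>a \<in> A n; rp i a = a; b \<in> A l; (b \<otimes> a) \<odot>\<^bsub>M\<^esub> z \<in> N (m + n + l); a \<odot>\<^bsub>M\<^esub> z \<notin> N (m + n)\<rbrakk>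
        \<Longrightarrow> b \<odot>\<^bsub>M\<^esub> z \<in> N (m + l)"
  shows "eventually_linear (dg ` set ys) (degs (extend N m z) N)"
proof -
  note Nst = graded_familyD(1)[OF N] and Nsub = graded_familyD(2)[OF N]
  have homog: "\<exists>a\<in>A (n - m). rp (k - j) a = a \<and> a \<odot>\<^bsub>M\<^esub> z \<notin> N n" if k: "k \<in> degs (extend N m z) N n" "n \<ge> m" for k n
  proof -
    obtain x where x: "x \<in> extend N m z n" "mp k x = x" "x \<notin> N n" using k by (auto simp: degs_def)
    from extend_homogeneous[OF N z(1,2) x(1,2) k(2)] show ?thesis
      using x(3) submodule_add[OF Nsub] by metis
  qed
  \<comment> \<open>The generators of I that lie outside P when placed in level 1.\<close>
  define Y where "Y = {y \<in> set ys. y \<odot>\<^bsub>M\<^esub> z \<notin> N (Suc m)}"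
  have swap: "(y \<otimes> b) \<odot>\<^bsub>M\<^esub> z \<in> N (m + Suc l)" if "y \<in> set ys" "y \<notin> Y" "b \<in> A l" for y b l
  proof -
    have "b \<odot>\<^bsub>M\<^esub> (y \<odot>\<^bsub>M\<^esub> z) \<in> N (Suc m + l)"
      using that by (intro A_smult[OF Nst]) (auto simp: Y_def)
    then show ?thesis
      using that ys z A_carrier[of b l] smult_swap[of b y z] by (auto simp: smult_assoc1)
  qed
  show ?thesis
  proof (cases "Y = {}")
    case True
    have "lin_comb (regular_module R) ys (A l) \<subseteq> colon R M (N (m + Suc l)) z" for l
    proof (rule RR.lin_comb_least[OF colon_submodule[OF Nsub z(1)]])
      show "y \<odot>\<^bsub>regular_module R\<^esub> b \<in> colon R M (N (m + Suc l)) z" if "y \<in> set ys" "b \<in> A l" for y b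
        using swap[of y b l] that True ys A_carrier[of b l] by (auto simp: colon_def)
    qed
    then have all: "a \<odot>\<^bsub>M\<^esub> z \<in> N (m + Suc l)" if "a \<in> A (Suc l)" for a l
      using that by (auto simp: colon_def)
    have "degs (extend N m z) N n = {}" if n: "n \<ge> Suc m" for n
    proof -
      obtain l where l: "n = m + Suc l" using le_Suc_ex[OF n] by auto
      show ?thesis
      proof (rule equals0I)
        fix k assume "k \<in> degs (extend N m z) N n"
        from homog[OF this] show False using all[of _ l] by (auto simp: l)
      qed
    qed
    then show ?thesis unfolding eventually_linear_def by blast
  next
    case False
    define d where "d = Min (dg ` Y)"
    have finY: "finite Y" by (simp add: Y_def)
    have "d \<in> dg ` Y" unfolding d_def using False finY by (intro Min_in) auto
    then obtain y0 where y0: "y0 \<in> Y" "dg y0 = d" by auto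
    have dmin: "d \<le> dg y" if "y \<in> Y" for y using that finY by (simp add: d_def)
    \<comment> \<open>In level 0 the bound is the absence of negative degrees in the ring. In the
      inductive step, splitting off a generator in \<open>Y\<close> costs one level and at least d
      in degree, and a generator outside \<open>Y\<close> kills the term.\<close>
    have lower: "\<forall>i < d * int l. \<forall>a\<in>A l. rp i a \<odot>\<^bsub>M\<^esub> z \<in> N (m + l)" for l
    proof (induction l)
      case 0
      then show ?case using rp_neg submodule_zero[OF Nsub] z by simp
    next
      case (Suc l)
      have "\<forall>i < d * int (Suc l). \<forall>a\<in>lin_comb (regular_module R) zs (A l). rp i a \<odot>\<^bsub>M\<^esub> z \<in> N (m + Suc l)"
        if "set zs \<subseteq> set ys" for zs
        using that
      proof (induction zs)
        case Nil
        then show ?case using RR.mp_zero submodule_zero[OF Nsub] z by simp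
      next
        case (Cons y zs)
        have yc: "y \<in> carrier R" "set zs \<subseteq> carrier R" "y \<in> set ys" using Cons.prems ys by auto
        show ?case
        proof (intro allI impI ballI)
          fix i a assume i: "i < d * int (Suc l)" and "a \<in> lin_comb (regular_module R) (y # zs) (A l)"
          then obtain b w where bw: "b \<in> A l" "w \<in> lin_comb (regular_module R) zs (A l)" "a = y \<otimes> b \<oplus> w"
            by auto
          have c: "b \<in> carrier R" "w \<in> carrier R"
            using bw A_carrier RR.submodule_mem[OF RR.submodule_lin_comb[OF A_submodule yc(2)]] by auto
          have b': "rp (i - dg y) b \<in> A l" using bw A_parts by (auto simp: parts_closed_def)
          have eq: "rp i a \<odot>\<^bsub>M\<^esub> z = (y \<otimes> rp (i - dg y) b) \<odot>\<^bsub>M\<^esub> z \<oplus>\<^bsub>M\<^esub> rp i w \<odot>\<^bsub>M\<^esub> z"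
            using bw c yc z RR.dg_mult[of y b i] by (simp add: rp_add smult_l_distr)
          have "(y \<otimes> rp (i - dg y) b) \<odot>\<^bsub>M\<^esub> z \<in> N (m + Suc l)"
          proof (cases "y \<in> Y")
            case True
            then have "i - dg y < d * int l" using i dmin[of y] by (simp add: algebra_simps)
            then have "y \<odot>\<^bsub>M\<^esub> (rp (i - dg y) b \<odot>\<^bsub>M\<^esub> z) \<in> N (Suc (m + l))"
              using Suc.IH bw by (intro stable_familyD(2)[OF Nst yc(3)]) auto
            then show ?thesis using yc c z by (simp add: smult_assoc1)
          qed (use swap[OF yc(3) _ b'] in auto)
          moreover have "rp i w \<odot>\<^bsub>M\<^esub> z \<in> N (m + Suc l)"
            using Cons.IH Cons.prems i bw by auto
          ultimately show "rp i a \<odot>\<^bsub>M\<^esub> z \<in> N (m + Suc l)" unfolding eq by (rule submodule_add[OF Nsub])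
        qed
      qed
      then show ?case by auto
    qed
    \<comment> \<open>The powers of \<open>y0\<close> are the witnesses: by primality they stay
      outside P.\<close>
    have attained: "\<exists>a\<in>A l. rp (d * int l) a = a \<and> a \<odot>\<^bsub>M\<^esub> z \<notin> N (m + l)" for l
    proof (induction l)
      case 0
      then show ?case using z rp_one by (auto intro!: bexI[of _ \<one>])
    next
      case (Suc l)
      then obtain a where a: "a \<in> A l" "rp (d * int l) a = a" "a \<odot>\<^bsub>M\<^esub> z \<notin> N (m + l)" by blast
      have y0c: "y0 \<in> set ys" "y0 \<in> carrier R" using y0 ys by (auto simp: Y_def)
      have y01: "y0 \<in> A 1" using A_Suc_mult[OF y0c(1), of \<one> 0] y0c by simp
      have "rp (d + d * int l) (y0 \<otimes> a) = y0 \<otimes> a"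
        using rp_mult[OF y0c(2) A_carrier[OF a(1)], of d "d * int l"] dg[OF y0c(1)] y0 a by simp
      moreover have "(y0 \<otimes> a) \<odot>\<^bsub>M\<^esub> z \<notin> N (m + Suc l)"
        using prime[OF a(1,2) y01 _ a(3)] y0 by (auto simp: Y_def)
      ultimately show ?case
        using A_Suc_mult[OF y0c(1) a(1)] by (intro bexI[of _ "y0 \<otimes> a"]) (auto simp: algebra_simps)
    qed
    have "d * int n + (j - d * int m) \<in> degs (extend N m z) N n \<and>
      (\<forall>k\<in>degs (extend N m z) N n. d * int n + (j - d * int m) \<le> k)" if mn: "n \<ge> m" for n
    proof
      have shift: "d * int n + (j - d * int m) = d * int (n - m) + j" using mn by (simp add: of_nat_diff algebra_simps)
      obtain a where a: "a \<in> A (n - m)" "rp (d * int (n - m)) a = a" "a \<odot>\<^bsub>M\<^esub> z \<notin> N n"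
        using attained[of "n - m"] mn by auto
      have "a \<odot>\<^bsub>M\<^esub> z = \<zero>\<^bsub>M\<^esub> \<oplus>\<^bsub>M\<^esub> a \<odot>\<^bsub>M\<^esub> z" using a A_carrier z by simp
      then have "a \<odot>\<^bsub>M\<^esub> z \<in> extend N m z n"
        using a mn submodule_zero[OF Nsub] unfolding extend_def by auto
      moreover have "mp (d * int (n - m) + j) (a \<odot>\<^bsub>M\<^esub> z) = a \<odot>\<^bsub>M\<^esub> z"
        using mp_smult[OF A_carrier[OF a(1)] a(2) z(1), of j] z by simp
      ultimately show "d * int n + (j - d * int m) \<in> degs (extend N m z) N n"
        unfolding shift degs_def using a by blast
      show "\<forall>k\<in>degs (extend N m z) N n. d * int n + (j - d * int m) \<le> k"
      proof
        fix k assume "k \<in> degs (extend N m z) N n"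
        then obtain a where a: "a \<in> A (n - m)" "rp (k - j) a = a" "a \<odot>\<^bsub>M\<^esub> z \<notin> N n" using homog[of k n] mn by blast
        then have "\<not> k - j < d * int (n - m)" using lower[of "n - m"] mn by force
        then show "d * int n + (j - d * int m) \<le> k" unfolding shift by simp
      qed
    qed
    moreover have "d \<in> dg ` set ys" using y0 by (auto simp: Y_def)
    ultimately show ?thesis unfolding eventually_linear_def by blast
  qed
qed

text \<open>Nonvanishing degrees unite along a filtration, so each step of the prime filtration adds
  the degrees of one cyclic factor.\<close>

lemma degs_linear:
  assumes K: "graded_family K" and U: "graded_family U" and KU: "K \<le> U"
    and gen: "eventually_generated M ys K U"
  shows "eventually_linear (dg ` set ys) (degs U K)"
proof (rule prime_filtration_induct[OF K U KU gen, where \<Phi> = "\<lambda>N. eventually_linear (dg ` set ys) (degs N K)"])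
  show "eventually_linear (dg ` set ys) (degs K K)" by (simp add: eventually_linear_def degs_def)
next
  fix N m j z
  assume N: "graded_family N" and KN: "K \<le> N" and lin: "eventually_linear (dg ` set ys) (degs N K)"
    and z: "z \<in> U m" "mp j z = z" "z \<notin> N m"
    and prime: "\<And>n l i a b. \<lbrakk>a \<in> A n; rp i a = a; b \<in> A l; (b \<otimes> a) \<odot>\<^bsub>M\<^esub> z \<in> N (m + n + l); a \<odot>\<^bsub>M\<^esub> z \<notin> N (m + n)\<rbrakk>
        \<Longrightarrow> b \<odot>\<^bsub>M\<^esub> z \<in> N (m + l)"
  have zc: "z \<in> carrier M" using z graded_familyD(5)[OF U] by blast
  have "(\<lambda>n. degs N K n \<union> degs (extend N m z) N n) = degs (extend N m z) K"
  proof
    show "degs N K n \<union> degs (extend N m z) N n = degs (extend N m z) K n" for n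
      using le_funD[OF extend_superset[OF N zc, of m], of n] le_funD[OF KN, of n] unfolding degs_def by blast
  qed
  moreover have "eventually_linear (dg ` set ys) (degs (extend N m z) N)"
    by (rule degs_extend_linear[OF N zc z(2,3)]) (fact prime)
  ultimately show "eventually_linear (dg ` set ys) (degs (extend N m z) K)"
    using eventually_linear_Un[OF lin, of "degs (extend N m z) N"] by simp
qed

section \<open>Finiteness of the set of associated primes over all levels\<close>

definition colon_primes :: "(nat \<Rightarrow> 'c set) \<Rightarrow> (nat \<Rightarrow> 'c set) \<Rightarrow> 'a set set" where
  "colon_primes U K = {p. primeideal p R \<and> (\<exists>n j. \<exists>x\<in>U n. mp j x = x \<and> p = colon R M (K n) x)}"

text \<open>The analogue of the inclusion for associated primes in an extension. A witness
  \<open>x\<close> either has a multiple in \<open>N\<close> with the same annihilator p, or p is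
  the annihilator of its class modulo \<open>N\<close>. In the cyclic factor every nonzero
  homogeneous class has the same annihilator in R as \<open>z\<close>, whatever its level, which is
  why one new prime suffices for all n.\<close>

lemma colon_primes_extend:
  assumes K: "graded_family K" and N: "graded_family N" and KN: "K \<le> N"
    and z: "z \<in> carrier M" "mp j z = z" "z \<notin> N m"
    and prime: "\<And>n l i a b. \<lbrakk>a \<in> A n; rp i a = a; b \<in> A l; (b \<otimes> a) \<odot>\<^bsub>M\<^esub> z \<in> N (m + n + l); a \<odot>\<^bsub>M\<^esub> z \<notin> N (m + n)\<rbrakk>
        \<Longrightarrow> b \<odot>\<^bsub>M\<^esub> z \<in> N (m + l)"
  shows "colon_primes (extend N m z) K \<subseteq> insert (colon R M (N m) z) (colon_primes N K)"
proof
  note Nst = graded_familyD(1)[OF N] and Nsub = graded_familyD(2)[OF N] and Ksub = graded_familyD(2)[OF K]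
  fix p assume "p \<in> colon_primes (extend N m z) K"
  then obtain n k x where p: "primeideal p R" and x: "x \<in> extend N m z n" "mp k x = x" and px: "p = colon R M (K n) x"
    by (auto simp: colon_primes_def)
  interpret primeideal p R by (rule p)
  have xc: "x \<in> carrier M"
    using x graded_familyD(5)[OF graded_family_extend[OF N z(1,2)]] by blast
  have psub: "submodule p R (regular_module R)" and pparts: "parts_closed rp p"
    unfolding px using colon_submodule[OF Ksub xc] colon_parts_closed[OF Ksub graded_familyD(4)[OF K] xc x(2)] by auto
  show "p \<in> insert (colon R M (N m) z) (colon_primes N K)"
  \<comment> \<open>A multiple s x with s outside p has the same annihilator p as x, because p is
    prime.\<close>
  proof (cases "\<exists>s i. s \<in> carrier R \<and> rp i s = s \<and> s \<notin> p \<and> s \<odot>\<^bsub>M\<^esub> x \<in> N n")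
    case True
    then obtain s i where s: "s \<in> carrier R" "rp i s = s" "s \<notin> p" "s \<odot>\<^bsub>M\<^esub> x \<in> N n" by blast
    have "c \<in> p \<longleftrightarrow> c \<in> colon R M (K n) (s \<odot>\<^bsub>M\<^esub> x)" for c
    proof -
      have "c \<in> colon R M (K n) (s \<odot>\<^bsub>M\<^esub> x) \<longleftrightarrow> c \<in> carrier R \<and> c \<otimes> s \<in> p"
        unfolding px using s xc by (auto simp: colon_def smult_assoc1)
      then show ?thesis using s I_prime[of c s] I_r_closed[of c s] by auto
    qed
    moreover have "mp (i + k) (s \<odot>\<^bsub>M\<^esub> x) = s \<odot>\<^bsub>M\<^esub> x" using mp_smult[OF s(1,2) xc, of k] x by simp
    ultimately show ?thesis using s(4) p unfolding colon_primes_def by blast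
  next
    case False
    have mn: "m \<le> n"
    proof (rule ccontr)
      assume "\<not> m \<le> n"
      then have "\<one> \<odot>\<^bsub>M\<^esub> x \<in> N n" using x(1) xc by (auto simp: extend_def)
      then show False using False rp_one one_imp_carrier I_notcarr by blast
    qed
    obtain v a where va: "v \<in> N n" "a \<in> A (n - m)" "rp (k - j) a = a" "x = v \<oplus>\<^bsub>M\<^esub> a \<odot>\<^bsub>M\<^esub> z"
      using extend_homogeneous[OF N z(1,2) x mn] .
    have c: "a \<in> carrier R" "v \<in> carrier M" using va A_carrier submodule_mem[OF Nsub] by auto
    have az: "a \<odot>\<^bsub>M\<^esub> z \<notin> N n"
    proof
      assume "a \<odot>\<^bsub>M\<^esub> z \<in> N n"
      then have "\<one> \<odot>\<^bsub>M\<^esub> x \<in> N n" using va xc submodule_add[OF Nsub] by auto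
      then show False using False rp_one one_imp_carrier I_notcarr by blast
    qed
    \<comment> \<open>The two ideals are compared on homogeneous scalars, where the primality
      hypothesis can be applied; both are homogeneous, so the parts of a general scalar can be
      treated one at a time afterwards.\<close>
    have homog: "s \<in> p \<longleftrightarrow> s \<in> colon R M (N m) z" if s: "s \<in> carrier R" "rp i s = s" for s i
    proof -
      have "s \<in> p \<longleftrightarrow> s \<odot>\<^bsub>M\<^esub> x \<in> N n"
      proof
        assume "s \<in> p"
        then have "s \<odot>\<^bsub>M\<^esub> x \<in> K n" unfolding px colon_def by blast
        then show "s \<odot>\<^bsub>M\<^esub> x \<in> N n" using le_funD[OF KN, of n] by blast
      qed (use False s in blast)
      also have "\<dots> \<longleftrightarrow> (s \<otimes> a) \<odot>\<^bsub>M\<^esub> z \<in> N n"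
      proof -
        have eq: "s \<odot>\<^bsub>M\<^esub> x = s \<odot>\<^bsub>M\<^esub> v \<oplus>\<^bsub>M\<^esub> (s \<otimes> a) \<odot>\<^bsub>M\<^esub> z"
          using s va c z by (simp add: smult_r_distr smult_assoc1)
        have sv: "s \<odot>\<^bsub>M\<^esub> v \<in> N n" using submodule_smult[OF Nsub s(1) va(1)] .
        have "(s \<otimes> a) \<odot>\<^bsub>M\<^esub> z \<in> carrier M" using s c z by simp
        then show ?thesis
          unfolding eq using submodule_add_cancel[OF Nsub sv] submodule_add[OF Nsub sv] by blast
      qed
      also have "\<dots> \<longleftrightarrow> s \<odot>\<^bsub>M\<^esub> z \<in> N m"
      proof
        assume "(s \<otimes> a) \<odot>\<^bsub>M\<^esub> z \<in> N n"
        \<comment> \<open>Here \<open>s\<close> is a scalar of level 0 in the Rees algebra, and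
          \<open>a\<close> is the homogeneous element outside the prime.\<close>
        then show "s \<odot>\<^bsub>M\<^esub> z \<in> N m"
          using prime[OF va(2,3), of s 0] s az mn by simp
      next
        assume "s \<odot>\<^bsub>M\<^esub> z \<in> N m"
        from A_smult[OF Nst va(2) this] have "a \<odot>\<^bsub>M\<^esub> (s \<odot>\<^bsub>M\<^esub> z) \<in> N n" using mn by simp
        then show "(s \<otimes> a) \<odot>\<^bsub>M\<^esub> z \<in> N n" using s c z smult_swap[of a s z] by (simp add: smult_assoc1)
      qed
      finally show ?thesis using s by (simp add: colon_def)
    qed
    have "p = colon R M (N m) z"
    proof
      show "p \<subseteq> colon R M (N m) z"
      proof
        fix c assume cp: "c \<in> p"
        then have cc: "c \<in> carrier R" using Icarr by blast
        have "rp i c \<in> colon R M (N m) z" for i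
          using homog[of "rp i c" i] cp cc pparts by (auto simp: parts_closed_def rp_rp)
        then show "c \<in> colon R M (N m) z"
          using cc by - (rule RR.submodule_parts_mem[OF colon_submodule[OF Nsub z(1)]], simp_all)
      qed
      show "colon R M (N m) z \<subseteq> p"
      proof
        fix c assume cp: "c \<in> colon R M (N m) z"
        then have cc: "c \<in> carrier R" by (simp add: colon_def)
        have "rp i c \<in> p" for i
          using homog[of "rp i c" i] cp cc colon_parts_closed[OF Nsub graded_familyD(4)[OF N] z(1,2)]
          by (auto simp: parts_closed_def rp_rp)
        then show "c \<in> p" using cc by - (rule RR.submodule_parts_mem[OF psub], simp_all)
      qed
    qed
    then show ?thesis by simp
  qed
qed

text \<open>Modulo itself \<open>K\<close> has no such prime, as all annihilators are the whole
  ring, and each cyclic extension adds at most one.\<close>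

lemma finite_colon_primes:
  assumes K: "graded_family K" and U: "graded_family U" and KU: "K \<le> U"
    and gen: "eventually_generated M ys K U"
  shows "finite (colon_primes U K)"
proof (rule prime_filtration_induct[OF K U KU gen, where \<Phi> = "\<lambda>N. finite (colon_primes N K)"])
  have "colon R M (K n) x = carrier R" if "x \<in> K n" for x n
    using that submodule_smult[OF graded_familyD(2)[OF K]] by (auto simp: colon_def)
  then have "colon_primes K K = {}"
    by (auto simp: colon_primes_def dest!: primeideal.I_notcarr)
  then show "finite (colon_primes K K)" by simp
next
  fix N m j z
  assume N: "graded_family N" and KN: "K \<le> N" and fin: "finite (colon_primes N K)"
    and z: "z \<in> U m" "mp j z = z" "z \<notin> N m"
    and prime: "\<And>n l i a b. \<lbrakk>a \<in> A n; rp i a = a; b \<in> A l; (b \<otimes> a) \<odot>\<^bsub>M\<^esub> z \<in> N (m + n + l); a \<odot>\<^bsub>M\<^esub> z \<notin> N (m + n)\<rbrakk>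
        \<Longrightarrow> b \<odot>\<^bsub>M\<^esub> z \<in> N (m + l)"
  have zc: "z \<in> carrier M" using z graded_familyD(5)[OF U] by blast
  have "colon_primes (extend N m z) K \<subseteq> insert (colon R M (N m) z) (colon_primes N K)"
    by (rule colon_primes_extend[OF K N KN zc z(2,3)]) (fact prime)
  then show "finite (colon_primes (extend N m z) K)"
    by (rule finite_subset) (simp add: fin)
qed

text \<open>For a fixed prime \<open>p\<close>, the elements with annihilator \<open>p\<close> modulo \<open>K\<close> are those killed by \<open>p\<close> (below: \<open>V p\<close>)
  but not by any homogeneous scalar outside \<open>p\<close> (below: \<open>W p\<close>); and only finitely many \<open>p\<close> occur.\<close>

theorem prime_degrees_linear:
  assumes K: "graded_family K" and U: "graded_family U" and KU: "K \<le> U"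
    and gen: "eventually_generated M ys K U"
  shows "eventually_linear (dg ` set ys) (\<lambda>n. {j. \<exists>x\<in>U n. mp j x = x \<and> primeideal (colon R M (K n) x) R})"
proof -
  note Ksub = graded_familyD(2)[OF K] and Usub = graded_familyD(2)[OF U] and Uc = graded_familyD(5)[OF U]
    and Kst = graded_familyD(1)[OF K] and Ust = graded_familyD(1)[OF U]
  define V where "V p n = {x \<in> U n. \<forall>a\<in>p. a \<odot>\<^bsub>M\<^esub> x \<in> K n}" for p n
  define W where "W p n = {x \<in> V p n. \<exists>s i. s \<in> carrier R \<and> rp i s = s \<and> s \<notin> p \<and> s \<odot>\<^bsub>M\<^esub> x \<in> K n}" for p n
  have *: "eventually_linear (dg ` set ys) (degs (V p) (W p)) \<and>
     degs (V p) (W p) = (\<lambda>n. {j. \<exists>x\<in>U n. mp j x = x \<and> colon R M (K n) x = p})" if p_in: "p \<in> colon_primes U K" for p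
  proof -
    obtain n0 j0 x0 where p: "primeideal p R" and x0: "x0 \<in> U n0" "mp j0 x0 = x0" and px: "p = colon R M (K n0) x0"
      using p_in by (auto simp: colon_primes_def)
    interpret primeideal p R by (rule p)
    have psub: "submodule p R (regular_module R)" and pparts: "parts_closed rp p"
      unfolding px using colon_submodule[OF Ksub Uc] colon_parts_closed[OF Ksub graded_familyD(4)[OF K] Uc] x0 by auto
    have Vsub: "submodule (V p n) R M" for n
    proof (rule submoduleI)
      show "V p n \<subseteq> carrier M" using Uc by (auto simp: V_def)
      show "\<zero>\<^bsub>M\<^esub> \<in> V p n" using submodule_zero[OF Usub] submodule_zero[OF Ksub] Icarr by (auto simp: V_def)
      show "\<ominus>\<^bsub>M\<^esub> x \<in> V p n" if "x \<in> V p n" for x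
        using that submodule_neg[OF Usub] submodule_neg[OF Ksub] Uc Icarr by (auto simp: V_def smult_r_minus)
      show "x \<oplus>\<^bsub>M\<^esub> y \<in> V p n" if "x \<in> V p n" "y \<in> V p n" for x y
        using that submodule_add[OF Usub] submodule_add[OF Ksub] Uc Icarr by (auto simp: V_def smult_r_distr)
      show "b \<odot>\<^bsub>M\<^esub> x \<in> V p n" if "b \<in> carrier R" "x \<in> V p n" for b x
        using that submodule_smult[OF Usub] submodule_smult[OF Ksub] Uc Icarr smult_swap[OF _ that(1)]
        by (auto simp: V_def)
    qed
    have Vc: "x \<in> V p n \<Longrightarrow> x \<in> carrier M" for x n using Uc by (auto simp: V_def)
    have Vst: "y \<odot>\<^bsub>M\<^esub> x \<in> V p (Suc n)" if "y \<in> set ys" "x \<in> V p n" for x y n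
      using that stable_familyD(2)[OF Ust] stable_familyD(2)[OF Kst] Vc ys Icarr smult_swap[of _ y x]
      by (auto simp: V_def subset_iff)
    have Vparts: "mp j x \<in> V p n" if x: "x \<in> V p n" for x j n
    proof -
      have xU: "x \<in> U n" and xK: "\<And>a. a \<in> p \<Longrightarrow> a \<odot>\<^bsub>M\<^esub> x \<in> K n" using x by (auto simp: V_def)
      have "a \<odot>\<^bsub>M\<^esub> mp j x \<in> K n" if a: "a \<in> p" for a
      proof -
        have "rp i a \<in> colon R M (K n) (mp j x)" for i
        proof -
          have "mp (i + j) (rp i a \<odot>\<^bsub>M\<^esub> x) \<in> K n"
            using pparts a xK graded_familyD(3)[OF K] by (auto simp: parts_closed_def)
          then show ?thesis
            using mp_smult[of "rp i a" i x j] a Icarr[OF a] Uc[OF xU] by (auto simp: colon_def rp_rp)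
        qed
        then have "a \<in> colon R M (K n) (mp j x)"
          using Icarr[OF a] Uc[OF xU] by - (rule RR.submodule_parts_mem[OF colon_submodule[OF Ksub]], simp_all)
        then show ?thesis by (simp add: colon_def)
      qed
      then show ?thesis using graded_familyD(3)[OF U xU] by (auto simp: V_def)
    qed
    have gV: "graded_family (V p)"
      using Vsub Vst Vparts by (auto simp: graded_family_def stable_family_def parts_closed_def)
    have KV: "K n \<subseteq> V p n" for n
      using KU submodule_smult[OF Ksub] Icarr by (auto simp: V_def le_fun_def)
    have "\<one> \<notin> p" using one_imp_carrier I_notcarr by blast
    then have KW: "K n \<subseteq> W p n" for n
      using KV submodule_mem[OF Ksub] rp_one by (auto simp: W_def intro!: exI[of _ \<one>] exI[of _ 0])
    have WV: "W p \<le> V p" by (auto simp: W_def le_fun_def)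
    have Wsub: "submodule (W p n) R M" for n
    proof (rule submoduleI)
      show "W p n \<subseteq> carrier M" using Vc by (auto simp: W_def)
      show "\<zero>\<^bsub>M\<^esub> \<in> W p n" using KW submodule_zero[OF Ksub] by blast
      show "\<ominus>\<^bsub>M\<^esub> x \<in> W p n" if xW: "x \<in> W p n" for x
      proof -
        obtain s i where s: "s \<in> carrier R" "rp i s = s" "s \<notin> p" "s \<odot>\<^bsub>M\<^esub> x \<in> K n" "x \<in> V p n"
          using xW by (auto simp: W_def)
        have "s \<odot>\<^bsub>M\<^esub> (\<ominus>\<^bsub>M\<^esub> x) \<in> K n"
          using submodule_neg[OF Ksub s(4)] smult_r_minus[OF s(1) Vc[OF s(5)]] by simp
        then show ?thesis using s submodule_neg[OF Vsub s(5)] unfolding W_def by blast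
      qed
      show "b \<odot>\<^bsub>M\<^esub> x \<in> W p n" if b: "b \<in> carrier R" and x: "x \<in> W p n" for b x
      proof -
        obtain s i where s: "s \<in> carrier R" "rp i s = s" "s \<notin> p" "s \<odot>\<^bsub>M\<^esub> x \<in> K n" "x \<in> V p n"
          using x by (auto simp: W_def)
        have "s \<odot>\<^bsub>M\<^esub> (b \<odot>\<^bsub>M\<^esub> x) \<in> K n"
          using submodule_smult[OF Ksub b s(4)] smult_swap[OF s(1) b Vc[OF s(5)]] by simp
        then show ?thesis using s submodule_smult[OF Vsub b s(5)] unfolding W_def by blast
      qed
      show "x \<oplus>\<^bsub>M\<^esub> y \<in> W p n" if x: "x \<in> W p n" and y: "y \<in> W p n" for x y
      proof -
        obtain s i where s: "s \<in> carrier R" "rp i s = s" "s \<notin> p" "s \<odot>\<^bsub>M\<^esub> x \<in> K n" "x \<in> V p n"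
          using x by (auto simp: W_def)
        obtain t l where t: "t \<in> carrier R" "rp l t = t" "t \<notin> p" "t \<odot>\<^bsub>M\<^esub> y \<in> K n" "y \<in> V p n"
          using y by (auto simp: W_def)
        have c: "x \<in> carrier M" "y \<in> carrier M" using s t Vc by auto
        \<comment> \<open>Primality makes \<open>W p\<close> closed under addition: the product of
          the two scalars is homogeneous, stays outside p, and sends both summands into
          \<open>K n\<close>.\<close>
        have "(s \<otimes> t) \<odot>\<^bsub>M\<^esub> (x \<oplus>\<^bsub>M\<^esub> y) = t \<odot>\<^bsub>M\<^esub> (s \<odot>\<^bsub>M\<^esub> x) \<oplus>\<^bsub>M\<^esub> s \<odot>\<^bsub>M\<^esub> (t \<odot>\<^bsub>M\<^esub> y)"
          using s t c smult_swap[of t s x] by (simp add: smult_r_distr smult_assoc1)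
        also have "\<dots> \<in> K n"
          by (rule submodule_add[OF Ksub submodule_smult[OF Ksub t(1) s(4)] submodule_smult[OF Ksub s(1) t(4)]])
        finally have "(s \<otimes> t) \<odot>\<^bsub>M\<^esub> (x \<oplus>\<^bsub>M\<^esub> y) \<in> K n" .
        moreover have "rp (i + l) (s \<otimes> t) = s \<otimes> t" using rp_mult[of s t i l] s t by simp
        moreover have "s \<otimes> t \<notin> p" using I_prime[of s t] s t by blast
        ultimately show ?thesis
          using s t submodule_add[OF Vsub s(5) t(5)] unfolding W_def by blast
      qed
    qed
    have Wst: "y \<odot>\<^bsub>M\<^esub> x \<in> W p (Suc n)" if y: "y \<in> set ys" and xW: "x \<in> W p n" for x y n
    proof -
      obtain s i where s: "s \<in> carrier R" "rp i s = s" "s \<notin> p" "s \<odot>\<^bsub>M\<^esub> x \<in> K n" "x \<in> V p n"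
        using xW by (auto simp: W_def)
      have "s \<odot>\<^bsub>M\<^esub> (y \<odot>\<^bsub>M\<^esub> x) \<in> K (Suc n)"
        using stable_familyD(2)[OF Kst y s(4)] smult_swap[of s y x] s Vc y ys by auto
      then show ?thesis using s Vst[OF y s(5)] unfolding W_def by blast
    qed
    have Wparts: "mp j x \<in> W p n" if xW: "x \<in> W p n" for x j n
    proof -
      obtain s i where s: "s \<in> carrier R" "rp i s = s" "s \<notin> p" "s \<odot>\<^bsub>M\<^esub> x \<in> K n" "x \<in> V p n"
        using xW by (auto simp: W_def)
      have "s \<odot>\<^bsub>M\<^esub> mp j x \<in> K n"
        using graded_familyD(3)[OF K s(4), of "i + j"] mp_smult[OF s(1,2) Vc[OF s(5)]] by simp
      then show ?thesis using s Vparts[OF s(5)] unfolding W_def by blast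
    qed
    have gW: "graded_family (W p)"
      using Wsub Wst Wparts by (auto simp: graded_family_def stable_family_def parts_closed_def)
    \<comment> \<open>\<open>V p\<close> lies between \<open>K\<close> and \<open>U\<close>, so the
      basis theorem makes it eventually generated relative to \<open>K\<close>, and then also
      relative to the larger \<open>W p\<close>.\<close>
    have "eventually_generated M ys K (V p)"
      by (rule eventually_generated_subfamily[where E = U, OF noeth ys Ust Kst graded_familyD(1)[OF gV] KV _ gen])
        (auto simp: V_def)
    then have "eventually_generated M ys (W p) (V p)"
    proof -
      have "lin_comb M ys (V p n) <+>\<^bsub>M\<^esub> K (Suc n) \<subseteq> lin_comb M ys (V p n) <+>\<^bsub>M\<^esub> W p (Suc n)" for n
        using KW[of "Suc n"] unfolding set_add_def' by blast
      then show ?thesis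
        using \<open>eventually_generated M ys K (V p)\<close> unfolding eventually_generated_def by (meson subset_trans)
    qed
    then have "eventually_linear (dg ` set ys) (degs (V p) (W p))"
      by (rule degs_linear[OF gW gV WV])
    \<comment> \<open>For x outside \<open>W p\<close> no homogeneous scalar outside p sends x into
      \<open>K n\<close>; since the annihilator of a homogeneous class is a homogeneous ideal, all
      of it lies in p.\<close>
    moreover have "x \<in> V p n \<and> x \<notin> W p n \<longleftrightarrow> x \<in> U n \<and> colon R M (K n) x = p" if x: "mp j x = x" for x j n
    proof
      assume xVW: "x \<in> V p n \<and> x \<notin> W p n"
      then have xU: "x \<in> U n" by (auto simp: V_def)
      have "colon R M (K n) x \<subseteq> p"
      proof
        fix c assume c: "c \<in> colon R M (K n) x"
        then have cc: "c \<in> carrier R" by (simp add: colon_def)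
        have "rp i c \<in> p" for i
        proof (rule ccontr)
          assume "rp i c \<notin> p"
          moreover have "rp i c \<odot>\<^bsub>M\<^esub> x \<in> K n"
            using colon_parts_closed[OF Ksub graded_familyD(4)[OF K] Uc[OF xU] x, of n] c
            by (auto simp: parts_closed_def colon_def)
          moreover have "rp i (rp i c) = rp i c" using cc by (simp add: rp_rp)
          ultimately have "x \<in> W p n" using xVW rp_closed[OF cc, of i] unfolding W_def by blast
          then show False using xVW by blast
        qed
        then show "c \<in> p" using cc by - (rule RR.submodule_parts_mem[OF psub], simp_all)
      qed
      moreover have "p \<subseteq> colon R M (K n) x" using xVW Icarr by (auto simp: V_def colon_def)
      ultimately show "x \<in> U n \<and> colon R M (K n) x = p" using xU by blast
    qed (auto simp: V_def W_def colon_def)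
    then have "degs (V p) (W p) = (\<lambda>n. {j. \<exists>x\<in>U n. mp j x = x \<and> colon R M (K n) x = p})"
      unfolding degs_def by (intro ext Collect_cong) blast
    ultimately show ?thesis by blast
  qed
  have "(\<Union>p\<in>colon_primes U K. degs (V p) (W p) n) =
      {j. \<exists>x\<in>U n. mp j x = x \<and> primeideal (colon R M (K n) x) R}" for n
  proof -
    have "(\<Union>p\<in>colon_primes U K. degs (V p) (W p) n) =
        (\<Union>p\<in>colon_primes U K. {j. \<exists>x\<in>U n. mp j x = x \<and> colon R M (K n) x = p})"
      using * by (intro SUP_cong refl) simp
    also have "\<dots> = {j. \<exists>x\<in>U n. mp j x = x \<and> primeideal (colon R M (K n) x) R}"
      by (auto simp: colon_primes_def)
    finally show ?thesis .
  qed
  moreover have "eventually_linear (dg ` set ys) (\<lambda>n. \<Union>p\<in>colon_primes U K. degs (V p) (W p) n)"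
    using * by (intro eventually_linear_UN finite_colon_primes[OF K U KU gen]) blast
  ultimately show ?thesis by simp
qed

end

section \<open>Artin-Rees bounds for colon submodules\<close>

definition pow_module :: "('a, 'b, 'd) module_scheme \<Rightarrow> 'i set \<Rightarrow> ('a, 'i \<Rightarrow> 'b) module" where
  "pow_module M T =
     \<lparr>carrier = T \<rightarrow>\<^sub>E carrier M, monoid.mult = undefined, one = undefined,
      zero = (\<lambda>t\<in>T. \<zero>\<^bsub>M\<^esub>), add = (\<lambda>f g. \<lambda>t\<in>T. f t \<oplus>\<^bsub>M\<^esub> g t),
      smult = (\<lambda>a f. \<lambda>t\<in>T. a \<odot>\<^bsub>M\<^esub> f t)\<rparr>"

lemma pow_module_simps [simp]:
  "carrier (pow_module M T) = T \<rightarrow>\<^sub>E carrier M"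
  "zero (pow_module M T) = (\<lambda>t\<in>T. \<zero>\<^bsub>M\<^esub>)"
  "add (pow_module M T) f g = (\<lambda>t\<in>T. f t \<oplus>\<^bsub>M\<^esub> g t)"
  "smult (pow_module M T) a f = (\<lambda>t\<in>T. a \<odot>\<^bsub>M\<^esub> f t)"
  by (simp_all add: pow_module_def)

context module
begin

lemma module_pow_module: "module R (pow_module M T)"
proof (rule moduleI[OF R.is_cring])
  show "abelian_group (pow_module M T)"
  proof (rule abelian_groupI)
    show "\<exists>g\<in>carrier (pow_module M T). g \<oplus>\<^bsub>pow_module M T\<^esub> f = \<zero>\<^bsub>pow_module M T\<^esub>"
      if "f \<in> carrier (pow_module M T)" for f
      using that by (intro bexI[of _ "\<lambda>t\<in>T. \<ominus>\<^bsub>M\<^esub> f t"]) (auto simp: M.l_neg PiE_iff fun_eq_iff)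
  qed (auto simp: PiE_iff extensional_def fun_eq_iff M.a_ac)
qed (auto simp: PiE_iff extensional_def fun_eq_iff smult_l_distr smult_r_distr smult_assoc1)

lemma pow_neg:
  assumes "f \<in> T \<rightarrow>\<^sub>E carrier M"
  shows "\<ominus>\<^bsub>pow_module M T\<^esub> f = (\<lambda>t\<in>T. \<ominus>\<^bsub>M\<^esub> f t)"
proof -
  interpret P: module R "pow_module M T" by (rule module_pow_module)
  show ?thesis
    using assms by (intro P.M.minus_equality) (auto simp: M.l_neg PiE_iff fun_eq_iff)
qed

lemma submodule_pow:
  assumes "submodule N R M"
  shows "submodule (T \<rightarrow>\<^sub>E N) R (pow_module M T)"
proof (rule module.submoduleI[OF module_pow_module])
  show sub: "T \<rightarrow>\<^sub>E N \<subseteq> carrier (pow_module M T)"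
    using submodule_mem[OF assms] by (auto simp: PiE_iff)
  show "\<ominus>\<^bsub>pow_module M T\<^esub> f \<in> T \<rightarrow>\<^sub>E N" if "f \<in> T \<rightarrow>\<^sub>E N" for f
    using that sub submodule_neg[OF assms] by (subst pow_neg) auto
qed (auto simp: PiE_iff submodule_zero[OF assms] submodule_add[OF assms] submodule_smult[OF assms])

text \<open>The elements multiplied by one generator are collected from all entries into one tuple.
  This carries generation by \<open>ys\<close> from \<open>M\<close> to its powers.\<close>

lemma lin_comb_pow_subset: "T \<rightarrow>\<^sub>E lin_comb M ys V \<subseteq> lin_comb (pow_module M T) ys (T \<rightarrow>\<^sub>E V)"
proof (induction ys)
  case Nil
  then show ?case by (auto simp: PiE_iff extensional_def fun_eq_iff)
next
  case (Cons y ys)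
  show ?case
  proof
    fix f assume f: "f \<in> T \<rightarrow>\<^sub>E lin_comb M (y # ys) V"
    have "\<forall>t\<in>T. \<exists>v w. f t = y \<odot>\<^bsub>M\<^esub> v \<oplus>\<^bsub>M\<^esub> w \<and> v \<in> V \<and> w \<in> lin_comb M ys V"
      using f by (auto simp: PiE_iff)
    then obtain v w where vw: "\<And>t. t \<in> T \<Longrightarrow> f t = y \<odot>\<^bsub>M\<^esub> v t \<oplus>\<^bsub>M\<^esub> w t \<and> v t \<in> V \<and> w t \<in> lin_comb M ys V"
      by metis
    have "f = y \<odot>\<^bsub>pow_module M T\<^esub> restrict v T \<oplus>\<^bsub>pow_module M T\<^esub> restrict w T"
      using f vw by (auto simp: PiE_iff extensional_def fun_eq_iff)
    moreover have "restrict w T \<in> lin_comb (pow_module M T) ys (T \<rightarrow>\<^sub>E V)" using Cons vw by auto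
    moreover have "restrict v T \<in> T \<rightarrow>\<^sub>E V" using vw by auto
    ultimately show "f \<in> lin_comb (pow_module M T) (y # ys) (T \<rightarrow>\<^sub>E V)"
      unfolding lin_comb.simps by blast
  qed
qed

lemma finsum_pow:
  assumes "finite J" "\<And>j. j \<in> J \<Longrightarrow> F j \<in> T \<rightarrow>\<^sub>E carrier M"
  shows "finsum (pow_module M T) F J = (\<lambda>t\<in>T. finsum M (\<lambda>j. F j t) J)"
  using assms
proof (induction J rule: finite_induct)
  case empty
  interpret P: module R "pow_module M T" by (rule module_pow_module)
  show ?case by (simp add: P.M.finsum_empty M.finsum_empty)
next
  case (insert j J)
  interpret P: module R "pow_module M T" by (rule module_pow_module)
  have "F \<in> J \<rightarrow> carrier (pow_module M T)" "F j \<in> carrier (pow_module M T)" using insert.prems by auto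
  moreover have "(\<lambda>j. F j t) \<in> J \<rightarrow> carrier M" "F j t \<in> carrier M" if "t \<in> T" for t
    using insert.prems that by (auto simp: PiE_iff)
  ultimately show ?case
    using insert by (simp add: P.M.finsum_insert M.finsum_insert cong: restrict_cong)
qed

text \<open>The generators are tuples with a single nonzero entry from \<open>S\<close>. For a fixed
  index, the entries x whose single-entry tuple lies in the span form a submodule, hence all of M; a
  general tuple is summed up one index at a time.\<close>

lemma fin_gen_pow_module:
  assumes "finite T" "fin_gen_module R M"
  shows "fin_gen_module R (pow_module M T)"
proof -
  interpret P: module R "pow_module M T" by (rule module_pow_module)
  obtain S where S: "S \<subseteq> carrier M" "finite S" "submodule_span R M S = carrier M"
    using assms(2) by (auto simp: fin_gen_module_def)
  define single where "single t x = (\<lambda>u\<in>T. if u = t then x else \<zero>\<^bsub>M\<^esub>)" for t x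
  define G where "G = (\<lambda>(t, x). single t x) ` (T \<times> S)"
  have Gc: "G \<subseteq> carrier (pow_module M T)" using S(1) by (auto simp: G_def single_def)
  note Gsub = P.submodule_submodule_span[OF Gc]
  have single_mem: "single t x \<in> submodule_span R (pow_module M T) G" if t: "t \<in> T" and x: "x \<in> carrier M" for t x
  proof -
    have "submodule {x \<in> carrier M. single t x \<in> submodule_span R (pow_module M T) G} R M"
    proof (rule submoduleI)
      have "single t \<zero>\<^bsub>M\<^esub> = \<zero>\<^bsub>pow_module M T\<^esub>" by (auto simp: single_def)
      then show "\<zero>\<^bsub>M\<^esub> \<in> {x \<in> carrier M. single t x \<in> submodule_span R (pow_module M T) G}"
        using P.submodule_zero[OF Gsub] by simp
      show add: "x \<oplus>\<^bsub>M\<^esub> y \<in> {x \<in> carrier M. single t x \<in> submodule_span R (pow_module M T) G}"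
        if "x \<in> {x \<in> carrier M. single t x \<in> submodule_span R (pow_module M T) G}"
          "y \<in> {x \<in> carrier M. single t x \<in> submodule_span R (pow_module M T) G}" for x y
      proof -
        have "single t (x \<oplus>\<^bsub>M\<^esub> y) = single t x \<oplus>\<^bsub>pow_module M T\<^esub> single t y"
          using that by (auto simp: single_def fun_eq_iff)
        then show ?thesis using that P.submodule_add[OF Gsub, of "single t x" "single t y"] by auto
      qed
      show smult: "a \<odot>\<^bsub>M\<^esub> x \<in> {x \<in> carrier M. single t x \<in> submodule_span R (pow_module M T) G}"
        if "a \<in> carrier R" "x \<in> {x \<in> carrier M. single t x \<in> submodule_span R (pow_module M T) G}" for a x
      proof -
        have "single t (a \<odot>\<^bsub>M\<^esub> x) = a \<odot>\<^bsub>pow_module M T\<^esub> single t x"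
          using that by (auto simp: single_def fun_eq_iff)
        then show ?thesis using that P.submodule_smult[OF Gsub, of a "single t x"] by auto
      qed
      show "\<ominus>\<^bsub>M\<^esub> x \<in> {x \<in> carrier M. single t x \<in> submodule_span R (pow_module M T) G}"
        if "x \<in> {x \<in> carrier M. single t x \<in> submodule_span R (pow_module M T) G}" for x
        using smult[of "\<ominus>\<^bsub>R\<^esub> \<one>\<^bsub>R\<^esub>" x] that by (auto simp: smult_l_minus)
    qed auto
    moreover have "S \<subseteq> {x \<in> carrier M. single t x \<in> submodule_span R (pow_module M T) G}"
    proof
      fix x assume x: "x \<in> S"
      then have "single t x \<in> G" using t by (auto simp: G_def)
      then show "x \<in> {x \<in> carrier M. single t x \<in> submodule_span R (pow_module M T) G}"
        using P.submodule_span_superset S(1) x by blast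
    qed
    ultimately show ?thesis using submodule_span_least S(3) x by blast
  qed
  have "(\<lambda>u\<in>T. if u \<in> A then f u else \<zero>\<^bsub>M\<^esub>) \<in> submodule_span R (pow_module M T) G"
    if f: "f \<in> T \<rightarrow>\<^sub>E carrier M" and A: "A \<subseteq> T" for f A
    using finite_subset[OF A assms(1)] A
  proof (induction A rule: finite_induct)
    case empty
    then show ?case using P.submodule_zero[OF Gsub] by (simp add: restrict_def)
  next
    case (insert t A)
    have ft: "f t \<in> carrier M" using f insert.prems by (auto simp: PiE_iff)
    have eq: "(\<lambda>u\<in>T. if u \<in> insert t A then f u else \<zero>\<^bsub>M\<^esub>) =
        single t (f t) \<oplus>\<^bsub>pow_module M T\<^esub> (\<lambda>u\<in>T. if u \<in> A then f u else \<zero>\<^bsub>M\<^esub>)"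
      using insert f ft by (auto simp: single_def fun_eq_iff PiE_iff)
    show ?case
      unfolding eq
    proof (rule P.submodule_add[OF Gsub single_mem[OF _ ft]])
      show "t \<in> T" using insert.prems by blast
      show "(\<lambda>u\<in>T. if u \<in> A then f u else \<zero>\<^bsub>M\<^esub>) \<in> submodule_span R (pow_module M T) G"
        using insert.IH insert.prems by blast
    qed
  qed
  from this[of _ T] have "f \<in> submodule_span R (pow_module M T) G" if "f \<in> T \<rightarrow>\<^sub>E carrier M" for f
    using that by (metis (mono_tags, lifting) PiE_restrict order_refl restrict_ext)
  then have "submodule_span R (pow_module M T) G = carrier (pow_module M T)"
    using P.submodule_mem[OF Gsub] by auto
  moreover have "finite G" using assms(1) S(2) by (simp add: G_def)
  ultimately show ?thesis using Gc unfolding fin_gen_module_def by blast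
qed

end

context module_parts
begin

text \<open>The grading of the direct sum of the twists M(s t). The shifts will be the degrees of
  basis elements, up to sign, which makes the differentials homogeneous of degree zero.\<close>

definition pow_parts :: "'i set \<Rightarrow> ('i \<Rightarrow> int) \<Rightarrow> int \<Rightarrow> ('i \<Rightarrow> 'c) \<Rightarrow> 'i \<Rightarrow> 'c" where
  "pow_parts T s j f = (\<lambda>t\<in>T. mp (j + s t) (f t))"

lemma module_parts_pow:
  assumes T: "finite T"
  shows "module_parts R (pow_module M T) rp (pow_parts T s)"
proof (intro module_parts.intro module_parts_axioms.intro module_pow_module ring_parts_axioms)
  interpret P: module R "pow_module M T" by (rule module_pow_module)
  fix f assume f: "f \<in> carrier (pow_module M T)"
  then have ft: "f t \<in> carrier M" if "t \<in> T" for t using that by (auto simp: PiE_iff)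
  show "pow_parts T s j f \<in> carrier (pow_module M T)" for j
    using f by (auto simp: pow_parts_def PiE_iff)
  show "pow_parts T s i (pow_parts T s j f) = (if i = j then pow_parts T s j f else \<zero>\<^bsub>pow_module M T\<^esub>)" for i j
    using f by (auto simp: pow_parts_def mp_mp fun_eq_iff PiE_iff)
  let ?S = "{j. pow_parts T s j f \<noteq> \<zero>\<^bsub>pow_module M T\<^esub>}"
  have "?S \<subseteq> (\<Union>t\<in>T. (\<lambda>i. i - s t) ` {i. mp i (f t) \<noteq> \<zero>\<^bsub>M\<^esub>})"
  proof
    fix j assume "j \<in> ?S"
    then obtain t where "t \<in> T" "mp (j + s t) (f t) \<noteq> \<zero>\<^bsub>M\<^esub>"
      by (auto simp: pow_parts_def fun_eq_iff split: if_splits)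
    then show "j \<in> (\<Union>t\<in>T. (\<lambda>i. i - s t) ` {i. mp i (f t) \<noteq> \<zero>\<^bsub>M\<^esub>})"
      by (auto intro!: bexI[of _ t] image_eqI[of _ _ "j + s t"])
  qed
  moreover have "finite (\<Union>t\<in>T. (\<lambda>i. i - s t) ` {i. mp i (f t) \<noteq> \<zero>\<^bsub>M\<^esub>})"
    using T mp_finite ft by auto
  ultimately show fin: "finite ?S" by (rule finite_subset)
  show "(\<Oplus>\<^bsub>pow_module M T\<^esub>j\<in>?S. pow_parts T s j f) = f"
  proof -
    have "finsum (pow_module M T) (\<lambda>j. pow_parts T s j f) ?S = (\<lambda>t\<in>T. finsum M (\<lambda>j. pow_parts T s j f t) ?S)"
      using f by (intro finsum_pow[OF fin]) (auto simp: pow_parts_def PiE_iff)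
    also have "\<dots> = (\<lambda>t\<in>T. f t)"
    proof (rule restrict_ext)
      fix t assume t: "t \<in> T"
      have "finsum M (\<lambda>j. pow_parts T s j f t) ?S = finsum M (\<lambda>j. mp (j + s t) (f t)) ?S"
        using t ft by (intro M.finsum_cong) (auto simp: pow_parts_def)
      also have "\<dots> = finsum M (\<lambda>i. mp i (f t)) ((\<lambda>j. j + s t) ` ?S)"
        using t ft by (subst M.finsum_reindex) (auto simp: inj_on_def)
      also have "\<dots> = finsum M (\<lambda>i. mp i (f t)) {i. mp i (f t) \<noteq> \<zero>\<^bsub>M\<^esub>}"
      proof (rule M.add.finprod_mono_neutral_cong_right)
        show "{i. mp i (f t) \<noteq> \<zero>\<^bsub>M\<^esub>} \<subseteq> (\<lambda>j. j + s t) ` ?S"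
        proof
          fix i assume "i \<in> {i. mp i (f t) \<noteq> \<zero>\<^bsub>M\<^esub>}"
          then have "pow_parts T s (i - s t) f t \<noteq> \<zero>\<^bsub>pow_module M T\<^esub> t" using t by (simp add: pow_parts_def)
          then show "i \<in> (\<lambda>j. j + s t) ` ?S" by (intro image_eqI[of _ _ "i - s t"]) auto
        qed
      qed (use fin ft[OF t] in auto)
      finally show "finsum M (\<lambda>j. pow_parts T s j f t) ?S = f t" using mp_sum[OF ft[OF t]] by simp
    qed
    also have "\<dots> = f" using f by (simp add: PiE_restrict)
    finally show ?thesis .
  qed
  show "pow_parts T s j (f \<oplus>\<^bsub>pow_module M T\<^esub> g) = pow_parts T s j f \<oplus>\<^bsub>pow_module M T\<^esub> pow_parts T s j g"
    if "g \<in> carrier (pow_module M T)" for g j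
    using f that by (auto simp: pow_parts_def fun_eq_iff PiE_iff mp_add)
  show "pow_parts T s (i + j) (a \<odot>\<^bsub>pow_module M T\<^esub> f) = a \<odot>\<^bsub>pow_module M T\<^esub> pow_parts T s j f"
    if "a \<in> carrier R" "rp i a = a" for a i j
    using f that mp_smult[OF that] by (auto simp: pow_parts_def fun_eq_iff PiE_iff add.assoc)
qed

end

lemma eventually_linear_shift:
  assumes "eventually_linear D (\<lambda>m. S (m + e))"
  shows "eventually_linear D S"
  using assms unfolding eventually_linear_def
proof (elim disjE exE bexE)
  fix n0 assume n0: "\<forall>n\<ge>n0. S (n + e) = {}"
  have "S n = {}" if "n \<ge> n0 + e" for n using n0[rule_format, of "n - e"] that by simp
  then show "(\<exists>n0. \<forall>n\<ge>n0. S n = {}) \<or>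
    (\<exists>a\<in>D. \<exists>b n0. \<forall>n\<ge>n0. a * int n + b \<in> S n \<and> (\<forall>j\<in>S n. a * int n + b \<le> j))" by blast
next
  fix a b n0 assume a: "a \<in> D" and n0: "\<forall>n\<ge>n0. a * int n + b \<in> S (n + e) \<and> (\<forall>j\<in>S (n + e). a * int n + b \<le> j)"
  have "a * int n + (b - a * int e) \<in> S n \<and> (\<forall>j\<in>S n. a * int n + (b - a * int e) \<le> j)" if "n \<ge> n0 + e" for n
  proof -
    have eq: "a * int (n - e) + b = a * int n + (b - a * int e)" using that by (simp add: of_nat_diff algebra_simps)
    show ?thesis unfolding eq[symmetric] using n0[rule_format, of "n - e"] that by (simp del: of_nat_diff)
  qed
  then show "(\<exists>n0. \<forall>n\<ge>n0. S n = {}) \<or>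
    (\<exists>a\<in>D. \<exists>b n0. \<forall>n\<ge>n0. a * int n + b \<in> S n \<and> (\<forall>j\<in>S n. a * int n + b \<le> j))" using a by blast
qed

section \<open>Linear maps, kernels and lifted combinations\<close>

context module
begin

lemma stable_family_const:
  assumes "submodule B R M" "set ys \<subseteq> carrier R"
  shows "stable_family R M ys (\<lambda>n. B)"
  using assms submodule_smult[OF assms(1)] by (auto simp: stable_family_def)

lemma submodule_kernel:
  assumes Y: "module R Y" and g: "g \<in> linear_maps R M Y" and V: "submodule V R Y"
  shows "submodule {x \<in> carrier M. g x \<in> V} R M"
proof -
  interpret Y: module R Y by (rule Y)
  have add: "x \<in> carrier M \<Longrightarrow> y \<in> carrier M \<Longrightarrow> g (x \<oplus>\<^bsub>M\<^esub> y) = g x \<oplus>\<^bsub>Y\<^esub> g y"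
    and smult: "a \<in> carrier R \<Longrightarrow> x \<in> carrier M \<Longrightarrow> g (a \<odot>\<^bsub>M\<^esub> x) = a \<odot>\<^bsub>Y\<^esub> g x"
    and closed: "x \<in> carrier M \<Longrightarrow> g x \<in> carrier Y" for a x y
    using g by (auto simp: linear_maps_def)
  show ?thesis
  proof (rule submoduleI)
    have "g \<zero>\<^bsub>M\<^esub> = \<zero>\<^bsub>R\<^esub> \<odot>\<^bsub>Y\<^esub> g \<zero>\<^bsub>M\<^esub>" using smult[of "\<zero>\<^bsub>R\<^esub>" "\<zero>\<^bsub>M\<^esub>"] by simp
    then show "\<zero>\<^bsub>M\<^esub> \<in> {x \<in> carrier M. g x \<in> V}"
      using closed[of "\<zero>\<^bsub>M\<^esub>"] Y.submodule_zero[OF V] by simp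
    show "\<ominus>\<^bsub>M\<^esub> x \<in> {x \<in> carrier M. g x \<in> V}" if "x \<in> {x \<in> carrier M. g x \<in> V}" for x
    proof -
      have "\<ominus>\<^bsub>M\<^esub> x = (\<ominus>\<^bsub>R\<^esub> \<one>\<^bsub>R\<^esub>) \<odot>\<^bsub>M\<^esub> x" using that by (simp add: smult_l_minus)
      then show ?thesis using that smult[of "\<ominus>\<^bsub>R\<^esub> \<one>\<^bsub>R\<^esub>" x] Y.submodule_smult[OF V, of "\<ominus>\<^bsub>R\<^esub> \<one>\<^bsub>R\<^esub>" "g x"] by simp
    qed
  qed (use add smult Y.submodule_add[OF V] Y.submodule_smult[OF V] in auto)
qed

lemma linear_maps_zero:
  assumes Y: "module R Y" and g: "g \<in> linear_maps R M Y"
  shows "g \<zero>\<^bsub>M\<^esub> = \<zero>\<^bsub>Y\<^esub>"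
  using submodule_zero[OF submodule_kernel[OF Y g module.zero_submodule[OF Y]]] by simp

lemma linear_maps_diff:
  assumes Y: "module R Y" and g: "g \<in> linear_maps R M Y" and xy: "x \<in> carrier M" "y \<in> carrier M"
  shows "g (x \<ominus>\<^bsub>M\<^esub> y) = g x \<ominus>\<^bsub>Y\<^esub> g y"
proof -
  interpret Y: module R Y by (rule Y)
  have gc: "g x \<in> carrier Y" "g y \<in> carrier Y" using g xy by (auto simp: linear_maps_def)
  have "\<ominus>\<^bsub>M\<^esub> y = (\<ominus>\<^bsub>R\<^esub> \<one>\<^bsub>R\<^esub>) \<odot>\<^bsub>M\<^esub> y" using xy by (simp add: smult_l_minus)
  moreover have "g ((\<ominus>\<^bsub>R\<^esub> \<one>\<^bsub>R\<^esub>) \<odot>\<^bsub>M\<^esub> y) = (\<ominus>\<^bsub>R\<^esub> \<one>\<^bsub>R\<^esub>) \<odot>\<^bsub>Y\<^esub> g y"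
    using g xy by (simp add: linear_maps_def)
  ultimately have "g (\<ominus>\<^bsub>M\<^esub> y) = \<ominus>\<^bsub>Y\<^esub> g y" using gc by (simp add: Y.smult_l_minus)
  then show ?thesis using g xy by (simp add: linear_maps_def a_minus_def)
qed

lemma lin_comb_lift:
  assumes Y: "module R Y" and g: "g \<in> linear_maps R M Y" and ys: "set ys \<subseteq> carrier R"
    and V: "submodule V R M" and w: "w \<in> lin_comb Y ys (g ` V)"
  shows "\<exists>u\<in>lin_comb M ys V. g u = w"
  using ys w
proof (induction ys arbitrary: w)
  case Nil
  then show ?case using linear_maps_zero[OF Y g] by simp
next
  case (Cons y ys)
  then obtain v w' where vw: "v \<in> V" "w' \<in> lin_comb Y ys (g ` V)" "w = y \<odot>\<^bsub>Y\<^esub> g v \<oplus>\<^bsub>Y\<^esub> w'" by auto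
  then obtain u where u: "u \<in> lin_comb M ys V" "g u = w'" using Cons by auto
  have "v \<in> carrier M" "u \<in> carrier M" "y \<in> carrier R"
    using vw u Cons.prems submodule_mem[OF V] submodule_mem[OF submodule_lin_comb[OF V]] by auto
  then have "g (y \<odot>\<^bsub>M\<^esub> v \<oplus>\<^bsub>M\<^esub> u) = w" using g u vw by (simp add: linear_maps_def)
  then show ?case using vw u by auto
qed

end

section \<open>Bounds of Artin-Rees type\<close>

context rees_setting
begin

text \<open>From level c on, each level of \<open>T\<close> comes from I times the one before,
  modulo \<open>B\<close>. So l steps put a factor I^l in front, and \<open>E l\<close> contains I^l
  times the whole module since \<open>E 0\<close> is everything.\<close>

lemma eventually_in_power:
  assumes E: "stable_family R M ys E" "E 0 = carrier M" and B: "submodule B R M"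
    and T: "\<And>n. n \<ge> c \<Longrightarrow> T (Suc n) \<subseteq> B <+>\<^bsub>M\<^esub> lin_comb M ys (T n)" "T c \<subseteq> carrier M"
  shows "T (c + l) \<subseteq> B <+>\<^bsub>M\<^esub> E l"
proof (induction l)
  case 0
  then show ?case using T(2) set_add_right[OF B stable_familyD(1)[OF E(1)], of _ 0] E(2) by auto
next
  case (Suc l)
  note Esub = stable_familyD(1)[OF E(1)]
  have sub: "submodule (B <+>\<^bsub>M\<^esub> E (Suc l)) R M" by (intro submodule_set_add B Esub)
  have "lin_comb M ys (T (c + l)) \<subseteq> B <+>\<^bsub>M\<^esub> E (Suc l)"
  proof (rule lin_comb_least[OF sub])
    fix y v assume y: "y \<in> set ys" and "v \<in> T (c + l)"
    then have "v \<in> B <+>\<^bsub>M\<^esub> E l" using Suc by blast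
    then show "y \<odot>\<^bsub>M\<^esub> v \<in> B <+>\<^bsub>M\<^esub> E (Suc l)"
      using stable_familyD(2)[OF stable_family_set_add[OF ys stable_family_const[OF B ys] E(1)] y] by blast
  qed
  moreover have "B \<subseteq> B <+>\<^bsub>M\<^esub> E (Suc l)" using set_add_left[OF B Esub] by blast
  ultimately have "B <+>\<^bsub>M\<^esub> lin_comb M ys (T (c + l)) \<subseteq> B <+>\<^bsub>M\<^esub> E (Suc l)"
    by (intro set_add_least[OF sub])
  then show ?case using T(1)[of "c + l"] by auto
qed

text \<open>With \<open>Z\<close> a submodule of \<open>M\<close> on which \<open>(0 :\<^bsub>Z/B\<^esub> I) = 0\<close>, the map \<open>w \<mapsto> (y w)\<^sub>y\<close> embeds \<open>Z / B\<close> into a finite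
  power of \<open>M / B\<close>, and the Artin-Rees lemma there bounds \<open>(I\<^sup>n : I)\<close>.\<close>

lemma colon_power_bound:
  assumes noeth_pow: "noetherian_module R (pow_module M (set ys))"
    and E: "stable_family R M ys E" "E 0 = carrier M" "\<And>n. E (Suc n) \<subseteq> lin_comb M ys (E n)"
    and B: "submodule B R M" and Z: "submodule Z R M" and BZ: "B \<subseteq> Z"
    and regular: "\<And>w. w \<in> Z \<Longrightarrow> (\<And>y. y \<in> set ys \<Longrightarrow> y \<odot>\<^bsub>M\<^esub> w \<in> B) \<Longrightarrow> w \<in> B"
  shows "\<exists>c. \<forall>l. {w \<in> Z. \<forall>y\<in>set ys. y \<odot>\<^bsub>M\<^esub> w \<in> B <+>\<^bsub>M\<^esub> E (c + l)} \<subseteq> B <+>\<^bsub>M\<^esub> E l"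
proof -
  interpret P: module R "pow_module M (set ys)" by (rule module_pow_module)
  note Esub = stable_familyD(1)[OF E(1)]
  define Bn where "Bn n = B <+>\<^bsub>M\<^esub> E n" for n
  have Bst: "stable_family R M ys Bn"
    unfolding Bn_def by (rule stable_family_set_add[OF ys stable_family_const[OF B ys] E(1)])
  note Bnsub = stable_familyD(1)[OF Bst]
  have BBn: "B \<subseteq> Bn n" for n unfolding Bn_def using set_add_left[OF B Esub] by blast
  define T where "T n = {w \<in> Z. \<forall>y\<in>set ys. y \<odot>\<^bsub>M\<^esub> w \<in> Bn n}" for n
  define EE where "EE n = (set ys \<rightarrow>\<^sub>E Bn n)" for n
  define KK where "KK = (set ys \<rightarrow>\<^sub>E B)"
  \<comment> \<open>The tuples (t w), over the generators t, with w in \<open>Z\<close>, taken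
    modulo tuples over \<open>B\<close> and cut down to level n. A fixed submodule is intersected
    with a decreasing family, which is the situation of Artin-Rees; \<open>EE\<close> is the ambient
    family and \<open>KK\<close> the bottom one.\<close>
  define NN where "NN n = {v \<in> EE n. \<exists>w\<in>Z. \<exists>k\<in>KK. v = (\<lambda>t\<in>set ys. t \<odot>\<^bsub>M\<^esub> w \<oplus>\<^bsub>M\<^esub> k t)}" for n
  have Zc: "w \<in> Z \<Longrightarrow> w \<in> carrier M" and Bc: "b \<in> B \<Longrightarrow> b \<in> carrier M" for w b
    using submodule_mem[OF Z] submodule_mem[OF B] by auto
  have EEsub: "submodule (EE n) R (pow_module M (set ys))" for n
    unfolding EE_def by (rule submodule_pow[OF Bnsub])
  have KKsub: "submodule KK R (pow_module M (set ys))"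
    unfolding KK_def by (rule submodule_pow[OF B])
  have EEst: "stable_family R (pow_module M (set ys)) ys EE"
    unfolding stable_family_def using EEsub stable_familyD(2)[OF Bst] by (auto simp: EE_def PiE_iff)
  have KKst: "stable_family R (pow_module M (set ys)) ys (\<lambda>n. KK)"
    by (rule P.stable_family_const[OF KKsub ys])
  have image_sub: "submodule {v \<in> carrier (pow_module M (set ys)). \<exists>w\<in>Z. \<exists>k\<in>KK. v = (\<lambda>t\<in>set ys. t \<odot>\<^bsub>M\<^esub> w \<oplus>\<^bsub>M\<^esub> k t)} R (pow_module M (set ys))"
    (is "submodule ?I R _")
  proof -
    have add: "u \<oplus>\<^bsub>pow_module M (set ys)\<^esub> v \<in> ?I" if u: "u \<in> ?I" and v: "v \<in> ?I" for u v
    proof -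
      obtain w k w' k' where *: "w \<in> Z" "k \<in> KK" "u = (\<lambda>t\<in>set ys. t \<odot>\<^bsub>M\<^esub> w \<oplus>\<^bsub>M\<^esub> k t)"
        "w' \<in> Z" "k' \<in> KK" "v = (\<lambda>t\<in>set ys. t \<odot>\<^bsub>M\<^esub> w' \<oplus>\<^bsub>M\<^esub> k' t)" using u v by blast
      have "u \<oplus>\<^bsub>pow_module M (set ys)\<^esub> v =
          (\<lambda>t\<in>set ys. t \<odot>\<^bsub>M\<^esub> (w \<oplus>\<^bsub>M\<^esub> w') \<oplus>\<^bsub>M\<^esub> (k \<oplus>\<^bsub>pow_module M (set ys)\<^esub> k') t)"
        using * Zc Bc ys by (auto simp: fun_eq_iff KK_def PiE_iff smult_r_distr M.a_ac subset_iff)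
      moreover have "u \<oplus>\<^bsub>pow_module M (set ys)\<^esub> v \<in> carrier (pow_module M (set ys))"
        using u v by (intro P.M.a_closed) auto
      ultimately show ?thesis
        using submodule_add[OF Z *(1,4)] P.submodule_add[OF KKsub *(2,5)] by blast
    qed
    have smult: "a \<odot>\<^bsub>pow_module M (set ys)\<^esub> u \<in> ?I" if a: "a \<in> carrier R" and u: "u \<in> ?I" for a u
    proof -
      obtain w k where *: "w \<in> Z" "k \<in> KK" "u = (\<lambda>t\<in>set ys. t \<odot>\<^bsub>M\<^esub> w \<oplus>\<^bsub>M\<^esub> k t)" using u by blast
      have "a \<odot>\<^bsub>pow_module M (set ys)\<^esub> u =
          (\<lambda>t\<in>set ys. t \<odot>\<^bsub>M\<^esub> (a \<odot>\<^bsub>M\<^esub> w) \<oplus>\<^bsub>M\<^esub> (a \<odot>\<^bsub>pow_module M (set ys)\<^esub> k) t)"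
        using * Zc Bc ys a smult_swap[OF a] by (auto simp: fun_eq_iff KK_def PiE_iff smult_r_distr subset_iff)
      moreover have "a \<odot>\<^bsub>pow_module M (set ys)\<^esub> u \<in> carrier (pow_module M (set ys))"
        using a u by (intro P.smult_closed) auto
      ultimately show ?thesis
        using submodule_smult[OF Z a *(1)] P.submodule_smult[OF KKsub a *(2)] by blast
    qed
    show ?thesis
    proof (rule P.submoduleI)
      have "\<zero>\<^bsub>pow_module M (set ys)\<^esub> = (\<lambda>t\<in>set ys. t \<odot>\<^bsub>M\<^esub> \<zero>\<^bsub>M\<^esub> \<oplus>\<^bsub>M\<^esub> \<zero>\<^bsub>pow_module M (set ys)\<^esub> t)"
        using ys by (auto simp: fun_eq_iff subset_iff)
      then show "\<zero>\<^bsub>pow_module M (set ys)\<^esub> \<in> ?I"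
        using submodule_zero[OF Z] P.submodule_zero[OF KKsub] P.M.zero_closed by blast
      show "\<ominus>\<^bsub>pow_module M (set ys)\<^esub> u \<in> ?I" if u: "u \<in> ?I" for u
      proof -
        have "\<ominus>\<^bsub>pow_module M (set ys)\<^esub> u = (\<ominus>\<^bsub>R\<^esub> \<one>\<^bsub>R\<^esub>) \<odot>\<^bsub>pow_module M (set ys)\<^esub> u"
          using u P.smult_l_minus[of "\<one>\<^bsub>R\<^esub>" u] P.smult_one[of u] by (metis (no_types, lifting) R.one_closed mem_Collect_eq)
        then show ?thesis using smult[OF _ u, of "\<ominus>\<^bsub>R\<^esub> \<one>\<^bsub>R\<^esub>"] by simp
      qed
    qed (use add smult in auto)
  qed
  have NN: "NN n = EE n \<inter> ?I" for n
    using P.submodule_mem[OF EEsub] by (auto simp: NN_def)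
  have NNsub: "submodule (NN n) R (pow_module M (set ys))" for n
    unfolding NN by (rule P.submodule_Int[OF EEsub image_sub])
  have NNst: "stable_family R (pow_module M (set ys)) ys NN"
    unfolding stable_family_def
  proof (intro conjI allI ballI NNsub)
    fix n y v assume y: "y \<in> set ys" and v: "v \<in> NN n"
    then show "y \<odot>\<^bsub>pow_module M (set ys)\<^esub> v \<in> NN (Suc n)"
      using P.stable_familyD(2)[OF EEst y] P.submodule_smult[OF image_sub] ys unfolding NN by blast
  qed
  have KN: "KK \<subseteq> NN n" for n
  proof
    fix k assume k: "k \<in> KK"
    have "k = (\<lambda>t\<in>set ys. t \<odot>\<^bsub>M\<^esub> \<zero>\<^bsub>M\<^esub> \<oplus>\<^bsub>M\<^esub> k t)"
      using k ys Bc by (auto simp: fun_eq_iff KK_def PiE_iff extensional_def subset_iff)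
    moreover have "k \<in> EE n" using k BBn[of n] by (auto simp: EE_def KK_def PiE_iff)
    ultimately show "k \<in> NN n" unfolding NN_def using k submodule_zero[OF Z] by blast
  qed
  have "eventually_generated (pow_module M (set ys)) ys (\<lambda>n. KK) EE"
    unfolding eventually_generated_def
  proof (intro exI[of _ 0] allI impI subsetI)
    fix n v assume v: "v \<in> EE (Suc n)"
    have "\<forall>t\<in>set ys. \<exists>b u. b \<in> B \<and> u \<in> lin_comb M ys (E n) \<and> v t = u \<oplus>\<^bsub>M\<^esub> b"
    proof
      fix t assume "t \<in> set ys"
      then have "v t \<in> B <+>\<^bsub>M\<^esub> E (Suc n)" using v by (auto simp: EE_def Bn_def)
      then obtain b u where bu: "b \<in> B" "u \<in> E (Suc n)" "v t = b \<oplus>\<^bsub>M\<^esub> u" by (auto simp: in_set_add)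
      then have "v t = u \<oplus>\<^bsub>M\<^esub> b" using Bc submodule_mem[OF Esub] by (simp add: M.a_comm)
      then show "\<exists>b u. b \<in> B \<and> u \<in> lin_comb M ys (E n) \<and> v t = u \<oplus>\<^bsub>M\<^esub> b"
        using bu E(3) by blast
    qed
    then obtain b u where bu: "\<And>t. t \<in> set ys \<Longrightarrow> b t \<in> B \<and> u t \<in> lin_comb M ys (E n) \<and> v t = u t \<oplus>\<^bsub>M\<^esub> b t"
      by metis
    have eq: "v = restrict u (set ys) \<oplus>\<^bsub>pow_module M (set ys)\<^esub> restrict b (set ys)"
      using v bu by (auto simp: EE_def PiE_iff extensional_def fun_eq_iff)
    have "restrict u (set ys) \<in> set ys \<rightarrow>\<^sub>E lin_comb M ys (E n)" using bu by auto
    then have "restrict u (set ys) \<in> lin_comb (pow_module M (set ys)) ys (set ys \<rightarrow>\<^sub>E E n)"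
      using lin_comb_pow_subset by blast
    moreover have "(set ys \<rightarrow>\<^sub>E E n) \<subseteq> EE n"
      unfolding EE_def Bn_def using set_add_right[OF B Esub] by (intro PiE_mono) blast
    ultimately have "restrict u (set ys) \<in> lin_comb (pow_module M (set ys)) ys (EE n)"
      using P.lin_comb_mono[of "set ys \<rightarrow>\<^sub>E E n" "EE n" ys] by blast
    moreover have "restrict b (set ys) \<in> KK" using bu by (auto simp: KK_def)
    ultimately show "v \<in> lin_comb (pow_module M (set ys)) ys (EE n) <+>\<^bsub>pow_module M (set ys)\<^esub> KK"
      unfolding eq by (rule P.in_set_addI)
  qed
  from P.eventually_generated_subfamily[OF noeth_pow ys EEst KKst NNst KN _ this]
  obtain c where c: "\<And>n. n \<ge> c \<Longrightarrow>
      NN (Suc n) \<subseteq> lin_comb (pow_module M (set ys)) ys (NN n) <+>\<^bsub>pow_module M (set ys)\<^esub> KK"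
    by (auto simp: eventually_generated_def NN_def)
  have Tsub: "submodule (T n) R M" for n
  proof -
    have "T n = Z \<inter> {w \<in> carrier M. \<forall>y\<in>set ys. y \<odot>\<^bsub>M\<^esub> w \<in> Bn n}" using Zc by (auto simp: T_def)
    moreover have "submodule {w \<in> carrier M. \<forall>y\<in>set ys. y \<odot>\<^bsub>M\<^esub> w \<in> Bn n} R M"
      using ys submodule_zero[OF Bnsub] submodule_add[OF Bnsub] submodule_neg[OF Bnsub] submodule_smult[OF Bnsub]
      by (intro submoduleI) (auto simp: subset_iff smult_r_distr smult_r_minus smult_swap)
    ultimately show ?thesis using submodule_Int[OF Z] by simp
  qed
  \<comment> \<open>Pulls generation back from tuples to \<open>Z\<close>: a combination of tuples
    (t w) comes from the same combination of the elements w, up to tuples over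
    \<open>B\<close>.\<close>
  have lift: "\<exists>w'\<in>lin_comb M zs (T n). \<exists>k\<in>KK. u = (\<lambda>t\<in>set ys. t \<odot>\<^bsub>M\<^esub> w' \<oplus>\<^bsub>M\<^esub> k t)"
    if "set zs \<subseteq> set ys" "u \<in> lin_comb (pow_module M (set ys)) zs (NN n)" for zs u n
    using that
  proof (induction zs arbitrary: u)
    case Nil
    have "u = (\<lambda>t\<in>set ys. t \<odot>\<^bsub>M\<^esub> \<zero>\<^bsub>M\<^esub> \<oplus>\<^bsub>M\<^esub> \<zero>\<^bsub>pow_module M (set ys)\<^esub> t)"
      using Nil ys by (auto simp: fun_eq_iff subset_iff)
    then show ?case using P.submodule_zero[OF KKsub] by (metis lin_comb.simps(1) singletonI)
  next
    case (Cons y zs)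
    then obtain v u' where vu: "v \<in> NN n" "u' \<in> lin_comb (pow_module M (set ys)) zs (NN n)"
      "u = y \<odot>\<^bsub>pow_module M (set ys)\<^esub> v \<oplus>\<^bsub>pow_module M (set ys)\<^esub> u'" by auto
    have "set zs \<subseteq> set ys" using Cons.prems by simp
    from Cons.IH[OF this vu(2)] obtain w' k'
      where w': "w' \<in> lin_comb M zs (T n)" "k' \<in> KK" "u' = (\<lambda>t\<in>set ys. t \<odot>\<^bsub>M\<^esub> w' \<oplus>\<^bsub>M\<^esub> k' t)"
      by blast
    obtain w k where w: "w \<in> Z" "k \<in> KK" "v = (\<lambda>t\<in>set ys. t \<odot>\<^bsub>M\<^esub> w \<oplus>\<^bsub>M\<^esub> k t)" "v \<in> EE n"
      using vu by (auto simp: NN_def)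
    have yc: "y \<in> carrier R" "set zs \<subseteq> carrier R" using Cons.prems ys by auto
    have wT: "w \<in> T n"
      unfolding T_def
    proof (intro CollectI conjI ballI w(1))
      fix t assume t: "t \<in> set ys"
      have "k t \<in> Bn n" using w(2) t BBn by (auto simp: KK_def PiE_iff)
      moreover have "k t \<oplus>\<^bsub>M\<^esub> t \<odot>\<^bsub>M\<^esub> w \<in> Bn n"
      proof -
        have "v t \<in> Bn n" using w(4) t by (auto simp: EE_def)
        moreover have "k t \<in> carrier M" "t \<odot>\<^bsub>M\<^esub> w \<in> carrier M"
          using w t ys Zc Bc by (auto simp: KK_def PiE_iff)
        ultimately show ?thesis using w(3) t by (simp add: M.a_comm)
      qed
      ultimately show "t \<odot>\<^bsub>M\<^esub> w \<in> Bn n"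
        using submodule_add_cancel[OF Bnsub] t ys w(1) Zc by (metis smult_closed subsetD)
    qed
    have w'c: "w' \<in> carrier M"
      using w'(1) submodule_mem[OF submodule_lin_comb[OF Tsub yc(2)]] by blast
    have "u = (\<lambda>t\<in>set ys. t \<odot>\<^bsub>M\<^esub> (y \<odot>\<^bsub>M\<^esub> w \<oplus>\<^bsub>M\<^esub> w') \<oplus>\<^bsub>M\<^esub>
        (y \<odot>\<^bsub>pow_module M (set ys)\<^esub> k \<oplus>\<^bsub>pow_module M (set ys)\<^esub> k') t)"
    proof
      fix t
      show "u t = (\<lambda>t\<in>set ys. t \<odot>\<^bsub>M\<^esub> (y \<odot>\<^bsub>M\<^esub> w \<oplus>\<^bsub>M\<^esub> w') \<oplus>\<^bsub>M\<^esub>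
        (y \<odot>\<^bsub>pow_module M (set ys)\<^esub> k \<oplus>\<^bsub>pow_module M (set ys)\<^esub> k') t) t"
      proof (cases "t \<in> set ys")
        case t: True
        have "t \<in> carrier R" "k t \<in> carrier M" "k' t \<in> carrier M" "w \<in> carrier M"
          using t ys w w' Bc Zc by (auto simp: KK_def PiE_iff)
        then show ?thesis
          using t yc w'c by (simp add: vu(3) w(3) w'(3) smult_r_distr smult_swap[of y t] M.a_ac)
      qed (simp add: vu(3))
    qed
    moreover have "y \<odot>\<^bsub>M\<^esub> w \<oplus>\<^bsub>M\<^esub> w' \<in> lin_comb M (y # zs) (T n)" using wT w' by auto
    moreover have "y \<odot>\<^bsub>pow_module M (set ys)\<^esub> k \<oplus>\<^bsub>pow_module M (set ys)\<^esub> k' \<in> KK"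
      by (rule P.submodule_add[OF KKsub P.submodule_smult[OF KKsub yc(1) w(2)] w'(2)])
    ultimately show ?case by blast
  qed
  have "T (Suc n) \<subseteq> B <+>\<^bsub>M\<^esub> lin_comb M ys (T n)" if n: "n \<ge> c" for n
  proof
    fix w assume w: "w \<in> T (Suc n)"
    have wZ: "w \<in> Z" using w by (auto simp: T_def)
    define v where "v = (\<lambda>t\<in>set ys. t \<odot>\<^bsub>M\<^esub> w)"
    have "v = (\<lambda>t\<in>set ys. t \<odot>\<^bsub>M\<^esub> w \<oplus>\<^bsub>M\<^esub> \<zero>\<^bsub>pow_module M (set ys)\<^esub> t)"
      using Zc[OF wZ] ys by (auto simp: v_def fun_eq_iff subset_iff)
    moreover have "v \<in> EE (Suc n)" using w by (auto simp: v_def EE_def T_def)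
    ultimately have "v \<in> NN (Suc n)"
      unfolding NN_def using wZ P.submodule_zero[OF KKsub] by blast
    then obtain u k where uk: "u \<in> lin_comb (pow_module M (set ys)) ys (NN n)" "k \<in> KK"
      "v = u \<oplus>\<^bsub>pow_module M (set ys)\<^esub> k"
      using c[OF n] by (force simp: P.in_set_add)
    obtain w' k' where w': "w' \<in> lin_comb M ys (T n)" "k' \<in> KK" "u = (\<lambda>t\<in>set ys. t \<odot>\<^bsub>M\<^esub> w' \<oplus>\<^bsub>M\<^esub> k' t)"
      using lift[OF subset_refl uk(1)] by blast
    have "lin_comb M ys (T n) \<subseteq> Z"
      using submodule_smult[OF Z] ys by (intro lin_comb_least[OF Z]) (auto simp: T_def)
    then have w'Z: "w' \<in> Z" using w' by blast
    have c: "w \<in> carrier M" "w' \<in> carrier M" using wZ w'Z Zc by auto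
    \<comment> \<open>All generators send w - w' into \<open>B\<close>, so \<open>regular\<close>
      applies. This is the injectivity of the embedding of Z / B into a power of M / B.\<close>
    have "w \<ominus>\<^bsub>M\<^esub> w' \<in> B"
    proof (rule regular[OF submodule_diff[OF Z wZ w'Z]])
      fix y assume y: "y \<in> set ys"
      have k: "k y \<in> B" "k' y \<in> B" "k y \<in> carrier M" "k' y \<in> carrier M" "y \<in> carrier R"
        using uk w' y Bc ys by (auto simp: KK_def PiE_iff)
      have "y \<odot>\<^bsub>M\<^esub> w = v y" using y by (simp add: v_def)
      also have "\<dots> = y \<odot>\<^bsub>M\<^esub> w' \<oplus>\<^bsub>M\<^esub> k' y \<oplus>\<^bsub>M\<^esub> k y" using y by (simp add: uk(3) w'(3))
      finally have eq: "y \<odot>\<^bsub>M\<^esub> w = y \<odot>\<^bsub>M\<^esub> w' \<oplus>\<^bsub>M\<^esub> k' y \<oplus>\<^bsub>M\<^esub> k y" .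
      have "y \<odot>\<^bsub>M\<^esub> (w \<ominus>\<^bsub>M\<^esub> w') = \<ominus>\<^bsub>M\<^esub> (y \<odot>\<^bsub>M\<^esub> w') \<oplus>\<^bsub>M\<^esub> (y \<odot>\<^bsub>M\<^esub> w' \<oplus>\<^bsub>M\<^esub> (k' y \<oplus>\<^bsub>M\<^esub> k y))"
        using k c eq by (simp add: a_minus_def smult_r_distr smult_r_minus M.a_ac)
      also have "\<dots> = k' y \<oplus>\<^bsub>M\<^esub> k y" using k c by (intro M.r_neg1) auto
      finally show "y \<odot>\<^bsub>M\<^esub> (w \<ominus>\<^bsub>M\<^esub> w') \<in> B" using k submodule_add[OF B] by simp
    qed
    moreover have "w = (w \<ominus>\<^bsub>M\<^esub> w') \<oplus>\<^bsub>M\<^esub> w'" using c by (simp add: a_minus_def M.a_assoc M.l_neg)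
    ultimately show "w \<in> B <+>\<^bsub>M\<^esub> lin_comb M ys (T n)" using w' in_set_addI by metis
  qed
  from eventually_in_power[where T = T and c = c, OF E(1,2) B this] have "T (c + l) \<subseteq> B <+>\<^bsub>M\<^esub> E l" for l
    using submodule_mem[OF Tsub] by blast
  then show ?thesis unfolding T_def Bn_def by blast
qed

lemma parts_closed_set_add:
  assumes "submodule B R M" "parts_closed mp B" "submodule C R M" "parts_closed mp C"
  shows "parts_closed mp (B <+>\<^bsub>M\<^esub> C)"
  unfolding parts_closed_def
proof (intro ballI allI)
  fix x j assume "x \<in> B <+>\<^bsub>M\<^esub> C"
  then obtain b c where bc: "b \<in> B" "c \<in> C" "x = b \<oplus>\<^bsub>M\<^esub> c" by (auto simp: in_set_add)
  then have "mp j x = mp j b \<oplus>\<^bsub>M\<^esub> mp j c"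
    using submodule_mem[OF assms(1)] submodule_mem[OF assms(3)] by (simp add: mp_add)
  then show "mp j x \<in> B <+>\<^bsub>M\<^esub> C"
    using bc assms(2,4) in_set_addI by (auto simp: parts_closed_def)
qed

text \<open>Artin-Rees for the image of g: in high levels its intersection with \<open>EY\<close> is
  I times the previous intersection. Lifting through g turns this into a statement about preimages
  modulo the kernel. With a differential as g and the tuples over I^n M as \<open>EY n\<close>, it
  compares cycles modulo I^n M with true cycles.\<close>

lemma preimage_power_bound:
  assumes Y: "module R Y" "noetherian_module R Y" and g: "g \<in> linear_maps R M Y"
    and EY: "stable_family R Y ys EY" "eventually_generated Y ys (\<lambda>n. {\<zero>\<^bsub>Y\<^esub>}) EY"
    and E: "stable_family R M ys E" "E 0 = carrier M"
  shows "\<exists>c. \<forall>l. {z \<in> carrier M. g z \<in> EY (c + l)} \<subseteq> {z \<in> carrier M. g z = \<zero>\<^bsub>Y\<^esub>} <+>\<^bsub>M\<^esub> E l"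
proof -
  interpret Y: module R Y by (rule Y(1))
  note EYsub = Y.stable_familyD(1)[OF EY(1)]
  have gsmult: "\<And>a x. a \<in> carrier R \<Longrightarrow> x \<in> carrier M \<Longrightarrow> g (a \<odot>\<^bsub>M\<^esub> x) = a \<odot>\<^bsub>Y\<^esub> g x"
    and gc: "\<And>x. x \<in> carrier M \<Longrightarrow> g x \<in> carrier Y"
    using g by (auto simp: linear_maps_def)
  define Zn where "Zn n = {z \<in> carrier M. g z \<in> EY n}" for n
  \<comment> \<open>This is the intersection of the image of g with \<open>EY n\<close>.\<close>
  define N where "N n = g ` Zn n" for n
  have Z: "submodule {z \<in> carrier M. g z = \<zero>\<^bsub>Y\<^esub>} R M"
    using submodule_kernel[OF Y(1) g Y.zero_submodule] by simp
  have Zn: "submodule (Zn n) R M" for n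
    unfolding Zn_def by (rule submodule_kernel[OF Y(1) g EYsub])
  have N: "submodule (N n) R Y" for n
  proof (rule Y.submoduleI)
    show "N n \<subseteq> carrier Y" using gc by (auto simp: N_def Zn_def)
    show "\<zero>\<^bsub>Y\<^esub> \<in> N n"
      unfolding N_def using linear_maps_zero[OF Y(1) g] submodule_zero[OF Zn] by (metis imageI)
    show "u \<oplus>\<^bsub>Y\<^esub> v \<in> N n" if u: "u \<in> N n" and v: "v \<in> N n" for u v
    proof -
      obtain x y where xy: "x \<in> Zn n" "u = g x" "y \<in> Zn n" "v = g y" using u v by (auto simp: N_def)
      then have "u \<oplus>\<^bsub>Y\<^esub> v = g (x \<oplus>\<^bsub>M\<^esub> y)" using g by (simp add: linear_maps_def Zn_def)
      then show ?thesis unfolding N_def using submodule_add[OF Zn xy(1,3)] by blast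
    qed
    show smult: "a \<odot>\<^bsub>Y\<^esub> u \<in> N n" if a: "a \<in> carrier R" and u: "u \<in> N n" for a u
    proof -
      obtain x where x: "x \<in> Zn n" "u = g x" using u by (auto simp: N_def)
      then have "a \<odot>\<^bsub>Y\<^esub> u = g (a \<odot>\<^bsub>M\<^esub> x)" using gsmult[OF a] by (simp add: Zn_def)
      then show ?thesis unfolding N_def using submodule_smult[OF Zn a x(1)] by blast
    qed
    show "\<ominus>\<^bsub>Y\<^esub> u \<in> N n" if u: "u \<in> N n" for u
    proof -
      have "u \<in> carrier Y" using u gc by (auto simp: N_def Zn_def)
      then show ?thesis using smult[OF _ u, of "\<ominus> \<one>"] by (simp add: Y.smult_l_minus)
    qed
  qed
  have Nst: "stable_family R Y ys N"
    unfolding stable_family_def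
  proof (intro conjI allI ballI N)
    fix n y v assume y: "y \<in> set ys" and v: "v \<in> N n"
    obtain x where x: "x \<in> Zn n" "v = g x" using v by (auto simp: N_def)
    have "y \<in> carrier R" using y ys by blast
    then have "y \<odot>\<^bsub>M\<^esub> x \<in> Zn (Suc n)" "g (y \<odot>\<^bsub>M\<^esub> x) = y \<odot>\<^bsub>Y\<^esub> v"
      using x gsmult Y.stable_familyD(2)[OF EY(1) y] by (auto simp: Zn_def)
    then show "y \<odot>\<^bsub>Y\<^esub> v \<in> N (Suc n)" unfolding N_def by (metis imageI)
  qed
  have zst: "stable_family R Y ys (\<lambda>n. {\<zero>\<^bsub>Y\<^esub>})" by (rule Y.stable_family_const[OF Y.zero_submodule ys])
  have "N n \<subseteq> EY n" for n by (auto simp: N_def Zn_def)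
  from Y.eventually_generated_subfamily[OF Y(2) ys EY(1) zst Nst _ this EY(2)] Y.submodule_zero[OF N]
  obtain c where c: "\<And>n. n \<ge> c \<Longrightarrow> N (Suc n) \<subseteq> lin_comb Y ys (N n) <+>\<^bsub>Y\<^esub> {\<zero>\<^bsub>Y\<^esub>}"
    by (auto simp: eventually_generated_def)
  have step: "Zn (Suc n) \<subseteq> {z \<in> carrier M. g z = \<zero>\<^bsub>Y\<^esub>} <+>\<^bsub>M\<^esub> lin_comb M ys (Zn n)" if n: "n \<ge> c" for n
  proof
    fix z assume z: "z \<in> Zn (Suc n)"
    then have zc: "z \<in> carrier M" by (simp add: Zn_def)
    have "g z \<in> lin_comb Y ys (N n) <+>\<^bsub>Y\<^esub> {\<zero>\<^bsub>Y\<^esub>}" using c[OF n] z by (auto simp: N_def)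
    then have "g z \<in> lin_comb Y ys (N n)"
      using Y.submodule_mem[OF Y.submodule_lin_comb[OF N ys]] by (auto simp: Y.in_set_add)
    then obtain u where u: "u \<in> lin_comb M ys (Zn n)" "g u = g z"
      using lin_comb_lift[OF Y(1) g ys Zn] by (auto simp: N_def)
    have uc: "u \<in> carrier M" using u submodule_mem[OF submodule_lin_comb[OF Zn ys]] by blast
    have "g (z \<ominus>\<^bsub>M\<^esub> u) = \<zero>\<^bsub>Y\<^esub>"
      using linear_maps_diff[OF Y(1) g zc uc] u gc[OF zc] by (simp add: a_minus_def Y.M.r_neg)
    then have "z \<ominus>\<^bsub>M\<^esub> u \<in> {z \<in> carrier M. g z = \<zero>\<^bsub>Y\<^esub>}" using zc uc by simp
    moreover have "z = (z \<ominus>\<^bsub>M\<^esub> u) \<oplus>\<^bsub>M\<^esub> u" using zc uc by (simp add: a_minus_def M.a_assoc M.l_neg)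
    ultimately show "z \<in> {z \<in> carrier M. g z = \<zero>\<^bsub>Y\<^esub>} <+>\<^bsub>M\<^esub> lin_comb M ys (Zn n)"
      using u in_set_addI by metis
  qed
  have "Zn (c + l) \<subseteq> {z \<in> carrier M. g z = \<zero>\<^bsub>Y\<^esub>} <+>\<^bsub>M\<^esub> E l" for l
    by (rule eventually_in_power[where T = Zn and c = c, OF E Z step]) (auto simp: Zn_def)
  then show ?thesis unfolding Zn_def by blast
qed

text \<open>A prime \<open>(B\<^sub>n : z)\<close> contains \<open>I\<close>, because \<open>I\<^sup>n\<close> kills the homology. Hence only classes killed by \<open>I\<close>
  matter; by the two bounds above they are represented in \<open>E (n - e)\<close> with \<open>e\<close> fixed, so they form a
  finitely generated module over the Rees algebra.\<close>

theorem homology_prime_degrees_linear: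
  assumes Y: "module R Y" "noetherian_module R Y" and g: "g \<in> linear_maps R M Y"
    and EY: "stable_family R Y ys EY" "eventually_generated Y ys (\<lambda>n. {\<zero>\<^bsub>Y\<^esub>}) EY"
    and g_parts: "\<And>n. parts_closed mp {z \<in> carrier M. g z \<in> EY n}"
    and E: "graded_family E" "E 0 = carrier M" "\<And>n. E (Suc n) \<subseteq> lin_comb M ys (E n)"
    and gE: "\<And>n. g ` E n \<subseteq> EY n"
    and B: "submodule B R M" "parts_closed mp B" "\<And>b. b \<in> B \<Longrightarrow> g b = \<zero>\<^bsub>Y\<^esub>"
    and noeth_pow: "noetherian_module R (pow_module M (set ys))"
    and regular: "\<And>w. \<lbrakk>w \<in> carrier M; g w = \<zero>\<^bsub>Y\<^esub>; \<And>y. y \<in> set ys \<Longrightarrow> y \<odot>\<^bsub>M\<^esub> w \<in> B\<rbrakk> \<Longrightarrow> w \<in> B"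
  shows "eventually_linear (dg ` set ys)
    (\<lambda>n. {j. \<exists>z\<in>{z \<in> carrier M. g z \<in> EY n}. mp j z = z \<and> primeideal (colon R M (B <+>\<^bsub>M\<^esub> E n) z) R})"
proof -
  interpret Y: module R Y by (rule Y(1))
  note Est = graded_familyD(1)[OF E(1)] and Esub = graded_familyD(2)[OF E(1)] and Ec = graded_familyD(5)[OF E(1)]
  note EYsub = Y.stable_familyD(1)[OF EY(1)]
  have Bc: "b \<in> B \<Longrightarrow> b \<in> carrier M" for b using submodule_mem[OF B(1)] .
  have gadd: "\<And>x y. x \<in> carrier M \<Longrightarrow> y \<in> carrier M \<Longrightarrow> g (x \<oplus>\<^bsub>M\<^esub> y) = g x \<oplus>\<^bsub>Y\<^esub> g y"
    and gsmult: "\<And>a x. a \<in> carrier R \<Longrightarrow> x \<in> carrier M \<Longrightarrow> g (a \<odot>\<^bsub>M\<^esub> x) = a \<odot>\<^bsub>Y\<^esub> g x"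
    and gc: "\<And>x. x \<in> carrier M \<Longrightarrow> g x \<in> carrier Y"
    using g by (auto simp: linear_maps_def)
  \<comment> \<open>\<open>Zn n\<close> and \<open>Bn n\<close> are the cycles and boundaries modulo
    level n, lifted to \<open>M\<close>, so that their quotient is the n-th homology.
    \<open>Z\<close> and \<open>B\<close> play the same role for the complex over \<open>M\<close>
    itself.\<close>
  define Zn where "Zn n = {z \<in> carrier M. g z \<in> EY n}" for n
  define Z where "Z = {z \<in> carrier M. g z = \<zero>\<^bsub>Y\<^esub>}"
  define Bn where "Bn n = B <+>\<^bsub>M\<^esub> E n" for n
  have Z: "submodule Z R M" using submodule_kernel[OF Y(1) g Y.zero_submodule] by (simp add: Z_def)
  have Zn: "submodule (Zn n) R M" for n unfolding Zn_def by (rule submodule_kernel[OF Y(1) g EYsub])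
  have BZ: "B \<subseteq> Z" using B(3) Bc by (auto simp: Z_def)
  have Bst: "stable_family R M ys Bn"
    unfolding Bn_def by (rule stable_family_set_add[OF ys stable_family_const[OF B(1) ys] Est])
  note Bnsub = stable_familyD(1)[OF Bst]
  have Bnparts: "parts_closed mp (Bn n)" for n
    unfolding Bn_def by (rule parts_closed_set_add[OF B(1,2) Esub graded_familyD(4)[OF E(1)]])
  have BBn: "B \<subseteq> Bn n" and EBn: "E n \<subseteq> Bn n" for n
    unfolding Bn_def using set_add_left[OF B(1) Esub] set_add_right[OF B(1) Esub] by blast+
  have BnZn: "Bn n \<subseteq> Zn n" for n
    unfolding Bn_def
  proof (rule set_add_least[OF Zn])
    show "B \<subseteq> Zn n" using B(3) Bc Y.submodule_zero[OF EYsub] by (auto simp: Zn_def)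
    show "E n \<subseteq> Zn n" using gE Ec by (auto simp: Zn_def)
  qed
  have Edec: "E (Suc n) \<subseteq> E n" for n
  proof -
    have "lin_comb M ys (E n) \<subseteq> E n"
      using submodule_smult[OF Esub] ys by (intro lin_comb_least[OF Esub]) auto
    then show ?thesis using E(3)[of n] by blast
  qed
  have Emono: "E n \<subseteq> E m" if "m \<le> n" for m n
    using lift_Suc_antimono_le[of E, OF _ that] Edec by blast
  have Bnmono: "Bn n \<subseteq> Bn m" if "m \<le> n" for m n
  proof -
    have "E n \<subseteq> Bn m" using Emono[OF that] EBn by (rule subset_trans)
    from set_add_least[OF Bnsub BBn this] show ?thesis by (simp add: Bn_def[of n])
  qed
  obtain c1 where c1: "\<And>l. Zn (c1 + l) \<subseteq> Z <+>\<^bsub>M\<^esub> E l"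
    using preimage_power_bound[OF Y g EY Est E(2)] unfolding Zn_def Z_def by blast
  obtain c2 where c2: "\<And>l. {w \<in> Z. \<forall>y\<in>set ys. y \<odot>\<^bsub>M\<^esub> w \<in> Bn (c2 + l)} \<subseteq> B <+>\<^bsub>M\<^esub> E l"
    using colon_power_bound[OF noeth_pow Est E(2,3) B(1) Z BZ] regular unfolding Z_def Bn_def by auto
  \<comment> \<open>\<open>c1\<close> is spent on replacing a cycle modulo level n by a true cycle,
    \<open>c2\<close> on the colon by I.\<close>
  define e where "e = c1 + c2"
  \<comment> \<open>z is split into a true cycle w and a remainder u in a high level. The generators
    send both z and u into the boundaries modulo level c2 + l, hence also w, and the colon bound
    applies to w.\<close>
  have bound: "z \<in> B <+>\<^bsub>M\<^esub> E l" if z: "z \<in> Zn (l + e)" "\<And>y. y \<in> set ys \<Longrightarrow> y \<odot>\<^bsub>M\<^esub> z \<in> Bn (l + e)" for z l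
  proof -
    have "z \<in> Z <+>\<^bsub>M\<^esub> E (c2 + l)" using c1[of "c2 + l"] z(1) by (auto simp: e_def add_ac)
    then obtain w u where wu: "w \<in> Z" "u \<in> E (c2 + l)" "z = w \<oplus>\<^bsub>M\<^esub> u" by (auto simp: in_set_add)
    have wuc: "w \<in> carrier M" "u \<in> carrier M" using wu submodule_mem[OF Z] Ec by auto
    have "y \<odot>\<^bsub>M\<^esub> w \<in> Bn (c2 + l)" if y: "y \<in> set ys" for y
    proof -
      have yc: "y \<in> carrier R" using y ys by blast
      have "y \<odot>\<^bsub>M\<^esub> u \<in> Bn (c2 + l)" using submodule_smult[OF Esub yc wu(2)] EBn by blast
      moreover have "y \<odot>\<^bsub>M\<^esub> u \<oplus>\<^bsub>M\<^esub> y \<odot>\<^bsub>M\<^esub> w \<in> Bn (c2 + l)"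
        using z(2)[OF y] Bnmono[of "c2 + l" "l + e"] wu wuc yc
        by (auto simp: e_def smult_r_distr M.a_comm)
      ultimately show ?thesis using submodule_add_cancel[OF Bnsub] wuc yc by blast
    qed
    then have "w \<in> B <+>\<^bsub>M\<^esub> E l" using c2[of l] wu by blast
    moreover have "u \<in> B <+>\<^bsub>M\<^esub> E l"
      using wu Emono[of l "c2 + l"] set_add_right[OF B(1) Esub] by auto
    ultimately show ?thesis using wu submodule_add[OF submodule_set_add[OF B(1) Esub]] by auto
  qed
  \<comment> \<open>Reindexed by e: U m / K m is the part killed by I in the homology of level m +
    e, where \<open>bound\<close> provides representatives in \<open>E m\<close>. In this indexing
    both families are stable and sit inside \<open>E\<close>.\<close>
  define U where "U m = {z \<in> E m. z \<in> Zn (m + e) \<and> (\<forall>y\<in>set ys. y \<odot>\<^bsub>M\<^esub> z \<in> Bn (m + e))}" for m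
  define K where "K m = E m \<inter> Bn (m + e)" for m
  have Znst: "y \<odot>\<^bsub>M\<^esub> z \<in> Zn (Suc n)" if y: "y \<in> set ys" and z: "z \<in> Zn n" for y z n
    using z Y.stable_familyD(2)[OF EY(1) y] gsmult y ys by (auto simp: Zn_def subset_iff)
  have gK: "graded_family K"
    unfolding graded_family_def stable_family_def
  proof (intro conjI allI ballI)
    show "submodule (K n) R M" for n unfolding K_def by (rule submodule_Int[OF Esub Bnsub])
    show "y \<odot>\<^bsub>M\<^esub> v \<in> K (Suc n)" if "y \<in> set ys" "v \<in> K n" for y v n
      using that stable_familyD(2)[OF Est] stable_familyD(2)[OF Bst] by (auto simp: K_def)
    show "parts_closed mp (K n)" for n
      using graded_familyD(3)[OF E(1)] Bnparts by (auto simp: K_def parts_closed_def)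
  qed
  have gU: "graded_family U"
    unfolding graded_family_def stable_family_def
  proof (intro conjI allI ballI)
    have "submodule {w \<in> carrier M. \<forall>y\<in>set ys. y \<odot>\<^bsub>M\<^esub> w \<in> Bn n} R M" for n
      using ys submodule_zero[OF Bnsub] submodule_add[OF Bnsub] submodule_neg[OF Bnsub] submodule_smult[OF Bnsub]
      by (intro submoduleI) (auto simp: subset_iff smult_r_distr smult_r_minus smult_swap)
    from submodule_Int[OF submodule_Int[OF Esub Zn] this]
    have "submodule (E n \<inter> Zn (n + e) \<inter> {w \<in> carrier M. \<forall>y\<in>set ys. y \<odot>\<^bsub>M\<^esub> w \<in> Bn (n + e)}) R M" for n .
    moreover have "U n = E n \<inter> Zn (n + e) \<inter> {w \<in> carrier M. \<forall>y\<in>set ys. y \<odot>\<^bsub>M\<^esub> w \<in> Bn (n + e)}" for n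
      using Ec by (auto simp: U_def)
    ultimately show "submodule (U n) R M" for n by simp
    show "y \<odot>\<^bsub>M\<^esub> v \<in> U (Suc n)" if y: "y \<in> set ys" and v: "v \<in> U n" for y v n
    proof -
      have vc: "v \<in> carrier M" and yc: "y \<in> carrier R" using v Ec y ys by (auto simp: U_def)
      have "t \<odot>\<^bsub>M\<^esub> (y \<odot>\<^bsub>M\<^esub> v) \<in> Bn (Suc n + e)" if t: "t \<in> set ys" for t
      proof -
        have tc: "t \<in> carrier R" using t ys by blast
        have "y \<odot>\<^bsub>M\<^esub> (t \<odot>\<^bsub>M\<^esub> v) \<in> Bn (Suc (n + e))"
          using stable_familyD(2)[OF Bst y] v t by (auto simp: U_def)
        then show ?thesis using smult_swap[OF tc yc vc] by simp
      qed
      then show ?thesis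
        using v stable_familyD(2)[OF Est y] Znst[OF y] by (auto simp: U_def)
    qed
    show "parts_closed mp (U n)" for n
      unfolding parts_closed_def
    proof (intro ballI allI)
      fix v j assume v: "v \<in> U n"
      have vc: "v \<in> carrier M" using v Ec by (auto simp: U_def)
      have "y \<odot>\<^bsub>M\<^esub> mp j v \<in> Bn (n + e)" if y: "y \<in> set ys" for y
      proof -
        have "mp (j + dg y) (y \<odot>\<^bsub>M\<^esub> v) \<in> Bn (n + e)"
          using v y Bnparts by (auto simp: U_def parts_closed_def)
        then show ?thesis using dg_mult[OF y vc, of "j + dg y"] by simp
      qed
      then show "mp j v \<in> U n"
        using v graded_familyD(3)[OF E(1)] g_parts[of "n + e"] by (auto simp: U_def Zn_def parts_closed_def)
    qed
  qed
  have KU: "K \<le> U"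
    using subsetD[OF BnZn] submodule_smult[OF Bnsub] ys by (auto simp: K_def U_def le_fun_def)
  \<comment> \<open>\<open>E\<close> is generated by \<open>ys\<close> from one level to the next,
    all the more so relative to \<open>K\<close>; the basis theorem passes this on to
    \<open>U\<close>.\<close>
  have "eventually_generated M ys K E"
  proof -
    have "lin_comb M ys (E n) \<subseteq> lin_comb M ys (E n) <+>\<^bsub>M\<^esub> K (Suc n)" for n
      using set_add_left[OF submodule_lin_comb[OF Esub ys] graded_familyD(2)[OF gK]] by blast
    then show ?thesis unfolding eventually_generated_def using E(3) by blast
  qed
  then have "eventually_generated M ys K U"
    by (rule eventually_generated_subfamily[OF noeth ys Est graded_familyD(1)[OF gK] graded_familyD(1)[OF gU], rotated 2])
      (use KU in \<open>auto simp: U_def le_fun_def\<close>)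
  from prime_degrees_linear[OF gK gU KU this]
  have lin: "eventually_linear (dg ` set ys) (\<lambda>n. {j. \<exists>x\<in>U n. mp j x = x \<and> primeideal (colon R M (K n) x) R})" .
  have colon_eq: "colon R M (K m) x = colon R M (Bn (m + e)) x" if "x \<in> E m" for x m
    using that submodule_smult[OF Esub] by (auto simp: colon_def K_def)
  have "{j. \<exists>x\<in>U m. mp j x = x \<and> primeideal (colon R M (K m) x) R} =
      {j. \<exists>z\<in>Zn (m + e). mp j z = z \<and> primeideal (colon R M (Bn (m + e)) z) R}" if m: "m \<ge> 1" for m
  proof (intro Collect_cong iffI)
    fix j assume "\<exists>x\<in>U m. mp j x = x \<and> primeideal (colon R M (K m) x) R"
    then show "\<exists>z\<in>Zn (m + e). mp j z = z \<and> primeideal (colon R M (Bn (m + e)) z) R"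
      using colon_eq by (auto simp: U_def)
  next
    fix j assume "\<exists>z\<in>Zn (m + e). mp j z = z \<and> primeideal (colon R M (Bn (m + e)) z) R"
    then obtain z where z: "z \<in> Zn (m + e)" "mp j z = z" and p: "primeideal (colon R M (Bn (m + e)) z) R" by blast
    have zc: "z \<in> carrier M" using z by (simp add: Zn_def)
    \<comment> \<open>y^(m+e) carries z into \<open>E (m + e)\<close>, so it lies in the colon
      ideal; this ideal is prime and therefore contains y.\<close>
    have yz: "y \<odot>\<^bsub>M\<^esub> z \<in> Bn (m + e)" if y: "y \<in> set ys" for y
    proof -
      interpret p: primeideal "colon R M (Bn (m + e)) z" R by (rule p)
      have yc: "y \<in> carrier R" using y ys by blast
      have pow: "(y [^]\<^bsub>R\<^esub> n) \<odot>\<^bsub>M\<^esub> z \<in> E n" for n :: nat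
      proof (induction n)
        case (Suc n)
        have "(y [^]\<^bsub>R\<^esub> Suc n) \<odot>\<^bsub>M\<^esub> z = y \<odot>\<^bsub>M\<^esub> ((y [^]\<^bsub>R\<^esub> n) \<odot>\<^bsub>M\<^esub> z)"
          using yc zc by (simp add: R.m_comm smult_assoc1)
        then show ?case using stable_familyD(2)[OF Est y Suc] by simp
      qed (use zc E(2) in simp)
      have root: "y \<in> colon R M (Bn (m + e)) z" if "y [^]\<^bsub>R\<^esub> n \<in> colon R M (Bn (m + e)) z" for n :: nat
        using that
      proof (induction n)
        case 0
        then show ?case using p.one_imp_carrier p.I_notcarr by simp
      next
        case (Suc n)
        then show ?case using p.I_prime[of "y [^]\<^bsub>R\<^esub> n" y] yc by auto
      qed
      have "y [^]\<^bsub>R\<^esub> (m + e) \<in> colon R M (Bn (m + e)) z"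
        unfolding colon_def using subsetD[OF EBn pow] R.nat_pow_closed[OF yc] by blast
      from root[OF this] show ?thesis unfolding colon_def by blast
    qed
    have "z \<in> B <+>\<^bsub>M\<^esub> E m" using bound[OF z(1) yz] .
    then obtain b u where bu: "b \<in> B" "u \<in> E m" "z = b \<oplus>\<^bsub>M\<^esub> u" by (auto simp: in_set_add)
    \<comment> \<open>The summands of z need not be homogeneous, but z is, so their parts of degree
      j also add up to z. Then u' represents the same class as z modulo \<open>Bn (m + e)\<close>
      and has the same colon ideal.\<close>
    define b' u' where "b' = mp j b" and "u' = mp j u"
    have b'u': "b' \<in> B" "u' \<in> E m" "b' \<in> carrier M" "u' \<in> carrier M" "mp j u' = u'" "z = b' \<oplus>\<^bsub>M\<^esub> u'"
      using bu z(2) Bc Ec B(2) graded_familyD(3)[OF E(1)] mp_add[of b u j]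
      by (auto simp: b'_def u'_def parts_closed_def mp_mp)
    have shift: "a \<odot>\<^bsub>M\<^esub> u' \<in> Bn (m + e) \<longleftrightarrow> a \<odot>\<^bsub>M\<^esub> z \<in> Bn (m + e)" if a: "a \<in> carrier R" for a
    proof -
      have eq: "a \<odot>\<^bsub>M\<^esub> z = a \<odot>\<^bsub>M\<^esub> b' \<oplus>\<^bsub>M\<^esub> a \<odot>\<^bsub>M\<^esub> u'" using b'u' a by (simp add: smult_r_distr)
      have ab: "a \<odot>\<^bsub>M\<^esub> b' \<in> Bn (m + e)" using submodule_smult[OF B(1) a b'u'(1)] BBn by blast
      show ?thesis
        unfolding eq using submodule_add_cancel[OF Bnsub ab] submodule_add[OF Bnsub ab] a b'u'(4) smult_closed by blast
    qed
    then have "colon R M (Bn (m + e)) u' = colon R M (Bn (m + e)) z" by (auto simp: colon_def)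
    then have "colon R M (K m) u' = colon R M (Bn (m + e)) z" using colon_eq[OF b'u'(2)] by simp
    moreover have "u' \<in> U m"
    proof -
      have "b' \<oplus>\<^bsub>M\<^esub> u' \<in> Zn (m + e)" "b' \<in> Zn (m + e)" using z b'u' BBn BnZn by auto
      then have "u' \<in> Zn (m + e)" using submodule_add_cancel[OF Zn] b'u' by blast
      then show ?thesis using shift yz ys b'u' by (auto simp: U_def)
    qed
    ultimately show "\<exists>x\<in>U m. mp j x = x \<and> primeideal (colon R M (K m) x) R"
      using p b'u'(5) by auto
  qed
  from eventually_linear_cong[OF this lin]
  show ?thesis unfolding Zn_def Bn_def by (rule eventually_linear_shift)
qed

end

section \<open>Homogeneous components\<close>

text \<open>Generic in the index type, so that it serves both the ring, graded by naturals, and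
  modules, graded by integers.\<close>

definition component :: "('a, 'c) ring_scheme \<Rightarrow> ('i \<Rightarrow> 'a set) \<Rightarrow> 'i \<Rightarrow> 'a \<Rightarrow> 'a" where
  "component G A i x = (THE f. (\<forall>i. f i \<in> A i) \<and> finite {i. f i \<noteq> \<zero>\<^bsub>G\<^esub>} \<and>
     x = (\<Oplus>\<^bsub>G\<^esub>i\<in>{i. f i \<noteq> \<zero>\<^bsub>G\<^esub>}. f i)) i"

context abelian_group
begin

lemma finsum_support:
  assumes "finite J" "{i. f i \<noteq> \<zero>} \<subseteq> J" "\<And>i. f i \<in> carrier G"
  shows "(\<Oplus>i\<in>{i. f i \<noteq> \<zero>}. f i) = (\<Oplus>i\<in>J. f i)"
  by (rule add.finprod_mono_neutral_cong_left) (use assms in auto)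

context
  fixes A :: "'i \<Rightarrow> 'a set"
  assumes A: "internal_direct_sum G A"
begin

lemma A_subgroup: "additive_subgroup (A i) G"
  using A by (simp add: internal_direct_sum_def)

lemma A_closed: "x \<in> A i \<Longrightarrow> x \<in> carrier G"
  using additive_subgroup.a_subset[OF A_subgroup] by blast

lemma A_zero: "\<zero> \<in> A i"
  using additive_subgroup.zero_closed[OF A_subgroup] .

lemma A_add: "x \<in> A i \<Longrightarrow> y \<in> A i \<Longrightarrow> x \<oplus> y \<in> A i"
  using additive_subgroup.a_closed[OF A_subgroup] .

lemma component_props:
  assumes "x \<in> carrier G"
  shows "component G A i x \<in> A i" "finite {i. component G A i x \<noteq> \<zero>}"
    "(\<Oplus>i\<in>{i. component G A i x \<noteq> \<zero>}. component G A i x) = x"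
proof -
  have "\<exists>!f. (\<forall>i. f i \<in> A i) \<and> finite {i. f i \<noteq> \<zero>} \<and> x = (\<Oplus>i\<in>{i. f i \<noteq> \<zero>}. f i)"
    using A assms unfolding internal_direct_sum_def by blast
  from theI'[OF this] show "component G A i x \<in> A i" "finite {i. component G A i x \<noteq> \<zero>}"
    "(\<Oplus>i\<in>{i. component G A i x \<noteq> \<zero>}. component G A i x) = x"
    unfolding component_def by auto
qed

lemma component_closed: "x \<in> carrier G \<Longrightarrow> component G A i x \<in> carrier G"
  using component_props(1) A_closed by blast

lemma component_unique:
  assumes "x \<in> carrier G" "\<And>i. f i \<in> A i" "finite J" "{i. f i \<noteq> \<zero>} \<subseteq> J" "x = (\<Oplus>i\<in>J. f i)"
  shows "component G A i x = f i"
proof -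
  have ex: "\<exists>!f. (\<forall>i. f i \<in> A i) \<and> finite {i. f i \<noteq> \<zero>} \<and> x = (\<Oplus>i\<in>{i. f i \<noteq> \<zero>}. f i)"
    using A assms(1) unfolding internal_direct_sum_def by blast
  have "finite {i. f i \<noteq> \<zero>}" using assms(3,4) finite_subset by blast
  moreover have "x = (\<Oplus>i\<in>{i. f i \<noteq> \<zero>}. f i)"
    using finsum_support[OF assms(3,4)] assms(2,5) A_closed by metis
  ultimately show ?thesis
    unfolding component_def using the1_equality[OF ex, of f] assms(2) by simp
qed

lemma component_homogeneous: "x \<in> A i \<Longrightarrow> component G A k x = (if k = i then x else \<zero>)"
  by (rule component_unique[where J = "{i}"]) (use A_closed A_zero in auto)

lemma component_add:
  assumes "x \<in> carrier G" "y \<in> carrier G"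
  shows "component G A k (x \<oplus> y) = component G A k x \<oplus> component G A k y"
proof (rule component_unique)
  let ?J = "{i. component G A i x \<noteq> \<zero>} \<union> {i. component G A i y \<noteq> \<zero>}"
  show "finite ?J" using component_props(2) assms by auto
  then show "x \<oplus> y = (\<Oplus>i\<in>?J. component G A i x \<oplus> component G A i y)"
    using assms component_closed component_props(3)
    by (subst finsum_addf) (auto simp flip: finsum_support[of ?J])
qed (use assms component_props(1) A_add in auto)

lemma direct_sum_induct:
  assumes "x \<in> carrier G" "\<And>i y. y \<in> A i \<Longrightarrow> P y"
    and "\<And>u v. \<lbrakk>u \<in> carrier G; v \<in> carrier G; P u; P v\<rbrakk> \<Longrightarrow> P (u \<oplus> v)"
  shows "P x"
proof -
  have "P (\<Oplus>i\<in>J. component G A i x)" if "finite J" for J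
    using that
  proof (induction J rule: finite_induct)
    case empty
    then show ?case using assms(2) A_zero by (simp add: finsum_empty)
  next
    case (insert i J)
    have "(\<lambda>i. component G A i x) \<in> J \<rightarrow> carrier G" "component G A i x \<in> carrier G"
      using component_closed assms(1) by auto
    moreover have "P (component G A i x)" using assms(2) component_props(1)[OF assms(1)] by blast
    ultimately show ?case using insert assms(3) by (simp add: finsum_insert)
  qed
  then show ?thesis using component_props(2,3)[OF assms(1)] by metis
qed

lemma component_component:
  "x \<in> carrier G \<Longrightarrow> component G A i (component G A j x) = (if i = j then component G A j x else \<zero>)"
  using component_homogeneous[OF component_props(1)] .

lemma mem_component_iff: "x \<in> A i \<longleftrightarrow> x \<in> carrier G \<and> component G A i x = x"
  using component_homogeneous component_props(1) A_closed by metis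

end

end

definition ring_part :: "'a gring \<Rightarrow> int \<Rightarrow> 'a \<Rightarrow> 'a" where
  "ring_part R i a = (if i < 0 then \<zero>\<^bsub>R\<^esub> else component R (rcomp R) (nat i) a)"

definition mod_part :: "('a, 'b) gmodule \<Rightarrow> int \<Rightarrow> 'b \<Rightarrow> 'b" where
  "mod_part M = component M (hcomp M)"

context graded_ring
begin

lemmas rsum = rcomp_direct_sum

lemma ring_parts: "ring_parts R (ring_part R)"
proof
  fix a i assume a: "a \<in> carrier R"
  show "ring_part R i a \<in> carrier R"
    using component_closed[OF rsum a] by (simp add: ring_part_def)
  show "ring_part R i (ring_part R j a) = (if i = j then ring_part R j a else \<zero>)" for j
    using component_component[OF rsum a] component_homogeneous[OF rsum A_zero[OF rsum]]
    by (auto simp: ring_part_def)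
  have sub: "{i. ring_part R i a \<noteq> \<zero>} = int ` {i. component R (rcomp R) i a \<noteq> \<zero>}"
  proof (intro equalityI subsetI)
    fix i assume "i \<in> {i. ring_part R i a \<noteq> \<zero>}"
    then show "i \<in> int ` {i. component R (rcomp R) i a \<noteq> \<zero>}"
      by (intro image_eqI[of _ _ "nat i"]) (auto simp: ring_part_def split: if_splits)
  qed (auto simp: ring_part_def)
  show "finite {i. ring_part R i a \<noteq> \<zero>}"
    unfolding sub using component_props(2)[OF rsum a] by simp
  have "(\<Oplus>i\<in>{i. ring_part R i a \<noteq> \<zero>}. ring_part R i a) =
      (\<Oplus>i\<in>{i. component R (rcomp R) i a \<noteq> \<zero>}. ring_part R (int i) a)"
    unfolding sub using component_closed[OF rsum a] by (intro finsum_reindex) (auto simp: ring_part_def)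
  also have "\<dots> = a" using component_props(3)[OF rsum a] by (simp add: ring_part_def)
  finally show "(\<Oplus>i\<in>{i. ring_part R i a \<noteq> \<zero>}. ring_part R i a) = a" .
  show "ring_part R i a = \<zero>" if "i < 0" using that by (simp add: ring_part_def)
  fix b assume b: "b \<in> carrier R"
  show "ring_part R i (a \<oplus> b) = ring_part R i a \<oplus> ring_part R i b"
    using a b by (simp add: ring_part_def component_add[OF rsum])
  show "ring_part R (i + j) (a \<otimes> b) = a \<otimes> ring_part R j b" if ai: "ring_part R i a = a" for j
  proof (cases "i < 0")
    case True
    then have "a = \<zero>" using ai by (simp add: ring_part_def)
    then show ?thesis
      using b component_homogeneous[OF rsum A_zero[OF rsum]] component_closed[OF rsum b] by (simp add: ring_part_def)
  next
    case False
    then have am: "a \<in> rcomp R (nat i)"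
      using ai a mem_component_iff[OF rsum] by (simp add: ring_part_def)
    show ?thesis
    \<comment> \<open>Both sides are additive in b, so b may be taken homogeneous; what remains is
      to compare indices through the truncation \<open>nat\<close>.\<close>
    proof (rule direct_sum_induct[OF rsum b, where P = "\<lambda>b. ring_part R (i + j) (a \<otimes> b) = a \<otimes> ring_part R j b"])
      fix l y assume y: "y \<in> rcomp R l"
      have eq: "nat (i + j) = nat i + l \<longleftrightarrow> nat j = l" if "0 \<le> i + j" "0 \<le> j" using that False by auto
      have neq: "nat (i + j) \<noteq> nat i + l" if "0 \<le> i + j" "j < 0" using that False by auto
      show "ring_part R (i + j) (a \<otimes> y) = a \<otimes> ring_part R j y"
        using component_homogeneous[OF rsum mult_rcomp[OF am y]] component_homogeneous[OF rsum y] eq neq False a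
        by (auto simp: ring_part_def)
    next
      fix u v assume uv: "u \<in> carrier R" "v \<in> carrier R" "ring_part R (i + j) (a \<otimes> u) = a \<otimes> ring_part R j u"
        "ring_part R (i + j) (a \<otimes> v) = a \<otimes> ring_part R j v"
      have "ring_part R k (u' \<oplus> v') = ring_part R k u' \<oplus> ring_part R k v'"
        if "u' \<in> carrier R" "v' \<in> carrier R" for k u' v'
        using that by (simp add: ring_part_def component_add[OF rsum])
      moreover have "ring_part R k u' \<in> carrier R" if "u' \<in> carrier R" for k u'
        using component_closed[OF rsum that] by (simp add: ring_part_def)
      ultimately show "ring_part R (i + j) (a \<otimes> (u \<oplus> v)) = a \<otimes> ring_part R j (u \<oplus> v)"
        using a uv by (simp add: r_distr)
    qed
  qed
next
  show "ring_part R 0 \<one> = \<one>"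
    using component_homogeneous[OF rsum one_rcomp] by (simp add: ring_part_def)
qed

lemma rcomp_iff: "a \<in> rcomp R i \<longleftrightarrow> a \<in> carrier R \<and> ring_part R (int i) a = a"
  using mem_component_iff[OF rsum] by (simp add: ring_part_def)

end

context graded_module
begin

lemma module_parts: "module_parts R M (ring_part R) (mod_part M)"
proof (intro module_parts.intro module_parts_axioms.intro ring_parts module_axioms)
  note hs = hcomp_direct_sum
  fix x j assume x: "x \<in> carrier M"
  show "mod_part M j x \<in> carrier M" by (simp add: mod_part_def M.component_closed[OF hs x])
  show "mod_part M i (mod_part M j x) = (if i = j then mod_part M j x else \<zero>\<^bsub>M\<^esub>)" for i
    by (simp add: mod_part_def M.component_component[OF hs x])
  show "finite {j. mod_part M j x \<noteq> \<zero>\<^bsub>M\<^esub>}"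
    "(\<Oplus>\<^bsub>M\<^esub>j\<in>{j. mod_part M j x \<noteq> \<zero>\<^bsub>M\<^esub>}. mod_part M j x) = x"
    using M.component_props(2,3)[OF hs x] by (simp_all add: mod_part_def)
  show "mod_part M j (x \<oplus>\<^bsub>M\<^esub> y) = mod_part M j x \<oplus>\<^bsub>M\<^esub> mod_part M j y" if "y \<in> carrier M" for y
    using x that by (simp add: mod_part_def M.component_add[OF hs])
  show "mod_part M (i + j) (a \<odot>\<^bsub>M\<^esub> x) = a \<odot>\<^bsub>M\<^esub> mod_part M j x" if a: "a \<in> carrier R" "ring_part R i a = a" for a i
  proof (cases "i < 0")
    case True
    then have "a = \<zero>" using a by (simp add: ring_part_def)
    then show ?thesis
      using x M.component_homogeneous[OF hs M.A_zero[OF hs]] M.component_closed[OF hs x] by (simp add: mod_part_def)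
  next
    case False
    then have am: "a \<in> rcomp R (nat i)" using a rcomp_iff[of a "nat i"] by simp
    show ?thesis
      unfolding mod_part_def
    proof (rule M.direct_sum_induct[OF hs x])
      fix l y assume y: "y \<in> hcomp M l"
      show "component M (hcomp M) (i + j) (a \<odot>\<^bsub>M\<^esub> y) = a \<odot>\<^bsub>M\<^esub> component M (hcomp M) j y"
        using M.component_homogeneous[OF hs smult_hcomp[OF am y]] M.component_homogeneous[OF hs y] False a
        by auto
    next
      fix u v
      assume "u \<in> carrier M" "v \<in> carrier M"
        "component M (hcomp M) (i + j) (a \<odot>\<^bsub>M\<^esub> u) = a \<odot>\<^bsub>M\<^esub> component M (hcomp M) j u"
        "component M (hcomp M) (i + j) (a \<odot>\<^bsub>M\<^esub> v) = a \<odot>\<^bsub>M\<^esub> component M (hcomp M) j v"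
      then show "component M (hcomp M) (i + j) (a \<odot>\<^bsub>M\<^esub> (u \<oplus>\<^bsub>M\<^esub> v)) = a \<odot>\<^bsub>M\<^esub> component M (hcomp M) j (u \<oplus>\<^bsub>M\<^esub> v)"
        using a by (simp add: M.component_add[OF hs] M.component_closed[OF hs] smult_r_distr)
    qed
  qed
qed

lemma hcomp_iff: "x \<in> hcomp M j \<longleftrightarrow> x \<in> carrier M \<and> mod_part M j x = x"
  using M.mem_component_iff[OF hcomp_direct_sum] by (simp add: mod_part_def)

end

section \<open>Powers of an ideal\<close>

abbreviation ideal_power :: "('a, 'c) ring_scheme \<Rightarrow> 'a set \<Rightarrow> nat \<Rightarrow> 'a set" where
  "ideal_power R I n \<equiv> I [^]\<^bsub>ideals_set R\<^esub> n"

lemma ideal_power_simps: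
  "ideal_power R I 0 = carrier R" "ideal_power R I (Suc n) = ideal_prod R (ideal_power R I n) I"
  by (simp_all add: nat_pow_def ideals_set_def)

lemma (in ring) ideal_ideal_power: "ideal I R \<Longrightarrow> ideal (ideal_power R I n) R"
proof (induction n)
  case (Suc n)
  then show ?case unfolding ideal_power_simps by (intro ideal_prod_is_ideal)
qed (simp only: ideal_power_simps oneideal)

context module
begin

lemma ideal_times_submodule:
  assumes "ideal J R" shows "submodule (ideal_times R J M) R M"
  unfolding ideal_times_def using ideal.Icarr[OF assms] by (intro submodule_submodule_span) auto

lemma ideal_times_mem: "a \<in> J \<Longrightarrow> x \<in> carrier M \<Longrightarrow> a \<odot>\<^bsub>M\<^esub> x \<in> ideal_times R J M"
  unfolding ideal_times_def using submodule_span_superset by fastforce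

lemma ideal_times_least:
  "submodule N R M \<Longrightarrow> (\<And>a x. a \<in> J \<Longrightarrow> x \<in> carrier M \<Longrightarrow> a \<odot>\<^bsub>M\<^esub> x \<in> N) \<Longrightarrow> ideal_times R J M \<subseteq> N"
  unfolding ideal_times_def by (rule submodule_span_least) auto

lemma ideal_times_carrier: "ideal_times R (carrier R) M = carrier M"
proof -
  have "carrier M \<subseteq> ideal_times R (carrier R) M"
    using ideal_times_mem[OF R.one_closed] by fastforce
  then show ?thesis using ideal_times_submodule[OF R.oneideal] submodule_mem by blast
qed

text \<open>Turns the powers of I into a family generated by \<open>ys\<close> in every step. For
  the inclusion into the combinations, the scalars c such that (b c) x is a combination for all b in
  I^n and all x form an ideal; it contains the generators and hence I.\<close>

lemma ideal_power_times_Suc: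
  assumes ys: "set ys \<subseteq> carrier R" and I: "I = Idl\<^bsub>R\<^esub> (set ys)"
  shows "ideal_times R (ideal_power R I (Suc n)) M = lin_comb M ys (ideal_times R (ideal_power R I n) M)"
proof
  let ?Q = "ideal_times R (ideal_power R I n) M"
  have Iid: "ideal I R" unfolding I using ys by (rule R.genideal_ideal)
  note Pid = R.ideal_ideal_power[OF Iid]
  note Q = ideal_times_submodule[OF Pid]
  note L = submodule_lin_comb[OF Q ys]
  have Pc: "b \<in> ideal_power R I n \<Longrightarrow> b \<in> carrier R" for b using ideal.Icarr[OF Pid] .
  have c_mem: "\<forall>b\<in>ideal_power R I n. \<forall>x\<in>carrier M. (b \<otimes> c) \<odot>\<^bsub>M\<^esub> x \<in> lin_comb M ys ?Q" if "c \<in> I" for c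
  proof -
    define J where "J = {c \<in> carrier R. \<forall>b\<in>ideal_power R I n. \<forall>x\<in>carrier M. (b \<otimes> c) \<odot>\<^bsub>M\<^esub> x \<in> lin_comb M ys ?Q}"
    have J: "submodule J R (regular_module R)"
    proof (rule module.submoduleI[OF R.regular_module])
      show "J \<subseteq> carrier (regular_module R)" by (auto simp: J_def)
      show "\<zero>\<^bsub>regular_module R\<^esub> \<in> J" using Pc submodule_zero[OF L] by (auto simp: J_def)
      show "\<ominus>\<^bsub>regular_module R\<^esub> c \<in> J" if "c \<in> J" for c
        using that Pc submodule_neg[OF L] by (auto simp: J_def R.r_minus smult_l_minus)
      show "c \<oplus>\<^bsub>regular_module R\<^esub> c' \<in> J" if "c \<in> J" "c' \<in> J" for c c'
        using that Pc submodule_add[OF L] by (auto simp: J_def R.r_distr smult_l_distr)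
      show "r \<odot>\<^bsub>regular_module R\<^esub> c \<in> J" if r: "r \<in> carrier R" and c: "c \<in> J" for r c
      proof -
        have "(b \<otimes> (r \<otimes> c)) \<odot>\<^bsub>M\<^esub> x = r \<odot>\<^bsub>M\<^esub> ((b \<otimes> c) \<odot>\<^bsub>M\<^esub> x)"
          if "b \<in> ideal_power R I n" "x \<in> carrier M" for b x
          using that r c Pc by (simp add: J_def smult_assoc1[symmetric] R.m_lcomm)
        then show ?thesis using r c submodule_smult[OF L r] by (auto simp: J_def)
      qed
    qed
    have "set ys \<subseteq> J"
    proof
      fix y assume y: "y \<in> set ys"
      then have yc: "y \<in> carrier R" using ys by blast
      have "(b \<otimes> y) \<odot>\<^bsub>M\<^esub> x \<in> lin_comb M ys ?Q" if "b \<in> ideal_power R I n" "x \<in> carrier M" for b x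
      proof -
        have "y \<odot>\<^bsub>M\<^esub> (b \<odot>\<^bsub>M\<^esub> x) \<in> lin_comb M ys ?Q"
          using ideal_times_mem[OF that] by (rule lin_comb_smult[OF Q ys y])
        then show ?thesis using Pc[OF that(1)] that(2) yc by (simp add: smult_assoc1 smult_swap)
      qed
      then show "y \<in> J" using yc by (simp add: J_def)
    qed
    moreover have "ideal J R" using J R.submodule_regular_iff by blast
    ultimately have "I \<subseteq> J" unfolding I by (rule R.genideal_minimal[rotated])
    then show ?thesis using that by (auto simp: J_def)
  qed
  show "ideal_times R (ideal_power R I (Suc n)) M \<subseteq> lin_comb M ys ?Q"
  proof (rule ideal_times_least[OF L])
    fix a x assume a: "a \<in> ideal_power R I (Suc n)" and x: "x \<in> carrier M"
    have "a \<in> ideal_prod R (ideal_power R I n) I" using a by (simp only: ideal_power_simps)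
    then show "a \<odot>\<^bsub>M\<^esub> x \<in> lin_comb M ys ?Q"
    proof (induction rule: ideal_prod.induct)
      case (sum s t)
      then have "s \<in> carrier R" "t \<in> carrier R" using R.ideal_prod_in_carrier[OF Pid Iid] by blast+
      then show ?case using sum x submodule_add[OF L] by (simp add: smult_l_distr)
    qed (use c_mem x in auto)
  qed
  show "lin_comb M ys ?Q \<subseteq> ideal_times R (ideal_power R I (Suc n)) M"
  proof (rule lin_comb_least[OF ideal_times_submodule[OF Pid]])
    fix y v assume y: "y \<in> set ys" and v: "v \<in> ?Q"
    have yc: "y \<in> carrier R" and yI: "y \<in> I" using y ys R.genideal_self[OF ys] I by auto
    let ?S = "ideal_times R (ideal_power R I (Suc n)) M"
    have S: "submodule ?S R M" by (rule ideal_times_submodule[OF Pid])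
    have "submodule {v \<in> carrier M. y \<odot>\<^bsub>M\<^esub> v \<in> ?S} R M"
      using yc submodule_zero[OF S] submodule_add[OF S] submodule_neg[OF S] submodule_smult[OF S]
      by (intro submoduleI) (auto simp: smult_r_distr smult_r_minus smult_swap)
    then have "?Q \<subseteq> {v \<in> carrier M. y \<odot>\<^bsub>M\<^esub> v \<in> ?S}"
    proof (rule ideal_times_least)
      fix b x assume b: "b \<in> ideal_power R I n" and x: "x \<in> carrier M"
      have "b \<otimes> y \<in> ideal_power R I (Suc n)"
        unfolding ideal_power_simps using b yI by (rule ideal_prod.prod)
      from ideal_times_mem[OF this x] show "b \<odot>\<^bsub>M\<^esub> x \<in> {v \<in> carrier M. y \<odot>\<^bsub>M\<^esub> v \<in> ?S}"
        using Pc[OF b] yc x smult_swap[of y b x] by (simp add: smult_assoc1)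
    qed
    then show "y \<odot>\<^bsub>M\<^esub> v \<in> ?S" using v by blast
  qed
qed

end

text \<open>A finite homogeneous generating set exists by the chain condition, and one of least
  cardinality is irredundant. The list form provides the \<open>ys\<close> of the Rees
  algebra.\<close>

lemma exists_minimal_homogeneous_generators:
  assumes "cring R" "noetherian_ring R" "homogeneous_ideal I R" "homogeneous_elements R \<subseteq> carrier R"
  shows "\<exists>ys. minimal_homogeneous_generators R I (set ys)"
proof -
  interpret cring R by fact
  obtain S where S: "S \<subseteq> homogeneous_elements R" "I = Idl\<^bsub>R\<^esub> S"
    using assms(3) by (auto simp: homogeneous_ideal_def)
  have Sc: "S \<subseteq> carrier R" using S assms(4) by blast
  define P where "P J \<longleftrightarrow> (\<exists>T. finite T \<and> T \<subseteq> S \<and> J = Idl\<^bsub>R\<^esub> T)" for J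
  have "P (Idl\<^bsub>R\<^esub> {})" by (auto simp: P_def)
  moreover have "\<exists>i. f (Suc i) = f i" if f: "\<And>i. P (f i)" "\<And>i. f i \<subseteq> f (Suc i)" for f :: "nat \<Rightarrow> _"
  proof -
    have "ideal (f i) R" for i using f(1)[of i] Sc genideal_ideal by (auto simp: P_def)
    then show ?thesis
      using noetherian_regular[OF assms(1,2), unfolded noetherian_module_def, rule_format, of f] f(2)
        submodule_regular_iff by (metis le_SucI order_refl)
  qed
  ultimately obtain J where J: "P J" "\<And>J'. P J' \<Longrightarrow> J \<subseteq> J' \<Longrightarrow> J' = J"
    using exists_maximal_chain[of P "Idl\<^bsub>R\<^esub> {}"] by blast
  then obtain T where T: "finite T" "T \<subseteq> S" "J = Idl\<^bsub>R\<^esub> T" by (auto simp: P_def)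
  have Tc: "T \<subseteq> carrier R" using T Sc by blast
  have "S \<subseteq> J"
  proof
    fix s assume s: "s \<in> S"
    have sTc: "insert s T \<subseteq> carrier R" using s Sc Tc by blast
    have "P (Idl\<^bsub>R\<^esub> (insert s T))" unfolding P_def using T s by (intro exI[of _ "insert s T"]) auto
    moreover have "J \<subseteq> Idl\<^bsub>R\<^esub> (insert s T)"
      unfolding T(3) by (rule genideal_minimal[OF genideal_ideal[OF sTc]]) (use genideal_self[OF sTc] in blast)
    ultimately have "Idl\<^bsub>R\<^esub> (insert s T) = J" by (rule J(2))
    then show "s \<in> J" using genideal_self[OF sTc] by blast
  qed
  then have "I \<subseteq> J" unfolding S(2) T(3) by (intro genideal_minimal genideal_ideal Tc)
  have "J \<subseteq> I"
    unfolding S(2) T(3) using genideal_self[OF Sc] T(2) by (intro genideal_minimal genideal_ideal Sc) blast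
  define Q where "Q T \<longleftrightarrow> finite T \<and> T \<subseteq> homogeneous_elements R \<and> Idl\<^bsub>R\<^esub> T = I" for T
  have "I = J" using \<open>I \<subseteq> J\<close> \<open>J \<subseteq> I\<close> by (rule equalityI)
  then have "Q T" unfolding Q_def using T S(1) by blast
  from ex_has_least_nat[of Q, OF this, of card] obtain X where X: "Q X" and min: "\<And>Y. Q Y \<Longrightarrow> card X \<le> card Y"
    by metis
  have "Idl\<^bsub>R\<^esub> Y \<noteq> I" if "Y \<subset> X" for Y
  proof
    assume "Idl\<^bsub>R\<^esub> Y = I"
    then have "Q Y" using that X finite_subset[of Y X] unfolding Q_def by blast
    then show False using min[of Y] psubset_card_mono[OF _ that] X by (simp add: Q_def)
  qed
  then have "minimal_homogeneous_generators R I X" using X by (auto simp: minimal_homogeneous_generators_def Q_def)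
  moreover obtain ys where "set ys = X" using finite_list X by (auto simp: Q_def)
  ultimately show ?thesis by blast
qed

section \<open>Subquotients\<close>

text \<open>The module axioms see these four fields only, so the structure passes between records
  with different gradings or unspecified multiplications.\<close>

lemma module_cong:
  assumes M: "module R M" and eq: "carrier M' = carrier M" "add M' = add M" "zero M' = zero M" "smult M' = smult M"
  shows "module R M'"
proof -
  interpret module R M by (rule M)
  show ?thesis
  proof (rule moduleI[OF R.is_cring])
    show "abelian_group M'"
      by (rule abelian_groupI) (auto simp: eq M.a_ac intro: bexI[of _ "\<ominus>\<^bsub>M\<^esub> _"] M.l_neg)
  qed (auto simp: eq smult_l_distr smult_r_distr smult_assoc1)
qed

context module
begin

lemma submodule_iff:
  "submodule N R M \<longleftrightarrow> N \<subseteq> carrier M \<and> \<zero>\<^bsub>M\<^esub> \<in> N \<and> (\<forall>x\<in>N. \<forall>y\<in>N. x \<oplus>\<^bsub>M\<^esub> y \<in> N) \<and>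
     (\<forall>a\<in>carrier R. \<forall>x\<in>N. a \<odot>\<^bsub>M\<^esub> x \<in> N)"
proof
  assume N: "N \<subseteq> carrier M \<and> \<zero>\<^bsub>M\<^esub> \<in> N \<and> (\<forall>x\<in>N. \<forall>y\<in>N. x \<oplus>\<^bsub>M\<^esub> y \<in> N) \<and>
     (\<forall>a\<in>carrier R. \<forall>x\<in>N. a \<odot>\<^bsub>M\<^esub> x \<in> N)"
  show "submodule N R M"
  proof (rule submoduleI)
    show "\<ominus>\<^bsub>M\<^esub> x \<in> N" if x: "x \<in> N" for x
    proof -
      have "\<ominus>\<^bsub>M\<^esub> x = (\<ominus>\<^bsub>R\<^esub> \<one>\<^bsub>R\<^esub>) \<odot>\<^bsub>M\<^esub> x" using x N by (simp add: smult_l_minus subset_iff)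
      moreover have "(\<ominus>\<^bsub>R\<^esub> \<one>\<^bsub>R\<^esub>) \<odot>\<^bsub>M\<^esub> x \<in> N" using x N by blast
      ultimately show ?thesis by simp
    qed
  qed (use N in auto)
qed (auto simp: submodule_mem submodule_zero submodule_add submodule_smult)

lemma submodule_image:
  assumes Y: "module R Y" and g: "g \<in> linear_maps R M Y" and V: "submodule V R M"
  shows "submodule (g ` V) R Y"
proof -
  interpret Y: module R Y by (rule Y)
  have lin: "\<And>x y. x \<in> carrier M \<Longrightarrow> y \<in> carrier M \<Longrightarrow> g x \<oplus>\<^bsub>Y\<^esub> g y = g (x \<oplus>\<^bsub>M\<^esub> y)"
    "\<And>a x. a \<in> carrier R \<Longrightarrow> x \<in> carrier M \<Longrightarrow> a \<odot>\<^bsub>Y\<^esub> g x = g (a \<odot>\<^bsub>M\<^esub> x)"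
    "\<And>x. x \<in> carrier M \<Longrightarrow> g x \<in> carrier Y"
    using g by (auto simp: linear_maps_def)
  show ?thesis
    unfolding Y.submodule_iff
  proof (intro conjI ballI)
    show "\<zero>\<^bsub>Y\<^esub> \<in> g ` V" using linear_maps_zero[OF Y g] submodule_zero[OF V] by (metis imageI)
  qed (use lin submodule_mem[OF V] submodule_add[OF V] submodule_smult[OF V] in auto)
qed

section \<open>Cosets and quotient modules\<close>

context
  fixes N assumes N: "submodule N R M"
begin

lemma abelian_subgroup_submodule: "abelian_subgroup N M"
  using N M.abelian_group_axioms
  by (intro abelian_subgroupI3 additive_subgroup.intro submodule.axioms(1)[of N R M])

lemma coset_mem: "y \<in> N +>\<^bsub>M\<^esub> x \<longleftrightarrow> (\<exists>n\<in>N. y = n \<oplus>\<^bsub>M\<^esub> x)"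
  by (auto simp: a_r_coset_def')

lemma coset_eq_iff:
  assumes "x \<in> carrier M" "y \<in> carrier M"
  shows "N +>\<^bsub>M\<^esub> x = N +>\<^bsub>M\<^esub> y \<longleftrightarrow> x \<ominus>\<^bsub>M\<^esub> y \<in> N"
proof
  assume "N +>\<^bsub>M\<^esub> x = N +>\<^bsub>M\<^esub> y"
  moreover have "x \<in> N +>\<^bsub>M\<^esub> x" using submodule_zero[OF N] assms by (force simp: coset_mem)
  ultimately obtain n where "n \<in> N" "x = n \<oplus>\<^bsub>M\<^esub> y" by (auto simp: coset_mem)
  then show "x \<ominus>\<^bsub>M\<^esub> y \<in> N"
    using assms submodule_mem[OF N] by (simp add: a_minus_def M.a_assoc M.r_neg)
next
  assume xy: "x \<ominus>\<^bsub>M\<^esub> y \<in> N"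
  then have "x \<in> N +>\<^bsub>M\<^esub> y"
    using assms by (auto simp: coset_mem a_minus_def M.a_assoc M.l_neg intro!: bexI[of _ "x \<ominus>\<^bsub>M\<^esub> y"])
  then show "N +>\<^bsub>M\<^esub> x = N +>\<^bsub>M\<^esub> y"
    using M.a_repr_independence[of x N y] assms submodule.axioms(1)[OF N] by simp
qed

lemma coset_zero_iff:
  assumes "x \<in> carrier M"
  shows "N +>\<^bsub>M\<^esub> x = N \<longleftrightarrow> x \<in> N"
proof -
  have "N +>\<^bsub>M\<^esub> \<zero>\<^bsub>M\<^esub> = N" using submodule_mem[OF N] by (intro M.a_coset_add_zero) blast
  moreover have "x \<ominus>\<^bsub>M\<^esub> \<zero>\<^bsub>M\<^esub> = x" using assms by (simp add: a_minus_def)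
  ultimately show ?thesis using coset_eq_iff[OF assms M.zero_closed] by simp
qed

lemma coset_add:
  "\<lbrakk>x \<in> carrier M; y \<in> carrier M\<rbrakk> \<Longrightarrow> (N +>\<^bsub>M\<^esub> x) <+>\<^bsub>M\<^esub> (N +>\<^bsub>M\<^esub> y) = N +>\<^bsub>M\<^esub> (x \<oplus>\<^bsub>M\<^esub> y)"
  using abelian_subgroup.a_rcos_sum[OF abelian_subgroup_submodule] .

text \<open>The cosets united here all coincide, since a n stays in \<open>N\<close> for n in
  \<open>N\<close>.\<close>

lemma coset_smult:
  assumes a: "a \<in> carrier R" and x: "x \<in> carrier M"
  shows "(\<Union>y\<in>N +>\<^bsub>M\<^esub> x. N +>\<^bsub>M\<^esub> (a \<odot>\<^bsub>M\<^esub> y)) = N +>\<^bsub>M\<^esub> (a \<odot>\<^bsub>M\<^esub> x)"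
proof -
  have "N +>\<^bsub>M\<^esub> (a \<odot>\<^bsub>M\<^esub> y) = N +>\<^bsub>M\<^esub> (a \<odot>\<^bsub>M\<^esub> x)" if y: "y \<in> N +>\<^bsub>M\<^esub> x" for y
  proof -
    obtain n where n: "n \<in> N" "y = n \<oplus>\<^bsub>M\<^esub> x" using y by (auto simp: coset_mem)
    have nc: "n \<in> carrier M" using submodule_mem[OF N] n by blast
    have "a \<odot>\<^bsub>M\<^esub> y \<ominus>\<^bsub>M\<^esub> a \<odot>\<^bsub>M\<^esub> x = a \<odot>\<^bsub>M\<^esub> n"
      using n(2) nc a x by (simp add: smult_r_distr a_minus_def M.a_assoc M.r_neg)
    then show ?thesis
      using coset_eq_iff[of "a \<odot>\<^bsub>M\<^esub> y" "a \<odot>\<^bsub>M\<^esub> x"] submodule_smult[OF N a n(1)] n(2) nc a x by simp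
  qed
  moreover have "x \<in> N +>\<^bsub>M\<^esub> x" using submodule_zero[OF N] x by (force simp: coset_mem)
  ultimately show ?thesis by blast
qed

lemma quot_carrier: "carrier (quot_module M N) = (\<lambda>x. N +>\<^bsub>M\<^esub> x) ` carrier M"
  by (auto simp: quot_module_def A_RCOSETS_def')

lemma quot_zero: "\<zero>\<^bsub>quot_module M N\<^esub> = N"
  by (simp add: quot_module_def)

lemma quot_add:
  "\<lbrakk>x \<in> carrier M; y \<in> carrier M\<rbrakk> \<Longrightarrow> (N +>\<^bsub>M\<^esub> x) \<oplus>\<^bsub>quot_module M N\<^esub> (N +>\<^bsub>M\<^esub> y) = N +>\<^bsub>M\<^esub> (x \<oplus>\<^bsub>M\<^esub> y)"
  by (simp add: quot_module_def coset_add)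

lemma quot_smult:
  "\<lbrakk>a \<in> carrier R; x \<in> carrier M\<rbrakk> \<Longrightarrow> a \<odot>\<^bsub>quot_module M N\<^esub> (N +>\<^bsub>M\<^esub> x) = N +>\<^bsub>M\<^esub> (a \<odot>\<^bsub>M\<^esub> x)"
  by (simp add: quot_module_def coset_smult)

lemma module_quot_module: "module R (quot_module M N)"
proof (rule moduleI[OF R.is_cring])
  have zero: "\<zero>\<^bsub>quot_module M N\<^esub> = N +>\<^bsub>M\<^esub> \<zero>\<^bsub>M\<^esub>"
    using coset_zero_iff[of "\<zero>\<^bsub>M\<^esub>"] submodule_zero[OF N] by (simp add: quot_zero)
  show "abelian_group (quot_module M N)"
  proof (rule abelian_groupI)
    show "\<exists>Y\<in>carrier (quot_module M N). Y \<oplus>\<^bsub>quot_module M N\<^esub> X = \<zero>\<^bsub>quot_module M N\<^esub>"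
      if X: "X \<in> carrier (quot_module M N)" for X
    proof -
      obtain x where x: "x \<in> carrier M" "X = N +>\<^bsub>M\<^esub> x" using X by (auto simp: quot_carrier)
      then show ?thesis
        by (intro bexI[of _ "N +>\<^bsub>M\<^esub> (\<ominus>\<^bsub>M\<^esub> x)"]) (auto simp: quot_add zero M.l_neg quot_carrier)
    qed
  qed (auto simp: quot_carrier quot_add zero M.a_ac)
qed (auto simp: quot_carrier quot_add quot_smult smult_l_distr smult_r_distr smult_assoc1)

lemma finsum_quot:
  assumes "f \<in> J \<rightarrow> carrier M"
  shows "finsum (quot_module M N) (\<lambda>i. N +>\<^bsub>M\<^esub> f i) J = N +>\<^bsub>M\<^esub> finsum M f J"
proof -
  interpret Q: module R "quot_module M N" by (rule module_quot_module)
  have zero: "\<zero>\<^bsub>quot_module M N\<^esub> = N +>\<^bsub>M\<^esub> \<zero>\<^bsub>M\<^esub>"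
    using coset_zero_iff[of "\<zero>\<^bsub>M\<^esub>"] submodule_zero[OF N] by (simp add: quot_zero)
  show ?thesis
    using assms
  proof (induction J rule: infinite_finite_induct)
    case (insert i J)
    have "(\<lambda>i. N +>\<^bsub>M\<^esub> f i) \<in> J \<rightarrow> carrier (quot_module M N)" "N +>\<^bsub>M\<^esub> f i \<in> carrier (quot_module M N)"
      using insert.prems by (auto simp: quot_carrier)
    moreover have "f \<in> J \<rightarrow> carrier M" "f i \<in> carrier M" using insert.prems by auto
    ultimately show ?case
      using insert by (simp add: Q.M.finsum_insert M.finsum_insert quot_add)
  qed (simp_all add: Q.M.finsum_infinite M.finsum_infinite Q.M.finsum_empty M.finsum_empty zero)
qed

end

end

text \<open>\<open>presents R C D E Z B\<close> says that \<open>E\<close> is the graded module \<open>Z / B\<close>, for \<open>B \<subseteq> Z\<close> in a module \<open>C\<close> whose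
  homogeneous parts are given by \<open>D\<close>.\<close>

definition presents ::
  "('a, 'c) ring_scheme \<Rightarrow> ('a, 'b, 'd) module_scheme \<Rightarrow> (int \<Rightarrow> 'b set) \<Rightarrow> ('a, 'e) gmodule
     \<Rightarrow> 'b set \<Rightarrow> 'b set \<Rightarrow> bool" where
  "presents R C D E Z B \<longleftrightarrow>
     (\<exists>\<pi>. carrier E = \<pi> ` Z \<and> (\<forall>z\<in>Z. \<pi> z = \<zero>\<^bsub>E\<^esub> \<longleftrightarrow> z \<in> B) \<and>
        (\<forall>a\<in>carrier R. \<forall>z\<in>Z. a \<odot>\<^bsub>E\<^esub> \<pi> z = \<pi> (a \<odot>\<^bsub>C\<^esub> z)) \<and> (\<forall>j. hcomp E j = \<pi> ` (Z \<inter> D j)))"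

section \<open>Presentations of subquotients and their v-numbers\<close>

lemma presents_subquot:
  assumes P: "module R P" and Z: "submodule Z R P" and B: "submodule B R P" and BZ: "B \<subseteq> Z"
  shows "presents R P (hcomp P) (subquot_gmodule P Z B) Z B"
proof -
  \<comment> \<open>\<open>Z\<close> as a module in its own right, with the induced grading: the
    ambient module of the quotient in \<open>subquot_gmodule\<close>.\<close>
  define P' where "P' = P\<lparr>carrier := Z, hcomp := (\<lambda>n. hcomp P n \<inter> Z)\<rparr>"
  have eq: "carrier P' = Z" "add P' = add P" "zero P' = zero P" "smult P' = smult P" "hcomp P' = (\<lambda>n. hcomp P n \<inter> Z)"
    by (simp_all add: P'_def)
  have P': "module R P'"
    by (rule module_cong[OF submodule.submodule_is_module[OF Z P]]) (simp_all add: P'_def)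
  interpret P': module R P' by (rule P')
  interpret P: module R P by (rule P)
  have B': "submodule B R P'"
    using B BZ unfolding P'.submodule_iff P.submodule_iff by (simp add: eq)
  have E: "subquot_gmodule P Z B = with_grading (quot_module P' B) (\<lambda>n. {B +>\<^bsub>P'\<^esub> x | x. x \<in> hcomp P' n})"
    by (simp add: subquot_gmodule_def quot_gmodule_def P'_def)
  show ?thesis
    unfolding presents_def
  proof (intro exI[of _ "\<lambda>z. B +>\<^bsub>P'\<^esub> z"] conjI ballI allI)
    show "carrier (subquot_gmodule P Z B) = (\<lambda>z. B +>\<^bsub>P'\<^esub> z) ` Z"
      using P'.quot_carrier[OF B'] by (simp add: E with_grading_def eq)
    show "(B +>\<^bsub>P'\<^esub> z = \<zero>\<^bsub>subquot_gmodule P Z B\<^esub>) = (z \<in> B)" if "z \<in> Z" for z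
      using P'.coset_zero_iff[OF B', of z] P'.quot_zero[OF B'] that by (simp add: E with_grading_def eq)
    show "a \<odot>\<^bsub>subquot_gmodule P Z B\<^esub> (B +>\<^bsub>P'\<^esub> z) = B +>\<^bsub>P'\<^esub> (a \<odot>\<^bsub>P\<^esub> z)" if "a \<in> carrier R" "z \<in> Z" for a z
      using P'.quot_smult[OF B', of a z] that by (simp add: E with_grading_def eq)
    show "hcomp (subquot_gmodule P Z B) j = (\<lambda>z. B +>\<^bsub>P'\<^esub> z) ` (Z \<inter> hcomp P j)" for j
      by (auto simp: E with_grading_def eq)
  qed
qed

text \<open>With \<open>\<theta>\<close> onto and \<open>B'\<close> the preimage of
  \<open>B\<close>, the quotients Z' / B' and Z / B are isomorphic. It is applied to the coordinate
  isomorphisms for Hom and tensor modules and to the projection from M to M / I^n M in each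
  coordinate.\<close>

lemma presents_lift:
  assumes E: "presents R P DP E Z B"
    and onto: "\<theta> ` Z' = Z" and B': "\<And>z. z \<in> Z' \<Longrightarrow> \<theta> z \<in> B \<longleftrightarrow> z \<in> B'"
    and smult: "\<And>a z. a \<in> carrier R \<Longrightarrow> z \<in> Z' \<Longrightarrow> \<theta> (a \<odot>\<^bsub>C\<^esub> z) = a \<odot>\<^bsub>P\<^esub> \<theta> z"
    and parts: "\<And>j. \<theta> ` (Z' \<inter> D j) = Z \<inter> DP j"
  shows "presents R C D E Z' B'"
proof -
  obtain \<pi> where "carrier E = \<pi> ` Z \<and> (\<forall>z\<in>Z. \<pi> z = \<zero>\<^bsub>E\<^esub> \<longleftrightarrow> z \<in> B) \<and>
      (\<forall>a\<in>carrier R. \<forall>z\<in>Z. a \<odot>\<^bsub>E\<^esub> \<pi> z = \<pi> (a \<odot>\<^bsub>P\<^esub> z)) \<and> (\<forall>j. hcomp E j = \<pi> ` (Z \<inter> DP j))"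
    using E unfolding presents_def by (elim exE)
  then have \<pi>: "carrier E = \<pi> ` Z" "\<And>z. z \<in> Z \<Longrightarrow> \<pi> z = \<zero>\<^bsub>E\<^esub> \<longleftrightarrow> z \<in> B"
    "\<And>a z. a \<in> carrier R \<Longrightarrow> z \<in> Z \<Longrightarrow> a \<odot>\<^bsub>E\<^esub> \<pi> z = \<pi> (a \<odot>\<^bsub>P\<^esub> z)" "\<And>j. hcomp E j = \<pi> ` (Z \<inter> DP j)"
    by simp_all
  have mem: "z \<in> Z' \<Longrightarrow> \<theta> z \<in> Z" for z using onto by blast
  show ?thesis
    unfolding presents_def
  proof (intro exI[of _ "\<pi> \<circ> \<theta>"] conjI ballI allI)
    show "carrier E = (\<pi> \<circ> \<theta>) ` Z'" by (simp only: \<pi>(1) onto[symmetric] image_comp)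
    show "hcomp E j = (\<pi> \<circ> \<theta>) ` (Z' \<inter> D j)" for j by (simp only: \<pi>(4) parts[symmetric] image_comp)
    show "((\<pi> \<circ> \<theta>) z = \<zero>\<^bsub>E\<^esub>) = (z \<in> B')" if "z \<in> Z'" for z
      using \<pi>(2)[OF mem[OF that]] B'[OF that] by simp
    show "a \<odot>\<^bsub>E\<^esub> (\<pi> \<circ> \<theta>) z = (\<pi> \<circ> \<theta>) (a \<odot>\<^bsub>C\<^esub> z)" if "a \<in> carrier R" "z \<in> Z'" for a z
      using \<pi>(3)[OF that(1) mem[OF that(2)]] smult[OF that] by simp
  qed
qed

lemma presents_annihilator:
  assumes "presents R C D E Z B" and smult: "\<And>a z. a \<in> carrier R \<Longrightarrow> z \<in> Z \<Longrightarrow> a \<odot>\<^bsub>C\<^esub> z \<in> Z"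
  shows "\<exists>\<pi>. carrier E = \<pi> ` Z \<and> (\<forall>z\<in>Z. \<pi> z = \<zero>\<^bsub>E\<^esub> \<longleftrightarrow> z \<in> B) \<and>
    (\<forall>z\<in>Z. annihilator R E (\<pi> z) = colon R C B z) \<and> (\<forall>j. hcomp E j = \<pi> ` (Z \<inter> D j))"
proof -
  obtain \<pi> where "carrier E = \<pi> ` Z \<and> (\<forall>z\<in>Z. \<pi> z = \<zero>\<^bsub>E\<^esub> \<longleftrightarrow> z \<in> B) \<and>
      (\<forall>a\<in>carrier R. \<forall>z\<in>Z. a \<odot>\<^bsub>E\<^esub> \<pi> z = \<pi> (a \<odot>\<^bsub>C\<^esub> z)) \<and> (\<forall>j. hcomp E j = \<pi> ` (Z \<inter> D j))"
    using assms(1) unfolding presents_def by (elim exE)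
  then have \<pi>: "carrier E = \<pi> ` Z" "\<And>z. z \<in> Z \<Longrightarrow> \<pi> z = \<zero>\<^bsub>E\<^esub> \<longleftrightarrow> z \<in> B"
    "\<And>a z. a \<in> carrier R \<Longrightarrow> z \<in> Z \<Longrightarrow> a \<odot>\<^bsub>E\<^esub> \<pi> z = \<pi> (a \<odot>\<^bsub>C\<^esub> z)" "\<And>j. hcomp E j = \<pi> ` (Z \<inter> D j)"
    by simp_all
  have "annihilator R E (\<pi> z) = colon R C B z" if "z \<in> Z" for z
    using \<pi>(2,3) smult that by (auto simp: annihilator_def colon_def)
  then show ?thesis using \<pi>(1,2,4) by (intro exI[of _ \<pi>]) simp
qed

text \<open>The double infimum, over primes and over the degrees belonging to each, is an infimum
  over all homogeneous classes with prime annihilator, and annihilators of classes are colon ideals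
  of representatives.\<close>

lemma v_number_presents:
  assumes "presents R C D E Z B" and smult: "\<And>a z. a \<in> carrier R \<Longrightarrow> z \<in> Z \<Longrightarrow> a \<odot>\<^bsub>C\<^esub> z \<in> Z"
  shows "v_number R E = Inf {ereal (of_int j) | j. \<exists>z\<in>Z. z \<in> D j \<and> primeideal (colon R C B z) R}"
proof -
  have "\<exists>\<pi>. carrier E = \<pi> ` Z \<and> (\<forall>z\<in>Z. \<pi> z = \<zero>\<^bsub>E\<^esub> \<longleftrightarrow> z \<in> B) \<and>
    (\<forall>z\<in>Z. annihilator R E (\<pi> z) = colon R C B z) \<and> (\<forall>j. hcomp E j = \<pi> ` (Z \<inter> D j))"
    by (rule presents_annihilator[OF assms(1)]) (fact smult)
  then obtain \<pi> where "carrier E = \<pi> ` Z \<and> (\<forall>z\<in>Z. \<pi> z = \<zero>\<^bsub>E\<^esub> \<longleftrightarrow> z \<in> B) \<and>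
    (\<forall>z\<in>Z. annihilator R E (\<pi> z) = colon R C B z) \<and> (\<forall>j. hcomp E j = \<pi> ` (Z \<inter> D j))" ..
  then have \<pi>: "carrier E = \<pi> ` Z" "\<And>z. z \<in> Z \<Longrightarrow> annihilator R E (\<pi> z) = colon R C B z"
    "\<And>j. hcomp E j = \<pi> ` (Z \<inter> D j)" by simp_all
  define S where "S \<pp> = {ereal (of_int n) | n. \<exists>x\<in>hcomp E n. \<pp> = annihilator R E x}" for \<pp>
  have "v_number R E = (INF \<pp>\<in>Ass R E. Inf (S \<pp>))"
    unfolding v_number_def local_v_number_def S_def by (simp add: image_def Bex_def conj_commute)
  also have "\<dots> = Inf (\<Union>\<pp>\<in>Ass R E. S \<pp>)"
  proof (rule order.antisym)
    show "(INF \<pp>\<in>Ass R E. Inf (S \<pp>)) \<le> Inf (\<Union>\<pp>\<in>Ass R E. S \<pp>)"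
      by (rule Inf_greatest) (auto intro: INF_lower2 Inf_lower)
    show "Inf (\<Union>\<pp>\<in>Ass R E. S \<pp>) \<le> (INF \<pp>\<in>Ass R E. Inf (S \<pp>))"
      by (rule INF_greatest) (auto intro: Inf_superset_mono)
  qed
  also have "(\<Union>\<pp>\<in>Ass R E. S \<pp>) = {ereal (of_int j) | j. \<exists>z\<in>Z. z \<in> D j \<and> primeideal (colon R C B z) R}"
  proof (intro equalityI subsetI)
    fix e assume "e \<in> (\<Union>\<pp>\<in>Ass R E. S \<pp>)"
    then obtain \<pp> n x where p: "\<pp> \<in> Ass R E" "e = ereal (of_int n)" "x \<in> hcomp E n" "\<pp> = annihilator R E x"
      by (auto simp: S_def)
    then obtain z where "z \<in> Z" "z \<in> D n" "x = \<pi> z" by (auto simp: \<pi>(3))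
    then show "e \<in> {ereal (of_int j) | j. \<exists>z\<in>Z. z \<in> D j \<and> primeideal (colon R C B z) R}"
      using p \<pi>(2)[of z] by (auto simp: Ass_def)
  next
    fix e assume "e \<in> {ereal (of_int j) | j. \<exists>z\<in>Z. z \<in> D j \<and> primeideal (colon R C B z) R}"
    then obtain j z where z: "e = ereal (of_int j)" "z \<in> Z" "z \<in> D j" "primeideal (colon R C B z) R" by blast
    have "colon R C B z \<in> Ass R E" unfolding Ass_def using z \<pi>(1,2) by blast
    moreover have "e \<in> S (colon R C B z)" unfolding S_def using z \<pi>(2,3) by blast
    ultimately show "e \<in> (\<Union>\<pp>\<in>Ass R E. S \<pp>)" by blast
  qed
  finally show ?thesis .
qed

section \<open>Complexes given by matrices\<close>

text \<open>Rows are indexed by T' and columns by T. The entries are ring elements, so one matrix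
  acts on the powers of every module.\<close>

definition mat_map :: "('a, 'b, 'd) module_scheme \<Rightarrow> 'i set \<Rightarrow> 'j set \<Rightarrow> ('j \<Rightarrow> 'i \<Rightarrow> 'a) \<Rightarrow> ('i \<Rightarrow> 'b) \<Rightarrow> 'j \<Rightarrow> 'b" where
  "mat_map N T T' \<alpha> v = (\<lambda>t'\<in>T'. \<Oplus>\<^bsub>N\<^esub>t\<in>T. \<alpha> t' t \<odot>\<^bsub>N\<^esub> v t)"

text \<open>The component sets matching \<open>pow_parts\<close>, with the same twists.\<close>

definition pow_comp :: "('a, 'b) gmodule \<Rightarrow> 'i set \<Rightarrow> ('i \<Rightarrow> int) \<Rightarrow> int \<Rightarrow> ('i \<Rightarrow> 'b) set" where
  "pow_comp N T s j = {v \<in> T \<rightarrow>\<^sub>E carrier N. \<forall>t\<in>T. v t \<in> hcomp N (j + s t)}"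

text \<open>Homology at the middle term of the complex that runs from the T'-fold over the T-fold to
  the T''-fold power of \<open>N\<close>.\<close>

definition presents_matrix ::
  "'a gring \<Rightarrow> ('a, 'b) gmodule \<Rightarrow> 'i set \<Rightarrow> 'i set \<Rightarrow> 'i set \<Rightarrow> ('i \<Rightarrow> int) \<Rightarrow> ('i \<Rightarrow> 'i \<Rightarrow> 'a) \<Rightarrow> ('i \<Rightarrow> 'i \<Rightarrow> 'a)
     \<Rightarrow> ('a, 'e) gmodule \<Rightarrow> bool" where
  "presents_matrix R N T' T T'' s \<alpha> \<beta> E \<longleftrightarrow>
     presents R (pow_module N T) (pow_comp N T s) E
       {v \<in> T \<rightarrow>\<^sub>E carrier N. mat_map N T T'' \<beta> v = \<zero>\<^bsub>pow_module N T''\<^esub>} (mat_map N T' T \<alpha> ` (T' \<rightarrow>\<^sub>E carrier N))"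

context module
begin

lemma mat_map_linear:
  assumes "\<And>t t'. t \<in> T \<Longrightarrow> t' \<in> T' \<Longrightarrow> \<alpha> t' t \<in> carrier R" "finite T"
  shows "mat_map M T T' \<alpha> \<in> linear_maps R (pow_module M T) (pow_module M T')"
  unfolding linear_maps_def
proof (intro CollectI conjI ballI)
  have c: "(\<lambda>t. \<alpha> t' t \<odot>\<^bsub>M\<^esub> v t) \<in> T \<rightarrow> carrier M" if "v \<in> T \<rightarrow>\<^sub>E carrier M" "t' \<in> T'" for v t'
    using that assms by (auto simp: PiE_iff)
  show "mat_map M T T' \<alpha> \<in> carrier (pow_module M T) \<rightarrow> carrier (pow_module M T')"
    using c by (auto simp: mat_map_def)
  show "mat_map M T T' \<alpha> (v \<oplus>\<^bsub>pow_module M T\<^esub> w) = mat_map M T T' \<alpha> v \<oplus>\<^bsub>pow_module M T'\<^esub> mat_map M T T' \<alpha> w"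
    if v: "v \<in> carrier (pow_module M T)" and w: "w \<in> carrier (pow_module M T)" for v w
  proof -
    have "(\<Oplus>\<^bsub>M\<^esub>t\<in>T. \<alpha> t' t \<odot>\<^bsub>M\<^esub> (v \<oplus>\<^bsub>pow_module M T\<^esub> w) t) =
        (\<Oplus>\<^bsub>M\<^esub>t\<in>T. \<alpha> t' t \<odot>\<^bsub>M\<^esub> v t) \<oplus>\<^bsub>M\<^esub> (\<Oplus>\<^bsub>M\<^esub>t\<in>T. \<alpha> t' t \<odot>\<^bsub>M\<^esub> w t)" if "t' \<in> T'" for t'
    proof -
      have "(\<Oplus>\<^bsub>M\<^esub>t\<in>T. \<alpha> t' t \<odot>\<^bsub>M\<^esub> (v \<oplus>\<^bsub>pow_module M T\<^esub> w) t) =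
          (\<Oplus>\<^bsub>M\<^esub>t\<in>T. \<alpha> t' t \<odot>\<^bsub>M\<^esub> v t \<oplus>\<^bsub>M\<^esub> \<alpha> t' t \<odot>\<^bsub>M\<^esub> w t)"
        using v w that assms by (intro M.finsum_cong) (auto simp: PiE_iff smult_r_distr simp_implies_def)
      then show ?thesis using c v w that by (simp add: M.finsum_addf)
    qed
    then show ?thesis by (auto simp: mat_map_def fun_eq_iff)
  qed
  show "mat_map M T T' \<alpha> (a \<odot>\<^bsub>pow_module M T\<^esub> v) = a \<odot>\<^bsub>pow_module M T'\<^esub> mat_map M T T' \<alpha> v"
    if a: "a \<in> carrier R" and v: "v \<in> carrier (pow_module M T)" for a v
  proof -
    have "(\<Oplus>\<^bsub>M\<^esub>t\<in>T. \<alpha> t' t \<odot>\<^bsub>M\<^esub> (a \<odot>\<^bsub>pow_module M T\<^esub> v) t) = a \<odot>\<^bsub>M\<^esub> (\<Oplus>\<^bsub>M\<^esub>t\<in>T. \<alpha> t' t \<odot>\<^bsub>M\<^esub> v t)"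
      if "t' \<in> T'" for t'
    proof -
      have "(\<Oplus>\<^bsub>M\<^esub>t\<in>T. \<alpha> t' t \<odot>\<^bsub>M\<^esub> (a \<odot>\<^bsub>pow_module M T\<^esub> v) t) = (\<Oplus>\<^bsub>M\<^esub>t\<in>T. a \<odot>\<^bsub>M\<^esub> (\<alpha> t' t \<odot>\<^bsub>M\<^esub> v t))"
        using v a that assms by (intro M.finsum_cong) (auto simp: PiE_iff smult_swap simp_implies_def)
      then show ?thesis using c v a that by (simp add: finsum_smult_ldistr assms)
    qed
    then show ?thesis by (auto simp: mat_map_def fun_eq_iff)
  qed
qed

lemma mat_map_submodule:
  assumes "submodule N R M" "\<And>t t'. t \<in> T \<Longrightarrow> t' \<in> T' \<Longrightarrow> \<alpha> t' t \<in> carrier R" "v \<in> T \<rightarrow>\<^sub>E N"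
  shows "mat_map M T T' \<alpha> v \<in> T' \<rightarrow>\<^sub>E N"
  using assms(2,3) by (auto simp: mat_map_def intro!: submodule_finsum[OF assms(1)] submodule_smult[OF assms(1)])

lemma mat_map_quot:
  assumes N: "submodule N R M" and \<alpha>: "\<And>t t'. t \<in> T \<Longrightarrow> t' \<in> T' \<Longrightarrow> \<alpha> t' t \<in> carrier R" and v: "v \<in> T \<rightarrow>\<^sub>E carrier M"
  shows "mat_map (quot_module M N) T T' \<alpha> (\<lambda>t\<in>T. N +>\<^bsub>M\<^esub> v t) = (\<lambda>t'\<in>T'. N +>\<^bsub>M\<^esub> mat_map M T T' \<alpha> v t')"
proof -
  interpret Q: module R "quot_module M N" by (rule module_quot_module[OF N])
  have "(\<Oplus>\<^bsub>quot_module M N\<^esub>t\<in>T. \<alpha> t' t \<odot>\<^bsub>quot_module M N\<^esub> (\<lambda>t\<in>T. N +>\<^bsub>M\<^esub> v t) t) =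
      N +>\<^bsub>M\<^esub> (\<Oplus>\<^bsub>M\<^esub>t\<in>T. \<alpha> t' t \<odot>\<^bsub>M\<^esub> v t)" if t': "t' \<in> T'" for t'
  proof -
    have "(\<Oplus>\<^bsub>quot_module M N\<^esub>t\<in>T. \<alpha> t' t \<odot>\<^bsub>quot_module M N\<^esub> (\<lambda>t\<in>T. N +>\<^bsub>M\<^esub> v t) t) =
        (\<Oplus>\<^bsub>quot_module M N\<^esub>t\<in>T. N +>\<^bsub>M\<^esub> (\<alpha> t' t \<odot>\<^bsub>M\<^esub> v t))"
      using t' \<alpha> v by (intro Q.M.finsum_cong) (auto simp: quot_smult[OF N] quot_carrier[OF N] PiE_iff simp_implies_def)
    also have "\<dots> = N +>\<^bsub>M\<^esub> (\<Oplus>\<^bsub>M\<^esub>t\<in>T. \<alpha> t' t \<odot>\<^bsub>M\<^esub> v t)"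
      using t' \<alpha> v by (intro finsum_quot[OF N]) (auto simp: PiE_iff)
    finally show ?thesis .
  qed
  then show ?thesis by (auto simp: mat_map_def fun_eq_iff)
qed

end

lemma finsum_with_grading [simp]: "finsum (with_grading M A) = finsum M"
  by (intro ext) (simp add: finsum_def finprod_def with_grading_def)

lemma with_grading_simps [simp]:
  "carrier (with_grading M A) = carrier M" "add (with_grading M A) = add M"
  "zero (with_grading M A) = zero M" "smult (with_grading M A) = smult M" "hcomp (with_grading M A) = A"
  by (simp_all add: with_grading_def)

lemma pow_module_with_grading [simp]: "pow_module (with_grading M A) T = pow_module M T"
  by (simp add: pow_module_def)

lemma mat_map_with_grading [simp]: "mat_map (with_grading M A) T T' \<alpha> = mat_map M T T' \<alpha>"
  by (simp add: mat_map_def fun_eq_iff)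

text \<open>Homology with coefficients in M / Q becomes a subquotient of a power of
  \<open>M\<close>: its cycles are the tuples that \<open>\<beta>\<close> sends into Q, and its
  boundaries acquire the tuples over Q. This places all H_n in one module, where Artin-Rees can
  compare them.\<close>

lemma presents_matrix_quot:
  fixes R :: "'a gring" and M :: "('a, 'm) gmodule" and T T' T'' :: "'i set"
  assumes M: "module R M" and hc: "\<And>j. hcomp M j \<subseteq> carrier M" and Q: "submodule Q R M"
    and \<alpha>: "\<And>t t'. t \<in> T \<Longrightarrow> t' \<in> T' \<Longrightarrow> \<alpha> t t' \<in> carrier R"
    and \<beta>: "\<And>t t''. t \<in> T \<Longrightarrow> t'' \<in> T'' \<Longrightarrow> \<beta> t'' t \<in> carrier R"
    and E: "presents_matrix R (quot_gmodule M Q) T' T T'' s \<alpha> \<beta> E"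
  shows "presents R (pow_module M T) (pow_comp M T s) E {v \<in> T \<rightarrow>\<^sub>E carrier M. mat_map M T T'' \<beta> v \<in> T'' \<rightarrow>\<^sub>E Q}
    (mat_map M T' T \<alpha> ` (T' \<rightarrow>\<^sub>E carrier M) <+>\<^bsub>pow_module M T\<^esub> (T \<rightarrow>\<^sub>E Q))"
proof -
  interpret module R M by (rule M)
  let ?N = "quot_gmodule M Q"
  let ?Z = "{v \<in> T \<rightarrow>\<^sub>E carrier ?N. mat_map ?N T T'' \<beta> v = \<zero>\<^bsub>pow_module ?N T''\<^esub>}"
  let ?Z' = "{v \<in> T \<rightarrow>\<^sub>E carrier M. mat_map M T T'' \<beta> v \<in> T'' \<rightarrow>\<^sub>E Q}"
  let ?B = "mat_map M T' T \<alpha> ` (T' \<rightarrow>\<^sub>E carrier M) <+>\<^bsub>pow_module M T\<^esub> (T \<rightarrow>\<^sub>E Q)"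
  have Nc: "carrier ?N = (\<lambda>x. Q +>\<^bsub>M\<^esub> x) ` carrier M" and Nh: "hcomp ?N j = (\<lambda>x. Q +>\<^bsub>M\<^esub> x) ` hcomp M j" for j
    using quot_carrier[OF Q] by (auto simp: quot_gmodule_def)
  have Qc: "q \<in> Q \<Longrightarrow> q \<in> carrier M" for q using submodule_mem[OF Q] .
  define \<theta> where "\<theta> S v = (\<lambda>t\<in>S. Q +>\<^bsub>M\<^esub> v t)" for S :: "'i set" and v
  have \<theta>c: "\<theta> S v \<in> S \<rightarrow>\<^sub>E carrier ?N" if "v \<in> S \<rightarrow>\<^sub>E carrier M" for S v
    using that by (auto simp: \<theta>_def Nc PiE_iff)
  \<comment> \<open>Representatives are chosen entry by entry from prescribed sets, so that
    homogeneous cosets receive homogeneous representatives.\<close>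
  have lift: "\<exists>v. v \<in> S \<rightarrow>\<^sub>E carrier M \<and> (\<forall>t\<in>S. v t \<in> H t) \<and> w = \<theta> S v"
    if w: "w \<in> S \<rightarrow>\<^sub>E carrier ?N" and H: "\<And>t. t \<in> S \<Longrightarrow> H t \<subseteq> carrier M" "\<And>t. t \<in> S \<Longrightarrow> w t \<in> (\<lambda>x. Q +>\<^bsub>M\<^esub> x) ` H t" for S w H
  proof -
    have "\<forall>t\<in>S. \<exists>x\<in>H t. w t = Q +>\<^bsub>M\<^esub> x" using H(2) by blast
    then obtain v where v: "\<And>t. t \<in> S \<Longrightarrow> v t \<in> H t \<and> w t = Q +>\<^bsub>M\<^esub> v t" by metis
    have "w = \<theta> S (restrict v S)"
    proof
      show "w t = \<theta> S (restrict v S) t" for t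
        using v[of t] w by (cases "t \<in> S") (auto simp: \<theta>_def PiE_iff extensional_def)
    qed
    moreover have "restrict v S \<in> S \<rightarrow>\<^sub>E carrier M" using v H(1) by auto
    ultimately show ?thesis using v by (intro exI[of _ "restrict v S"]) auto
  qed
  have \<theta>\<beta>: "mat_map ?N T T'' \<beta> (\<theta> T v) = (\<lambda>t\<in>T''. Q +>\<^bsub>M\<^esub> mat_map M T T'' \<beta> v t)" if "v \<in> T \<rightarrow>\<^sub>E carrier M" for v
    using mat_map_quot[OF Q _ that, of T'' \<beta>] \<beta> by (simp add: \<theta>_def quot_gmodule_def)
  have \<theta>\<alpha>: "mat_map ?N T' T \<alpha> (\<theta> T' u) = (\<lambda>t\<in>T. Q +>\<^bsub>M\<^esub> mat_map M T' T \<alpha> u t)" if "u \<in> T' \<rightarrow>\<^sub>E carrier M" for u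
    using mat_map_quot[OF Q _ that, of T \<alpha>] \<alpha> by (simp add: \<theta>_def quot_gmodule_def)
  have \<beta>c: "mat_map M T T'' \<beta> v \<in> T'' \<rightarrow>\<^sub>E carrier M" if "v \<in> T \<rightarrow>\<^sub>E carrier M" for v
    by (rule mat_map_submodule[OF carrier_is_submodule _ that]) (use \<beta> in auto)
  have \<alpha>c: "mat_map M T' T \<alpha> u \<in> T \<rightarrow>\<^sub>E carrier M" if "u \<in> T' \<rightarrow>\<^sub>E carrier M" for u
    by (rule mat_map_submodule[OF carrier_is_submodule _ that]) (use \<alpha> in auto)
  have zero: "\<zero>\<^bsub>pow_module ?N T''\<^esub> = (\<lambda>t\<in>T''. Q)"
    by (simp add: quot_gmodule_def quot_zero[OF Q])
  have Z_iff: "\<theta> T v \<in> ?Z \<longleftrightarrow> v \<in> ?Z'" if v: "v \<in> T \<rightarrow>\<^sub>E carrier M" for v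
  proof -
    have "\<theta> T v \<in> ?Z \<longleftrightarrow> (\<lambda>t\<in>T''. Q +>\<^bsub>M\<^esub> mat_map M T T'' \<beta> v t) = (\<lambda>t\<in>T''. Q)"
      using \<theta>c[OF v] \<theta>\<beta>[OF v] zero by simp
    also have "\<dots> \<longleftrightarrow> (\<forall>t\<in>T''. Q +>\<^bsub>M\<^esub> mat_map M T T'' \<beta> v t = Q)"
      by (auto simp: fun_eq_iff restrict_def)
    also have "\<dots> \<longleftrightarrow> (\<forall>t\<in>T''. mat_map M T T'' \<beta> v t \<in> Q)"
      using \<beta>c[OF v] coset_zero_iff[OF Q] by (auto simp: PiE_iff)
    also have "\<dots> \<longleftrightarrow> v \<in> ?Z'" using v \<beta>c[OF v] by (auto simp: PiE_iff)
    finally show ?thesis .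
  qed
  show ?thesis
  proof (rule presents_lift[OF E[unfolded presents_matrix_def], of "\<theta> T"])
    show "\<theta> T ` ?Z' = ?Z"
    proof (intro equalityI subsetI)
      fix w assume w: "w \<in> ?Z"
      then obtain v where "v \<in> T \<rightarrow>\<^sub>E carrier M" "w = \<theta> T v"
        using lift[of w T "\<lambda>t. carrier M"] by (auto simp: Nc PiE_iff)
      then show "w \<in> \<theta> T ` ?Z'" using w Z_iff by blast
    qed (use Z_iff in blast)
    show "\<theta> T (a \<odot>\<^bsub>pow_module M T\<^esub> z) = a \<odot>\<^bsub>pow_module ?N T\<^esub> \<theta> T z" if a: "a \<in> carrier R" and z: "z \<in> ?Z'" for a z
      using a z quot_smult[OF Q a] by (auto simp: \<theta>_def fun_eq_iff quot_gmodule_def PiE_iff)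
    show "\<theta> T z \<in> mat_map ?N T' T \<alpha> ` (T' \<rightarrow>\<^sub>E carrier ?N) \<longleftrightarrow> z \<in> ?B" if z: "z \<in> ?Z'" for z
    proof
      have zc: "z \<in> T \<rightarrow>\<^sub>E carrier M" using z by simp
      assume "\<theta> T z \<in> mat_map ?N T' T \<alpha> ` (T' \<rightarrow>\<^sub>E carrier ?N)"
      then obtain w where w: "w \<in> T' \<rightarrow>\<^sub>E carrier ?N" "\<theta> T z = mat_map ?N T' T \<alpha> w" by blast
      then obtain u where u: "u \<in> T' \<rightarrow>\<^sub>E carrier M" "w = \<theta> T' u"
        using lift[of w T' "\<lambda>t. carrier M"] by (auto simp: Nc PiE_iff)
      let ?u = "mat_map M T' T \<alpha> u"
      have q: "z t \<ominus>\<^bsub>M\<^esub> ?u t \<in> Q" if t: "t \<in> T" for t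
      proof -
        have "\<theta> T z t = mat_map ?N T' T \<alpha> (\<theta> T' u) t" using w u by simp
        then have "Q +>\<^bsub>M\<^esub> z t = Q +>\<^bsub>M\<^esub> ?u t" using t \<theta>\<alpha>[OF u(1)] by (simp add: \<theta>_def)
        moreover have "z t \<in> carrier M" "?u t \<in> carrier M" using zc \<alpha>c[OF u(1)] t by (auto simp: PiE_iff)
        ultimately show ?thesis using coset_eq_iff[OF Q] by blast
      qed
      have "z = ?u \<oplus>\<^bsub>pow_module M T\<^esub> (\<lambda>t\<in>T. z t \<ominus>\<^bsub>M\<^esub> ?u t)"
      proof
        fix t
        show "z t = (?u \<oplus>\<^bsub>pow_module M T\<^esub> (\<lambda>t\<in>T. z t \<ominus>\<^bsub>M\<^esub> ?u t)) t"
        proof (cases "t \<in> T")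
          case True
          then have "z t \<in> carrier M" "?u t \<in> carrier M" using zc \<alpha>c[OF u(1)] by (auto simp: PiE_iff)
          then have "z t = ?u t \<oplus>\<^bsub>M\<^esub> (z t \<ominus>\<^bsub>M\<^esub> ?u t)"
            using M.r_neg2[of "?u t" "z t"] by (simp add: a_minus_def M.a_comm M.a_lcomm)
          then show ?thesis using True by simp
        qed (use zc in \<open>simp add: PiE_iff extensional_def\<close>)
      qed
      moreover have "(\<lambda>t\<in>T. z t \<ominus>\<^bsub>M\<^esub> ?u t) \<in> T \<rightarrow>\<^sub>E Q" using q by auto
      ultimately show "z \<in> ?B" using u(1) unfolding set_add_def' by blast
    next
      assume "z \<in> ?B"
      then obtain u q where u: "u \<in> T' \<rightarrow>\<^sub>E carrier M" and q: "q \<in> T \<rightarrow>\<^sub>E Q"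
        and zq: "z = mat_map M T' T \<alpha> u \<oplus>\<^bsub>pow_module M T\<^esub> q" unfolding set_add_def' by blast
      let ?u = "mat_map M T' T \<alpha> u"
      have "Q +>\<^bsub>M\<^esub> z t = Q +>\<^bsub>M\<^esub> ?u t" if t: "t \<in> T" for t
      proof -
        have c: "?u t \<in> carrier M" "q t \<in> Q" "q t \<in> carrier M" using \<alpha>c[OF u] q t Qc by (auto simp: PiE_iff)
        then have "(?u t \<oplus>\<^bsub>M\<^esub> q t) \<ominus>\<^bsub>M\<^esub> ?u t = q t"
          using M.r_neg1[of "?u t" "q t"] by (simp add: a_minus_def M.a_comm M.a_lcomm)
        then show ?thesis using coset_eq_iff[OF Q, of "?u t \<oplus>\<^bsub>M\<^esub> q t" "?u t"] c t by (simp add: zq)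
      qed
      then have "\<theta> T z = mat_map ?N T' T \<alpha> (\<theta> T' u)"
        unfolding \<theta>\<alpha>[OF u] unfolding \<theta>_def by (rule restrict_ext)
      then show "\<theta> T z \<in> mat_map ?N T' T \<alpha> ` (T' \<rightarrow>\<^sub>E carrier ?N)" using \<theta>c[OF u] by blast
    qed
    show "\<theta> T ` (?Z' \<inter> pow_comp M T s j) = ?Z \<inter> pow_comp ?N T s j" for j
    proof (intro equalityI subsetI)
      fix w assume "w \<in> \<theta> T ` (?Z' \<inter> pow_comp M T s j)"
      then obtain v where v: "v \<in> ?Z'" "v \<in> pow_comp M T s j" "w = \<theta> T v" by blast
      then have vc: "v \<in> T \<rightarrow>\<^sub>E carrier M" by simp
      have "w \<in> ?Z" using Z_iff[OF vc] v by blast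
      moreover have "w \<in> pow_comp ?N T s j"
        using v \<theta>c[OF vc] by (auto simp: pow_comp_def Nh \<theta>_def)
      ultimately show "w \<in> ?Z \<inter> pow_comp ?N T s j" by blast
    next
      fix w assume w: "w \<in> ?Z \<inter> pow_comp ?N T s j"
      then obtain v where v: "v \<in> T \<rightarrow>\<^sub>E carrier M" "\<forall>t\<in>T. v t \<in> hcomp M (j + s t)" "w = \<theta> T v"
        using lift[of w T "\<lambda>t. hcomp M (j + s t)"] hc by (auto simp: pow_comp_def Nh)
      then have "v \<in> ?Z'" using w Z_iff[OF v(1)] by blast
      moreover have "v \<in> pow_comp M T s j" using v by (simp add: pow_comp_def)
      ultimately show "w \<in> \<theta> T ` (?Z' \<inter> pow_comp M T s j)" using v(3) by blast
    qed
  qed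
qed

lemma Inf_least_int:
  assumes "m \<in> S" "\<And>j. j \<in> S \<Longrightarrow> m \<le> j"
  shows "Inf {ereal (of_int j) | j. j \<in> S} = ereal (of_int m)"
  by (rule antisym) (use assms in \<open>auto intro!: Inf_lower Inf_greatest\<close>)

context module_parts
begin

text \<open>An entry of degree s' t' - s t compensates the difference of the twists, so the matrix
  is homogeneous of degree zero.\<close>

lemma mat_map_parts:
  assumes T: "finite T" and \<alpha>: "\<And>t t'. t \<in> T \<Longrightarrow> t' \<in> T' \<Longrightarrow> \<alpha> t' t \<in> carrier R"
    and deg: "\<And>t t'. t \<in> T \<Longrightarrow> t' \<in> T' \<Longrightarrow> rp (s' t' - s t) (\<alpha> t' t) = \<alpha> t' t"
    and v: "v \<in> T \<rightarrow>\<^sub>E carrier M"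
  shows "mat_map M T T' \<alpha> (pow_parts T s j v) = pow_parts T' s' j (mat_map M T T' \<alpha> v)"
proof -
  have "(\<Oplus>\<^bsub>M\<^esub>t\<in>T. \<alpha> t' t \<odot>\<^bsub>M\<^esub> pow_parts T s j v t) = mp (j + s' t') (\<Oplus>\<^bsub>M\<^esub>t\<in>T. \<alpha> t' t \<odot>\<^bsub>M\<^esub> v t)" if t': "t' \<in> T'" for t'
  proof -
    have "(\<Oplus>\<^bsub>M\<^esub>t\<in>S. \<alpha> t' t \<odot>\<^bsub>M\<^esub> pow_parts T s j v t) = mp (j + s' t') (\<Oplus>\<^bsub>M\<^esub>t\<in>S. \<alpha> t' t \<odot>\<^bsub>M\<^esub> v t)"
      if S: "S \<subseteq> T" for S
      using finite_subset[OF S T] S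
    proof (induction S rule: finite_induct)
      case empty
      then show ?case by (simp add: M.finsum_empty)
    next
      case (insert t S)
      have t: "t \<in> T" "v t \<in> carrier M" using insert.prems v by auto
      have eq: "\<alpha> t' t \<odot>\<^bsub>M\<^esub> pow_parts T s j v t = mp (j + s' t') (\<alpha> t' t \<odot>\<^bsub>M\<^esub> v t)"
        using mp_smult[OF \<alpha>[OF t(1) t'] deg[OF t(1) t'] t(2), of "j + s t"] t by (simp add: pow_parts_def add.commute)
      have c: "(\<lambda>t. \<alpha> t' t \<odot>\<^bsub>M\<^esub> v t) \<in> S \<rightarrow> carrier M" "(\<lambda>t. \<alpha> t' t \<odot>\<^bsub>M\<^esub> pow_parts T s j v t) \<in> S \<rightarrow> carrier M"
        using insert.prems v \<alpha> t' by (auto simp: pow_parts_def PiE_iff subset_iff)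
      show ?case
        using insert c eq t \<alpha>[OF t(1) t'] by (simp add: M.finsum_insert mp_add M.finsum_closed)
    qed
    then show ?thesis by simp
  qed
  then show ?thesis by (auto simp: mat_map_def pow_parts_def fun_eq_iff)
qed

end

text \<open>Ext and Tor differ in the matrices and in the sign of the twists only, so both are
  instances of this statement. The degree conditions on \<open>\<alpha>\<close> and
  \<open>\<beta>\<close> make the families of cycles and boundaries homogeneous, and
  \<open>complex\<close> makes the boundaries cycles.\<close>

theorem matrix_homology_v_number:
  fixes R :: "'a gring" and M :: "('a, 'm) gmodule" and I :: "'a set" and \<alpha> \<beta> :: "'i \<Rightarrow> 'i \<Rightarrow> 'a"
    and H :: "('a, 'h) gmodule" and Hn :: "nat \<Rightarrow> ('a, 'e) gmodule"
  assumes R: "graded_ring R" "noetherian_ring R" and M: "graded_module R M" "fin_gen_module R M"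
    and I: "homogeneous_ideal I R"
    and fin: "finite T" "finite T'" "finite T''"
    and \<alpha>: "\<And>t t'. t \<in> T \<Longrightarrow> t' \<in> T' \<Longrightarrow> \<alpha> t t' \<in> carrier R \<and> ring_part R (s t - s' t') (\<alpha> t t') = \<alpha> t t'"
    and \<beta>: "\<And>t t''. t \<in> T \<Longrightarrow> t'' \<in> T'' \<Longrightarrow> \<beta> t'' t \<in> carrier R \<and> ring_part R (s'' t'' - s t) (\<beta> t'' t) = \<beta> t'' t"
    and complex: "\<And>u. u \<in> T' \<rightarrow>\<^sub>E carrier M \<Longrightarrow> mat_map M T T'' \<beta> (mat_map M T' T \<alpha> u) = \<zero>\<^bsub>pow_module M T''\<^esub>"
    and H: "presents_matrix R M T' T T'' s \<alpha> \<beta> H"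
    and Hn: "\<And>n. presents_matrix R (mod_ideal_power R I M n) T' T T'' s \<alpha> \<beta> (Hn n)"
    and regular: "ideal_annihilated H I = {\<zero>\<^bsub>H\<^esub>}"
  shows "(\<forall>\<^sub>F n in sequentially. carrier (Hn n) = {\<zero>\<^bsub>Hn n\<^esub>}) \<or>
    (\<exists>(a::nat) (b::int). minimal_generator_degree R I a \<and>
       (\<forall>\<^sub>F n in sequentially. v_number R (Hn n) = ereal (of_int (int a * int n + b))))"
proof -
  interpret M: graded_module R M by (rule M(1))
  interpret MP: module_parts R M "ring_part R" "mod_part M" by (rule M.module_parts)
  have hom_c: "homogeneous_elements R \<subseteq> carrier R"
    using M.rcomp_iff by (auto simp: homogeneous_elements_def)
  \<comment> \<open>An irredundant generating set is fixed at the outset: the slope found below is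
    the degree of some member of \<open>ys\<close>, hence of a minimal generator.\<close>
  obtain ys where min: "minimal_homogeneous_generators R I (set ys)"
    using exists_minimal_homogeneous_generators[OF M.is_cring R(2) I hom_c] by blast
  then have ys_hom: "set ys \<subseteq> homogeneous_elements R" and I_eq: "I = Idl\<^bsub>R\<^esub> (set ys)"
    by (auto simp: minimal_homogeneous_generators_def)
  have ys: "set ys \<subseteq> carrier R" using ys_hom hom_c by blast
  define dg where "dg y = int (SOME d. y \<in> rcomp R d)" for y
  have dg: "ring_part R (dg y) y = y" and dg_min: "\<exists>d. dg y = int d \<and> minimal_generator_degree R I d" if y: "y \<in> set ys" for y
  proof -
    have ex: "\<exists>d. y \<in> rcomp R d" using y ys_hom by (auto simp: homogeneous_elements_def)
    from someI_ex[OF this] have y_mem: "y \<in> rcomp R (SOME d. y \<in> rcomp R d)" .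
    then show "ring_part R (dg y) y = y" unfolding dg_def using iffD1[OF M.rcomp_iff y_mem] by blast
    show "\<exists>d. dg y = int d \<and> minimal_generator_degree R I d"
      unfolding dg_def minimal_generator_degree_def using min y y_mem by blast
  qed
  have Iid: "ideal I R" unfolding I_eq by (rule M.genideal_ideal[OF ys])
  interpret MM: rees_setting R M "ring_part R" "mod_part M" ys dg
    by (intro rees_setting.intro rees_setting_axioms.intro M.module_parts ys dg R(2)
        M.noetherian_fin_gen_module M(2))
  let ?C = "pow_module M T"
  let ?mp = "MP.pow_parts T s"
  have fgC: "fin_gen_module R ?C" by (rule M.fin_gen_pow_module[OF fin(1) M(2)])
  have partsC: "module_parts R ?C (ring_part R) ?mp" by (rule MP.module_parts_pow[OF fin(1)])
  interpret CM: module R ?C by (rule M.module_pow_module)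
  interpret C: rees_setting R ?C "ring_part R" ?mp ys dg
    by (intro rees_setting.intro rees_setting_axioms.intro partsC ys dg R(2)
        CM.noetherian_fin_gen_module fgC)
  let ?Y = "pow_module M T''"
  have Y: "module R ?Y" by (rule M.module_pow_module)
  interpret Y: module R ?Y by (rule Y)
  have noethY: "noetherian_module R ?Y"
    by (rule Y.noetherian_fin_gen_module[OF R(2) M.fin_gen_pow_module[OF fin(3) M(2)]])
  have pow_noeth: "noetherian_module R (pow_module ?C (set ys))"
    by (rule module.noetherian_fin_gen_module[OF CM.module_pow_module R(2) CM.fin_gen_pow_module[OF _ fgC]]) simp
  \<comment> \<open>\<open>Q n\<close> is I^n M; the tuples over it give the families
    \<open>E\<close> on the middle term and \<open>EY\<close> on the last one.\<close>
  define Q where "Q n = ideal_times R (ideal_power R I n) M" for n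
  have Qsub: "submodule (Q n) R M" for n
    unfolding Q_def by (rule M.ideal_times_submodule[OF M.ideal_ideal_power[OF Iid]])
  have Q0: "Q 0 = carrier M" unfolding Q_def ideal_power_simps by (rule M.ideal_times_carrier)
  have QSuc: "Q (Suc n) = lin_comb M ys (Q n)" for n
    unfolding Q_def by (rule M.ideal_power_times_Suc[OF ys I_eq])
  have Qst: "y \<odot>\<^bsub>M\<^esub> v \<in> Q (Suc n)" if "y \<in> set ys" "v \<in> Q n" for y v n
    unfolding QSuc by (rule M.lin_comb_smult[OF Qsub ys that])
  have Qparts: "parts_closed (mod_part M) (Q n)" for n
  proof (induction n)
    case (Suc n)
    then show ?case unfolding QSuc by (rule MM.lin_comb_parts_closed[OF Qsub])
  qed (simp add: Q0 parts_closed_def)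
  define E where "E n = (T \<rightarrow>\<^sub>E Q n)" for n
  define EY where "EY n = (T'' \<rightarrow>\<^sub>E Q n)" for n
  define g where "g = mat_map M T T'' \<beta>"
  define Bd where "Bd = mat_map M T' T \<alpha> ` (T' \<rightarrow>\<^sub>E carrier M)"
  have g: "g \<in> linear_maps R ?C ?Y"
    unfolding g_def by (rule M.mat_map_linear) (use \<beta> fin in auto)
  have f: "mat_map M T' T \<alpha> \<in> linear_maps R (pow_module M T') ?C"
    by (rule M.mat_map_linear) (use \<alpha> fin in auto)
  have EYst: "stable_family R ?Y ys EY"
    using M.submodule_pow[OF Qsub] Qst by (auto simp: stable_family_def EY_def PiE_iff)
  have EYgen: "eventually_generated ?Y ys (\<lambda>n. {\<zero>\<^bsub>?Y\<^esub>}) EY"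
    unfolding eventually_generated_def
  proof (intro exI[of _ 0] allI impI)
    fix n
    have L: "submodule (lin_comb ?Y ys (EY n)) R ?Y"
      by (rule Y.submodule_lin_comb[OF Y.stable_familyD(1)[OF EYst] ys])
    have "EY (Suc n) \<subseteq> lin_comb ?Y ys (EY n)"
      unfolding EY_def QSuc by (rule M.lin_comb_pow_subset)
    then show "EY (Suc n) \<subseteq> lin_comb ?Y ys (EY n) <+>\<^bsub>?Y\<^esub> {\<zero>\<^bsub>?Y\<^esub>}"
      using Y.set_add_left[OF L Y.zero_submodule] by blast
  qed
  have g_comm: "g (?mp j v) = MP.pow_parts T'' s'' j (g v)" if "v \<in> T \<rightarrow>\<^sub>E carrier M" for j v
    unfolding g_def by (rule MP.mat_map_parts[OF fin(1) _ _ that]) (use \<beta> in auto)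
  have f_comm: "mat_map M T' T \<alpha> (MP.pow_parts T' s' j u) = ?mp j (mat_map M T' T \<alpha> u)" if "u \<in> T' \<rightarrow>\<^sub>E carrier M" for j u
    by (rule MP.mat_map_parts[OF fin(2) _ _ that]) (use \<alpha> in auto)
  have g_parts: "parts_closed ?mp {z \<in> carrier ?C. g z \<in> EY n}" for n
    unfolding parts_closed_def
  proof (intro ballI allI)
    fix z j assume z: "z \<in> {z \<in> carrier ?C. g z \<in> EY n}"
    then have "MP.pow_parts T'' s'' j (g z) \<in> EY n"
      using Qparts by (auto simp: EY_def MP.pow_parts_def parts_closed_def PiE_iff)
    then show "?mp j z \<in> {z \<in> carrier ?C. g z \<in> EY n}" using z g_comm[of z j] C.mp_closed[of z j] by simp
  qed
  have gE: "C.graded_family E"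
    unfolding C.graded_family_def stable_family_def
  proof (intro conjI allI ballI)
    show "submodule (E n) R ?C" for n unfolding E_def by (rule M.submodule_pow[OF Qsub])
    show "y \<odot>\<^bsub>?C\<^esub> v \<in> E (Suc n)" if "y \<in> set ys" "v \<in> E n" for y v n
      using that Qst by (auto simp: E_def PiE_iff)
    show "parts_closed ?mp (E n)" for n
      using Qparts by (auto simp: E_def MP.pow_parts_def parts_closed_def PiE_iff)
  qed
  have E0: "E 0 = carrier ?C" by (simp add: E_def Q0)
  have ESuc: "E (Suc n) \<subseteq> lin_comb ?C ys (E n)" for n
    unfolding E_def QSuc by (rule M.lin_comb_pow_subset)
  have gEE: "g ` E n \<subseteq> EY n" for n
    unfolding E_def EY_def g_def using M.mat_map_submodule[OF Qsub, of T T'' \<beta>] \<beta> by blast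
  have Bsub: "submodule Bd R ?C"
    using module.submodule_image[OF M.module_pow_module M.module_pow_module f module.carrier_is_submodule[OF M.module_pow_module]]
    by (simp add: Bd_def)
  have Bparts: "parts_closed ?mp Bd"
    unfolding parts_closed_def
  proof (intro ballI allI)
    fix b j assume "b \<in> Bd"
    then obtain u where u: "u \<in> T' \<rightarrow>\<^sub>E carrier M" "b = mat_map M T' T \<alpha> u" by (auto simp: Bd_def)
    have "MP.pow_parts T' s' j u \<in> T' \<rightarrow>\<^sub>E carrier M" using u(1) by (auto simp: MP.pow_parts_def PiE_iff)
    then show "?mp j b \<in> Bd" unfolding Bd_def u(2) f_comm[OF u(1), symmetric] by blast
  qed
  have gB: "g b = \<zero>\<^bsub>?Y\<^esub>" if "b \<in> Bd" for b using that complex by (auto simp: Bd_def g_def)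
  have Zker: "submodule {v \<in> carrier ?C. g v = \<zero>\<^bsub>?Y\<^esub>} R ?C"
    using CM.submodule_kernel[OF Y g Y.zero_submodule] by simp
  \<comment> \<open>Translates the hypothesis on H: if all generators send the cycle w into the
    boundaries, the ideal of scalars that do so contains I, and the class of w in H is killed by
    I.\<close>
  have reg: "w \<in> Bd" if w: "w \<in> carrier ?C" "g w = \<zero>\<^bsub>?Y\<^esub>" and yw: "\<And>y. y \<in> set ys \<Longrightarrow> y \<odot>\<^bsub>?C\<^esub> w \<in> Bd" for w
  proof -
    have "presents R ?C (pow_comp M T s) H {v \<in> carrier ?C. g v = \<zero>\<^bsub>?Y\<^esub>} Bd"
      using H by (simp add: presents_matrix_def g_def Bd_def)
    from presents_annihilator[OF this CM.submodule_smult[OF Zker]] obtain \<pi> where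
      pi: "carrier H = \<pi> ` {v \<in> carrier ?C. g v = \<zero>\<^bsub>?Y\<^esub>} \<and>
        (\<forall>z\<in>{v \<in> carrier ?C. g v = \<zero>\<^bsub>?Y\<^esub>}. \<pi> z = \<zero>\<^bsub>H\<^esub> \<longleftrightarrow> z \<in> Bd) \<and>
        (\<forall>z\<in>{v \<in> carrier ?C. g v = \<zero>\<^bsub>?Y\<^esub>}. annihilator R H (\<pi> z) = colon R ?C Bd z)" by blast
    have "ideal (colon R ?C Bd w) R"
      using C.colon_submodule[OF Bsub w(1)] M.submodule_regular_iff by blast
    moreover have "set ys \<subseteq> colon R ?C Bd w" using yw ys by (auto simp: colon_def)
    ultimately have "I \<subseteq> colon R ?C Bd w" unfolding I_eq by (rule M.genideal_minimal)
    then have "I \<subseteq> annihilator R H (\<pi> w)" using pi w by blast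
    moreover have "\<pi> w \<in> carrier H" using pi w by blast
    ultimately have "\<pi> w \<in> ideal_annihilated H I" unfolding ideal_annihilated_def annihilator_def by blast
    then have "\<pi> w = \<zero>\<^bsub>H\<^esub>" using regular by blast
    then show ?thesis using pi w by blast
  qed
  have lin: "eventually_linear (dg ` set ys) (\<lambda>n. {j. \<exists>z\<in>{z \<in> carrier ?C. g z \<in> EY n}. ?mp j z = z \<and>
      primeideal (colon R ?C (Bd <+>\<^bsub>?C\<^esub> E n) z) R})"
    by (rule C.homology_prime_degrees_linear[OF Y noethY g EYst EYgen g_parts gE E0 ESuc gEE Bsub Bparts gB pow_noeth reg])
  define Z where "Z n = {z \<in> carrier ?C. g z \<in> EY n}" for n
  define B where "B n = Bd <+>\<^bsub>?C\<^esub> E n" for n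
  \<comment> \<open>The degrees of homogeneous classes of \<open>Hn n\<close> with prime
    annihilator; the v-number will be their infimum.\<close>
  define S where "S n = {j. \<exists>z\<in>Z n. ?mp j z = z \<and> primeideal (colon R ?C (B n) z) R}" for n
  have Zsub: "submodule (Z n) R ?C" for n
    unfolding Z_def by (rule CM.submodule_kernel[OF Y g Y.stable_familyD(1)[OF EYst]])
  note Esub = C.graded_familyD(2)[OF gE]
  have Bnsub: "submodule (B n) R ?C" for n
    unfolding B_def by (rule CM.submodule_set_add[OF Bsub Esub])
  have Bnparts: "parts_closed ?mp (B n)" for n
    unfolding B_def by (rule C.parts_closed_set_add[OF Bsub Bparts Esub C.graded_familyD(4)[OF gE]])
  have pres: "presents R ?C (pow_comp M T s) (Hn n) (Z n) (B n)" for n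
  proof -
    have "hcomp M j \<subseteq> carrier M" for j using M.hcomp_iff by blast
    from presents_matrix_quot[OF M.module_axioms this Qsub _ _ Hn[of n, unfolded mod_ideal_power_def, folded Q_def]]
    show ?thesis
      unfolding Z_def B_def E_def EY_def Bd_def g_def using \<alpha> \<beta> by simp
  qed
  have comp: "z \<in> pow_comp M T s j \<longleftrightarrow> ?mp j z = z" if z: "z \<in> carrier ?C" for z j
  proof -
    have "?mp j z = z \<longleftrightarrow> (\<forall>t\<in>T. mod_part M (j + s t) (z t) = z t)"
      using z by (auto simp: MP.pow_parts_def fun_eq_iff PiE_iff extensional_def)
    then show ?thesis using z M.hcomp_iff by (auto simp: pow_comp_def PiE_iff)
  qed
  have v: "v_number R (Hn n) = Inf {ereal (of_int j) | j. j \<in> S n}" for n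
  proof -
    have "v_number R (Hn n) = Inf {ereal (of_int j) | j. \<exists>z\<in>Z n. z \<in> pow_comp M T s j \<and> primeideal (colon R ?C (B n) z) R}"
      by (rule v_number_presents[OF pres]) (rule CM.submodule_smult[OF Zsub])
    also have "{ereal (of_int j) | j. \<exists>z\<in>Z n. z \<in> pow_comp M T s j \<and> primeideal (colon R ?C (B n) z) R} =
        {ereal (of_int j) | j. j \<in> S n}"
      using comp CM.submodule_mem[OF Zsub] unfolding S_def by (intro Collect_cong) blast
    finally show ?thesis .
  qed
  \<comment> \<open>If \<open>Hn n\<close> were nonzero, it would have an associated prime with a
    homogeneous witness, whose degree would be a member of \<open>S n\<close>.\<close>
  have Sempty: "carrier (Hn n) = {\<zero>\<^bsub>Hn n\<^esub>}" if "S n = {}" for n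
  proof -
    have ZB: "Z n \<subseteq> B n"
    proof
      fix z assume z: "z \<in> Z n"
      show "z \<in> B n"
      proof (rule ccontr)
        assume "z \<notin> B n"
        have "parts_closed ?mp (Z n)" unfolding Z_def by (rule g_parts)
        from C.exists_prime_colon[OF R(2) Bnsub Bnparts Zsub this z \<open>z \<notin> B n\<close>] show False
          using that by (auto simp: S_def)
      qed
    qed
    obtain \<pi> where \<pi>: "carrier (Hn n) = \<pi> ` Z n" "\<forall>z\<in>Z n. \<pi> z = \<zero>\<^bsub>Hn n\<^esub> \<longleftrightarrow> z \<in> B n"
      using presents_annihilator[OF pres CM.submodule_smult[OF Zsub]] by blast
    have zero: "\<pi> z = \<zero>\<^bsub>Hn n\<^esub>" if "z \<in> Z n" for z using that ZB \<pi>(2) by blast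
    note z0 = CM.submodule_zero[OF Zsub, of n]
    show ?thesis
    proof
      show "carrier (Hn n) \<subseteq> {\<zero>\<^bsub>Hn n\<^esub>}" unfolding \<pi>(1) using zero by (intro image_subsetI singletonI) simp
      show "{\<zero>\<^bsub>Hn n\<^esub>} \<subseteq> carrier (Hn n)" unfolding \<pi>(1) using imageI[OF z0, of \<pi>] unfolding zero[OF z0] by simp
    qed
  qed
  have "eventually_linear (dg ` set ys) S" using lin unfolding S_def Z_def B_def .
  then show ?thesis
    unfolding eventually_linear_def
  proof (elim disjE exE bexE)
    fix n0 assume "\<forall>n\<ge>n0. S n = {}"
    then show ?thesis using Sempty unfolding eventually_sequentially by blast
  next
    fix a b n0 assume a: "a \<in> dg ` set ys" and n0: "\<forall>n\<ge>n0. a * int n + b \<in> S n \<and> (\<forall>j\<in>S n. a * int n + b \<le> j)"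
    obtain d where d: "a = int d" "minimal_generator_degree R I d" using a dg_min by blast
    have "v_number R (Hn n) = ereal (of_int (int d * int n + b))" if "n \<ge> n0" for n
      unfolding v using n0 that d(1) by (intro Inf_least_int) auto
    then show ?thesis using d(2) unfolding eventually_sequentially by blast
  qed
qed

section \<open>Finite sums and products of matrices\<close>

context module
begin

lemma linear_maps_finsum:
  assumes Y: "module R Y" and g: "g \<in> linear_maps R M Y" and f: "f \<in> J \<rightarrow> carrier M"
  shows "g (finsum M f J) = finsum Y (\<lambda>i. g (f i)) J"
proof -
  interpret Y: module R Y by (rule Y)
  have gc: "\<And>x. x \<in> carrier M \<Longrightarrow> g x \<in> carrier Y" using g by (auto simp: linear_maps_def)
  show ?thesis
    using f
  proof (induction J rule: infinite_finite_induct)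
    case (insert i J)
    have "f \<in> J \<rightarrow> carrier M" "f i \<in> carrier M" "(\<lambda>i. g (f i)) \<in> J \<rightarrow> carrier Y" "g (f i) \<in> carrier Y"
      using insert.prems gc by auto
    then show ?case
      using insert g by (simp add: M.finsum_insert Y.M.finsum_insert linear_maps_def)
  qed (simp_all add: linear_maps_zero[OF Y g])
qed

lemma finsum_smult_rdistr:
  assumes "f \<in> J \<rightarrow> carrier R" "x \<in> carrier M"
  shows "finsum R f J \<odot>\<^bsub>M\<^esub> x = (\<Oplus>\<^bsub>M\<^esub>i\<in>J. f i \<odot>\<^bsub>M\<^esub> x)"
proof -
  have "(\<lambda>a. a \<odot>\<^bsub>M\<^esub> x) \<in> linear_maps R (regular_module R) M"
    using assms(2) by (auto simp: linear_maps_def smult_l_distr smult_assoc1)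
  from module.linear_maps_finsum[OF R.regular_module module_axioms this, of f J] assms(1)
  show ?thesis by simp
qed

lemma finsum_swap:
  assumes "finite I" "finite J" "\<And>i j. i \<in> I \<Longrightarrow> j \<in> J \<Longrightarrow> f i j \<in> carrier M"
  shows "(\<Oplus>\<^bsub>M\<^esub>i\<in>I. \<Oplus>\<^bsub>M\<^esub>j\<in>J. f i j) = (\<Oplus>\<^bsub>M\<^esub>j\<in>J. \<Oplus>\<^bsub>M\<^esub>i\<in>I. f i j)"
  using assms(1,3)
proof (induction I rule: finite_induct)
  case (insert i I)
  have c: "f i \<in> J \<rightarrow> carrier M" "(\<lambda>i. \<Oplus>\<^bsub>M\<^esub>j\<in>J. f i j) \<in> I \<rightarrow> carrier M"
    "(\<lambda>j. \<Oplus>\<^bsub>M\<^esub>i\<in>I. f i j) \<in> J \<rightarrow> carrier M"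
    using insert.prems by (auto intro!: M.finsum_closed)
  have "(\<Oplus>\<^bsub>M\<^esub>j\<in>J. \<Oplus>\<^bsub>M\<^esub>i\<in>insert i I. f i j) = (\<Oplus>\<^bsub>M\<^esub>j\<in>J. f i j \<oplus>\<^bsub>M\<^esub> (\<Oplus>\<^bsub>M\<^esub>i\<in>I. f i j))"
    using insert c by (intro M.finsum_cong) (auto simp: simp_implies_def M.finsum_insert Pi_def)
  also have "\<dots> = (\<Oplus>\<^bsub>M\<^esub>j\<in>J. f i j) \<oplus>\<^bsub>M\<^esub> (\<Oplus>\<^bsub>M\<^esub>j\<in>J. \<Oplus>\<^bsub>M\<^esub>i\<in>I. f i j)"
    using c by (intro M.finsum_addf) auto
  finally show ?case using insert c by (simp add: M.finsum_insert M.finsum_closed)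
qed (simp add: M.finsum_empty)

text \<open>The product of the two matrices vanishes over R, and interchanging the sums shows that
  the composite then vanishes on tuples over the module.\<close>

lemma mat_map_comp_zero:
  assumes fin: "finite T" "finite T'" and \<alpha>: "\<And>t t'. t \<in> T \<Longrightarrow> t' \<in> T' \<Longrightarrow> \<alpha> t' t \<in> carrier R"
    and \<beta>: "\<And>t' t''. t' \<in> T' \<Longrightarrow> t'' \<in> T'' \<Longrightarrow> \<beta> t'' t' \<in> carrier R"
    and zero: "\<And>t t''. t \<in> T \<Longrightarrow> t'' \<in> T'' \<Longrightarrow> (\<Oplus>\<^bsub>R\<^esub>t'\<in>T'. \<beta> t'' t' \<otimes>\<^bsub>R\<^esub> \<alpha> t' t) = \<zero>\<^bsub>R\<^esub>"
    and v: "v \<in> T \<rightarrow>\<^sub>E carrier M"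
  shows "mat_map M T' T'' \<beta> (mat_map M T T' \<alpha> v) = \<zero>\<^bsub>pow_module M T''\<^esub>"
proof -
  have "(\<Oplus>\<^bsub>M\<^esub>t'\<in>T'. \<beta> t'' t' \<odot>\<^bsub>M\<^esub> mat_map M T T' \<alpha> v t') = \<zero>\<^bsub>M\<^esub>" if t'': "t'' \<in> T''" for t''
  proof -
    have vc: "\<And>t. t \<in> T \<Longrightarrow> v t \<in> carrier M" using v by auto
    have "(\<Oplus>\<^bsub>M\<^esub>t'\<in>T'. \<beta> t'' t' \<odot>\<^bsub>M\<^esub> mat_map M T T' \<alpha> v t') =
        (\<Oplus>\<^bsub>M\<^esub>t'\<in>T'. \<Oplus>\<^bsub>M\<^esub>t\<in>T. (\<beta> t'' t' \<otimes>\<^bsub>R\<^esub> \<alpha> t' t) \<odot>\<^bsub>M\<^esub> v t)"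
    proof (rule M.finsum_cong'[OF refl])
      show "(\<lambda>t'. \<Oplus>\<^bsub>M\<^esub>t\<in>T. (\<beta> t'' t' \<otimes>\<^bsub>R\<^esub> \<alpha> t' t) \<odot>\<^bsub>M\<^esub> v t) \<in> T' \<rightarrow> carrier M"
        using \<alpha> \<beta>[OF _ t''] vc by (auto intro!: M.finsum_closed)
      fix t' assume t': "t' \<in> T'"
      have "\<beta> t'' t' \<odot>\<^bsub>M\<^esub> mat_map M T T' \<alpha> v t' = (\<Oplus>\<^bsub>M\<^esub>t\<in>T. \<beta> t'' t' \<odot>\<^bsub>M\<^esub> (\<alpha> t' t \<odot>\<^bsub>M\<^esub> v t))"
        using \<alpha> \<beta>[OF t' t''] vc t' fin by (simp add: mat_map_def finsum_smult_ldistr Pi_def)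
      also have "\<dots> = (\<Oplus>\<^bsub>M\<^esub>t\<in>T. (\<beta> t'' t' \<otimes>\<^bsub>R\<^esub> \<alpha> t' t) \<odot>\<^bsub>M\<^esub> v t)"
        using \<alpha>[OF _ t'] \<beta>[OF t' t''] vc by (intro M.finsum_cong') (auto simp: smult_assoc1)
      finally show "\<beta> t'' t' \<odot>\<^bsub>M\<^esub> mat_map M T T' \<alpha> v t' = (\<Oplus>\<^bsub>M\<^esub>t\<in>T. (\<beta> t'' t' \<otimes>\<^bsub>R\<^esub> \<alpha> t' t) \<odot>\<^bsub>M\<^esub> v t)" .
    qed
    also have "\<dots> = (\<Oplus>\<^bsub>M\<^esub>t\<in>T. \<Oplus>\<^bsub>M\<^esub>t'\<in>T'. (\<beta> t'' t' \<otimes>\<^bsub>R\<^esub> \<alpha> t' t) \<odot>\<^bsub>M\<^esub> v t)"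
      using \<alpha> \<beta>[OF _ t''] vc by (intro finsum_swap fin) auto
    also have "\<dots> = (\<Oplus>\<^bsub>M\<^esub>t\<in>T. \<zero>\<^bsub>M\<^esub>)"
    proof (rule M.add.finprod_cong')
      fix t assume t: "t \<in> T"
      have "(\<Oplus>\<^bsub>M\<^esub>t'\<in>T'. (\<beta> t'' t' \<otimes>\<^bsub>R\<^esub> \<alpha> t' t) \<odot>\<^bsub>M\<^esub> v t) = (\<Oplus>\<^bsub>R\<^esub>t'\<in>T'. \<beta> t'' t' \<otimes>\<^bsub>R\<^esub> \<alpha> t' t) \<odot>\<^bsub>M\<^esub> v t"
        using \<alpha> \<beta>[OF _ t''] vc t by (intro finsum_smult_rdistr[symmetric]) auto
      then show "(\<Oplus>\<^bsub>M\<^esub>t'\<in>T'. (\<beta> t'' t' \<otimes>\<^bsub>R\<^esub> \<alpha> t' t) \<odot>\<^bsub>M\<^esub> v t) = \<zero>\<^bsub>M\<^esub>"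
        using zero[OF t t''] vc[OF t] by simp
    qed auto
    finally show ?thesis by simp
  qed
  then show ?thesis by (auto simp: mat_map_def[of M T' T''] fun_eq_iff)
qed

end

section \<open>Homogeneous bases\<close>

text \<open>The basis elements themselves serve as index set for tuples and matrices, and
  \<open>deg\<close> records a choice of their degrees.\<close>

locale graded_basis = graded_module R F for R :: "'a gring" (structure) and F :: "('a, 'f) gmodule" (structure) +
  fixes B :: "'f set" and deg :: "'f \<Rightarrow> int"
  assumes fin_B: "finite B" and B_deg: "b \<in> B \<Longrightarrow> b \<in> hcomp F (deg b)"
    and B_basis: "x \<in> carrier F \<Longrightarrow> \<exists>!c. c \<in> B \<rightarrow>\<^sub>E carrier R \<and> x = (\<Oplus>\<^bsub>F\<^esub>b\<in>B. c b \<odot>\<^bsub>F\<^esub> b)"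

lemma graded_free_basis:
  assumes "graded_free R F"
  shows "\<exists>B deg. graded_basis R F B deg"
proof -
  obtain B where F: "graded_module R F" and B: "finite B" "B \<subseteq> (\<Union>n. hcomp F n)"
    "\<forall>x\<in>carrier F. \<exists>!c. c \<in> B \<rightarrow>\<^sub>E carrier R \<and> x = (\<Oplus>\<^bsub>F\<^esub>b\<in>B. c b \<odot>\<^bsub>F\<^esub> b)"
    using assms unfolding graded_free_def by blast
  have "\<forall>b\<in>B. \<exists>n. b \<in> hcomp F n" using B(2) by blast
  then obtain deg where "\<And>b. b \<in> B \<Longrightarrow> b \<in> hcomp F (deg b)" by metis
  then have "graded_basis R F B deg"
    using F B(1,3) by (intro graded_basis.intro graded_basis_axioms.intro) auto
  then show ?thesis by blast
qed

context graded_basis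
begin

definition coef :: "'f \<Rightarrow> 'f \<Rightarrow> 'a" where
  "coef x = (THE c. c \<in> B \<rightarrow>\<^sub>E carrier R \<and> x = (\<Oplus>\<^bsub>F\<^esub>b\<in>B. c b \<odot>\<^bsub>F\<^esub> b))"

lemma B_carrier: "b \<in> B \<Longrightarrow> b \<in> carrier F"
  using B_deg hcomp_iff by blast

lemma coef_PiE: "x \<in> carrier F \<Longrightarrow> coef x \<in> B \<rightarrow>\<^sub>E carrier R"
  and coef_sum: "x \<in> carrier F \<Longrightarrow> x = (\<Oplus>\<^bsub>F\<^esub>b\<in>B. coef x b \<odot>\<^bsub>F\<^esub> b)"
  using theI'[OF B_basis, of x] unfolding coef_def by auto

lemma coef_closed: "x \<in> carrier F \<Longrightarrow> b \<in> B \<Longrightarrow> coef x b \<in> carrier R"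
  using coef_PiE by blast

lemma coef_unique:
  assumes "x \<in> carrier F" "c \<in> B \<rightarrow>\<^sub>E carrier R" "x = (\<Oplus>\<^bsub>F\<^esub>b\<in>B. c b \<odot>\<^bsub>F\<^esub> b)"
  shows "coef x = c"
  using the1_equality[OF B_basis[OF assms(1)]] assms(2,3) unfolding coef_def by blast

lemma coef_linear: "b \<in> B \<Longrightarrow> (\<lambda>x. coef x b) \<in> linear_maps R F (regular_module R)"
proof -
  assume b: "b \<in> B"
  have add: "coef (x \<oplus>\<^bsub>F\<^esub> y) = (\<lambda>b\<in>B. coef x b \<oplus>\<^bsub>R\<^esub> coef y b)" if "x \<in> carrier F" "y \<in> carrier F" for x y
  proof (rule coef_unique)
    have "(\<Oplus>\<^bsub>F\<^esub>b\<in>B. (\<lambda>b\<in>B. coef x b \<oplus>\<^bsub>R\<^esub> coef y b) b \<odot>\<^bsub>F\<^esub> b) = (\<Oplus>\<^bsub>F\<^esub>b\<in>B. coef x b \<odot>\<^bsub>F\<^esub> b \<oplus>\<^bsub>F\<^esub> coef y b \<odot>\<^bsub>F\<^esub> b)"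
      using that coef_closed B_carrier by (intro M.finsum_cong) (auto simp: simp_implies_def smult_l_distr)
    also have "\<dots> = x \<oplus>\<^bsub>F\<^esub> y"
      using that coef_closed B_carrier by (subst M.finsum_addf) (auto simp flip: coef_sum)
    finally show "x \<oplus>\<^bsub>F\<^esub> y = (\<Oplus>\<^bsub>F\<^esub>b\<in>B. (\<lambda>b\<in>B. coef x b \<oplus>\<^bsub>R\<^esub> coef y b) b \<odot>\<^bsub>F\<^esub> b)" by simp
  qed (use that coef_closed in auto)
  have smult: "coef (a \<odot>\<^bsub>F\<^esub> x) = (\<lambda>b\<in>B. a \<otimes>\<^bsub>R\<^esub> coef x b)" if "a \<in> carrier R" "x \<in> carrier F" for a x
  proof (rule coef_unique)
    have "(\<Oplus>\<^bsub>F\<^esub>b\<in>B. (\<lambda>b\<in>B. a \<otimes>\<^bsub>R\<^esub> coef x b) b \<odot>\<^bsub>F\<^esub> b) = (\<Oplus>\<^bsub>F\<^esub>b\<in>B. a \<odot>\<^bsub>F\<^esub> (coef x b \<odot>\<^bsub>F\<^esub> b))"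
      using that coef_closed B_carrier by (intro M.finsum_cong) (auto simp: simp_implies_def smult_assoc1)
    also have "\<dots> = a \<odot>\<^bsub>F\<^esub> x"
      using that coef_closed B_carrier fin_B by (subst finsum_smult_ldistr[symmetric]) (auto simp flip: coef_sum)
    finally show "a \<odot>\<^bsub>F\<^esub> x = (\<Oplus>\<^bsub>F\<^esub>b\<in>B. (\<lambda>b\<in>B. a \<otimes>\<^bsub>R\<^esub> coef x b) b \<odot>\<^bsub>F\<^esub> b)" by simp
  qed (use that coef_closed in auto)
  show ?thesis
    using b add smult coef_closed by (auto simp: linear_maps_def)
qed

lemma coef_basis: "b \<in> B \<Longrightarrow> coef b = (\<lambda>b'\<in>B. if b' = b then \<one>\<^bsub>R\<^esub> else \<zero>\<^bsub>R\<^esub>)"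
proof (rule coef_unique)
  assume b: "b \<in> B"
  have "(\<Oplus>\<^bsub>F\<^esub>b'\<in>B. (\<lambda>b'\<in>B. if b' = b then \<one>\<^bsub>R\<^esub> else \<zero>\<^bsub>R\<^esub>) b' \<odot>\<^bsub>F\<^esub> b') = (\<Oplus>\<^bsub>F\<^esub>b'\<in>B. if b = b' then b' else \<zero>\<^bsub>F\<^esub>)"
    using B_carrier by (intro M.finsum_cong) (auto simp: simp_implies_def)
  also have "\<dots> = b"
    using M.finsum_singleton[OF b fin_B, of "\<lambda>b. b"] B_carrier by simp
  finally show "b = (\<Oplus>\<^bsub>F\<^esub>b'\<in>B. (\<lambda>b'\<in>B. if b' = b then \<one>\<^bsub>R\<^esub> else \<zero>\<^bsub>R\<^esub>) b' \<odot>\<^bsub>F\<^esub> b')" by simp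
qed (use B_carrier in auto)

text \<open>Taking the part of degree i in the basis expansion of \<open>x\<close> yields a second
  expansion of \<open>x\<close>, with each coefficient replaced by one of its parts; uniqueness
  identifies the two.\<close>

lemma coef_degree:
  assumes x: "x \<in> hcomp F i" and b: "b \<in> B"
  shows "ring_part R (i - deg b) (coef x b) = coef x b"
proof -
  interpret P: module_parts R F "ring_part R" "mod_part F" by (rule module_parts)
  have xc: "x \<in> carrier F" and xi: "mod_part F i x = x" using x hcomp_iff by auto
  have bdeg: "mod_part F (deg b) b = b" "b \<in> carrier F" if "b \<in> B" for b using B_deg[OF that] hcomp_iff by auto
  have eq: "mod_part F i (coef x b \<odot>\<^bsub>F\<^esub> b) = ring_part R (i - deg b) (coef x b) \<odot>\<^bsub>F\<^esub> b" if "b \<in> B" for b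
    using P.mp_smult_homogeneous[OF coef_closed[OF xc that] bdeg(2)[OF that] bdeg(1)[OF that]] .
  have sum: "mod_part F i (finsum F (\<lambda>b. coef x b \<odot>\<^bsub>F\<^esub> b) S) = (\<Oplus>\<^bsub>F\<^esub>b\<in>S. ring_part R (i - deg b) (coef x b) \<odot>\<^bsub>F\<^esub> b)"
    if "S \<subseteq> B" for S
    using finite_subset[OF that fin_B] that
  proof (induction S rule: finite_induct)
    case (insert b S)
    have c: "(\<lambda>b. coef x b \<odot>\<^bsub>F\<^esub> b) \<in> S \<rightarrow> carrier F"
      "(\<lambda>b. ring_part R (i - deg b) (coef x b) \<odot>\<^bsub>F\<^esub> b) \<in> S \<rightarrow> carrier F"
      "coef x b \<odot>\<^bsub>F\<^esub> b \<in> carrier F" "ring_part R (i - deg b) (coef x b) \<odot>\<^bsub>F\<^esub> b \<in> carrier F"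
      using insert.prems coef_closed[OF xc] B_carrier by (auto simp: subset_iff)
    then show ?case
      using insert eq[of b] by (simp add: M.finsum_insert P.mp_add M.finsum_closed)
  qed (simp add: M.finsum_empty)
  have coef_eq: "coef x = (\<lambda>b\<in>B. ring_part R (i - deg b) (coef x b))"
  proof (rule coef_unique[OF xc])
    have "(\<Oplus>\<^bsub>F\<^esub>b\<in>B. (\<lambda>b\<in>B. ring_part R (i - deg b) (coef x b)) b \<odot>\<^bsub>F\<^esub> b) =
        (\<Oplus>\<^bsub>F\<^esub>b\<in>B. ring_part R (i - deg b) (coef x b) \<odot>\<^bsub>F\<^esub> b)"
      using coef_closed[OF xc] B_carrier by (intro M.finsum_cong) (auto simp: simp_implies_def)
    also have "\<dots> = mod_part F i (\<Oplus>\<^bsub>F\<^esub>b\<in>B. coef x b \<odot>\<^bsub>F\<^esub> b)" using sum[of B] by simp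
    also have "\<dots> = x" using coef_sum[OF xc] xi by simp
    finally show "x = (\<Oplus>\<^bsub>F\<^esub>b\<in>B. (\<lambda>b\<in>B. ring_part R (i - deg b) (coef x b)) b \<odot>\<^bsub>F\<^esub> b)" by simp
  qed (use coef_closed[OF xc] in auto)
  show ?thesis using fun_cong[OF coef_eq, of b] unfolding restrict_apply'[OF b] by (rule sym)
qed

lemma linear_maps_eq_on_basis:
  assumes V: "module R V" and f: "f \<in> linear_maps R F V" and x: "x \<in> carrier F"
  shows "f x = (\<Oplus>\<^bsub>V\<^esub>b\<in>B. coef x b \<odot>\<^bsub>V\<^esub> f b)"
proof -
  interpret V: module R V by (rule V)
  have "f x = f (\<Oplus>\<^bsub>F\<^esub>b\<in>B. coef x b \<odot>\<^bsub>F\<^esub> b)" using coef_sum[OF x] by simp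
  also have "\<dots> = (\<Oplus>\<^bsub>V\<^esub>b\<in>B. f (coef x b \<odot>\<^bsub>F\<^esub> b))"
    using coef_closed[OF x] B_carrier by (intro linear_maps_finsum[OF V f]) auto
  also have "\<dots> = (\<Oplus>\<^bsub>V\<^esub>b\<in>B. coef x b \<odot>\<^bsub>V\<^esub> f b)"
    using f coef_closed[OF x] B_carrier by (intro V.M.finsum_cong) (auto simp: simp_implies_def linear_maps_def)
  finally show ?thesis .
qed

end

text \<open>The part of a grading that passes to M / Q for every submodule Q, and that suffices to
  follow degrees through the coordinates of Hom and tensor modules.\<close>

locale weakly_graded_module = graded_ring R + module R N
  for R :: "'a gring" (structure) and N :: "('a, 'b) gmodule" (structure) +
  assumes hcomp_additive: "additive_subgroup (hcomp N j) N"
    and hcomp_smult: "\<lbrakk>a \<in> rcomp R i; x \<in> hcomp N j\<rbrakk> \<Longrightarrow> a \<odot>\<^bsub>N\<^esub> x \<in> hcomp N (int i + j)"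
begin

lemma hcomp_carrier: "x \<in> hcomp N j \<Longrightarrow> x \<in> carrier N"
  using additive_subgroup.a_subset[OF hcomp_additive] by blast

lemma hcomp_finsum:
  assumes "\<And>i. i \<in> J \<Longrightarrow> f i \<in> hcomp N j"
  shows "finsum N f J \<in> hcomp N j"
  using assms
proof (induction J rule: infinite_finite_induct)
  case (insert i J)
  then have "f \<in> J \<rightarrow> carrier N" "f i \<in> carrier N" using hcomp_carrier by auto
  then show ?case using insert additive_subgroup.a_closed[OF hcomp_additive] by (simp add: M.finsum_insert)
qed (simp_all add: additive_subgroup.zero_closed[OF hcomp_additive])

lemma hcomp_smult_part:
  assumes "a \<in> carrier R" "ring_part R i a = a" "x \<in> hcomp N j"
  shows "a \<odot>\<^bsub>N\<^esub> x \<in> hcomp N (i + j)"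
proof (cases "i < 0")
  case True
  then have "a = \<zero>" using assms(2) by (simp add: ring_part_def)
  then show ?thesis using hcomp_carrier[OF assms(3)] additive_subgroup.zero_closed[OF hcomp_additive] by simp
next
  case False
  then have "a \<in> rcomp R (nat i)" using assms rcomp_iff[of a "nat i"] by simp
  from hcomp_smult[OF this assms(3)] show ?thesis using False by simp
qed

end

lemma (in graded_module) weakly_graded: "weakly_graded_module R M"
  by (intro weakly_graded_module.intro weakly_graded_module_axioms.intro graded_ring_axioms module_axioms
      smult_hcomp M.A_subgroup[OF hcomp_direct_sum])

lemma (in graded_module) weakly_graded_quot:
  assumes Q: "submodule Q R M"
  shows "weakly_graded_module R (quot_gmodule M Q)"
proof (intro weakly_graded_module.intro weakly_graded_module_axioms.intro graded_ring_axioms)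
  show N: "module R (quot_gmodule M Q)"
    unfolding quot_gmodule_def by (rule module_cong[OF module_quot_module[OF Q]]) simp_all
  interpret N: module R "quot_gmodule M Q" by (rule N)
  have hN: "hcomp (quot_gmodule M Q) j = (\<lambda>x. Q +>\<^bsub>M\<^esub> x) ` hcomp M j" for j
    by (auto simp: quot_gmodule_def)
  have hc: "x \<in> hcomp M j \<Longrightarrow> x \<in> carrier M" for x j using hcomp_iff by blast
  have smult: "a \<odot>\<^bsub>quot_gmodule M Q\<^esub> (Q +>\<^bsub>M\<^esub> x) = Q +>\<^bsub>M\<^esub> (a \<odot>\<^bsub>M\<^esub> x)" if "a \<in> carrier R" "x \<in> carrier M" for a x
    using quot_smult[OF Q that] by (simp add: quot_gmodule_def)
  have add: "(Q +>\<^bsub>M\<^esub> x) \<oplus>\<^bsub>quot_gmodule M Q\<^esub> (Q +>\<^bsub>M\<^esub> y) = Q +>\<^bsub>M\<^esub> (x \<oplus>\<^bsub>M\<^esub> y)" if "x \<in> carrier M" "y \<in> carrier M" for x y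
    using quot_add[OF Q that] by (simp add: quot_gmodule_def)
  have carr: "carrier (quot_gmodule M Q) = (\<lambda>x. Q +>\<^bsub>M\<^esub> x) ` carrier M"
    using quot_carrier[OF Q] by (simp add: quot_gmodule_def)
  note sub = M.A_subgroup[OF hcomp_direct_sum] and m0 = M.A_zero[OF hcomp_direct_sum]
    and madd = M.A_add[OF hcomp_direct_sum]
  have zero: "\<zero>\<^bsub>quot_gmodule M Q\<^esub> = Q +>\<^bsub>M\<^esub> \<zero>\<^bsub>M\<^esub>"
    using coset_zero_iff[OF Q, of "\<zero>\<^bsub>M\<^esub>"] submodule_zero[OF Q] by (simp add: quot_gmodule_def quot_zero[OF Q])
  show "additive_subgroup (hcomp (quot_gmodule M Q) j) (quot_gmodule M Q)" for j
  proof (intro additive_subgroup.intro N.M.add.subgroupI)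
    show "hcomp (quot_gmodule M Q) j \<subseteq> carrier (quot_gmodule M Q)" using hc by (auto simp: hN carr)
    show "hcomp (quot_gmodule M Q) j \<noteq> {}" using m0 by (auto simp: hN)
    show "\<ominus>\<^bsub>quot_gmodule M Q\<^esub> X \<in> hcomp (quot_gmodule M Q) j" if X: "X \<in> hcomp (quot_gmodule M Q) j" for X
    proof -
      obtain x where x: "x \<in> hcomp M j" "X = Q +>\<^bsub>M\<^esub> x" using X by (auto simp: hN)
      have nx: "\<ominus>\<^bsub>M\<^esub> x \<in> hcomp M j" using additive_subgroup.a_inv_closed[OF sub x(1)] .
      have "\<ominus>\<^bsub>quot_gmodule M Q\<^esub> X = Q +>\<^bsub>M\<^esub> (\<ominus>\<^bsub>M\<^esub> x)"
        using x(2) hc[OF x(1)] hc[OF nx] by (intro N.M.minus_equality) (auto simp: add zero carr M.l_neg)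
      then show ?thesis using nx by (simp add: hN)
    qed
    show "X \<oplus>\<^bsub>quot_gmodule M Q\<^esub> Y \<in> hcomp (quot_gmodule M Q) j"
      if XY: "X \<in> hcomp (quot_gmodule M Q) j" "Y \<in> hcomp (quot_gmodule M Q) j" for X Y
    proof -
      obtain x y where xy: "x \<in> hcomp M j" "X = Q +>\<^bsub>M\<^esub> x" "y \<in> hcomp M j" "Y = Q +>\<^bsub>M\<^esub> y" using XY by (auto simp: hN)
      then show ?thesis using add[OF hc hc, of x j y j] madd by (auto simp: hN)
    qed
  qed
  show "a \<odot>\<^bsub>quot_gmodule M Q\<^esub> X \<in> hcomp (quot_gmodule M Q) (int i + j)"
    if a: "a \<in> rcomp R i" and X: "X \<in> hcomp (quot_gmodule M Q) j" for a i X j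
  proof -
    obtain x where x: "x \<in> hcomp M j" "X = Q +>\<^bsub>M\<^esub> x" using X by (auto simp: hN)
    have "a \<in> carrier R" using a rcomp_iff by blast
    then show ?thesis using smult[OF _ hc[OF x(1)]] smult_hcomp[OF a x(1)] x(2) by (auto simp: hN)
  qed
qed

section \<open>Homomorphisms out of a free module\<close>

locale graded_basis_pair = F: graded_basis R F B deg + N: weakly_graded_module R N
  for R :: "'a gring" (structure) and F :: "('a, 'f) gmodule" and B deg and N :: "('a, 'b) gmodule"
begin

text \<open>Linear extension from the basis, the inverse of restriction to \<open>B\<close>; it
  identifies Hom(F, N) with a power of N.\<close>

definition hom_of :: "('f \<Rightarrow> 'b) \<Rightarrow> 'f \<Rightarrow> 'b" where
  "hom_of v = (\<lambda>x\<in>carrier F. \<Oplus>\<^bsub>N\<^esub>b\<in>B. F.coef x b \<odot>\<^bsub>N\<^esub> v b)"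

lemma Hom_simps:
  "carrier (Hom_gmodule R F N) = linear_maps R F N \<inter> extensional (carrier F)"
  "\<zero>\<^bsub>Hom_gmodule R F N\<^esub> = (\<lambda>x\<in>carrier F. \<zero>\<^bsub>N\<^esub>)"
  "f \<oplus>\<^bsub>Hom_gmodule R F N\<^esub> g = (\<lambda>x\<in>carrier F. f x \<oplus>\<^bsub>N\<^esub> g x)"
  "a \<odot>\<^bsub>Hom_gmodule R F N\<^esub> f = (\<lambda>x\<in>carrier F. a \<odot>\<^bsub>N\<^esub> f x)"
  by (simp_all add: Hom_gmodule_def)

lemma module_Hom: "module R (Hom_gmodule R F N)"
proof (rule moduleI[OF F.is_cring])
  let ?H = "Hom_gmodule R F N"
  have lin: "f x \<in> carrier N" "f (x \<oplus>\<^bsub>F\<^esub> y) = f x \<oplus>\<^bsub>N\<^esub> f y" "f (a \<odot>\<^bsub>F\<^esub> x) = a \<odot>\<^bsub>N\<^esub> f x"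
    if "f \<in> carrier ?H" "x \<in> carrier F" "y \<in> carrier F" "a \<in> carrier R" for f x y a
    using that by (auto simp: Hom_simps linear_maps_def)
  have closed: "f x \<in> carrier N" if "f \<in> carrier ?H" "x \<in> carrier F" for f x
    using that by (auto simp: Hom_simps linear_maps_def)
  have ext: "f = g" if "f \<in> carrier ?H" "g \<in> carrier ?H" "\<And>x. x \<in> carrier F \<Longrightarrow> f x = g x" for f g
    using that by (intro extensionalityI[of f "carrier F" g]) (auto simp: Hom_simps)
  have zero: "\<zero>\<^bsub>?H\<^esub> \<in> carrier ?H"
    by (auto simp: Hom_simps linear_maps_def)
  have add: "f \<oplus>\<^bsub>?H\<^esub> g \<in> carrier ?H" if "f \<in> carrier ?H" "g \<in> carrier ?H" for f g
    using that by (auto simp: Hom_simps linear_maps_def Pi_iff N.M.a_ac N.smult_r_distr)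
  have smult: "a \<odot>\<^bsub>?H\<^esub> f \<in> carrier ?H" if "a \<in> carrier R" "f \<in> carrier ?H" for a f
    using that by (auto simp: Hom_simps linear_maps_def Pi_iff N.smult_r_distr N.smult_swap)
  show "abelian_group ?H"
  proof (rule abelian_groupI)
    show "\<exists>g\<in>carrier ?H. g \<oplus>\<^bsub>?H\<^esub> f = \<zero>\<^bsub>?H\<^esub>" if f: "f \<in> carrier ?H" for f
    proof (rule bexI[OF _ smult[OF _ f, of "\<ominus> \<one>"]])
      show "(\<ominus> \<one>) \<odot>\<^bsub>?H\<^esub> f \<oplus>\<^bsub>?H\<^esub> f = \<zero>\<^bsub>?H\<^esub>"
        using closed[OF f] by (auto simp: Hom_simps fun_eq_iff N.smult_l_minus N.M.l_neg)
    qed simp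
    show "\<zero>\<^bsub>?H\<^esub> \<oplus>\<^bsub>?H\<^esub> f = f" if f: "f \<in> carrier ?H" for f
      by (rule ext[OF add[OF zero f] f]) (use closed[OF f] in \<open>simp add: Hom_simps\<close>)
    show "f \<oplus>\<^bsub>?H\<^esub> g = g \<oplus>\<^bsub>?H\<^esub> f" if f: "f \<in> carrier ?H" and g: "g \<in> carrier ?H" for f g
      by (rule ext[OF add[OF f g] add[OF g f]]) (use closed[OF f] closed[OF g] in \<open>simp add: Hom_simps N.M.a_comm\<close>)
    show "(f \<oplus>\<^bsub>?H\<^esub> g) \<oplus>\<^bsub>?H\<^esub> h = f \<oplus>\<^bsub>?H\<^esub> (g \<oplus>\<^bsub>?H\<^esub> h)"
      if f: "f \<in> carrier ?H" and g: "g \<in> carrier ?H" and h: "h \<in> carrier ?H" for f g h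
      by (rule ext[OF add[OF add[OF f g] h] add[OF f add[OF g h]]])
        (use closed[OF f] closed[OF g] closed[OF h] in \<open>simp add: Hom_simps N.M.a_assoc\<close>)
  qed (fact add zero)+
  show "a \<odot>\<^bsub>?H\<^esub> f \<in> carrier ?H" if "a \<in> carrier R" "f \<in> carrier ?H" for a f using smult that .
  show "(a \<oplus> b) \<odot>\<^bsub>?H\<^esub> f = (a \<odot>\<^bsub>?H\<^esub> f) \<oplus>\<^bsub>?H\<^esub> (b \<odot>\<^bsub>?H\<^esub> f)" if "a \<in> carrier R" "b \<in> carrier R" "f \<in> carrier ?H" for a b f
    using that closed[OF that(3)] by (auto simp: Hom_simps fun_eq_iff N.smult_l_distr)
  show "a \<odot>\<^bsub>?H\<^esub> (f \<oplus>\<^bsub>?H\<^esub> g) = (a \<odot>\<^bsub>?H\<^esub> f) \<oplus>\<^bsub>?H\<^esub> (a \<odot>\<^bsub>?H\<^esub> g)" if "a \<in> carrier R" "f \<in> carrier ?H" "g \<in> carrier ?H" for a f g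
    using that closed[OF that(2)] closed[OF that(3)] by (auto simp: Hom_simps fun_eq_iff N.smult_r_distr)
  show "(a \<otimes> b) \<odot>\<^bsub>?H\<^esub> f = a \<odot>\<^bsub>?H\<^esub> (b \<odot>\<^bsub>?H\<^esub> f)" if "a \<in> carrier R" "b \<in> carrier R" "f \<in> carrier ?H" for a b f
    using that closed[OF that(3)] by (auto simp: Hom_simps fun_eq_iff N.smult_assoc1)
  show "\<one> \<odot>\<^bsub>?H\<^esub> f = f" if f: "f \<in> carrier ?H" for f
    by (rule ext[OF smult[OF F.one_closed f] f]) (use closed[OF f] in \<open>simp add: Hom_simps\<close>)
qed

lemma hom_of_linear:
  assumes v: "v \<in> B \<rightarrow>\<^sub>E carrier N"
  shows "hom_of v \<in> carrier (Hom_gmodule R F N)"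
proof -
  have vc: "\<And>b. b \<in> B \<Longrightarrow> v b \<in> carrier N" using v by auto
  have c: "(\<lambda>b. F.coef x b \<odot>\<^bsub>N\<^esub> v b) \<in> B \<rightarrow> carrier N" if "x \<in> carrier F" for x
    using vc F.coef_closed[OF that] by auto
  have add: "F.coef (x \<oplus>\<^bsub>F\<^esub> y) b = F.coef x b \<oplus> F.coef y b" and smult: "F.coef (a \<odot>\<^bsub>F\<^esub> x) b = a \<otimes> F.coef x b"
    if "b \<in> B" "x \<in> carrier F" "y \<in> carrier F" "a \<in> carrier R" for b x y a
    using F.coef_linear[OF that(1)] that by (auto simp: linear_maps_def)
  have "(\<Oplus>\<^bsub>N\<^esub>b\<in>B. F.coef (x \<oplus>\<^bsub>F\<^esub> y) b \<odot>\<^bsub>N\<^esub> v b) = (\<Oplus>\<^bsub>N\<^esub>b\<in>B. F.coef x b \<odot>\<^bsub>N\<^esub> v b) \<oplus>\<^bsub>N\<^esub> (\<Oplus>\<^bsub>N\<^esub>b\<in>B. F.coef y b \<odot>\<^bsub>N\<^esub> v b)"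
    if "x \<in> carrier F" "y \<in> carrier F" for x y
  proof -
    have "(\<Oplus>\<^bsub>N\<^esub>b\<in>B. F.coef (x \<oplus>\<^bsub>F\<^esub> y) b \<odot>\<^bsub>N\<^esub> v b) = (\<Oplus>\<^bsub>N\<^esub>b\<in>B. F.coef x b \<odot>\<^bsub>N\<^esub> v b \<oplus>\<^bsub>N\<^esub> F.coef y b \<odot>\<^bsub>N\<^esub> v b)"
      using add[OF _ that F.one_closed] c that F.coef_closed vc by (intro N.M.finsum_cong') (auto simp: N.smult_l_distr)
    then show ?thesis using c that by (simp add: N.M.finsum_addf)
  qed
  moreover have "(\<Oplus>\<^bsub>N\<^esub>b\<in>B. F.coef (a \<odot>\<^bsub>F\<^esub> x) b \<odot>\<^bsub>N\<^esub> v b) = a \<odot>\<^bsub>N\<^esub> (\<Oplus>\<^bsub>N\<^esub>b\<in>B. F.coef x b \<odot>\<^bsub>N\<^esub> v b)"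
    if "a \<in> carrier R" "x \<in> carrier F" for a x
  proof -
    have "(\<Oplus>\<^bsub>N\<^esub>b\<in>B. F.coef (a \<odot>\<^bsub>F\<^esub> x) b \<odot>\<^bsub>N\<^esub> v b) = (\<Oplus>\<^bsub>N\<^esub>b\<in>B. a \<odot>\<^bsub>N\<^esub> (F.coef x b \<odot>\<^bsub>N\<^esub> v b))"
      using smult[OF _ that(2) that(2) that(1)] c that F.coef_closed vc by (intro N.M.finsum_cong') (auto simp: N.smult_assoc1)
    then show ?thesis using c that F.fin_B by (simp add: N.finsum_smult_ldistr)
  qed
  ultimately show ?thesis
    using c by (auto simp: Hom_simps linear_maps_def hom_of_def intro!: N.M.finsum_closed)
qed

lemma hom_of_basis:
  assumes v: "v \<in> B \<rightarrow>\<^sub>E carrier N" and b: "b \<in> B"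
  shows "hom_of v b = v b"
proof -
  have vc: "\<And>b. b \<in> B \<Longrightarrow> v b \<in> carrier N" using v by auto
  have "hom_of v b = (\<Oplus>\<^bsub>N\<^esub>b'\<in>B. if b = b' then v b' else \<zero>\<^bsub>N\<^esub>)"
    unfolding hom_of_def using F.B_carrier[OF b] F.coef_basis[OF b] vc by (simp, intro N.M.finsum_cong') auto
  also have "\<dots> = v b" using N.M.finsum_singleton[OF b F.fin_B, of v] vc by auto
  finally show ?thesis .
qed

lemma hom_of_restrict:
  assumes f: "f \<in> carrier (Hom_gmodule R F N)"
  shows "hom_of (restrict f B) = f"
proof (rule extensionalityI[of _ "carrier F"])
  show "hom_of (restrict f B) \<in> extensional (carrier F)" by (simp add: hom_of_def)
  show "f \<in> extensional (carrier F)" using f by (simp add: Hom_simps)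
  fix x assume x: "x \<in> carrier F"
  have fl: "f \<in> linear_maps R F N" using f by (simp add: Hom_simps)
  have fc: "\<And>b. b \<in> B \<Longrightarrow> f b \<in> carrier N" using fl F.B_carrier by (auto simp: linear_maps_def)
  have "hom_of (restrict f B) x = (\<Oplus>\<^bsub>N\<^esub>b\<in>B. F.coef x b \<odot>\<^bsub>N\<^esub> f b)"
    unfolding hom_of_def using x fc F.coef_closed[OF x] by (simp, intro N.M.finsum_cong') auto
  then show "hom_of (restrict f B) x = f x"
    using F.linear_maps_eq_on_basis[OF N.module_axioms fl x] by simp
qed

text \<open>A homomorphism of degree j sends the basis element b to degree j + deg b, so Hom
  corresponds to the twist by + deg. The converse uses that the coefficient of b in an element of
  degree m has degree m - deg b.\<close>

lemma hom_of_hcomp: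
  assumes v: "v \<in> B \<rightarrow>\<^sub>E carrier N"
  shows "hom_of v \<in> hcomp (Hom_gmodule R F N) j \<longleftrightarrow> v \<in> pow_comp N B deg j"
proof
  assume "hom_of v \<in> hcomp (Hom_gmodule R F N) j"
  then have "hom_of v ` hcomp F m \<subseteq> hcomp N (m + j)" for m by (simp add: Hom_gmodule_def)
  then have "hom_of v b \<in> hcomp N (deg b + j)" if "b \<in> B" for b using F.B_deg[OF that] by blast
  then show "v \<in> pow_comp N B deg j" using v hom_of_basis[OF v] by (simp add: pow_comp_def add.commute)
next
  assume "v \<in> pow_comp N B deg j"
  then have vb: "v b \<in> hcomp N (j + deg b)" if "b \<in> B" for b using that by (simp add: pow_comp_def)
  have "hom_of v x \<in> hcomp N (m + j)" if x: "x \<in> hcomp F m" for x m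
  proof -
    have xc: "x \<in> carrier F" using x F.hcomp_iff by blast
    have "F.coef x b \<odot>\<^bsub>N\<^esub> v b \<in> hcomp N (m + j)" if b: "b \<in> B" for b
      using N.hcomp_smult_part[OF F.coef_closed[OF xc b] F.coef_degree[OF x b] vb[OF b]] by (simp add: add.commute)
    then show ?thesis unfolding hom_of_def using xc by (simp add: N.hcomp_finsum)
  qed
  then show "hom_of v \<in> hcomp (Hom_gmodule R F N) j"
    using hom_of_linear[OF v] by (auto simp: Hom_gmodule_def)
qed

lemma hom_of_linear_maps: "hom_of \<in> linear_maps R (pow_module N B) (Hom_gmodule R F N)"
  unfolding linear_maps_def
proof (intro CollectI conjI ballI)
  show "hom_of \<in> carrier (pow_module N B) \<rightarrow> carrier (Hom_gmodule R F N)" using hom_of_linear by auto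
  interpret H: module R "Hom_gmodule R F N" by (rule module_Hom)
  interpret P: module R "pow_module N B" by (rule N.module_pow_module)
  \<comment> \<open>A homomorphism is recovered from its values on the basis, so both linearity
    equations reduce to values at basis elements.\<close>
  have eq: "f = hom_of w" if "f \<in> carrier (Hom_gmodule R F N)" "w \<in> B \<rightarrow>\<^sub>E carrier N" "\<And>b. b \<in> B \<Longrightarrow> f b = w b" for f w
  proof -
    have "restrict f B = w" using that by (auto simp: fun_eq_iff PiE_iff extensional_def)
    then show ?thesis using hom_of_restrict[OF that(1)] by simp
  qed
  show "hom_of (v \<oplus>\<^bsub>pow_module N B\<^esub> w) = hom_of v \<oplus>\<^bsub>Hom_gmodule R F N\<^esub> hom_of w"
    if v: "v \<in> carrier (pow_module N B)" and w: "w \<in> carrier (pow_module N B)" for v w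
  proof (rule eq[symmetric])
    show "hom_of v \<oplus>\<^bsub>Hom_gmodule R F N\<^esub> hom_of w \<in> carrier (Hom_gmodule R F N)"
      using v w hom_of_linear by simp
    show "v \<oplus>\<^bsub>pow_module N B\<^esub> w \<in> B \<rightarrow>\<^sub>E carrier N" using P.M.a_closed[OF v w] by simp
    show "(hom_of v \<oplus>\<^bsub>Hom_gmodule R F N\<^esub> hom_of w) b = (v \<oplus>\<^bsub>pow_module N B\<^esub> w) b" if "b \<in> B" for b
      using hom_of_basis[OF _ that] v w that F.B_carrier[OF that] by (simp add: Hom_simps)
  qed
  show "hom_of (a \<odot>\<^bsub>pow_module N B\<^esub> v) = a \<odot>\<^bsub>Hom_gmodule R F N\<^esub> hom_of v"
    if a: "a \<in> carrier R" and v: "v \<in> carrier (pow_module N B)" for a v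
  proof (rule eq[symmetric])
    show "a \<odot>\<^bsub>Hom_gmodule R F N\<^esub> hom_of v \<in> carrier (Hom_gmodule R F N)"
      using a v hom_of_linear by simp
    show "a \<odot>\<^bsub>pow_module N B\<^esub> v \<in> B \<rightarrow>\<^sub>E carrier N" using P.smult_closed[OF a v] by simp
    show "(a \<odot>\<^bsub>Hom_gmodule R F N\<^esub> hom_of v) b = (a \<odot>\<^bsub>pow_module N B\<^esub> v) b" if "b \<in> B" for b
      using hom_of_basis[OF _ that] v a that F.B_carrier[OF that] by (simp add: Hom_simps)
  qed
qed

lemma hom_of_onto: "hom_of ` (B \<rightarrow>\<^sub>E carrier N) = carrier (Hom_gmodule R F N)"
proof
  show "carrier (Hom_gmodule R F N) \<subseteq> hom_of ` (B \<rightarrow>\<^sub>E carrier N)"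
  proof
    fix f assume f: "f \<in> carrier (Hom_gmodule R F N)"
    then have "restrict f B \<in> B \<rightarrow>\<^sub>E carrier N" using F.B_carrier by (auto simp: Hom_simps linear_maps_def)
    then show "f \<in> hom_of ` (B \<rightarrow>\<^sub>E carrier N)" using hom_of_restrict[OF f] by (metis imageI)
  qed
qed (use hom_of_linear in blast)

lemma hom_of_inj: "inj_on hom_of (B \<rightarrow>\<^sub>E carrier N)"
proof (rule inj_onI)
  fix v w assume v: "v \<in> B \<rightarrow>\<^sub>E carrier N" and w: "w \<in> B \<rightarrow>\<^sub>E carrier N" and eq: "hom_of v = hom_of w"
  show "v = w"
    by (rule PiE_ext[OF v w]) (metis eq hom_of_basis v w)
qed

end

section \<open>Ext\<close>

text \<open>Transport along an injective linear map that respects degrees, in the uses below the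
  coordinate isomorphism for Hom or for the tensor product.\<close>

lemma presents_subquot_image:
  fixes P :: "('a, 'p) gmodule" and N :: "('a, 'b) gmodule" and R :: "'a gring"
  assumes N: "module R N" and P: "module R P" and \<theta>: "\<theta> \<in> linear_maps R (pow_module N T) P"
    and inj: "inj_on \<theta> (T \<rightarrow>\<^sub>E carrier N)"
    and parts: "\<And>v j. v \<in> T \<rightarrow>\<^sub>E carrier N \<Longrightarrow> \<theta> v \<in> hcomp P j \<longleftrightarrow> v \<in> pow_comp N T s j"
    and Z: "submodule Z R (pow_module N T)" and B: "submodule B R (pow_module N T)" and BZ: "B \<subseteq> Z"
  shows "presents R (pow_module N T) (pow_comp N T s) (subquot_gmodule P (\<theta> ` Z) (\<theta> ` B)) Z B"
proof -
  interpret N: module R N by (rule N)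
  interpret C: module R "pow_module N T" by (rule N.module_pow_module)
  have Zc: "z \<in> Z \<Longrightarrow> z \<in> T \<rightarrow>\<^sub>E carrier N" for z using C.submodule_mem[OF Z] by simp
  show ?thesis
  proof (rule presents_lift[of R P "hcomp P" _ "\<theta> ` Z" "\<theta> ` B" \<theta>])
    show "presents R P (hcomp P) (subquot_gmodule P (\<theta> ` Z) (\<theta> ` B)) (\<theta> ` Z) (\<theta> ` B)"
      by (intro presents_subquot P C.submodule_image[OF P \<theta>] Z B image_mono BZ)
    show "\<theta> z \<in> \<theta> ` B \<longleftrightarrow> z \<in> B" if "z \<in> Z" for z
      using inj_on_image_mem_iff[OF inj Zc[OF that]] BZ Zc by (meson subset_iff)
    show "\<theta> (a \<odot>\<^bsub>pow_module N T\<^esub> z) = a \<odot>\<^bsub>P\<^esub> \<theta> z" if "a \<in> carrier R" "z \<in> Z" for a z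
      using \<theta> that C.submodule_mem[OF Z] by (simp add: linear_maps_def)
    show "\<theta> ` (Z \<inter> pow_comp N T s j) = \<theta> ` Z \<inter> hcomp P j" for j
      using parts Zc by blast
  qed simp
qed

section \<open>Complexes of graded free modules in coordinates\<close>

lemma linear_maps_compose:
  "f \<in> linear_maps R L M \<Longrightarrow> g \<in> linear_maps R M N \<Longrightarrow> (\<lambda>x. g (f x)) \<in> linear_maps R L N"
  by (simp add: linear_maps_def Pi_iff)

text \<open>The coefficient module \<open>N\<close> is a parameter, to be instantiated with M and
  with every M / I^n M, while bases and differentials stay the same.\<close>

locale free_complex = N: weakly_graded_module R N
  for R :: "'a gring" (structure) and N :: "('a, 'b) gmodule" +
  fixes F :: "nat \<Rightarrow> ('a, 'f) gmodule" and B :: "nat \<Rightarrow> 'f set" and deg :: "nat \<Rightarrow> 'f \<Rightarrow> int"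
    and \<delta> :: "nat \<Rightarrow> 'f \<Rightarrow> 'f"
  assumes basis: "graded_basis R (F i) (B i) (deg i)"
    and diff: "\<delta> i \<in> graded_linear_maps R (F (Suc i)) (F i)"
    and diff_diff: "x \<in> carrier (F (Suc (Suc i))) \<Longrightarrow> \<delta> i (\<delta> (Suc i) x) = \<zero>\<^bsub>F i\<^esub>"
begin

sublocale G: graded_basis_pair R "F i" "B i" "deg i" N for i
  by (intro graded_basis_pair.intro basis N.weakly_graded_module_axioms)

text \<open>Depends on the bases and on \<open>\<delta>\<close> but not on \<open>N\<close>, so M
  and all M / I^n M share these matrices. The basis element of the source comes before that of the
  target.\<close>

definition entry :: "nat \<Rightarrow> 'f \<Rightarrow> 'f \<Rightarrow> 'a" where
  "entry i x b = graded_basis.coef R (F i) (B i) (\<delta> i x) b"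

lemma diff_linear: "\<delta> i \<in> linear_maps R (F (Suc i)) (F i)"
  using diff by (simp add: graded_linear_maps_def)

lemma diff_closed: "x \<in> carrier (F (Suc i)) \<Longrightarrow> \<delta> i x \<in> carrier (F i)"
  using diff_linear[of i] by (auto simp: linear_maps_def)

lemma entry_closed: "b' \<in> B (Suc i) \<Longrightarrow> b \<in> B i \<Longrightarrow> entry i b' b \<in> carrier R"
  unfolding entry_def by (intro G.F.coef_closed diff_closed G.F.B_carrier)

lemma entry_degree:
  assumes "b' \<in> B (Suc i)" "b \<in> B i"
  shows "ring_part R (deg (Suc i) b' - deg i b) (entry i b' b) = entry i b' b"
proof -
  have "\<delta> i b' \<in> hcomp (F i) (deg (Suc i) b')"
    using diff[of i] G.F.B_deg[OF assms(1)] by (auto simp: graded_linear_maps_def)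
  then show ?thesis unfolding entry_def by (rule G.F.coef_degree[OF _ assms(2)])
qed

text \<open>The b-coefficient of the outer differential is a linear form, hence determined by its
  values on the basis of the middle module. Applied to the image of b'', it gives the sum, and it
  vanishes as the differentials compose to zero.\<close>

lemma entry_comp:
  assumes b'': "b'' \<in> B (Suc (Suc i))" and b: "b \<in> B i"
  shows "(\<Oplus>\<^bsub>R\<^esub>b'\<in>B (Suc i). entry (Suc i) b'' b' \<otimes> entry i b' b) = \<zero>"
proof -
  let ?f = "\<lambda>x. graded_basis.coef R (F i) (B i) (\<delta> i x) b"
  have lin: "?f \<in> linear_maps R (F (Suc i)) (regular_module R)"
    by (rule linear_maps_compose[OF diff_linear G.F.coef_linear[OF b]])
  let ?x = "\<delta> (Suc i) b''"
  have x: "?x \<in> carrier (F (Suc i))" by (intro diff_closed G.F.B_carrier b'')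
  have "?f ?x = (\<Oplus>\<^bsub>R\<^esub>b'\<in>B (Suc i). entry (Suc i) b'' b' \<otimes> entry i b' b)"
    using G.F.linear_maps_eq_on_basis[OF N.regular_module lin x] by (simp add: entry_def)
  moreover have "?f ?x = \<zero>"
    using diff_diff[OF G.F.B_carrier[OF b'']] G.F.linear_maps_zero[OF N.regular_module G.F.coef_linear[OF b]] by simp
  ultimately show ?thesis by simp
qed

text \<open>The index set in position k - 1, empty for k = 0. The power over the empty set is the
  zero module, so the end of the complex is covered by the same matrix statement; the entry given by
  \<open>prev_entry\<close> at k = 0 is a default.\<close>

definition prev_basis :: "nat \<Rightarrow> 'f set" where
  "prev_basis k = (case k of 0 \<Rightarrow> {} | Suc j \<Rightarrow> B j)"

definition prev_entry :: "nat \<Rightarrow> 'f \<Rightarrow> 'f \<Rightarrow> 'a" where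
  "prev_entry k b b' = (case k of 0 \<Rightarrow> \<zero> | Suc j \<Rightarrow> entry j b b')"

lemma prev_entry_closed: "t \<in> B k \<Longrightarrow> t' \<in> prev_basis k \<Longrightarrow> prev_entry k t t' \<in> carrier R"
  by (auto simp: prev_basis_def prev_entry_def entry_closed split: nat.splits)

lemma Ext_complex:
  assumes "u \<in> prev_basis k \<rightarrow>\<^sub>E carrier N"
  shows "mat_map N (B k) (B (Suc k)) (entry k) (mat_map N (prev_basis k) (B k) (prev_entry k) u) = \<zero>\<^bsub>pow_module N (B (Suc k))\<^esub>"
  using assms G.F.fin_B
  by (intro N.mat_map_comp_zero)
    (auto simp: prev_basis_def prev_entry_def entry_closed entry_comp split: nat.splits)

text \<open>Evaluation at a basis element b' expands its image under the differential in the basis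
  below, so the row of b' consists of the coefficients of that image.\<close>

lemma Hom_diff_hom_of:
  assumes v: "v \<in> B i \<rightarrow>\<^sub>E carrier N"
  shows "Hom_diff F \<delta> i (G.hom_of i v) = G.hom_of (Suc i) (mat_map N (B i) (B (Suc i)) (entry i) v)"
proof -
  let ?f = "Hom_diff F \<delta> i (G.hom_of i v)"
  have h: "G.hom_of i v \<in> linear_maps R (F i) N" using G.hom_of_linear[OF v] by (simp add: G.Hom_simps)
  have f: "?f \<in> carrier (Hom_gmodule R (F (Suc i)) N)"
    using h diff_linear[of i] by (auto simp: G.Hom_simps Hom_diff_def linear_maps_def Pi_iff)
  have "restrict ?f (B (Suc i)) = mat_map N (B i) (B (Suc i)) (entry i) v"
  proof
    fix b'
    show "restrict ?f (B (Suc i)) b' = mat_map N (B i) (B (Suc i)) (entry i) v b'"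
    proof (cases "b' \<in> B (Suc i)")
      case True
      then have "\<delta> i b' \<in> carrier (F i)" "b' \<in> carrier (F (Suc i))" using diff_closed G.F.B_carrier by blast+
      then show ?thesis using True by (simp add: Hom_diff_def G.hom_of_def mat_map_def entry_def)
    qed (simp add: mat_map_def)
  qed
  then show ?thesis using G.hom_of_restrict[OF f] by simp
qed

lemma presents_Ext:
  "presents_matrix R N (prev_basis k) (B k) (B (Suc k)) (deg k) (prev_entry k) (entry k) (Ext R F \<delta> k N)"
proof -
  let ?C = "pow_module N (B k)" and ?\<theta> = "G.hom_of k"
  let ?Z = "{v \<in> B k \<rightarrow>\<^sub>E carrier N. mat_map N (B k) (B (Suc k)) (entry k) v = \<zero>\<^bsub>pow_module N (B (Suc k))\<^esub>}"
  let ?B = "mat_map N (prev_basis k) (B k) (prev_entry k) ` (prev_basis k \<rightarrow>\<^sub>E carrier N)"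
  interpret C: module R ?C by (rule N.module_pow_module)
  interpret Y: module R "pow_module N (B (Suc k))" by (rule N.module_pow_module)
  interpret X: module R "pow_module N (prev_basis k)" by (rule N.module_pow_module)
  have gl: "mat_map N (B k) (B (Suc k)) (entry k) \<in> linear_maps R ?C (pow_module N (B (Suc k)))"
    by (rule N.mat_map_linear) (auto simp: entry_closed G.F.fin_B)
  have fl: "mat_map N (prev_basis k) (B k) (prev_entry k) \<in> linear_maps R (pow_module N (prev_basis k)) ?C"
    by (rule N.mat_map_linear) (auto simp: prev_basis_def prev_entry_def entry_closed G.F.fin_B split: nat.splits)
  have Z: "submodule ?Z R ?C" using C.submodule_kernel[OF N.module_pow_module gl Y.zero_submodule] by simp
  have B: "submodule ?B R ?C" using X.submodule_image[OF N.module_pow_module fl X.carrier_is_submodule] by simp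
  have BZ: "?B \<subseteq> ?Z"
  proof (rule image_subsetI, intro CollectI conjI)
    fix u assume u: "u \<in> prev_basis k \<rightarrow>\<^sub>E carrier N"
    show "mat_map N (prev_basis k) (B k) (prev_entry k) u \<in> B k \<rightarrow>\<^sub>E carrier N"
      by (rule N.mat_map_submodule[OF N.carrier_is_submodule prev_entry_closed u])
  qed (rule Ext_complex)
  have zero: "G.hom_of i \<zero>\<^bsub>pow_module N (B i)\<^esub> = \<zero>\<^bsub>Hom_gmodule R (F i) N\<^esub>" for i
    by (rule module.linear_maps_zero[OF N.module_pow_module G.module_Hom G.hom_of_linear_maps])
  have mc: "mat_map N (B k) (B (Suc k)) (entry k) v \<in> B (Suc k) \<rightarrow>\<^sub>E carrier N" if "v \<in> B k \<rightarrow>\<^sub>E carrier N" for v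
    by (rule N.mat_map_submodule[OF N.carrier_is_submodule entry_closed that])
  have ker: "Hom_diff F \<delta> k (?\<theta> v) = \<zero>\<^bsub>Hom_gmodule R (F (Suc k)) N\<^esub> \<longleftrightarrow> v \<in> ?Z" if v: "v \<in> B k \<rightarrow>\<^sub>E carrier N" for v
    unfolding Hom_diff_hom_of[OF v] zero[symmetric]
    using inj_on_eq_iff[OF G.hom_of_inj mc[OF v], of "\<zero>\<^bsub>pow_module N (B (Suc k))\<^esub>"] Y.M.zero_closed v by simp
  have "?\<theta> ` ?Z = a_kernel (Hom_gmodule R (F k) N) (Hom_gmodule R (F (Suc k)) N) (Hom_diff F \<delta> k)"
    unfolding a_kernel_def' G.hom_of_onto[symmetric] using ker by blast
  moreover have "?\<theta> ` ?B = (case k of 0 \<Rightarrow> {\<zero>\<^bsub>Hom_gmodule R (F k) N\<^esub>}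
      | Suc j \<Rightarrow> Hom_diff F \<delta> j ` carrier (Hom_gmodule R (F j) N))"
  \<comment> \<open>For k = 0 the incoming matrix starts from the empty power, whose only element
    goes to the zero tuple; this matches the zero submodule in the definition of Ext.\<close>
  proof (cases k)
    case 0
    have "?B = {\<zero>\<^bsub>?C\<^esub>}" using 0 by (simp add: prev_basis_def mat_map_def N.M.finsum_empty)
    then show ?thesis using 0 zero[of k] by simp
  next
    case (Suc j)
    have "?\<theta> ` ?B = (\<lambda>u. ?\<theta> (mat_map N (B j) (B k) (entry j) u)) ` (B j \<rightarrow>\<^sub>E carrier N)"
      using Suc by (simp add: prev_basis_def prev_entry_def[abs_def] image_image)
    also have "\<dots> = (\<lambda>u. Hom_diff F \<delta> j (G.hom_of j u)) ` (B j \<rightarrow>\<^sub>E carrier N)"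
      using Hom_diff_hom_of[of _ j] Suc by (intro image_cong) auto
    also have "\<dots> = Hom_diff F \<delta> j ` carrier (Hom_gmodule R (F j) N)"
      unfolding G.hom_of_onto[symmetric] by (simp add: image_image)
    finally show ?thesis using Suc by simp
  qed
  moreover have "presents R ?C (pow_comp N (B k) (deg k)) (subquot_gmodule (Hom_gmodule R (F k) N) (?\<theta> ` ?Z) (?\<theta> ` ?B)) ?Z ?B"
    by (rule presents_subquot_image[OF N.module_axioms G.module_Hom G.hom_of_linear_maps G.hom_of_inj G.hom_of_hcomp Z B BZ])
  ultimately show ?thesis unfolding presents_matrix_def Ext_def by (simp only:)
qed

end

section \<open>Tensor products with a free module\<close>

lemma free_module_simps:
  "carrier (free_module R X) = {c. (\<forall>p. c p \<in> carrier R) \<and> finite {p. c p \<noteq> \<zero>\<^bsub>R\<^esub>} \<and> {p. c p \<noteq> \<zero>\<^bsub>R\<^esub>} \<subseteq> X}"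
  "\<zero>\<^bsub>free_module R X\<^esub> = (\<lambda>p. \<zero>\<^bsub>R\<^esub>)"
  "c \<oplus>\<^bsub>free_module R X\<^esub> c' = (\<lambda>p. c p \<oplus>\<^bsub>R\<^esub> c' p)"
  "a \<odot>\<^bsub>free_module R X\<^esub> c = (\<lambda>p. a \<otimes>\<^bsub>R\<^esub> c p)"
  by (simp_all add: free_module_def)

text \<open>The linear extension of h to the free module on its domain. With values in pure tensors
  this is the expression evaluated inside \<open>tensor_map\<close>.\<close>

definition free_ext :: "('a, 'c) ring_scheme \<Rightarrow> ('a, 'v, 'd) module_scheme \<Rightarrow> ('x \<Rightarrow> 'v) \<Rightarrow> ('x \<Rightarrow> 'a) \<Rightarrow> 'v" where
  "free_ext R V h c = (\<Oplus>\<^bsub>V\<^esub>p\<in>{p. c p \<noteq> \<zero>\<^bsub>R\<^esub>}. c p \<odot>\<^bsub>V\<^esub> h p)"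

lemma (in cring) module_free_module: "module R (free_module R X)"
proof (rule moduleI[OF is_cring])
  let ?P = "free_module R X"
  have add: "c \<oplus>\<^bsub>?P\<^esub> c' \<in> carrier ?P" if "c \<in> carrier ?P" "c' \<in> carrier ?P" for c c'
  proof -
    have "{p. c p \<oplus> c' p \<noteq> \<zero>} \<subseteq> {p. c p \<noteq> \<zero>} \<union> {p. c' p \<noteq> \<zero>}" by auto
    then show ?thesis using that finite_subset[of "{p. c p \<oplus> c' p \<noteq> \<zero>}"] by (auto simp: free_module_simps)
  qed
  have smult: "a \<odot>\<^bsub>?P\<^esub> c \<in> carrier ?P" if "a \<in> carrier R" "c \<in> carrier ?P" for a c
  proof -
    have "{p. a \<otimes> c p \<noteq> \<zero>} \<subseteq> {p. c p \<noteq> \<zero>}" using that by auto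
    then show ?thesis using that finite_subset[of "{p. a \<otimes> c p \<noteq> \<zero>}"] by (auto simp: free_module_simps)
  qed
  show "a \<odot>\<^bsub>?P\<^esub> c \<in> carrier ?P" if "a \<in> carrier R" "c \<in> carrier ?P" for a c using smult that .
  show "abelian_group ?P"
  proof (rule abelian_groupI)
    show "\<exists>d\<in>carrier ?P. d \<oplus>\<^bsub>?P\<^esub> c = \<zero>\<^bsub>?P\<^esub>" if c: "c \<in> carrier ?P" for c
      by (rule bexI[OF _ smult[OF _ c, of "\<ominus> \<one>"]]) (use c in \<open>auto simp: free_module_simps l_minus l_neg\<close>)
  qed (use add in \<open>auto simp: free_module_simps a_ac\<close>)
qed (auto simp: free_module_simps l_distr r_distr m_assoc)

context module
begin

context
  fixes h :: "'x \<Rightarrow> 'c" and X :: "'x set"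
  assumes h: "h \<in> X \<rightarrow> carrier M"
begin

text \<open>Lets several elements be summed over one finite set that contains all their
  supports.\<close>

lemma free_ext_support:
  assumes "c \<in> carrier (free_module R X)" "finite J" "{p. c p \<noteq> \<zero>\<^bsub>R\<^esub>} \<subseteq> J" "J \<subseteq> X"
  shows "free_ext R M h c = (\<Oplus>\<^bsub>M\<^esub>p\<in>J. c p \<odot>\<^bsub>M\<^esub> h p)"
proof -
  have "h p \<in> carrier M" if "p \<in> J" for p using that assms(4) h by auto
  then show ?thesis
    unfolding free_ext_def using assms
    by (intro M.add.finprod_mono_neutral_cong_left) (auto simp: free_module_simps)
qed

lemma free_ext_linear: "free_ext R M h \<in> linear_maps R (free_module R X) M"
  unfolding linear_maps_def
proof (intro CollectI conjI ballI)
  let ?P = "free_module R X"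
  interpret P: module R ?P by (rule R.module_free_module)
  have S: "c \<in> carrier ?P \<Longrightarrow> finite {p. c p \<noteq> \<zero>\<^bsub>R\<^esub>} \<and> {p. c p \<noteq> \<zero>\<^bsub>R\<^esub>} \<subseteq> X \<and> (\<forall>p. c p \<in> carrier R)" for c
    by (auto simp: free_module_simps)
  have cl: "(\<lambda>p. c p \<odot>\<^bsub>M\<^esub> h p) \<in> J \<rightarrow> carrier M" if "c \<in> carrier ?P" "J \<subseteq> X" for c J
    using S[OF that(1)] that(2) h by (auto simp: Pi_iff subset_iff)
  have hJ: "p \<in> X \<Longrightarrow> h p \<in> carrier M" for p using h by auto
  show "free_ext R M h \<in> carrier ?P \<rightarrow> carrier M"
    unfolding free_ext_def using cl S by (auto intro!: M.finsum_closed)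
  show "free_ext R M h (c \<oplus>\<^bsub>?P\<^esub> d) = free_ext R M h c \<oplus>\<^bsub>M\<^esub> free_ext R M h d" if c: "c \<in> carrier ?P" and d: "d \<in> carrier ?P" for c d
  proof -
    let ?J = "{p. c p \<noteq> \<zero>\<^bsub>R\<^esub>} \<union> {p. d p \<noteq> \<zero>\<^bsub>R\<^esub>}"
    have J: "finite ?J" "?J \<subseteq> X" using S[OF c] S[OF d] by auto
    have "free_ext R M h (c \<oplus>\<^bsub>?P\<^esub> d) = (\<Oplus>\<^bsub>M\<^esub>p\<in>?J. (c \<oplus>\<^bsub>?P\<^esub> d) p \<odot>\<^bsub>M\<^esub> h p)"
      by (rule free_ext_support[OF P.M.a_closed[OF c d] J(1) _ J(2)]) (use S[OF c] S[OF d] in \<open>auto simp: free_module_simps\<close>)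
    also have "\<dots> = (\<Oplus>\<^bsub>M\<^esub>p\<in>?J. c p \<odot>\<^bsub>M\<^esub> h p \<oplus>\<^bsub>M\<^esub> d p \<odot>\<^bsub>M\<^esub> h p)"
      using S[OF c] S[OF d] J hJ[OF subsetD[OF J(2)]] by (intro M.finsum_cong'[OF refl] Pi_I) (simp_all only: free_module_simps smult_l_distr M.a_closed smult_closed)
    also have "\<dots> = free_ext R M h c \<oplus>\<^bsub>M\<^esub> free_ext R M h d"
      using free_ext_support[OF c J(1) _ J(2)] free_ext_support[OF d J(1) _ J(2)] cl[OF c J(2)] cl[OF d J(2)]
      by (simp add: M.finsum_addf)
    finally show ?thesis .
  qed
  show "free_ext R M h (a \<odot>\<^bsub>?P\<^esub> c) = a \<odot>\<^bsub>M\<^esub> free_ext R M h c" if a: "a \<in> carrier R" and c: "c \<in> carrier ?P" for a c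
  proof -
    let ?J = "{p. c p \<noteq> \<zero>\<^bsub>R\<^esub>}"
    have J: "finite ?J" "?J \<subseteq> X" using S[OF c] by auto
    have "free_ext R M h (a \<odot>\<^bsub>?P\<^esub> c) = (\<Oplus>\<^bsub>M\<^esub>p\<in>?J. (a \<odot>\<^bsub>?P\<^esub> c) p \<odot>\<^bsub>M\<^esub> h p)"
      by (rule free_ext_support[OF P.smult_closed[OF a c] J(1) _ J(2)]) (use a in \<open>auto simp: free_module_simps\<close>)
    also have "\<dots> = (\<Oplus>\<^bsub>M\<^esub>p\<in>?J. a \<odot>\<^bsub>M\<^esub> (c p \<odot>\<^bsub>M\<^esub> h p))"
      using S[OF c] J a hJ[OF subsetD[OF J(2)]] by (intro M.finsum_cong'[OF refl] Pi_I) (simp_all only: free_module_simps smult_assoc1 smult_closed)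
    also have "\<dots> = a \<odot>\<^bsub>M\<^esub> free_ext R M h c"
      unfolding free_ext_def using cl[OF c J(2)] J(1) a by (simp add: finsum_smult_ldistr)
    finally show ?thesis .
  qed
qed

end

lemma free_gen_closed: "p \<in> X \<Longrightarrow> free_gen R p \<in> carrier (free_module R X)"
  by (auto simp: free_module_simps free_gen_def intro: finite_subset[of _ "{p}"])

lemma free_ext_gen:
  assumes "h \<in> X \<rightarrow> carrier M" "p \<in> X"
  shows "free_ext R M h (free_gen R p) = h p"
proof -
  have "free_ext R M h (free_gen R p) = (\<Oplus>\<^bsub>M\<^esub>q\<in>{p}. free_gen R p q \<odot>\<^bsub>M\<^esub> h q)"
    by (rule free_ext_support[OF assms(1) free_gen_closed[OF assms(2)]]) (use assms in \<open>auto simp: free_gen_def split: if_splits\<close>)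
  also have "\<dots> = h p"
  proof -
    have "h p \<in> carrier M" using assms by auto
    then show ?thesis by (simp add: M.finsum_insert M.finsum_empty free_gen_def)
  qed
  finally show ?thesis .
qed

end

lemma (in cring) free_module_induct:
  assumes c: "c \<in> carrier (free_module R X)" and zero: "Q \<zero>\<^bsub>free_module R X\<^esub>"
    and add: "\<And>c d. \<lbrakk>c \<in> carrier (free_module R X); d \<in> carrier (free_module R X); Q c; Q d\<rbrakk> \<Longrightarrow> Q (c \<oplus>\<^bsub>free_module R X\<^esub> d)"
    and gen: "\<And>a p. \<lbrakk>a \<in> carrier R; p \<in> X\<rbrakk> \<Longrightarrow> Q (a \<odot>\<^bsub>free_module R X\<^esub> free_gen R p)"
  shows "Q c"
proof -
  have cp: "\<And>p. c p \<in> carrier R" "finite {p. c p \<noteq> \<zero>}" "{p. c p \<noteq> \<zero>} \<subseteq> X"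
    using c by (auto simp: free_module_simps)
  define r where "r J = (\<lambda>p. if p \<in> J then c p else \<zero>)" for J
  have rc: "r J \<in> carrier (free_module R X)" if "J \<subseteq> X" "finite J" for J
    using cp that by (auto simp: free_module_simps r_def intro: finite_subset[of _ J])
  have "Q (r J)" if "finite J" "J \<subseteq> X" for J
    using that
  proof (induction J rule: finite_induct)
    case empty
    then show ?case using zero by (simp add: r_def free_module_simps)
  next
    case (insert p J)
    interpret P: module R "free_module R X" by (rule module_free_module)
    have p: "p \<in> X" using insert.prems by blast
    have "free_gen R p \<in> carrier (free_module R X)"
      using p by (auto simp: free_module_simps free_gen_def intro: finite_subset[of _ "{p}"])
    then have gc: "c p \<odot>\<^bsub>free_module R X\<^esub> free_gen R p \<in> carrier (free_module R X)"
      by (rule P.smult_closed[OF cp(1)])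
    have "r (insert p J) = c p \<odot>\<^bsub>free_module R X\<^esub> free_gen R p \<oplus>\<^bsub>free_module R X\<^esub> r J"
      using insert.hyps cp(1) by (auto simp: r_def free_module_simps free_gen_def fun_eq_iff)
    then show ?case
      using add[OF gc rc gen[OF cp(1) p] insert.IH] insert by simp
  qed
  from this[OF cp(2,3)] have "Q (r {p. c p \<noteq> \<zero>})" .
  moreover have "r {p. c p \<noteq> \<zero>} = c" by (auto simp: r_def)
  ultimately show ?thesis by simp
qed

section \<open>The universal property of the tensor product\<close>

definition bilinear_map ::
  "'a gring \<Rightarrow> ('a, 'f) gmodule \<Rightarrow> ('a, 'b) gmodule \<Rightarrow> ('a, 'v, 'd) module_scheme \<Rightarrow> ('f \<times> 'b \<Rightarrow> 'v) \<Rightarrow> bool" where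
  "bilinear_map R F N V h \<longleftrightarrow>
     (\<forall>y\<in>carrier N. (\<lambda>x. h (x, y)) \<in> linear_maps R F V) \<and> (\<forall>x\<in>carrier F. (\<lambda>y. h (x, y)) \<in> linear_maps R N V)"

text \<open>Built like \<open>tensor_map\<close>: the extension is evaluated on all representatives,
  and the common value is taken. For bilinear h there is one by
  \<open>tensor_lift_coset\<close>.\<close>

definition tensor_lift ::
  "'a gring \<Rightarrow> ('a, 'v, 'd) module_scheme \<Rightarrow> ('f \<times> 'b \<Rightarrow> 'v) \<Rightarrow> ('f \<times> 'b \<Rightarrow> 'a) set \<Rightarrow> 'v" where
  "tensor_lift R V h X = the_elem (free_ext R V h ` X)"

context graded_basis_pair
begin

abbreviation "P \<equiv> free_module R (carrier F \<times> carrier N)"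
abbreviation "TS \<equiv> tensor_submodule R F N"
abbreviation "TM \<equiv> tensor_module R F N"
abbreviation "tens \<equiv> pure_tensor R F N"

sublocale P: module R P by (rule F.module_free_module)

lemma e_closed: "x \<in> carrier F \<Longrightarrow> y \<in> carrier N \<Longrightarrow> free_gen R (x, y) \<in> carrier P"
  by (intro F.free_gen_closed) auto

lemma TS_submodule: "submodule TS R P"
proof -
  have "tensor_relations R F N \<subseteq> carrier P"
    unfolding tensor_relations_def Let_def
    by (intro Un_least subsetI; elim CollectE exE conjE; simp only:;
        intro P.M.minus_closed P.M.a_closed P.smult_closed e_closed; (assumption | rule F.M.a_closed N.M.a_closed F.smult_closed N.smult_closed)+)
  then show ?thesis unfolding tensor_submodule_def by (rule P.submodule_submodule_span)
qed

lemma TM_eq: "TM = quot_module P TS"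
  by (simp add: tensor_module_def)

sublocale TM: module R TM
  unfolding TM_eq by (rule P.module_quot_module[OF TS_submodule])

lemma tens_eq: "tens x y = TS +>\<^bsub>P\<^esub> free_gen R (x, y)"
  by (simp add: pure_tensor_def)

lemma tens_closed: "x \<in> carrier F \<Longrightarrow> y \<in> carrier N \<Longrightarrow> tens x y \<in> carrier TM"
  unfolding TM_eq tens_eq P.quot_carrier[OF TS_submodule] using e_closed by blast

lemma coset_rel:
  assumes "c \<in> carrier P" "d \<in> carrier P" "c \<ominus>\<^bsub>P\<^esub> d \<in> tensor_relations R F N"
  shows "TS +>\<^bsub>P\<^esub> c = TS +>\<^bsub>P\<^esub> d"
  using assms P.coset_eq_iff[OF TS_submodule] P.submodule_span_superset unfolding tensor_submodule_def by blast

lemma tens_add_left: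
  assumes "x \<in> carrier F" "x' \<in> carrier F" "y \<in> carrier N"
  shows "tens (x \<oplus>\<^bsub>F\<^esub> x') y = tens x y \<oplus>\<^bsub>TM\<^esub> tens x' y"
  unfolding TM_eq tens_eq P.quot_add[OF TS_submodule e_closed[OF assms(1,3)] e_closed[OF assms(2,3)]]
  by (rule coset_rel) (use assms in \<open>auto simp: tensor_relations_def Let_def e_closed\<close>)

lemma tens_add_right:
  assumes "x \<in> carrier F" "y \<in> carrier N" "y' \<in> carrier N"
  shows "tens x (y \<oplus>\<^bsub>N\<^esub> y') = tens x y \<oplus>\<^bsub>TM\<^esub> tens x y'"
  unfolding TM_eq tens_eq P.quot_add[OF TS_submodule e_closed[OF assms(1,2)] e_closed[OF assms(1,3)]]
  by (rule coset_rel) (use assms in \<open>auto simp: tensor_relations_def Let_def e_closed\<close>)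

lemma tens_smult_left:
  assumes "a \<in> carrier R" "x \<in> carrier F" "y \<in> carrier N"
  shows "tens (a \<odot>\<^bsub>F\<^esub> x) y = a \<odot>\<^bsub>TM\<^esub> tens x y"
  unfolding TM_eq tens_eq P.quot_smult[OF TS_submodule assms(1) e_closed[OF assms(2,3)]]
  by (rule coset_rel) (use assms in \<open>auto simp: tensor_relations_def Let_def e_closed\<close>)

lemma tens_smult_right:
  assumes "a \<in> carrier R" "x \<in> carrier F" "y \<in> carrier N"
  shows "tens x (a \<odot>\<^bsub>N\<^esub> y) = a \<odot>\<^bsub>TM\<^esub> tens x y"
  unfolding TM_eq tens_eq P.quot_smult[OF TS_submodule assms(1) e_closed[OF assms(2,3)]]
  by (rule coset_rel) (use assms in \<open>auto simp: tensor_relations_def Let_def e_closed\<close>)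

lemma tens_linear_left: "y \<in> carrier N \<Longrightarrow> (\<lambda>x. tens x y) \<in> linear_maps R F TM"
  by (simp add: linear_maps_def tens_add_left tens_smult_left tens_closed)

lemma tens_linear_right: "x \<in> carrier F \<Longrightarrow> (\<lambda>y. tens x y) \<in> linear_maps R N TM"
  by (simp add: linear_maps_def tens_add_right tens_smult_right tens_closed)

text \<open>Pure tensors generate additively, because a scalar is absorbed into the left
  factor.\<close>

lemma tensor_induct:
  assumes X: "X \<in> carrier TM" and tens: "\<And>x y. x \<in> carrier F \<Longrightarrow> y \<in> carrier N \<Longrightarrow> Q (tens x y)"
    and add: "\<And>X Y. \<lbrakk>X \<in> carrier TM; Y \<in> carrier TM; Q X; Q Y\<rbrakk> \<Longrightarrow> Q (X \<oplus>\<^bsub>TM\<^esub> Y)"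
  shows "Q X"
proof -
  have sm: "TS +>\<^bsub>P\<^esub> (a \<odot>\<^bsub>P\<^esub> free_gen R (x, y)) = tens (a \<odot>\<^bsub>F\<^esub> x) y"
    if "a \<in> carrier R" "x \<in> carrier F" "y \<in> carrier N" for a x y
    using tens_smult_left[OF that] P.quot_smult[OF TS_submodule that(1) e_closed[OF that(2,3)]]
    unfolding TM_eq tens_eq by simp
  obtain c where c: "c \<in> carrier P" "X = TS +>\<^bsub>P\<^esub> c"
    using X unfolding TM_eq P.quot_carrier[OF TS_submodule] by blast
  have "Q (TS +>\<^bsub>P\<^esub> c)"
  proof (rule F.free_module_induct[OF c(1), where Q = "\<lambda>c. Q (TS +>\<^bsub>P\<^esub> c)"])
    have "\<zero>\<^bsub>P\<^esub> = \<zero> \<odot>\<^bsub>P\<^esub> free_gen R (\<zero>\<^bsub>F\<^esub>, \<zero>\<^bsub>N\<^esub>)"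
      using P.smult_l_null[OF e_closed[OF F.M.zero_closed N.M.zero_closed]] by simp
    then show "Q (TS +>\<^bsub>P\<^esub> \<zero>\<^bsub>P\<^esub>)" using sm[of \<zero> "\<zero>\<^bsub>F\<^esub>" "\<zero>\<^bsub>N\<^esub>"] tens by simp
    show "Q (TS +>\<^bsub>P\<^esub> (c \<oplus>\<^bsub>P\<^esub> d))" if "c \<in> carrier P" "d \<in> carrier P" "Q (TS +>\<^bsub>P\<^esub> c)" "Q (TS +>\<^bsub>P\<^esub> d)" for c d
      using add[OF _ _ that(3,4)] that(1,2) P.quot_carrier[OF TS_submodule] P.quot_add[OF TS_submodule that(1,2)]
      by (simp add: TM_eq)
    show "Q (TS +>\<^bsub>P\<^esub> (a \<odot>\<^bsub>P\<^esub> free_gen R p))" if "a \<in> carrier R" "p \<in> carrier F \<times> carrier N" for a p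
      using that sm tens by (cases p) auto
  qed
  then show ?thesis using c by simp
qed

context
  fixes V :: "('a, 'v, 'w) module_scheme" and h :: "'f \<times> 'b \<Rightarrow> 'v"
  assumes V: "module R V" and h: "bilinear_map R F N V h"
begin

interpretation V: module R V by (rule V)

lemma h_closed: "h \<in> carrier F \<times> carrier N \<rightarrow> carrier V"
  using h by (auto simp: bilinear_map_def linear_maps_def)

text \<open>The four kinds of relations express the bilinearity of h, so they lie in the kernel of
  its linear extension, and the kernel is a submodule.\<close>

lemma free_ext_kills: "c \<in> TS \<Longrightarrow> free_ext R V h c = \<zero>\<^bsub>V\<^esub>"
proof -
  note lin = V.free_ext_linear[OF h_closed] and gen = V.free_ext_gen[OF h_closed]
  have hc: "h (x, y) \<in> carrier V" if "x \<in> carrier F" "y \<in> carrier N" for x y using h_closed that by auto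
  have g: "free_ext R V h (free_gen R (x, y)) = h (x, y)" if "x \<in> carrier F" "y \<in> carrier N" for x y
    using gen that by auto
  have hl: "h (x \<oplus>\<^bsub>F\<^esub> x', y) = h (x, y) \<oplus>\<^bsub>V\<^esub> h (x', y)" "h (a \<odot>\<^bsub>F\<^esub> x, y) = a \<odot>\<^bsub>V\<^esub> h (x, y)"
    if "x \<in> carrier F" "x' \<in> carrier F" "y \<in> carrier N" "a \<in> carrier R" for x x' y a
    using h that by (auto simp: bilinear_map_def linear_maps_def)
  have hr: "h (x, y \<oplus>\<^bsub>N\<^esub> y') = h (x, y) \<oplus>\<^bsub>V\<^esub> h (x, y')" "h (x, a \<odot>\<^bsub>N\<^esub> y) = a \<odot>\<^bsub>V\<^esub> h (x, y)"
    if "x \<in> carrier F" "y \<in> carrier N" "y' \<in> carrier N" "a \<in> carrier R" for x y y' a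
    using h that by (auto simp: bilinear_map_def linear_maps_def)
  have add: "free_ext R V h (c \<oplus>\<^bsub>P\<^esub> d) = free_ext R V h c \<oplus>\<^bsub>V\<^esub> free_ext R V h d" if "c \<in> carrier P" "d \<in> carrier P" for c d
    using lin that by (simp add: linear_maps_def)
  have smult: "free_ext R V h (a \<odot>\<^bsub>P\<^esub> c) = a \<odot>\<^bsub>V\<^esub> free_ext R V h c" if "a \<in> carrier R" "c \<in> carrier P" for a c
    using lin that by (simp add: linear_maps_def)
  have zero: "c \<ominus>\<^bsub>P\<^esub> d \<in> {c \<in> carrier P. free_ext R V h c \<in> {\<zero>\<^bsub>V\<^esub>}}"
    if "c \<in> carrier P" "d \<in> carrier P" "free_ext R V h c = free_ext R V h d" for c d
  proof -
    have "free_ext R V h d \<in> carrier V" using lin that by (auto simp: linear_maps_def)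
    then show ?thesis using P.linear_maps_diff[OF V lin that(1,2)] that by (simp add: a_minus_def V.M.r_neg)
  qed
  have rel: "free_gen R (x \<oplus>\<^bsub>F\<^esub> x', y) \<ominus>\<^bsub>P\<^esub> (free_gen R (x, y) \<oplus>\<^bsub>P\<^esub> free_gen R (x', y)) \<in> {c \<in> carrier P. free_ext R V h c \<in> {\<zero>\<^bsub>V\<^esub>}}"
    "free_gen R (a \<odot>\<^bsub>F\<^esub> x, y) \<ominus>\<^bsub>P\<^esub> (a \<odot>\<^bsub>P\<^esub> free_gen R (x, y)) \<in> {c \<in> carrier P. free_ext R V h c \<in> {\<zero>\<^bsub>V\<^esub>}}"
    "free_gen R (x, y \<oplus>\<^bsub>N\<^esub> y') \<ominus>\<^bsub>P\<^esub> (free_gen R (x, y) \<oplus>\<^bsub>P\<^esub> free_gen R (x, y')) \<in> {c \<in> carrier P. free_ext R V h c \<in> {\<zero>\<^bsub>V\<^esub>}}"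
    "free_gen R (x, a \<odot>\<^bsub>N\<^esub> y) \<ominus>\<^bsub>P\<^esub> (a \<odot>\<^bsub>P\<^esub> free_gen R (x, y)) \<in> {c \<in> carrier P. free_ext R V h c \<in> {\<zero>\<^bsub>V\<^esub>}}"
    if c: "x \<in> carrier F" "x' \<in> carrier F" "y \<in> carrier N" "y' \<in> carrier N" "a \<in> carrier R" for x x' y y' a
  proof -
    note e = e_closed[OF c(1,3)] e_closed[OF c(2,3)] e_closed[OF c(1,4)]
    show "free_gen R (x \<oplus>\<^bsub>F\<^esub> x', y) \<ominus>\<^bsub>P\<^esub> (free_gen R (x, y) \<oplus>\<^bsub>P\<^esub> free_gen R (x', y)) \<in> {c \<in> carrier P. free_ext R V h c \<in> {\<zero>\<^bsub>V\<^esub>}}"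
      by (rule zero) (use c e in \<open>simp_all only: e_closed F.M.a_closed P.M.a_closed add g hl(1)[OF _ _ _ c(5)]\<close>)
    show "free_gen R (a \<odot>\<^bsub>F\<^esub> x, y) \<ominus>\<^bsub>P\<^esub> (a \<odot>\<^bsub>P\<^esub> free_gen R (x, y)) \<in> {c \<in> carrier P. free_ext R V h c \<in> {\<zero>\<^bsub>V\<^esub>}}"
      by (rule zero) (use c e in \<open>simp_all only: e_closed F.smult_closed P.smult_closed smult g hl(2)[OF _ c(2)]\<close>)
    show "free_gen R (x, y \<oplus>\<^bsub>N\<^esub> y') \<ominus>\<^bsub>P\<^esub> (free_gen R (x, y) \<oplus>\<^bsub>P\<^esub> free_gen R (x, y')) \<in> {c \<in> carrier P. free_ext R V h c \<in> {\<zero>\<^bsub>V\<^esub>}}"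
      by (rule zero) (use c e in \<open>simp_all only: e_closed N.M.a_closed P.M.a_closed add g hr(1)[OF _ _ _ c(5)]\<close>)
    show "free_gen R (x, a \<odot>\<^bsub>N\<^esub> y) \<ominus>\<^bsub>P\<^esub> (a \<odot>\<^bsub>P\<^esub> free_gen R (x, y)) \<in> {c \<in> carrier P. free_ext R V h c \<in> {\<zero>\<^bsub>V\<^esub>}}"
      by (rule zero) (use c e in \<open>simp_all only: e_closed N.smult_closed P.smult_closed smult g hr(2)[OF _ _ c(4)]\<close>)
  qed
  note z = F.M.zero_closed N.M.zero_closed F.one_closed
  have "tensor_relations R F N \<subseteq> {c \<in> carrier P. free_ext R V h c \<in> {\<zero>\<^bsub>V\<^esub>}}"
    unfolding tensor_relations_def Let_def
    by (intro Un_least subsetI; elim CollectE exE conjE; hypsubst;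
        rule rel(1)[OF _ _ _ z(2,3)] rel(2)[OF _ z(1) _ z(2)] rel(3)[OF _ z(1) _ _ z(3)] rel(4)[OF _ z(1) _ z(2)]; assumption)
  then have "TS \<subseteq> {c \<in> carrier P. free_ext R V h c \<in> {\<zero>\<^bsub>V\<^esub>}}"
    unfolding tensor_submodule_def by (intro P.submodule_span_least P.submodule_kernel[OF V lin V.zero_submodule])
  then show "c \<in> TS \<Longrightarrow> free_ext R V h c = \<zero>\<^bsub>V\<^esub>" by blast
qed

lemma tensor_lift_coset:
  assumes c: "c \<in> carrier P"
  shows "tensor_lift R V h (TS +>\<^bsub>P\<^esub> c) = free_ext R V h c"
proof -
  note lin = V.free_ext_linear[OF h_closed]
  have "free_ext R V h d = free_ext R V h c" if d: "d \<in> TS +>\<^bsub>P\<^esub> c" for d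
  proof -
    obtain n where n: "n \<in> TS" "d = n \<oplus>\<^bsub>P\<^esub> c" using d P.coset_mem[OF TS_submodule] by blast
    have "n \<in> carrier P" using P.submodule_mem[OF TS_submodule n(1)] .
    moreover have "free_ext R V h c \<in> carrier V" using lin c by (auto simp: linear_maps_def)
    ultimately show ?thesis using n(2) c lin free_ext_kills[OF n(1)] by (simp add: linear_maps_def)
  qed
  moreover have "c \<in> TS +>\<^bsub>P\<^esub> c"
    using P.submodule_zero[OF TS_submodule] c P.coset_mem[OF TS_submodule] by (metis P.M.l_zero)
  ultimately have "free_ext R V h ` (TS +>\<^bsub>P\<^esub> c) = {free_ext R V h c}" by blast
  then show ?thesis by (simp add: tensor_lift_def)
qed

lemma tensor_lift_tens: "x \<in> carrier F \<Longrightarrow> y \<in> carrier N \<Longrightarrow> tensor_lift R V h (tens x y) = h (x, y)"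
  unfolding tens_eq using tensor_lift_coset[OF e_closed] V.free_ext_gen[OF h_closed, of "(x, y)"] by simp

lemma tensor_lift_linear: "tensor_lift R V h \<in> linear_maps R TM V"
proof -
  have lin: "free_ext R V h c \<in> carrier V" "free_ext R V h (c \<oplus>\<^bsub>P\<^esub> d) = free_ext R V h c \<oplus>\<^bsub>V\<^esub> free_ext R V h d"
    "free_ext R V h (a \<odot>\<^bsub>P\<^esub> c) = a \<odot>\<^bsub>V\<^esub> free_ext R V h c" if "c \<in> carrier P" "d \<in> carrier P" "a \<in> carrier R" for c d a
    using V.free_ext_linear[OF h_closed] that by (auto simp: linear_maps_def)
  have carr: "carrier TM = (\<lambda>c. TS +>\<^bsub>P\<^esub> c) ` carrier P"
    unfolding TM_eq by (rule P.quot_carrier[OF TS_submodule])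
  show ?thesis
    unfolding linear_maps_def
  proof (intro CollectI conjI ballI)
    show "tensor_lift R V h \<in> carrier TM \<rightarrow> carrier V"
      unfolding carr using tensor_lift_coset lin(1)[OF _ _ F.one_closed] by auto
    show "tensor_lift R V h (X \<oplus>\<^bsub>TM\<^esub> Y) = tensor_lift R V h X \<oplus>\<^bsub>V\<^esub> tensor_lift R V h Y"
      if XY: "X \<in> carrier TM" "Y \<in> carrier TM" for X Y
    proof -
      obtain c d where "c \<in> carrier P" "X = TS +>\<^bsub>P\<^esub> c" "d \<in> carrier P" "Y = TS +>\<^bsub>P\<^esub> d" using XY carr by auto
      then show ?thesis
        using P.quot_add[OF TS_submodule] lin(2)[OF _ _ F.one_closed] tensor_lift_coset P.M.a_closed by (simp add: TM_eq)
    qed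
    show "tensor_lift R V h (a \<odot>\<^bsub>TM\<^esub> X) = a \<odot>\<^bsub>V\<^esub> tensor_lift R V h X" if a: "a \<in> carrier R" and X: "X \<in> carrier TM" for a X
    proof -
      obtain c where "c \<in> carrier P" "X = TS +>\<^bsub>P\<^esub> c" using X carr by auto
      then show ?thesis
        using P.quot_smult[OF TS_submodule a] lin(3)[OF _ _ a] tensor_lift_coset P.smult_closed[OF a] by (simp add: TM_eq)
    qed
  qed
qed

end

end

section \<open>Coordinates on the tensor product with a free module\<close>

context graded_basis_pair
begin

abbreviation "TG \<equiv> tensor_gmodule R F N"

lemma TG_simps [simp]:
  "carrier TG = carrier TM" "add TG = add TM" "zero TG = zero TM" "smult TG = smult TM"
  by (simp_all add: tensor_gmodule_def)

lemma module_TG: "module R TG"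
  by (rule module_cong[OF TM.module_axioms]) simp_all

text \<open>The b-coordinate on the tensor product. Together with \<open>tens_sum\<close> in the
  other direction, these maps identify the tensor product with a power of N.\<close>

definition coord :: "'f \<Rightarrow> ('f \<times> 'b \<Rightarrow> 'a) set \<Rightarrow> 'b" where
  "coord b = tensor_lift R N (\<lambda>p. F.coef (fst p) b \<odot>\<^bsub>N\<^esub> snd p)"

lemma coord_bilinear: 
  assumes b: "b \<in> B"
  shows "bilinear_map R F N N (\<lambda>p. F.coef (fst p) b \<odot>\<^bsub>N\<^esub> snd p)"
proof -
  have "F.coef (x \<oplus>\<^bsub>F\<^esub> y) b = F.coef x b \<oplus> F.coef y b" if "x \<in> carrier F" "y \<in> carrier F" for x y
    using F.coef_linear[OF b] that by (auto simp: linear_maps_def)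
  moreover have "F.coef (a \<odot>\<^bsub>F\<^esub> x) b = a \<otimes> F.coef x b" if "x \<in> carrier F" "a \<in> carrier R" for x a
    using F.coef_linear[OF b] that by (auto simp: linear_maps_def)
  ultimately show ?thesis
    using F.coef_closed[OF _ b]
    by (auto simp: bilinear_map_def linear_maps_def N.smult_l_distr N.smult_r_distr N.smult_assoc1 N.smult_swap)
qed

lemma coord_linear: "b \<in> B \<Longrightarrow> coord b \<in> linear_maps R TM N"
  unfolding coord_def by (rule tensor_lift_linear[OF N.module_axioms coord_bilinear])

lemma coord_closed: "b \<in> B \<Longrightarrow> X \<in> carrier TM \<Longrightarrow> coord b X \<in> carrier N"
  using coord_linear[of b] by (auto simp: linear_maps_def)

lemma coord_tens: "\<lbrakk>b \<in> B; x \<in> carrier F; y \<in> carrier N\<rbrakk> \<Longrightarrow> coord b (tens x y) = F.coef x b \<odot>\<^bsub>N\<^esub> y"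
  unfolding coord_def by (simp add: tensor_lift_tens[OF N.module_axioms coord_bilinear])

definition tens_sum :: "('f \<Rightarrow> 'b) \<Rightarrow> ('f \<times> 'b \<Rightarrow> 'a) set" where
  "tens_sum v = (\<Oplus>\<^bsub>TM\<^esub>b\<in>B. tens b (v b))"

lemma tens_terms_closed: "v \<in> B \<rightarrow>\<^sub>E carrier N \<Longrightarrow> (\<lambda>b. tens b (v b)) \<in> B \<rightarrow> carrier TM"
  using tens_closed F.B_carrier by auto

lemma tens_sum_closed: "v \<in> B \<rightarrow>\<^sub>E carrier N \<Longrightarrow> tens_sum v \<in> carrier TM"
  unfolding tens_sum_def by (intro TM.M.finsum_closed tens_terms_closed)

lemma coord_tens_sum:
  assumes v: "v \<in> B \<rightarrow>\<^sub>E carrier N" and b: "b \<in> B"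
  shows "coord b (tens_sum v) = v b"
proof -
  have vc: "\<And>b. b \<in> B \<Longrightarrow> v b \<in> carrier N" using v by auto
  have "coord b (tens_sum v) = (\<Oplus>\<^bsub>N\<^esub>b'\<in>B. coord b (tens b' (v b')))"
    unfolding tens_sum_def by (rule TM.linear_maps_finsum[OF N.module_axioms coord_linear[OF b] tens_terms_closed[OF v]])
  also have "\<dots> = (\<Oplus>\<^bsub>N\<^esub>b'\<in>B. if b = b' then v b' else \<zero>\<^bsub>N\<^esub>)"
    using b vc F.coef_basis F.B_carrier by (intro N.M.finsum_cong') (auto simp: coord_tens)
  also have "\<dots> = v b" using N.M.finsum_singleton[OF b F.fin_B, of v] vc by auto
  finally show ?thesis .
qed

lemma tens_sum_linear: "tens_sum \<in> linear_maps R (pow_module N B) TG"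
  unfolding linear_maps_def
proof (intro CollectI conjI ballI)
  show "tens_sum \<in> carrier (pow_module N B) \<rightarrow> carrier TG" using tens_sum_closed by simp
  show "tens_sum (v \<oplus>\<^bsub>pow_module N B\<^esub> w) = tens_sum v \<oplus>\<^bsub>TG\<^esub> tens_sum w"
    if v: "v \<in> carrier (pow_module N B)" and w: "w \<in> carrier (pow_module N B)" for v w
  proof -
    have vc: "\<And>b. b \<in> B \<Longrightarrow> v b \<in> carrier N" and wc: "\<And>b. b \<in> B \<Longrightarrow> w b \<in> carrier N" using v w by auto
    have "tens_sum (v \<oplus>\<^bsub>pow_module N B\<^esub> w) = (\<Oplus>\<^bsub>TM\<^esub>b\<in>B. tens b (v b) \<oplus>\<^bsub>TM\<^esub> tens b (w b))"
      unfolding tens_sum_def using vc wc F.B_carrier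
      by (intro TM.M.finsum_cong') (auto simp: tens_add_right tens_closed)
    then show ?thesis
      using tens_terms_closed v w by (simp add: tens_sum_def TM.M.finsum_addf)
  qed
  show "tens_sum (a \<odot>\<^bsub>pow_module N B\<^esub> v) = a \<odot>\<^bsub>TG\<^esub> tens_sum v"
    if a: "a \<in> carrier R" and v: "v \<in> carrier (pow_module N B)" for a v
  proof -
    have vc: "\<And>b. b \<in> B \<Longrightarrow> v b \<in> carrier N" using v by auto
    have "tens_sum (a \<odot>\<^bsub>pow_module N B\<^esub> v) = (\<Oplus>\<^bsub>TM\<^esub>b\<in>B. a \<odot>\<^bsub>TM\<^esub> tens b (v b))"
      unfolding tens_sum_def using a vc F.B_carrier
      by (intro TM.M.finsum_cong') (auto simp: tens_smult_right tens_closed)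
    then show ?thesis
      using tens_terms_closed v a F.fin_B by (simp add: tens_sum_def TM.finsum_smult_ldistr)
  qed
qed

text \<open>Both sides are additive, so pure tensors suffice; there it is the expansion of the left
  factor in the basis.\<close>

lemma tens_sum_coord:
  assumes "X \<in> carrier TM"
  shows "tens_sum (\<lambda>b\<in>B. coord b X) = X"
proof (rule tensor_induct[OF assms])
  fix x y assume x: "x \<in> carrier F" and y: "y \<in> carrier N"
  have "tens_sum (\<lambda>b\<in>B. coord b (tens x y)) = (\<Oplus>\<^bsub>TM\<^esub>b\<in>B. F.coef x b \<odot>\<^bsub>TM\<^esub> tens b y)"
    unfolding tens_sum_def using x y F.coef_closed F.B_carrier
    by (intro TM.M.finsum_cong') (auto simp: coord_tens tens_smult_right tens_closed)
  then show "tens_sum (\<lambda>b\<in>B. coord b (tens x y)) = tens x y"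
    using F.linear_maps_eq_on_basis[OF TM.module_axioms tens_linear_left[OF y] x] by simp
next
  fix X Y assume XY: "X \<in> carrier TM" "Y \<in> carrier TM"
    and IH: "tens_sum (\<lambda>b\<in>B. coord b X) = X" "tens_sum (\<lambda>b\<in>B. coord b Y) = Y"
  have "(\<lambda>b\<in>B. coord b (X \<oplus>\<^bsub>TM\<^esub> Y)) = (\<lambda>b\<in>B. coord b X) \<oplus>\<^bsub>pow_module N B\<^esub> (\<lambda>b\<in>B. coord b Y)"
    using XY coord_linear by (auto simp: linear_maps_def fun_eq_iff)
  moreover have "(\<lambda>b\<in>B. coord b X) \<in> carrier (pow_module N B)" "(\<lambda>b\<in>B. coord b Y) \<in> carrier (pow_module N B)"
    using XY coord_closed by auto
  moreover have "tens_sum (v \<oplus>\<^bsub>pow_module N B\<^esub> w) = tens_sum v \<oplus>\<^bsub>TG\<^esub> tens_sum w"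
    if "v \<in> carrier (pow_module N B)" "w \<in> carrier (pow_module N B)" for v w
    using tens_sum_linear that unfolding linear_maps_def by blast
  ultimately show "tens_sum (\<lambda>b\<in>B. coord b (X \<oplus>\<^bsub>TM\<^esub> Y)) = X \<oplus>\<^bsub>TM\<^esub> Y"
    by (simp only: IH TG_simps)
qed

lemma tens_sum_onto: "tens_sum ` (B \<rightarrow>\<^sub>E carrier N) = carrier TM"
proof
  show "carrier TM \<subseteq> tens_sum ` (B \<rightarrow>\<^sub>E carrier N)"
  proof
    fix X assume X: "X \<in> carrier TM"
    show "X \<in> tens_sum ` (B \<rightarrow>\<^sub>E carrier N)"
      by (rule image_eqI[where f = tens_sum, OF tens_sum_coord[OF X, symmetric]]) (use coord_closed X in auto)
  qed
qed (use tens_sum_closed in blast)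

lemma tens_sum_inj: "inj_on tens_sum (B \<rightarrow>\<^sub>E carrier N)"
proof (rule inj_onI)
  fix v w assume v: "v \<in> B \<rightarrow>\<^sub>E carrier N" and w: "w \<in> B \<rightarrow>\<^sub>E carrier N" and eq: "tens_sum v = tens_sum w"
  show "v = w"
    by (rule PiE_ext[OF v w]) (metis eq coord_tens_sum v w)
qed

text \<open>In degree j the factor next to b has degree j - deg b, whence the twist by - deg,
  opposite to Hom. For the forward direction, the elements whose coordinates have these degrees form
  a subgroup that contains the generators of the component.\<close>

lemma tens_sum_hcomp:
  assumes v: "v \<in> B \<rightarrow>\<^sub>E carrier N"
  shows "tens_sum v \<in> hcomp TG j \<longleftrightarrow> v \<in> pow_comp N B (\<lambda>b. - deg b) j"
proof -
  let ?S = "{tens x y | x y i i'. x \<in> hcomp F i \<and> y \<in> hcomp N i' \<and> i + i' = j}"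
  have hj: "hcomp TG j = generate (add_monoid TM) ?S" by (simp add: tensor_gmodule_def)
  have hF: "x \<in> hcomp F i \<Longrightarrow> x \<in> carrier F" for x i using F.hcomp_iff by blast
  have S: "?S \<subseteq> carrier (add_monoid TM)" using hF N.hcomp_carrier tens_closed by auto
  have gen: "subgroup (generate (add_monoid TM) ?S) (add_monoid TM)"
    by (rule group.generate_is_subgroup[OF TM.M.a_group S])
  show ?thesis
  proof
    let ?K = "{X \<in> carrier TM. \<forall>b\<in>B. coord b X \<in> hcomp N (j - deg b)}"
    have lin: "coord b (X \<oplus>\<^bsub>TM\<^esub> Y) = coord b X \<oplus>\<^bsub>N\<^esub> coord b Y"
      if "b \<in> B" "X \<in> carrier TM" "Y \<in> carrier TM" for b X Y
      using coord_linear[OF that(1)] that by (simp add: linear_maps_def)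
    have zero: "coord b \<zero>\<^bsub>TM\<^esub> = \<zero>\<^bsub>N\<^esub>" if "b \<in> B" for b
      by (rule TM.linear_maps_zero[OF N.module_axioms coord_linear[OF that]])
    have neg: "coord b (\<ominus>\<^bsub>TM\<^esub> X) = \<ominus>\<^bsub>N\<^esub> coord b X" if b: "b \<in> B" and X: "X \<in> carrier TM" for b X
      using lin[OF b TM.M.a_inv_closed[OF X] X] zero[OF b] X coord_closed[OF b]
      by (intro N.M.minus_equality[symmetric]) (auto simp: TM.M.l_neg)
    have "subgroup ?K (add_monoid TM)"
    proof (rule TM.M.add.subgroupI)
      have "\<zero>\<^bsub>TM\<^esub> \<in> ?K" using zero additive_subgroup.zero_closed[OF N.hcomp_additive] by simp
      then show "?K \<noteq> {}" by blast
      show "\<ominus>\<^bsub>TM\<^esub> X \<in> ?K" if "X \<in> ?K" for X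
        using that neg additive_subgroup.a_inv_closed[OF N.hcomp_additive] by auto
      show "X \<oplus>\<^bsub>TM\<^esub> Y \<in> ?K" if "X \<in> ?K" "Y \<in> ?K" for X Y
        using that lin additive_subgroup.a_closed[OF N.hcomp_additive] by auto
    qed auto
    moreover have "?S \<subseteq> ?K"
    proof (intro subsetI, elim CollectE exE conjE)
      fix X x y i i' assume X: "X = tens x y" and x: "x \<in> hcomp F i" and y: "y \<in> hcomp N i'" and i: "i + i' = j"
      have "F.coef x b \<odot>\<^bsub>N\<^esub> y \<in> hcomp N (j - deg b)" if b: "b \<in> B" for b
        using N.hcomp_smult_part[OF F.coef_closed[OF hF[OF x] b] F.coef_degree[OF x b] y] i
        by (simp add: algebra_simps)
      then show "X \<in> ?K" using X hF[OF x] N.hcomp_carrier[OF y] by (simp add: coord_tens tens_closed)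
    qed
    ultimately have "generate (add_monoid TM) ?S \<subseteq> ?K"
      by (intro group.generate_subgroup_incl[OF TM.M.a_group])
    moreover assume "tens_sum v \<in> hcomp TG j"
    ultimately have "coord b (tens_sum v) \<in> hcomp N (j - deg b)" if "b \<in> B" for b using that unfolding hj by blast
    then show "v \<in> pow_comp N B (\<lambda>b. - deg b) j" using v by (simp add: pow_comp_def coord_tens_sum)
  next
    assume "v \<in> pow_comp N B (\<lambda>b. - deg b) j"
    then have vb: "v b \<in> hcomp N (j - deg b)" if "b \<in> B" for b using that by (simp add: pow_comp_def)
    have mem: "tens b (v b) \<in> generate (add_monoid TM) ?S" if b: "b \<in> B" for b
    proof (rule generate.incl, intro CollectI exI conjI)
      show "deg b + (j - deg b) = j" by simp
    qed (use F.B_deg[OF b] vb[OF b] in auto)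
    have "(\<Oplus>\<^bsub>TM\<^esub>b\<in>B'. tens b (v b)) \<in> generate (add_monoid TM) ?S" if "B' \<subseteq> B" for B'
      using finite_subset[OF that F.fin_B] that
    proof (induction B' rule: finite_induct)
      case empty
      then show ?case using subgroup.one_closed[OF gen] by (simp add: TM.M.finsum_empty)
    next
      case (insert b B')
      then have "(\<lambda>b. tens b (v b)) \<in> B' \<rightarrow> carrier TM" "tens b (v b) \<in> carrier TM"
        using tens_terms_closed[OF v] by auto
      then show ?case
        using insert subgroup.m_closed[OF gen mem[of b]] by (simp add: TM.M.finsum_insert)
    qed
    then show "tens_sum v \<in> hcomp TG j" unfolding hj tens_sum_def by blast
  qed
qed

end

section \<open>Tor\<close>

context free_complex
begin

text \<open>Makes well-definedness and linearity of the tensored map available from the universal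
  property.\<close>

lemma tensor_map_lift:
  "tensor_map R (F i) N f = tensor_lift R (tensor_module R (F i) N) (\<lambda>p. pure_tensor R (F i) N (f (fst p)) (snd p))"
  by (simp add: fun_eq_iff tensor_map_def tensor_lift_def free_ext_def[abs_def])

lemma diff_bilinear:
  "bilinear_map R (F (Suc i)) N (tensor_module R (F i) N) (\<lambda>p. pure_tensor R (F i) N (\<delta> i (fst p)) (snd p))"
  unfolding bilinear_map_def fst_conv snd_conv
  by (intro conjI ballI linear_maps_compose[OF diff_linear G.tens_linear_left] G.tens_linear_right diff_closed)

text \<open>The entries are those used for Hom, with the matrix transposed, since the tensor product
  is covariant in the resolution. Equality is checked on coordinates.\<close>

lemma tensor_map_tens_sum:
  assumes v: "v \<in> B (Suc i) \<rightarrow>\<^sub>E carrier N"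
  shows "tensor_map R (F i) N (\<delta> i) (G.tens_sum (Suc i) v) =
    G.tens_sum i (mat_map N (B (Suc i)) (B i) (\<lambda>b b'. entry i b' b) v)"
proof -
  let ?T = "tensor_map R (F i) N (\<delta> i)"
  have vc: "\<And>b. b \<in> B (Suc i) \<Longrightarrow> v b \<in> carrier N" using v by auto
  have lin: "?T \<in> linear_maps R (tensor_module R (F (Suc i)) N) (tensor_module R (F i) N)"
    unfolding tensor_map_lift by (rule G.tensor_lift_linear[OF G.TM.module_axioms diff_bilinear])
  then have X: "?T (G.tens_sum (Suc i) v) \<in> carrier (tensor_module R (F i) N)"
    using G.tens_sum_closed[OF v] by (auto simp: linear_maps_def)
  have "G.coord i b (?T (G.tens_sum (Suc i) v)) = (\<Oplus>\<^bsub>N\<^esub>b'\<in>B (Suc i). entry i b' b \<odot>\<^bsub>N\<^esub> v b')" if b: "b \<in> B i" for b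
  proof -
    have "G.coord i b (?T (G.tens_sum (Suc i) v)) =
        (\<Oplus>\<^bsub>N\<^esub>b'\<in>B (Suc i). G.coord i b (?T (pure_tensor R (F (Suc i)) N b' (v b'))))"
      unfolding G.tens_sum_def
      by (rule module.linear_maps_finsum[OF G.TM.module_axioms N.module_axioms linear_maps_compose[OF lin G.coord_linear[OF b]] G.tens_terms_closed[OF v]])
    also have "\<dots> = (\<Oplus>\<^bsub>N\<^esub>b'\<in>B (Suc i). entry i b' b \<odot>\<^bsub>N\<^esub> v b')"
    proof (rule N.M.finsum_cong'[OF refl])
      show "(\<lambda>b'. entry i b' b \<odot>\<^bsub>N\<^esub> v b') \<in> B (Suc i) \<rightarrow> carrier N" using vc entry_closed b by auto
      fix b' assume b': "b' \<in> B (Suc i)"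
      show "G.coord i b (?T (pure_tensor R (F (Suc i)) N b' (v b'))) = entry i b' b \<odot>\<^bsub>N\<^esub> v b'"
        unfolding tensor_map_lift
        using G.tensor_lift_tens[OF G.TM.module_axioms diff_bilinear G.F.B_carrier[OF b'] vc[OF b']]
          G.coord_tens[OF b diff_closed[OF G.F.B_carrier[OF b']] vc[OF b']]
        by (simp add: entry_def)
    qed
    finally show ?thesis .
  qed
  then have "(\<lambda>b\<in>B i. G.coord i b (?T (G.tens_sum (Suc i) v))) = mat_map N (B (Suc i)) (B i) (\<lambda>b b'. entry i b' b) v"
    by (auto simp: mat_map_def fun_eq_iff)
  then show ?thesis using G.tens_sum_coord[OF X] by simp
qed

lemma Tor_complex:
  assumes "u \<in> B (Suc k) \<rightarrow>\<^sub>E carrier N"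
  shows "mat_map N (B k) (prev_basis k) (\<lambda>b b'. prev_entry k b' b) (mat_map N (B (Suc k)) (B k) (\<lambda>b b'. entry k b' b) u) =
    \<zero>\<^bsub>pow_module N (prev_basis k)\<^esub>"
proof -
  have "(\<Oplus>\<^bsub>R\<^esub>b'\<in>B k. prev_entry k b' t'' \<otimes> entry k t b') = \<zero>" if t: "t \<in> B (Suc k)" "t'' \<in> prev_basis k" for t t''
  proof -
    \<comment> \<open>Commuting the factors brings the product of the transposed matrices into the
      form of \<open>entry_comp\<close>.\<close>
    have "(\<Oplus>\<^bsub>R\<^esub>b'\<in>B k. prev_entry k b' t'' \<otimes> entry k t b') = (\<Oplus>\<^bsub>R\<^esub>b'\<in>B k. entry k t b' \<otimes> prev_entry k b' t'')"
      by (rule abelian_monoid.finsum_cong'[OF ring.is_abelian_group[THEN abelian_group.axioms(1), OF cring.axioms(1)[OF N.is_cring]] refl]) (use t prev_entry_closed entry_closed in \<open>auto simp: N.m_comm\<close>)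
    also have "\<dots> = \<zero>"
      using t entry_comp by (auto simp: prev_basis_def prev_entry_def split: nat.splits)
    finally show ?thesis .
  qed
  then show ?thesis
    using assms G.F.fin_B entry_closed prev_entry_closed by (intro N.mat_map_comp_zero) auto
qed

lemma presents_Tor:
  "presents_matrix R N (B (Suc k)) (B k) (prev_basis k) (\<lambda>b. - deg k b) (\<lambda>b b'. entry k b' b) (\<lambda>b b'. prev_entry k b' b) (Tor R F \<delta> k N)"
proof -
  let ?C = "pow_module N (B k)" and ?\<theta> = "G.tens_sum k"
  let ?g = "mat_map N (B k) (prev_basis k) (\<lambda>b b'. prev_entry k b' b)"
  let ?f = "mat_map N (B (Suc k)) (B k) (\<lambda>b b'. entry k b' b)"
  let ?Z = "{v \<in> B k \<rightarrow>\<^sub>E carrier N. ?g v = \<zero>\<^bsub>pow_module N (prev_basis k)\<^esub>}"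
  let ?B = "?f ` (B (Suc k) \<rightarrow>\<^sub>E carrier N)"
  interpret C: module R ?C by (rule N.module_pow_module)
  interpret X: module R "pow_module N (B (Suc k))" by (rule N.module_pow_module)
  interpret Y: module R "pow_module N (prev_basis k)" by (rule N.module_pow_module)
  have gl: "?g \<in> linear_maps R ?C (pow_module N (prev_basis k))"
    by (rule N.mat_map_linear) (auto simp: prev_entry_closed G.F.fin_B)
  have fl: "?f \<in> linear_maps R (pow_module N (B (Suc k))) ?C"
    by (rule N.mat_map_linear) (auto simp: entry_closed G.F.fin_B)
  have Z: "submodule ?Z R ?C" using C.submodule_kernel[OF N.module_pow_module gl Y.zero_submodule] by simp
  have B: "submodule ?B R ?C" using X.submodule_image[OF N.module_pow_module fl X.carrier_is_submodule] by simp
  have BZ: "?B \<subseteq> ?Z"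
  proof (rule image_subsetI, intro CollectI conjI)
    fix u assume u: "u \<in> B (Suc k) \<rightarrow>\<^sub>E carrier N"
    show "?f u \<in> B k \<rightarrow>\<^sub>E carrier N"
      by (rule N.mat_map_submodule[OF N.carrier_is_submodule entry_closed u])
  qed (rule Tor_complex)
  have "?\<theta> ` ?Z = (case k of 0 \<Rightarrow> carrier (tensor_gmodule R (F k) N)
      | Suc j \<Rightarrow> a_kernel (tensor_gmodule R (F k) N) (tensor_gmodule R (F j) N) (tensor_map R (F j) N (\<delta> j)))"
  proof (cases k)
    case 0
    \<comment> \<open>For k = 0 the target is the empty power, so every tuple is a cycle.\<close>
    have "?Z = B k \<rightarrow>\<^sub>E carrier N" using 0 by (auto simp: prev_basis_def mat_map_def)
    then show ?thesis using 0 G.tens_sum_onto[of 0] by simp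
  next
    case (Suc j)
    have zero: "G.tens_sum j \<zero>\<^bsub>pow_module N (B j)\<^esub> = \<zero>\<^bsub>tensor_module R (F j) N\<^esub>"
      using module.linear_maps_zero[OF N.module_pow_module G.module_TG G.tens_sum_linear[of j]] by simp
    interpret Yj: module R "pow_module N (B j)" by (rule N.module_pow_module)
    have g: "?g = mat_map N (B (Suc j)) (B j) (\<lambda>b b'. entry j b' b)" "prev_basis k = B j"
      using Suc by (simp_all add: prev_basis_def prev_entry_def[abs_def])
    have mc: "?g v \<in> B j \<rightarrow>\<^sub>E carrier N" if "v \<in> B k \<rightarrow>\<^sub>E carrier N" for v
      unfolding g(1) by (rule N.mat_map_submodule[OF N.carrier_is_submodule entry_closed]) (use that Suc in auto)
    have "tensor_map R (F j) N (\<delta> j) (?\<theta> v) = \<zero>\<^bsub>tensor_module R (F j) N\<^esub> \<longleftrightarrow> v \<in> ?Z" if v: "v \<in> B k \<rightarrow>\<^sub>E carrier N" for v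
    proof -
      have "tensor_map R (F j) N (\<delta> j) (?\<theta> v) = G.tens_sum j (?g v)"
        unfolding g(1) unfolding Suc by (rule tensor_map_tens_sum[OF v[unfolded Suc]])
      then show ?thesis
        using inj_on_eq_iff[OF G.tens_sum_inj mc[OF v], of "\<zero>\<^bsub>pow_module N (B j)\<^esub>"] Yj.M.zero_closed v
        unfolding zero[symmetric] g(2) by simp
    qed
    then have "?\<theta> ` ?Z = {X \<in> carrier (tensor_module R (F k) N). tensor_map R (F j) N (\<delta> j) X = \<zero>\<^bsub>tensor_module R (F j) N\<^esub>}"
      unfolding G.tens_sum_onto[of k, symmetric] by blast
    then show ?thesis unfolding a_kernel_def' by (simp add: Suc)
  qed
  moreover have "?\<theta> ` ?B = tensor_map R (F k) N (\<delta> k) ` carrier (tensor_gmodule R (F (Suc k)) N)"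
  proof -
    have "?\<theta> ` ?B = (\<lambda>u. tensor_map R (F k) N (\<delta> k) (G.tens_sum (Suc k) u)) ` (B (Suc k) \<rightarrow>\<^sub>E carrier N)"
      unfolding image_image by (intro image_cong refl tensor_map_tens_sum[symmetric])
    then show ?thesis using G.tens_sum_onto[of "Suc k"] by (simp add: image_image[symmetric])
  qed
  moreover have "presents R ?C (pow_comp N (B k) (\<lambda>b. - deg k b)) (subquot_gmodule (tensor_gmodule R (F k) N) (?\<theta> ` ?Z) (?\<theta> ` ?B)) ?Z ?B"
    by (rule presents_subquot_image[OF N.module_axioms G.module_TG G.tens_sum_linear G.tens_sum_inj G.tens_sum_hcomp Z B BZ])
  ultimately show ?thesis unfolding presents_matrix_def Tor_def by (simp only:)
qed

end

section \<open>From a graded free resolution to matrices\<close>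

lemma homogeneous_ideal_ideal:
  assumes "graded_ring R" "homogeneous_ideal I R"
  shows "ideal I R"
proof -
  interpret graded_ring R by (rule assms(1))
  have "homogeneous_elements R \<subseteq> carrier R" using rcomp_iff by (auto simp: homogeneous_elements_def)
  then show ?thesis using assms(2) genideal_ideal unfolding homogeneous_ideal_def by blast
qed

lemma resolution_free_complex:
  fixes R :: "'a gring" and F :: "nat \<Rightarrow> ('a, 'f) gmodule" and deg :: "nat \<Rightarrow> 'f \<Rightarrow> int"
  assumes "graded_free_resolution R L F \<delta> \<epsilon>" and B: "\<And>i. graded_basis R (F i) (B i) (deg i)"
    and N: "weakly_graded_module R N"
  shows "free_complex R N F B deg \<delta>"
proof (intro free_complex.intro free_complex_axioms.intro N B)
  show "\<delta> i \<in> graded_linear_maps R (F (Suc i)) (F i)" for i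
    using assms(1) by (simp add: graded_free_resolution_def)
  have "\<delta> (Suc i) ` carrier (F (Suc (Suc i))) = a_kernel (F (Suc i)) (F i) (\<delta> i)" for i
    using assms(1) by (simp add: graded_free_resolution_def)
  then show "\<delta> i (\<delta> (Suc i) x) = \<zero>\<^bsub>F i\<^esub>" if "x \<in> carrier (F (Suc (Suc i)))" for i x
    using that unfolding a_kernel_def' by blast
qed

theorem theorem1p3:
  fixes R :: "'a gring" and x :: "nat \<Rightarrow> 'a" and d k :: nat
    and L :: "('a, 'l) gmodule" and M :: "('a, 'm) gmodule" and I :: "'a set"
    and F :: "nat \<Rightarrow> ('a, 'f) gmodule" and \<delta> :: "nat \<Rightarrow> 'f \<Rightarrow> 'f" and \<epsilon> :: "'f \<Rightarrow> 'l"
  assumes "graded_ring R" and "noetherian_ring R"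
    and "\<forall>i\<in>{1..d}. x i \<in> homogeneous_elements R"
    and "generate_ring R (rcomp R 0 \<union> x ` {1..d}) = carrier R"
    and "graded_module R L" and "fin_gen_module R L"
    and "graded_module R M" and "fin_gen_module R M"
    and "homogeneous_ideal I R"
    and "graded_free_resolution R L F \<delta> \<epsilon>"
  shows
    "(ideal_annihilated (Ext R F \<delta> k M) I = {\<zero>\<^bsub>Ext R F \<delta> k M\<^esub>} \<longrightarrow>
        (\<forall>\<^sub>F n in sequentially.
           carrier (Ext R F \<delta> k (mod_ideal_power R I M n)) = {\<zero>\<^bsub>Ext R F \<delta> k (mod_ideal_power R I M n)\<^esub>}) \<or>
        (\<exists>(a::nat) (b::int). minimal_generator_degree R I a \<and>
           (\<forall>\<^sub>F n in sequentially.
              v_number R (Ext R F \<delta> k (mod_ideal_power R I M n)) = ereal (of_int (int a * int n + b))))) \<and>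
     (ideal_annihilated (Tor R F \<delta> k M) I = {\<zero>\<^bsub>Tor R F \<delta> k M\<^esub>} \<longrightarrow>
        (\<forall>\<^sub>F n in sequentially.
           carrier (Tor R F \<delta> k (mod_ideal_power R I M n)) = {\<zero>\<^bsub>Tor R F \<delta> k (mod_ideal_power R I M n)\<^esub>}) \<or>
        (\<exists>(a::nat) (b::int). minimal_generator_degree R I a \<and>
           (\<forall>\<^sub>F n in sequentially.
              v_number R (Tor R F \<delta> k (mod_ideal_power R I M n)) = ereal (of_int (int a * int n + b)))))"
proof -
  interpret M: graded_module R M by (rule assms(7))
  \<comment> \<open>Bases are chosen once, before any coefficient module is considered, so that all
    complexes below have literally the same matrices.\<close>
  have "\<forall>i. \<exists>p. graded_basis R (F i) (fst p) (snd p)"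
  proof
    fix i
    obtain B deg where "graded_basis R (F i) B deg"
      using assms(10) graded_free_basis[of R "F i"] by (auto simp: graded_free_resolution_def)
    then show "\<exists>p. graded_basis R (F i) (fst p) (snd p)" by (intro exI[of _ "(B, deg)"]) simp
  qed
  then obtain p where p: "\<forall>i. graded_basis R (F i) (fst (p i)) (snd (p i))" unfolding choice_iff ..
  define B where "B i = fst (p i)" for i
  define deg where "deg i = snd (p i)" for i
  have basis: "graded_basis R (F i) (B i) (deg i)" for i using p by (simp add: B_def deg_def)
  have "weakly_graded_module R (mod_ideal_power R I M n)" for n
    unfolding mod_ideal_power_def
    by (intro M.weakly_graded_quot M.ideal_times_submodule M.ideal_ideal_power homogeneous_ideal_ideal assms)
  then have fcn: "free_complex R (mod_ideal_power R I M n) F B deg \<delta>" for n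
    by (rule resolution_free_complex[OF assms(10) basis])
  interpret X: free_complex R M F B deg \<delta>
    by (rule resolution_free_complex[OF assms(10) basis M.weakly_graded])
  let ?deg = "\<lambda>b. deg (k - 1) b"
  have fin: "finite (B i)" "finite (X.prev_basis k)" for i
    by (auto simp: X.prev_basis_def X.G.F.fin_B split: nat.splits)
  have e: "X.entry k b' b \<in> carrier R \<and> ring_part R (deg (Suc k) b' - deg k b) (X.entry k b' b) = X.entry k b' b"
    if "b \<in> B k" "b' \<in> B (Suc k)" for b b'
    using that X.entry_closed X.entry_degree by simp
  \<comment> \<open>At k = 0 the truncated k - 1 is harmless, because \<open>prev_basis\<close> is
    empty there.\<close>
  have pe: "X.prev_entry k b' b \<in> carrier R \<and> ring_part R (deg k b' - deg (k - 1) b) (X.prev_entry k b' b) = X.prev_entry k b' b"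
    if "b' \<in> B k" "b \<in> X.prev_basis k" for b b'
    using that X.entry_closed X.entry_degree
    by (cases k) (simp_all add: X.prev_basis_def X.prev_entry_def)
  show ?thesis
  proof (intro conjI impI)
    assume reg: "ideal_annihilated (Ext R F \<delta> k M) I = {\<zero>\<^bsub>Ext R F \<delta> k M\<^esub>}"
    show "(\<forall>\<^sub>F n in sequentially.
           carrier (Ext R F \<delta> k (mod_ideal_power R I M n)) = {\<zero>\<^bsub>Ext R F \<delta> k (mod_ideal_power R I M n)\<^esub>}) \<or>
        (\<exists>(a::nat) (b::int). minimal_generator_degree R I a \<and>
           (\<forall>\<^sub>F n in sequentially.
              v_number R (Ext R F \<delta> k (mod_ideal_power R I M n)) = ereal (of_int (int a * int n + b))))"
      by (rule matrix_homology_v_number[OF assms(1,2,7,8,9) fin(1,2,1) pe e X.Ext_complex X.presents_Ext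
            free_complex.presents_Ext[OF fcn] reg])
  next
    assume reg: "ideal_annihilated (Tor R F \<delta> k M) I = {\<zero>\<^bsub>Tor R F \<delta> k M\<^esub>}"
    \<comment> \<open>For Tor the complex runs in the other direction and the twists change sign, so
      the differences of twists, and with them the required degrees of the entries, are the same as
      for Ext.\<close>
    have e': "X.entry k b' b \<in> carrier R \<and> ring_part R (- deg k b - - deg (Suc k) b') (X.entry k b' b) = X.entry k b' b"
      if "b \<in> B k" "b' \<in> B (Suc k)" for b b'
      using e[OF that] by simp
    have pe': "X.prev_entry k b' b \<in> carrier R \<and> ring_part R (- deg (k - 1) b - - deg k b') (X.prev_entry k b' b) = X.prev_entry k b' b"
      if "b' \<in> B k" "b \<in> X.prev_basis k" for b b'
      using pe[OF that] by simp
    show "(\<forall>\<^sub>F n in sequentially.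
           carrier (Tor R F \<delta> k (mod_ideal_power R I M n)) = {\<zero>\<^bsub>Tor R F \<delta> k (mod_ideal_power R I M n)\<^esub>}) \<or>
        (\<exists>(a::nat) (b::int). minimal_generator_degree R I a \<and>
           (\<forall>\<^sub>F n in sequentially.
              v_number R (Tor R F \<delta> k (mod_ideal_power R I M n)) = ereal (of_int (int a * int n + b))))"
      by (rule matrix_homology_v_number[OF assms(1,2,7,8,9) fin(1,1,2) e' pe' X.Tor_complex X.presents_Tor
            free_complex.presents_Tor[OF fcn] reg])
  qed
qed

end
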